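(* For each category $B$, the componentwise formulas $\kappa_P(f\colon x\to y)=(x,Pf)$, $\kappa_P(r,s)=(r,Ps)$ restrict to a colax monad morphism from $\mathbb C_B$ on $\mathbf{CAT}/B$ to $\mathbb S$ on $\mathbf{CAT}$, with underlying 2-functor $\mathrm{Dom}\colon\mathbf{CAT}/B\to\mathbf{CAT}$. Restriction of scalars along this fixed-base form of $\kappa$ and the isomorphism $\mathbf{ClCoFib}(B)\cong\mathbf{PsAlg}(\mathbb C_B)$ give a 2-functor $$\mathsf{Fact}^{\mathrm{ps}}_B\colon\mathbf{ClCoFib}(B)\longrightarrow\mathbf{PsAlg}(\mathbb S).$$ For a cloven cofibration $P\colon E\to B$, its action is $F^P=L^P\kappa_P$. If $\jmath_x:=\delta^x_{1_{Px}}\colon x\xrightarrow{\cong}F^P(1_x)$ denotes its pseudo-$\mathbb S$-unit, the factors selected from the pseudoaction at $f\colon x\to y$ are $$e_f:=F^P(1_x,f)\,\jmath_x=\delta^x_{Pf},\qquad m_f:=\jmath_y^{-1}F^P(f,1_y)=\nu_f.$$ They determine the orthogonal factorization system $\bigl(\mathrm{CoCart}(P),P^{-1}\mathrm{Iso}(B)\bigr)$. The chosen factorization of $1_x$ is $x\xrightarrow{\jmath_x}F^P(1_x)\xrightarrow{\jmath_x^{-1}}x$; it is the identity–identity factorization precisely when the cleavage is normal.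
   Context: $\mathbf{CAT}$ is the strict 2-category of locally small categories, functors and natural transformations. $\mathbf{CAT}/B$ is the strict slice 2-category: functors $P\colon E\to B$, functors strictly over $B$, natural transformations over $1_B$. $\mathrm{Dom}$ sends $P\colon E\to B$ to $E$. **Cloven cofibrations.** For $P\colon E\to B$, an arrow $e\colon x\to y$ of $E$ is $P$-cocartesian if for all $g\colon x\to z$ and $v\colon Py\to Pz$ with $Pg=v\,Pe$ there is a unique $h\colon y\to z$ with $he=g$, $Ph=v$; $\mathrm{CoCart}(P)$ is the class of these. $P^{-1}\mathrm{Iso}(B)$ is the class of arrows $f$ with $Pf$ invertible. A cleavage chooses, for each $x\in E$ and $u\colon Px\to b$, a $P$-cocartesian arrow $\delta^x_u\colon x\to u_!x$ over $u$; it is normal if $\delta^x_{1_{Px}}=1_x$ for all $x$ (not assumed here). $\nu_f\colon(Pf)_!x\to y$ is the unique arrow with $\nu_f\delta^x_{Pf}=f$, $P\nu_f=1_{Py}$. $\mathbf{ClCoFib}(B)$: cloven cofibrations over $B$, functors over $B$ preserving cocartesian arrows, natural transformations over $1_B$. **Comma 2-monad over $B$.** $P\downarrow B$ has objects $(x,u)$, $u\colon Px\to b$; arrows $(f,v)\colon(x,u)\to(y,w)$ with $vu=w\,Pf$. $\mathbb C_BP=\mathrm{Cod}_P\colon P\downarrow B\to B$, $(x,u)\mapsto b$, $(f,v)\mapsto v$; $T\mapsto\overline T$, $\overline T(x,u)=(Tx,u)$, $\overline T(f,v)=(Tf,v)$; $\beta\mapsto\overline\beta$, $\overline\beta_{(x,u)}=(\beta_x,1_b)$;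 unit $H^Px=(x,1_{Px})$, $H^Pf=(f,Pf)$; multiplication $M^P((x,u),v)=(x,vu)$, $M^P((f,r),s)=(f,s)$. $L^P\colon P\downarrow B\to E$ is the unique functor with $L^P(x,u)=u_!x$, $PL^P=\mathrm{Cod}_P$, $L^P(f,v)\delta^x_u=\delta^y_wf$. The isomorphism $\mathbf{ClCoFib}(B)\cong\mathbf{PsAlg}(\mathbb C_B)$ sends $P$ to the action $L^P$ with unit $\iota_x=\delta^x_{1_{Px}}$ and multiplication cell the unique isomorphisms $\chi^x_{v,u}\colon v_!u_!x\to(vu)_!x$ over identities with $\chi^x_{v,u}\delta^{u_!x}_v\delta^x_u=\delta^x_{vu}$; a cocartesian-arrow-preserving $T$ gets the comparison $\theta_{x,u}\colon u_!Tx\to T(u_!x)$, the unique isomorphism over an identity with $\theta_{x,u}\delta^{Tx}_u=T\delta^x_u$. **Pseudoalgebras.** For a strict 2-monad $\mathbb T=(\mathbb T,\eta,\mu)$, a pseudoalgebra is $a\colon\mathbb TX\to X$ with invertible $\iota\colon1_X\Rightarrow a\eta_X$, $\chi\colon a\,\mathbb Ta\Rightarrow a\mu_X$ such that $(\chi\,\mathbb T\eta_X)(a\,\mathbb T\iota)=1_a$, $(\chi\,\eta_{\mathbb TX})(\iota a)=1_a$, $(\chi\,\mathbb T\mu_X)(a\,\mathbb T\chi)=(\chi\,\mu_{\mathbb TX})(\chi\,\mathbb T^2a)$. A pseudomorphism is a 1-cell $f$ with invertible $\overline f\colon b\,\mathbb Tf\Rightarrow fa$ such that $(\overline f\,\eta_X)(\iota^bf)=f\iota^a$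 and $(\overline f\,\mu_X)(\chi^b\,\mathbb T^2f)=(f\chi^a)(\overline f\,\mathbb Ta)(b\,\mathbb T\overline f)$. An algebra transformation satisfies $(\alpha a)\overline f=\overline g(b\,\mathbb T\alpha)$. These form $\mathbf{PsAlg}(\mathbb T)$. **Squaring 2-monad $\mathbb S$ on $\mathbf{CAT}$.** $\mathbb SE=E^{\mathbf 2}$ (arrows $(r,s)\colon f\to g$ are commutative squares $sf=gr$); unit $I_E$, $x\mapsto1_x$; multiplication $m_E$ sends a square to its diagonal (and a morphism of squares to its components at the initial and terminal vertices). **Colax monad morphisms and restriction.** A colax morphism of 2-monads from $\mathbb T$ on $\mathcal K$ to $\mathbb R$ on $\mathcal L$ is a strict 2-functor $V\colon\mathcal K\to\mathcal L$ with 2-natural $\lambda\colon\mathbb RV\Rightarrow V\mathbb T$ such that $\lambda_X\eta^{\mathbb R}_{VX}=V\eta^{\mathbb T}_X$, $\lambda_X\mu^{\mathbb R}_{VX}=V\mu^{\mathbb T}_X\lambda_{\mathbb TX}\mathbb R\lambda_X$. Restriction of scalars sends $(a,\iota,\chi)$ to $(Va\,\lambda_X,\ V\iota,\ V\chi\,(\lambda_{\mathbb TX}\mathbb R\lambda_X))$, $(f,\overline f)$ to $(Vf,V\overline f\,\lambda_X)$, $\alpha$ to $V\alpha$. **Determined system.** Given selected factors $f=m_fe_f$, the classes are $\{f\mid m_f\text{ invertible}\}$ (left) and $\{f\mid e_f\text{ invertible}\}$ (right). An orthogonal factorization system is a pair of classes closed under composition with isomorphisms, with (left, right)-factorizations of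 every arrow and unique diagonals for squares from a left-class arrow to a right-class arrow. *)

theory Defs
  imports "HOL-Library.FuncSet"
begin

section \<open>Strict 2-categories\<close>

record 'x edge =
  source :: 'x
  target :: 'x

record ('o, 'm, 'c) two_cat =
  cells0 :: "'o set"
  cells1 :: "'m set"
  cells2 :: "'c set"
  src1 :: "'m \<Rightarrow> 'o"
  tgt1 :: "'m \<Rightarrow> 'o"
  src2 :: "'c \<Rightarrow> 'm"
  tgt2 :: "'c \<Rightarrow> 'm"
  id1 :: "'o \<Rightarrow> 'm"
  id2 :: "'m \<Rightarrow> 'c"
  comp1 :: "'m \<Rightarrow> 'm \<Rightarrow> 'm"  (infixl "\<cdot>\<index>" 70)
  vcomp :: "'c \<Rightarrow> 'c \<Rightarrow> 'c"  (infixl "\<bullet>\<index>" 60)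
  hcomp :: "'c \<Rightarrow> 'c \<Rightarrow> 'c"  (infixl "\<star>\<index>" 70)

text \<open>All compositions are written in applicative order: the cell applied first is on the right.
  Whiskering with a 1-cell \<open>f\<close> is horizontal composition with \<open>id2 K f\<close>.\<close>

definition hom1 :: "('o, 'm, 'c) two_cat \<Rightarrow> 'o \<Rightarrow> 'o \<Rightarrow> 'm set" where
  "hom1 K X Y = {f \<in> cells1 K. src1 K f = X \<and> tgt1 K f = Y}"

definition hom2 :: "('o, 'm, 'c) two_cat \<Rightarrow> 'm \<Rightarrow> 'm \<Rightarrow> 'c set" where
  "hom2 K f g = {\<alpha> \<in> cells2 K. src2 K \<alpha> = f \<and> tgt2 K \<alpha> = g}"

locale two_category =
  fixes K :: "('o, 'm, 'c) two_cat" (structure)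
  assumes src1_in: "f \<in> cells1 K \<Longrightarrow> src1 K f \<in> cells0 K"
    and tgt1_in: "f \<in> cells1 K \<Longrightarrow> tgt1 K f \<in> cells0 K"
    and src2_in: "\<alpha> \<in> cells2 K \<Longrightarrow> src2 K \<alpha> \<in> cells1 K"
    and tgt2_in: "\<alpha> \<in> cells2 K \<Longrightarrow> tgt2 K \<alpha> \<in> cells1 K"
    and parallel_src: "\<alpha> \<in> cells2 K \<Longrightarrow> src1 K (src2 K \<alpha>) = src1 K (tgt2 K \<alpha>)"
    and parallel_tgt: "\<alpha> \<in> cells2 K \<Longrightarrow> tgt1 K (src2 K \<alpha>) = tgt1 K (tgt2 K \<alpha>)"
    and id1_hom: "X \<in> cells0 K \<Longrightarrow> id1 K X \<in> hom1 K X X"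
    and id2_hom: "f \<in> cells1 K \<Longrightarrow> id2 K f \<in> hom2 K f f"
    and comp1_hom: "f \<in> hom1 K X Y \<Longrightarrow> g \<in> hom1 K Y Z \<Longrightarrow> g \<cdot> f \<in> hom1 K X Z"
    and vcomp_hom: "\<alpha> \<in> hom2 K f g \<Longrightarrow> \<beta> \<in> hom2 K g h \<Longrightarrow> \<beta> \<bullet> \<alpha> \<in> hom2 K f h"
    and hcomp_hom: "\<alpha> \<in> hom2 K f f' \<Longrightarrow> \<beta> \<in> hom2 K g g' \<Longrightarrow> tgt1 K f = src1 K g
          \<Longrightarrow> \<beta> \<star> \<alpha> \<in> hom2 K (g \<cdot> f) (g' \<cdot> f')"
    and comp1_id_left: "f \<in> hom1 K X Y \<Longrightarrow> id1 K Y \<cdot> f = f"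
    and comp1_id_right: "f \<in> hom1 K X Y \<Longrightarrow> f \<cdot> id1 K X = f"
    and comp1_assoc: "f \<in> hom1 K W X \<Longrightarrow> g \<in> hom1 K X Y \<Longrightarrow> h \<in> hom1 K Y Z
          \<Longrightarrow> h \<cdot> g \<cdot> f = h \<cdot> (g \<cdot> f)"
    and vcomp_id_left: "\<alpha> \<in> hom2 K f g \<Longrightarrow> id2 K g \<bullet> \<alpha> = \<alpha>"
    and vcomp_id_right: "\<alpha> \<in> hom2 K f g \<Longrightarrow> \<alpha> \<bullet> id2 K f = \<alpha>"
    and vcomp_assoc: "\<alpha> \<in> hom2 K f g \<Longrightarrow> \<beta> \<in> hom2 K g h \<Longrightarrow> \<gamma> \<in> hom2 K h k
          \<Longrightarrow> \<gamma> \<bullet> \<beta> \<bullet> \<alpha> = \<gamma> \<bullet> (\<beta> \<bullet> \<alpha>)"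
    and hcomp_id_left: "\<alpha> \<in> hom2 K f g \<Longrightarrow> f \<in> hom1 K X Y \<Longrightarrow> id2 K (id1 K Y) \<star> \<alpha> = \<alpha>"
    and hcomp_id_right: "\<alpha> \<in> hom2 K f g \<Longrightarrow> f \<in> hom1 K X Y \<Longrightarrow> \<alpha> \<star> id2 K (id1 K X) = \<alpha>"
    and hcomp_assoc: "\<alpha> \<in> hom2 K f f' \<Longrightarrow> \<beta> \<in> hom2 K g g' \<Longrightarrow> \<gamma> \<in> hom2 K h h'
          \<Longrightarrow> tgt1 K f = src1 K g \<Longrightarrow> tgt1 K g = src1 K h
          \<Longrightarrow> \<gamma> \<star> \<beta> \<star> \<alpha> = \<gamma> \<star> (\<beta> \<star> \<alpha>)"
    and hcomp_id2: "f \<in> hom1 K X Y \<Longrightarrow> g \<in> hom1 K Y Z \<Longrightarrow> id2 K g \<star> id2 K f = id2 K (g \<cdot> f)"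
    and interchange: "\<alpha> \<in> hom2 K f f' \<Longrightarrow> \<alpha>' \<in> hom2 K f' f'' \<Longrightarrow> \<beta> \<in> hom2 K g g'
          \<Longrightarrow> \<beta>' \<in> hom2 K g' g'' \<Longrightarrow> tgt1 K f = src1 K g
          \<Longrightarrow> (\<beta>' \<bullet> \<beta>) \<star> (\<alpha>' \<bullet> \<alpha>) = (\<beta>' \<star> \<alpha>') \<bullet> (\<beta> \<star> \<alpha>)"

definition invertible2 :: "('o, 'm, 'c) two_cat \<Rightarrow> 'c \<Rightarrow> bool" where
  "invertible2 K \<alpha> \<longleftrightarrow> \<alpha> \<in> cells2 K \<and>
     (\<exists>\<beta> \<in> hom2 K (tgt2 K \<alpha>) (src2 K \<alpha>).
        \<beta> \<bullet>\<^bsub>K\<^esub> \<alpha> = id2 K (src2 K \<alpha>) \<and> \<alpha> \<bullet>\<^bsub>K\<^esub> \<beta> = id2 K (tgt2 K \<alpha>))"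

record ('o, 'm, 'c, 'o2, 'm2, 'c2) two_fun =
  map0 :: "'o \<Rightarrow> 'o2"
  map1 :: "'m \<Rightarrow> 'm2"
  map2 :: "'c \<Rightarrow> 'c2"

locale two_functor = dom: two_category C + cod: two_category D
  for C :: "('o, 'm, 'c) two_cat" and D :: "('o2, 'm2, 'c2) two_cat"
    and F :: "('o, 'm, 'c, 'o2, 'm2, 'c2) two_fun" +
  assumes map0_in: "X \<in> cells0 C \<Longrightarrow> map0 F X \<in> cells0 D"
    and map1_hom: "f \<in> hom1 C X Y \<Longrightarrow> map1 F f \<in> hom1 D (map0 F X) (map0 F Y)"
    and map2_hom: "\<alpha> \<in> hom2 C f g \<Longrightarrow> map2 F \<alpha> \<in> hom2 D (map1 F f) (map1 F g)"
    and map1_id: "X \<in> cells0 C \<Longrightarrow> map1 F (id1 C X) = id1 D (map0 F X)"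
    and map2_id: "f \<in> cells1 C \<Longrightarrow> map2 F (id2 C f) = id2 D (map1 F f)"
    and map1_comp: "f \<in> hom1 C X Y \<Longrightarrow> g \<in> hom1 C Y Z
          \<Longrightarrow> map1 F (g \<cdot>\<^bsub>C\<^esub> f) = map1 F g \<cdot>\<^bsub>D\<^esub> map1 F f"
    and map2_vcomp: "\<alpha> \<in> hom2 C f g \<Longrightarrow> \<beta> \<in> hom2 C g h
          \<Longrightarrow> map2 F (\<beta> \<bullet>\<^bsub>C\<^esub> \<alpha>) = map2 F \<beta> \<bullet>\<^bsub>D\<^esub> map2 F \<alpha>"
    and map2_hcomp: "\<alpha> \<in> hom2 C f f' \<Longrightarrow> \<beta> \<in> hom2 C g g' \<Longrightarrow> tgt1 C f = src1 C g
          \<Longrightarrow> map2 F (\<beta> \<star>\<^bsub>C\<^esub> \<alpha>) = map2 F \<beta> \<star>\<^bsub>D\<^esub> map2 F \<alpha>"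

locale two_isomorphism = two_functor C D F
  for C :: "('o, 'm, 'c) two_cat" and D :: "('o2, 'm2, 'c2) two_cat"
    and F :: "('o, 'm, 'c, 'o2, 'm2, 'c2) two_fun" +
  assumes bij0: "bij_betw (map0 F) (cells0 C) (cells0 D)"
    and bij1: "bij_betw (map1 F) (cells1 C) (cells1 D)"
    and bij2: "bij_betw (map2 F) (cells2 C) (cells2 D)"

definition id_two_fun :: "('o, 'm, 'c, 'o, 'm, 'c) two_fun" where
  "id_two_fun = \<lparr>map0 = \<lambda>X. X, map1 = \<lambda>f. f, map2 = \<lambda>\<alpha>. \<alpha>\<rparr>"

definition comp_two_fun ::
  "('o2, 'm2, 'c2, 'o3, 'm3, 'c3) two_fun \<Rightarrow> ('o, 'm, 'c, 'o2, 'm2, 'c2) two_fun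
    \<Rightarrow> ('o, 'm, 'c, 'o3, 'm3, 'c3) two_fun"  (infixl "\<circ>\<^sub>2" 70) where
  "G \<circ>\<^sub>2 F = \<lparr>map0 = \<lambda>X. map0 G (map0 F X), map1 = \<lambda>f. map1 G (map1 F f),
     map2 = \<lambda>\<alpha>. map2 G (map2 F \<alpha>)\<rparr>"

locale two_natural = src: two_functor C D F + tgt: two_functor C D G
  for C :: "('o, 'm, 'c) two_cat" and D :: "('o2, 'm2, 'c2) two_cat"
    and F :: "('o, 'm, 'c, 'o2, 'm2, 'c2) two_fun"
    and G :: "('o, 'm, 'c, 'o2, 'm2, 'c2) two_fun"
    and t :: "'o \<Rightarrow> 'm2" +
  assumes component_hom: "X \<in> cells0 C \<Longrightarrow> t X \<in> hom1 D (map0 F X) (map0 G X)"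
    and natural1: "f \<in> hom1 C X Y \<Longrightarrow> t Y \<cdot>\<^bsub>D\<^esub> map1 F f = map1 G f \<cdot>\<^bsub>D\<^esub> t X"
    and natural2: "\<alpha> \<in> hom2 C f g \<Longrightarrow> f \<in> hom1 C X Y
          \<Longrightarrow> id2 D (t Y) \<star>\<^bsub>D\<^esub> map2 F \<alpha> = map2 G \<alpha> \<star>\<^bsub>D\<^esub> id2 D (t X)"

section \<open>2-monads, pseudoalgebras and restriction of scalars\<close>

record ('o, 'm, 'c) two_mon =
  endo :: "('o, 'm, 'c, 'o, 'm, 'c) two_fun"
  eta :: "'o \<Rightarrow> 'm"
  mu :: "'o \<Rightarrow> 'm"

locale two_monad =
  endo: two_functor K K "endo T" +
  unit: two_natural K K id_two_fun "endo T" "eta T" +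
  mult: two_natural K K "endo T \<circ>\<^sub>2 endo T" "endo T" "mu T"
  for K :: "('o, 'm, 'c) two_cat" and T :: "('o, 'm, 'c) two_mon" +
  assumes unit_left: "X \<in> cells0 K
      \<Longrightarrow> mu T X \<cdot>\<^bsub>K\<^esub> eta T (map0 (endo T) X) = id1 K (map0 (endo T) X)"
    and unit_right: "X \<in> cells0 K
      \<Longrightarrow> mu T X \<cdot>\<^bsub>K\<^esub> map1 (endo T) (eta T X) = id1 K (map0 (endo T) X)"
    and mult_assoc: "X \<in> cells0 K
      \<Longrightarrow> mu T X \<cdot>\<^bsub>K\<^esub> mu T (map0 (endo T) X) = mu T X \<cdot>\<^bsub>K\<^esub> map1 (endo T) (mu T X)"

record ('o, 'm, 'c) psalg =
  under :: 'o
  act :: 'm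
  unitor :: 'c
  multor :: 'c

record ('o, 'm, 'c) psmor = "('o, 'm, 'c) psalg edge" +
  mor :: 'm
  mcell :: 'c

record ('o, 'm, 'c) algtrans = "('o, 'm, 'c) psmor edge" +
  trans :: 'c

definition pseudoalgebra ::
  "('o, 'm, 'c) two_cat \<Rightarrow> ('o, 'm, 'c) two_mon \<Rightarrow> ('o, 'm, 'c) psalg \<Rightarrow> bool" where
  "pseudoalgebra K T A \<longleftrightarrow>
    (let X = under A; a = act A; \<iota> = unitor A; \<chi> = multor A;
         T0 = map0 (endo T); T1 = map1 (endo T); T2 = map2 (endo T) in
      X \<in> cells0 K \<and> a \<in> hom1 K (T0 X) X \<and>
      \<iota> \<in> hom2 K (id1 K X) (a \<cdot>\<^bsub>K\<^esub> eta T X) \<and> invertible2 K \<iota> \<and>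
      \<chi> \<in> hom2 K (a \<cdot>\<^bsub>K\<^esub> T1 a) (a \<cdot>\<^bsub>K\<^esub> mu T X) \<and> invertible2 K \<chi> \<and>
      (\<chi> \<star>\<^bsub>K\<^esub> id2 K (T1 (eta T X))) \<bullet>\<^bsub>K\<^esub> (id2 K a \<star>\<^bsub>K\<^esub> T2 \<iota>) = id2 K a \<and>
      (\<chi> \<star>\<^bsub>K\<^esub> id2 K (eta T (T0 X))) \<bullet>\<^bsub>K\<^esub> (\<iota> \<star>\<^bsub>K\<^esub> id2 K a) = id2 K a \<and>
      (\<chi> \<star>\<^bsub>K\<^esub> id2 K (T1 (mu T X))) \<bullet>\<^bsub>K\<^esub> (id2 K a \<star>\<^bsub>K\<^esub> T2 \<chi>)
        = (\<chi> \<star>\<^bsub>K\<^esub> id2 K (mu T (T0 X))) \<bullet>\<^bsub>K\<^esub> (\<chi> \<star>\<^bsub>K\<^esub> id2 K (T1 (T1 a))))"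

definition pseudomorphism ::
  "('o, 'm, 'c) two_cat \<Rightarrow> ('o, 'm, 'c) two_mon \<Rightarrow> ('o, 'm, 'c) psmor \<Rightarrow> bool" where
  "pseudomorphism K T F \<longleftrightarrow>
    (let A = source F; A' = target F; f = mor F; \<phi> = mcell F; X = under A; a = act A; b = act A';
         T1 = map1 (endo T); T2 = map2 (endo T) in
      pseudoalgebra K T A \<and> pseudoalgebra K T A' \<and>
      f \<in> hom1 K X (under A') \<and>
      \<phi> \<in> hom2 K (b \<cdot>\<^bsub>K\<^esub> T1 f) (f \<cdot>\<^bsub>K\<^esub> a) \<and> invertible2 K \<phi> \<and>
      (\<phi> \<star>\<^bsub>K\<^esub> id2 K (eta T X)) \<bullet>\<^bsub>K\<^esub> (unitor A' \<star>\<^bsub>K\<^esub> id2 K f) = id2 K f \<star>\<^bsub>K\<^esub> unitor A \<and>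
      (\<phi> \<star>\<^bsub>K\<^esub> id2 K (mu T X)) \<bullet>\<^bsub>K\<^esub> (multor A' \<star>\<^bsub>K\<^esub> id2 K (T1 (T1 f)))
        = (id2 K f \<star>\<^bsub>K\<^esub> multor A) \<bullet>\<^bsub>K\<^esub> (\<phi> \<star>\<^bsub>K\<^esub> id2 K (T1 a)) \<bullet>\<^bsub>K\<^esub> (id2 K b \<star>\<^bsub>K\<^esub> T2 \<phi>))"

definition algebra_transformation ::
  "('o, 'm, 'c) two_cat \<Rightarrow> ('o, 'm, 'c) two_mon \<Rightarrow> ('o, 'm, 'c) algtrans \<Rightarrow> bool" where
  "algebra_transformation K T \<tau> \<longleftrightarrow>
    (let F = source \<tau>; G = target \<tau>; \<alpha> = trans \<tau> in
      pseudomorphism K T F \<and> pseudomorphism K T G \<and>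
      source F = source G \<and> target F = target G \<and>
      \<alpha> \<in> hom2 K (mor F) (mor G) \<and>
      (\<alpha> \<star>\<^bsub>K\<^esub> id2 K (act (source F))) \<bullet>\<^bsub>K\<^esub> mcell F
        = mcell G \<bullet>\<^bsub>K\<^esub> (id2 K (act (target F)) \<star>\<^bsub>K\<^esub> map2 (endo T) \<alpha>))"

definition PsAlg :: "('o, 'm, 'c) two_cat \<Rightarrow> ('o, 'm, 'c) two_mon
    \<Rightarrow> (('o, 'm, 'c) psalg, ('o, 'm, 'c) psmor, ('o, 'm, 'c) algtrans) two_cat" where
  "PsAlg K T = \<lparr>
     cells0 = {A. pseudoalgebra K T A},
     cells1 = {F. pseudomorphism K T F},
     cells2 = {\<tau>. algebra_transformation K T \<tau>},
     src1 = source, tgt1 = target, src2 = source, tgt2 = target,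
     id1 = \<lambda>A. \<lparr>source = A, target = A, mor = id1 K (under A), mcell = id2 K (act A)\<rparr>,
     id2 = \<lambda>F. \<lparr>source = F, target = F, trans = id2 K (mor F)\<rparr>,
     comp1 = \<lambda>G F. \<lparr>source = source F, target = target G, mor = mor G \<cdot>\<^bsub>K\<^esub> mor F,
        mcell = (id2 K (mor G) \<star>\<^bsub>K\<^esub> mcell F) \<bullet>\<^bsub>K\<^esub> (mcell G \<star>\<^bsub>K\<^esub> id2 K (map1 (endo T) (mor F)))\<rparr>,
     vcomp = \<lambda>\<tau> \<sigma>. \<lparr>source = source \<sigma>, target = target \<tau>, trans = trans \<tau> \<bullet>\<^bsub>K\<^esub> trans \<sigma>\<rparr>,
     hcomp = \<lambda>\<tau> \<sigma>.
       let comp = \<lambda>G F. \<lparr>source = source F, target = target G, mor = mor G \<cdot>\<^bsub>K\<^esub> mor F,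
        mcell = (id2 K (mor G) \<star>\<^bsub>K\<^esub> mcell F) \<bullet>\<^bsub>K\<^esub> (mcell G \<star>\<^bsub>K\<^esub> id2 K (map1 (endo T) (mor F)))\<rparr>
       in \<lparr>source = comp (source \<tau>) (source \<sigma>), target = comp (target \<tau>) (target \<sigma>),
           trans = trans \<tau> \<star>\<^bsub>K\<^esub> trans \<sigma>\<rparr>\<rparr>"

locale colax_monad_morphism =
  dom: two_monad K T + cod: two_monad L R +
  underlying: two_functor K L V +
  nat: two_natural K L "endo R \<circ>\<^sub>2 V" "V \<circ>\<^sub>2 endo T" lam
  for K :: "('o, 'm, 'c) two_cat" and T :: "('o, 'm, 'c) two_mon"
    and L :: "('o2, 'm2, 'c2) two_cat" and R :: "('o2, 'm2, 'c2) two_mon"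
    and V :: "('o, 'm, 'c, 'o2, 'm2, 'c2) two_fun" and lam :: "'o \<Rightarrow> 'm2" +
  assumes colax_unit: "X \<in> cells0 K
      \<Longrightarrow> lam X \<cdot>\<^bsub>L\<^esub> eta R (map0 V X) = map1 V (eta T X)"
    and colax_mult: "X \<in> cells0 K
      \<Longrightarrow> lam X \<cdot>\<^bsub>L\<^esub> mu R (map0 V X)
          = map1 V (mu T X) \<cdot>\<^bsub>L\<^esub> lam (map0 (endo T) X) \<cdot>\<^bsub>L\<^esub> map1 (endo R) (lam X)"

definition restrict_scalars ::
  "('o, 'm, 'c) two_mon \<Rightarrow> ('o2, 'm2, 'c2) two_cat \<Rightarrow> ('o2, 'm2, 'c2) two_mon
    \<Rightarrow> ('o, 'm, 'c, 'o2, 'm2, 'c2) two_fun \<Rightarrow> ('o \<Rightarrow> 'm2)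
    \<Rightarrow> (('o, 'm, 'c) psalg, ('o, 'm, 'c) psmor, ('o, 'm, 'c) algtrans,
        ('o2, 'm2, 'c2) psalg, ('o2, 'm2, 'c2) psmor, ('o2, 'm2, 'c2) algtrans) two_fun" where
  "restrict_scalars T L R V lam =
    (let r0 = \<lambda>A. \<lparr>under = map0 V (under A),
                    act = map1 V (act A) \<cdot>\<^bsub>L\<^esub> lam (under A),
                    unitor = map2 V (unitor A),
                    multor = map2 V (multor A) \<star>\<^bsub>L\<^esub>
                      id2 L (lam (map0 (endo T) (under A)) \<cdot>\<^bsub>L\<^esub> map1 (endo R) (lam (under A)))\<rparr>;
         r1 = \<lambda>F. \<lparr>source = r0 (source F), target = r0 (target F),
                    mor = map1 V (mor F),
                    mcell = map2 V (mcell F) \<star>\<^bsub>L\<^esub> id2 L (lam (under (source F)))\<rparr>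
     in \<lparr>map0 = r0, map1 = r1,
         map2 = \<lambda>\<tau>. \<lparr>source = r1 (source \<tau>), target = r1 (target \<tau>), trans = map2 V (trans \<tau>)\<rparr>\<rparr>)"

section \<open>The strict slice 2-category\<close>

record 'm slice_mor = "'m edge" +
  over1 :: 'm

record ('m, 'c) slice_cell = "'m slice_mor edge" +
  over2 :: 'c

definition Slice :: "('o, 'm, 'c) two_cat \<Rightarrow> 'o
    \<Rightarrow> ('m, 'm slice_mor, ('m, 'c) slice_cell) two_cat" where
  "Slice K B =
    (let c1 = {T. source T \<in> cells1 K \<and> tgt1 K (source T) = B \<and>
                  target T \<in> cells1 K \<and> tgt1 K (target T) = B \<and>
                  over1 T \<in> hom1 K (src1 K (source T)) (src1 K (target T)) \<and>
                  target T \<cdot>\<^bsub>K\<^esub> over1 T = source T};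
         cmp = \<lambda>S T. \<lparr>source = source T, target = target S, over1 = over1 S \<cdot>\<^bsub>K\<^esub> over1 T\<rparr>
     in \<lparr>cells0 = {P \<in> cells1 K. tgt1 K P = B},
         cells1 = c1,
         cells2 = {\<alpha>. source \<alpha> \<in> c1 \<and> target \<alpha> \<in> c1 \<and>
                      source (source \<alpha>) = source (target \<alpha>) \<and>
                      target (source \<alpha>) = target (target \<alpha>) \<and>
                      over2 \<alpha> \<in> hom2 K (over1 (source \<alpha>)) (over1 (target \<alpha>)) \<and>
                      id2 K (target (source \<alpha>)) \<star>\<^bsub>K\<^esub> over2 \<alpha> = id2 K (source (source \<alpha>))},
         src1 = source, tgt1 = target, src2 = source, tgt2 = target,
         id1 = \<lambda>P. \<lparr>source = P, target = P, over1 = id1 K (src1 K P)\<rparr>,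
         id2 = \<lambda>T. \<lparr>source = T, target = T, over2 = id2 K (over1 T)\<rparr>,
         comp1 = cmp,
         vcomp = \<lambda>\<beta> \<alpha>. \<lparr>source = source \<alpha>, target = target \<beta>, over2 = over2 \<beta> \<bullet>\<^bsub>K\<^esub> over2 \<alpha>\<rparr>,
         hcomp = \<lambda>\<beta> \<alpha>. \<lparr>source = cmp (source \<beta>) (source \<alpha>), target = cmp (target \<beta>) (target \<alpha>),
                        over2 = over2 \<beta> \<star>\<^bsub>K\<^esub> over2 \<alpha>\<rparr>\<rparr>)"

definition Dom_fun :: "('o, 'm, 'c) two_cat
    \<Rightarrow> ('m, 'm slice_mor, ('m, 'c) slice_cell, 'o, 'm, 'c) two_fun" where
  "Dom_fun K = \<lparr>map0 = src1 K, map1 = over1, map2 = over2\<rparr>"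

section \<open>Categories, functors and natural transformations\<close>

text \<open>Categories, functors and natural transformations are required to be \<open>undefined\<close> outside
  their carriers, so that HOL equality of these data is equality of the mathematical objects, as
  strict 2-categories demand.\<close>

record 'u cat =
  Obj :: "'u set"
  Arr :: "'u set"
  Dom :: "'u \<Rightarrow> 'u"
  Cod :: "'u \<Rightarrow> 'u"
  Ide :: "'u \<Rightarrow> 'u"
  Cmp :: "'u \<Rightarrow> 'u \<Rightarrow> 'u"

definition hom :: "'u cat \<Rightarrow> 'u \<Rightarrow> 'u \<Rightarrow> 'u set" where
  "hom C x y = {f \<in> Arr C. Dom C f = x \<and> Cod C f = y}"

locale category =
  fixes C :: "'u cat"
  assumes Dom_in: "f \<in> Arr C \<Longrightarrow> Dom C f \<in> Obj C"
    and Cod_in: "f \<in> Arr C \<Longrightarrow> Cod C f \<in> Obj C"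
    and Ide_hom: "x \<in> Obj C \<Longrightarrow> Ide C x \<in> hom C x x"
    and Cmp_hom: "f \<in> hom C x y \<Longrightarrow> g \<in> hom C y z \<Longrightarrow> Cmp C g f \<in> hom C x z"
    and Cmp_id_left: "f \<in> hom C x y \<Longrightarrow> Cmp C (Ide C y) f = f"
    and Cmp_id_right: "f \<in> hom C x y \<Longrightarrow> Cmp C f (Ide C x) = f"
    and Cmp_assoc: "f \<in> hom C w x \<Longrightarrow> g \<in> hom C x y \<Longrightarrow> h \<in> hom C y z
          \<Longrightarrow> Cmp C (Cmp C h g) f = Cmp C h (Cmp C g f)"
    and Dom_ext: "Dom C \<in> extensional (Arr C)"
    and Cod_ext: "Cod C \<in> extensional (Arr C)"
    and Ide_ext: "Ide C \<in> extensional (Obj C)"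
    and Cmp_ext: "\<not> (f \<in> Arr C \<and> g \<in> Arr C \<and> Cod C f = Dom C g) \<Longrightarrow> Cmp C g f = undefined"

definition iso :: "'u cat \<Rightarrow> 'u \<Rightarrow> bool" where
  "iso C f \<longleftrightarrow> f \<in> Arr C \<and>
     (\<exists>g \<in> hom C (Cod C f) (Dom C f). Cmp C g f = Ide C (Dom C f) \<and> Cmp C f g = Ide C (Cod C f))"

definition inv_arr :: "'u cat \<Rightarrow> 'u \<Rightarrow> 'u" where
  "inv_arr C f = (THE g. g \<in> hom C (Cod C f) (Dom C f) \<and>
     Cmp C g f = Ide C (Dom C f) \<and> Cmp C f g = Ide C (Cod C f))"

record 'u func = "'u cat edge" +
  omap :: "'u \<Rightarrow> 'u"
  amap :: "'u \<Rightarrow> 'u"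

locale is_functor = dom: category "source F" + cod: category "target F"
  for F :: "'u func" +
  assumes omap_in: "x \<in> Obj (source F) \<Longrightarrow> omap F x \<in> Obj (target F)"
    and amap_hom: "f \<in> hom (source F) x y \<Longrightarrow> amap F f \<in> hom (target F) (omap F x) (omap F y)"
    and amap_id: "x \<in> Obj (source F) \<Longrightarrow> amap F (Ide (source F) x) = Ide (target F) (omap F x)"
    and amap_comp: "f \<in> hom (source F) x y \<Longrightarrow> g \<in> hom (source F) y z
          \<Longrightarrow> amap F (Cmp (source F) g f) = Cmp (target F) (amap F g) (amap F f)"
    and omap_ext: "omap F \<in> extensional (Obj (source F))"
    and amap_ext: "amap F \<in> extensional (Arr (source F))"

definition mk_functor :: "'u cat \<Rightarrow> 'u cat \<Rightarrow> ('u \<Rightarrow> 'u) \<Rightarrow> ('u \<Rightarrow> 'u) \<Rightarrow> 'u func" where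
  "mk_functor C D ob ar =
     \<lparr>source = C, target = D, omap = restrict ob (Obj C), amap = restrict ar (Arr C)\<rparr>"

definition id_functor :: "'u cat \<Rightarrow> 'u func" where
  "id_functor C = mk_functor C C (\<lambda>x. x) (\<lambda>f. f)"

definition comp_functor :: "'u func \<Rightarrow> 'u func \<Rightarrow> 'u func" where
  "comp_functor G F =
     mk_functor (source F) (target G) (\<lambda>x. omap G (omap F x)) (\<lambda>f. amap G (amap F f))"

record 'u ntrans = "'u func edge" +
  component :: "'u \<Rightarrow> 'u"

locale is_ntrans = src: is_functor "source \<alpha>" + tgt: is_functor "target \<alpha>"
  for \<alpha> :: "'u ntrans" +
  assumes same_source: "source (source \<alpha>) = source (target \<alpha>)"
    and same_target: "target (source \<alpha>) = target (target \<alpha>)"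
    and component_hom: "x \<in> Obj (source (source \<alpha>))
          \<Longrightarrow> component \<alpha> x \<in> hom (target (source \<alpha>)) (omap (source \<alpha>) x) (omap (target \<alpha>) x)"
    and naturality: "f \<in> hom (source (source \<alpha>)) x y
          \<Longrightarrow> Cmp (target (source \<alpha>)) (component \<alpha> y) (amap (source \<alpha>) f)
            = Cmp (target (source \<alpha>)) (amap (target \<alpha>) f) (component \<alpha> x)"
    and component_ext: "component \<alpha> \<in> extensional (Obj (source (source \<alpha>)))"

definition mk_ntrans :: "'u func \<Rightarrow> 'u func \<Rightarrow> ('u \<Rightarrow> 'u) \<Rightarrow> 'u ntrans" where
  "mk_ntrans F G c = \<lparr>source = F, target = G, component = restrict c (Obj (source F))\<rparr>"

definition id_ntrans :: "'u func \<Rightarrow> 'u ntrans" where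
  "id_ntrans F = mk_ntrans F F (\<lambda>x. Ide (target F) (omap F x))"

definition vcomp_ntrans :: "'u ntrans \<Rightarrow> 'u ntrans \<Rightarrow> 'u ntrans" where
  "vcomp_ntrans \<beta> \<alpha> = mk_ntrans (source \<alpha>) (target \<beta>)
     (\<lambda>x. Cmp (target (source \<alpha>)) (component \<beta> x) (component \<alpha> x))"

definition hcomp_ntrans :: "'u ntrans \<Rightarrow> 'u ntrans \<Rightarrow> 'u ntrans" where
  "hcomp_ntrans \<beta> \<alpha> =
     mk_ntrans (comp_functor (source \<beta>) (source \<alpha>)) (comp_functor (target \<beta>) (target \<alpha>))
       (\<lambda>x. Cmp (target (source \<beta>)) (component \<beta> (omap (target \<alpha>) x))
                                    (amap (source \<beta>) (component \<alpha> x)))"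

definition locally_small :: "('u set \<Rightarrow> bool) \<Rightarrow> 'u cat \<Rightarrow> bool" where
  "locally_small small C \<longleftrightarrow> (\<forall>x \<in> Obj C. \<forall>y \<in> Obj C. small (hom C x y))"

text \<open>The parameter \<open>small\<close> says which sets of the ambient type count as small. Collections of
  objects are not restricted.\<close>

definition CAT :: "('u set \<Rightarrow> bool) \<Rightarrow> ('u cat, 'u func, 'u ntrans) two_cat" where
  "CAT small =
    (let c0 = {C. category C \<and> locally_small small C};
         c1 = {F. is_functor F \<and> source F \<in> c0 \<and> target F \<in> c0}
     in \<lparr>cells0 = c0,
         cells1 = c1,
         cells2 = {\<alpha>. is_ntrans \<alpha> \<and> source \<alpha> \<in> c1 \<and> target \<alpha> \<in> c1},
         src1 = source, tgt1 = target, src2 = source, tgt2 = target,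
         id1 = id_functor, id2 = id_ntrans,
         comp1 = comp_functor, vcomp = vcomp_ntrans, hcomp = hcomp_ntrans\<rparr>)"

abbreviation CAT_over :: "('u set \<Rightarrow> bool) \<Rightarrow> 'u cat
    \<Rightarrow> ('u func, 'u func slice_mor, ('u func, 'u ntrans) slice_cell) two_cat" where
  "CAT_over small B \<equiv> Slice (CAT small) B"

section \<open>A universe closed under pairing\<close>

text \<open>Arrow categories and comma categories have pairs as objects and arrows. To make them
  endo-operations on \<open>CAT\<close>, the objects and arrows of all categories are drawn from one type that
  is closed under pairing; a category on any type \<open>'a\<close> is transported to it along \<open>Atom\<close>.\<close>

datatype 'a elt = Atom 'a | Pair (lft: "'a elt") (rgt: "'a elt")

definition smallness :: "('a elt set \<Rightarrow> bool) \<Rightarrow> bool" where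
  "smallness small \<longleftrightarrow>
     (\<forall>A A'. small A \<and> A' \<subseteq> A \<longrightarrow> small A') \<and>
     (\<forall>A f. small A \<longrightarrow> small (f ` A)) \<and>
     (\<forall>A A'. small A \<and> small A' \<longrightarrow> small {Pair x y | x y. x \<in> A \<and> y \<in> A'})"

text \<open>\<open>tag s t c\<close> is the arrow \<open>c\<close> regarded as an arrow from \<open>s\<close> to \<open>t\<close>; the same pair of underlying
  arrows may have several sources and targets.\<close>

definition tag :: "'a elt \<Rightarrow> 'a elt \<Rightarrow> 'a elt \<Rightarrow> 'a elt" where
  "tag s t c = Pair (Pair s t) c"

definition tag_src :: "'a elt \<Rightarrow> 'a elt" where "tag_src t = lft (lft t)"
definition tag_tgt :: "'a elt \<Rightarrow> 'a elt" where "tag_tgt t = rgt (lft t)"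
definition tag_fst :: "'a elt \<Rightarrow> 'a elt" where "tag_fst t = lft (rgt t)"
definition tag_snd :: "'a elt \<Rightarrow> 'a elt" where "tag_snd t = rgt (rgt t)"

text \<open>The category with object set \<open>S\<close> whose arrows \<open>s \<rightarrow> t\<close> are the pairs of an arrow
  \<open>r : p s \<rightarrow> p t\<close> of \<open>C\<close> and an arrow \<open>v : q s \<rightarrow> q t\<close> of \<open>D\<close> with \<open>Q s t r v\<close>; composition and
  identities are componentwise.\<close>

definition pair_category :: "'a elt cat \<Rightarrow> 'a elt cat \<Rightarrow> 'a elt set \<Rightarrow> ('a elt \<Rightarrow> 'a elt)
    \<Rightarrow> ('a elt \<Rightarrow> 'a elt) \<Rightarrow> ('a elt \<Rightarrow> 'a elt \<Rightarrow> 'a elt \<Rightarrow> 'a elt \<Rightarrow> bool) \<Rightarrow> 'a elt cat" where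
  "pair_category C D S p q Q =
    (let A = {tag s t (Pair r v) | s t r v. s \<in> S \<and> t \<in> S \<and>
                r \<in> hom C (p s) (p t) \<and> v \<in> hom D (q s) (q t) \<and> Q s t r v}
     in \<lparr>Obj = S, Arr = A, Dom = restrict tag_src A, Cod = restrict tag_tgt A,
         Ide = restrict (\<lambda>s. tag s s (Pair (Ide C (p s)) (Ide D (q s)))) S,
         Cmp = (\<lambda>b a. if a \<in> A \<and> b \<in> A \<and> tag_tgt a = tag_src b
            then tag (tag_src a) (tag_tgt b)
                   (Pair (Cmp C (tag_fst b) (tag_fst a)) (Cmp D (tag_snd b) (tag_snd a)))
            else undefined)\<rparr>)"

section \<open>The squaring 2-monad\<close>

definition arrow_cat :: "'a elt cat \<Rightarrow> 'a elt cat" where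
  "arrow_cat E = pair_category E E (Arr E) (Dom E) (Cod E) (\<lambda>f g r s. Cmp E s f = Cmp E g r)"

definition square :: "'a elt \<Rightarrow> 'a elt \<Rightarrow> 'a elt \<Rightarrow> 'a elt \<Rightarrow> 'a elt" where
  "square f g r s = tag f g (Pair r s)"

definition diagonal :: "'a elt cat \<Rightarrow> 'a elt \<Rightarrow> 'a elt" where
  "diagonal E \<sigma> = Cmp E (tag_snd \<sigma>) (tag_src \<sigma>)"

definition arrow_functor :: "'a elt func \<Rightarrow> 'a elt func" where
  "arrow_functor F = mk_functor (arrow_cat (source F)) (arrow_cat (target F)) (amap F)
     (\<lambda>t. square (amap F (tag_src t)) (amap F (tag_tgt t)) (amap F (tag_fst t)) (amap F (tag_snd t)))"

definition arrow_ntrans :: "'a elt ntrans \<Rightarrow> 'a elt ntrans" where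
  "arrow_ntrans \<alpha> = mk_ntrans (arrow_functor (source \<alpha>)) (arrow_functor (target \<alpha>))
     (\<lambda>f. let E = source (source \<alpha>) in
        square (amap (source \<alpha>) f) (amap (target \<alpha>) f)
               (component \<alpha> (Dom E f)) (component \<alpha> (Cod E f)))"

text \<open>An arrow \<open>\<rho>\<close> of \<open>arrow_cat (arrow_cat E)\<close> is a morphism of squares; its two parts
  \<open>tag_fst \<rho>\<close> and \<open>tag_snd \<rho>\<close> are themselves squares, so that its component at the initial vertex is
  \<open>tag_fst (tag_fst \<rho>)\<close> and the one at the terminal vertex is \<open>tag_snd (tag_snd \<rho>)\<close>.\<close>

definition square_monad :: "('a elt cat, 'a elt func, 'a elt ntrans) two_mon" where
  "square_monad = \<lparr>
     endo = \<lparr>map0 = arrow_cat, map1 = arrow_functor, map2 = arrow_ntrans\<rparr>,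
     eta = \<lambda>E. mk_functor E (arrow_cat E) (Ide E)
              (\<lambda>f. square (Ide E (Dom E f)) (Ide E (Cod E f)) f f),
     mu = \<lambda>E. mk_functor (arrow_cat (arrow_cat E)) (arrow_cat E) (diagonal E)
              (\<lambda>\<rho>. square (diagonal E (tag_src \<rho>)) (diagonal E (tag_tgt \<rho>))
                         (tag_fst (tag_fst \<rho>)) (tag_snd (tag_snd \<rho>)))\<rparr>"

section \<open>The comma 2-monad\<close>

definition comma :: "'a elt func \<Rightarrow> 'a elt cat" where
  "comma P = (let E = source P; B = target P in
     pair_category E B {Pair x u | x u. x \<in> Obj E \<and> u \<in> Arr B \<and> Dom B u = omap P x}
       lft (\<lambda>s. Cod B (rgt s))
       (\<lambda>s t f v. Cmp B v (rgt s) = Cmp B (rgt t) (amap P f)))"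

definition Cod_functor :: "'a elt func \<Rightarrow> 'a elt func" where
  "Cod_functor P = mk_functor (comma P) (target P) (\<lambda>s. Cod (target P) (rgt s)) tag_snd"

definition comma_map_obj :: "'a elt func \<Rightarrow> 'a elt \<Rightarrow> 'a elt" where
  "comma_map_obj T s = Pair (omap T (lft s)) (rgt s)"

definition comma_functor :: "'a elt func slice_mor \<Rightarrow> 'a elt func" where
  "comma_functor T = mk_functor (comma (source T)) (comma (target T))
     (comma_map_obj (over1 T))
     (\<lambda>t. tag (comma_map_obj (over1 T) (tag_src t)) (comma_map_obj (over1 T) (tag_tgt t))
             (Pair (amap (over1 T) (tag_fst t)) (tag_snd t)))"

definition comma_mor :: "'a elt func slice_mor \<Rightarrow> 'a elt func slice_mor" where
  "comma_mor T = \<lparr>source = Cod_functor (source T), target = Cod_functor (target T),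
     over1 = comma_functor T\<rparr>"

definition comma_cell ::
  "('a elt func, 'a elt ntrans) slice_cell \<Rightarrow> ('a elt func, 'a elt ntrans) slice_cell" where
  "comma_cell \<beta> =
    (let S = source \<beta>; T = target \<beta>; B = target (source S) in
     \<lparr>source = comma_mor S, target = comma_mor T,
      over2 = mk_ntrans (comma_functor S) (comma_functor T)
        (\<lambda>s. tag (comma_map_obj (over1 S) s) (comma_map_obj (over1 T) s)
                (Pair (component (over2 \<beta>) (lft s)) (Ide B (Cod B (rgt s)))))\<rparr>)"

definition comma_unit_obj :: "'a elt func \<Rightarrow> 'a elt \<Rightarrow> 'a elt" where
  "comma_unit_obj P x = Pair x (Ide (target P) (omap P x))"

definition comma_mult_obj :: "'a elt func \<Rightarrow> 'a elt \<Rightarrow> 'a elt" where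
  "comma_mult_obj P s = Pair (lft (lft s)) (Cmp (target P) (rgt s) (rgt (lft s)))"

definition comma_unit :: "'a elt func \<Rightarrow> 'a elt func slice_mor" where
  "comma_unit P = \<lparr>source = P, target = Cod_functor P,
     over1 = mk_functor (source P) (comma P) (comma_unit_obj P)
       (\<lambda>f. tag (comma_unit_obj P (Dom (source P) f)) (comma_unit_obj P (Cod (source P) f))
               (Pair f (amap P f)))\<rparr>"

definition comma_mult :: "'a elt func \<Rightarrow> 'a elt func slice_mor" where
  "comma_mult P = \<lparr>source = Cod_functor (Cod_functor P), target = Cod_functor P,
     over1 = mk_functor (comma (Cod_functor P)) (comma P) (comma_mult_obj P)
       (\<lambda>t. tag (comma_mult_obj P (tag_src t)) (comma_mult_obj P (tag_tgt t))
               (Pair (tag_fst (tag_fst t)) (tag_snd t)))\<rparr>"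

definition comma_monad ::
  "('a elt func, 'a elt func slice_mor, ('a elt func, 'a elt ntrans) slice_cell) two_mon" where
  "comma_monad = \<lparr>
     endo = \<lparr>map0 = Cod_functor, map1 = comma_mor, map2 = comma_cell\<rparr>,
     eta = comma_unit,
     mu = comma_mult\<rparr>"

definition kappa_obj :: "'a elt func \<Rightarrow> 'a elt \<Rightarrow> 'a elt" where
  "kappa_obj P f = Pair (Dom (source P) f) (amap P f)"

definition kappa :: "'a elt func \<Rightarrow> 'a elt func" where
  "kappa P = mk_functor (arrow_cat (source P)) (comma P) (kappa_obj P)
     (\<lambda>t. tag (kappa_obj P (tag_src t)) (kappa_obj P (tag_tgt t))
             (Pair (tag_fst t) (amap P (tag_snd t))))"

section \<open>Cloven cofibrations\<close>

definition cocartesian :: "'u func \<Rightarrow> 'u \<Rightarrow> bool" where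
  "cocartesian P e \<longleftrightarrow> (let E = source P; B = target P in
     e \<in> Arr E \<and>
     (\<forall>z \<in> Obj E. \<forall>g \<in> hom E (Dom E e) z. \<forall>v \<in> hom B (omap P (Cod E e)) (omap P z).
        amap P g = Cmp B v (amap P e) \<longrightarrow>
        (\<exists>!h. h \<in> hom E (Cod E e) z \<and> Cmp E h e = g \<and> amap P h = v)))"

definition CoCart :: "'u func \<Rightarrow> 'u set" where
  "CoCart P = {e. cocartesian P e}"

definition inverse_image_Iso :: "'u func \<Rightarrow> 'u set" where
  "inverse_image_Iso P = {f \<in> Arr (source P). iso (target P) (amap P f)}"

text \<open>\<open>clv \<P> x u\<close> is the chosen arrow \<open>\<delta>\<^sup>x\<^sub>u\<close>, hence its codomain is \<open>u\<^sub>!x\<close>.\<close>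

record 'u cloven =
  proj :: "'u func"
  clv :: "'u \<Rightarrow> 'u \<Rightarrow> 'u"

definition cloven_cofibration :: "'u cloven \<Rightarrow> bool" where
  "cloven_cofibration \<P> \<longleftrightarrow> (let P = proj \<P>; E = source P; B = target P; \<delta> = clv \<P> in
     is_functor P \<and>
     (\<forall>x u. if x \<in> Obj E \<and> u \<in> Arr B \<and> Dom B u = omap P x
            then cocartesian P (\<delta> x u) \<and> Dom E (\<delta> x u) = x \<and> amap P (\<delta> x u) = u
            else \<delta> x u = undefined))"

definition normal_cleavage :: "'u cloven \<Rightarrow> bool" where
  "normal_cleavage \<P> \<longleftrightarrow> (let P = proj \<P>; E = source P; B = target P in
     \<forall>x \<in> Obj E. clv \<P> x (Ide B (omap P x)) = Ide E x)"

definition push :: "'u cloven \<Rightarrow> 'u \<Rightarrow> 'u \<Rightarrow> 'u" where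
  "push \<P> x u = Cod (source (proj \<P>)) (clv \<P> x u)"

definition nu :: "'u cloven \<Rightarrow> 'u \<Rightarrow> 'u" where
  "nu \<P> f = (let P = proj \<P>; E = source P; B = target P; x = Dom E f; y = Cod E f in
     THE h. h \<in> hom E (push \<P> x (amap P f)) y \<and>
       Cmp E h (clv \<P> x (amap P f)) = f \<and> amap P h = Ide B (omap P y))"

record 'u cloven_mor = "'u cloven edge" +
  fun_over :: "'u func"

record 'u cloven_cell = "'u cloven_mor edge" +
  trans_over :: "'u ntrans"

definition slice_of_mor :: "'u cloven_mor \<Rightarrow> 'u func slice_mor" where
  "slice_of_mor T = \<lparr>source = proj (source T), target = proj (target T), over1 = fun_over T\<rparr>"

definition slice_of_cell :: "'u cloven_cell \<Rightarrow> ('u func, 'u ntrans) slice_cell" where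
  "slice_of_cell \<alpha> = \<lparr>source = slice_of_mor (source \<alpha>), target = slice_of_mor (target \<alpha>),
     over2 = trans_over \<alpha>\<rparr>"

definition ClCoFib :: "('u set \<Rightarrow> bool) \<Rightarrow> 'u cat
    \<Rightarrow> ('u cloven, 'u cloven_mor, 'u cloven_cell) two_cat" where
  "ClCoFib small B =
    (let c0 = {\<P>. cloven_cofibration \<P> \<and> proj \<P> \<in> cells0 (CAT_over small B)};
         c1 = {T. source T \<in> c0 \<and> target T \<in> c0 \<and> slice_of_mor T \<in> cells1 (CAT_over small B) \<and>
                  amap (fun_over T) ` CoCart (proj (source T)) \<subseteq> CoCart (proj (target T))};
         cmp = \<lambda>S T. \<lparr>source = source T, target = target S,
                      fun_over = comp_functor (fun_over S) (fun_over T)\<rparr>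
     in \<lparr>cells0 = c0,
         cells1 = c1,
         cells2 = {\<alpha>. source \<alpha> \<in> c1 \<and> target \<alpha> \<in> c1 \<and>
                      source (source \<alpha>) = source (target \<alpha>) \<and>
                      target (source \<alpha>) = target (target \<alpha>) \<and>
                      slice_of_cell \<alpha> \<in> cells2 (CAT_over small B)},
         src1 = source, tgt1 = target, src2 = source, tgt2 = target,
         id1 = \<lambda>\<P>. \<lparr>source = \<P>, target = \<P>, fun_over = id_functor (source (proj \<P>))\<rparr>,
         id2 = \<lambda>T. \<lparr>source = T, target = T, trans_over = id_ntrans (fun_over T)\<rparr>,
         comp1 = cmp,
         vcomp = \<lambda>\<beta> \<alpha>. \<lparr>source = source \<alpha>, target = target \<beta>,
                        trans_over = vcomp_ntrans (trans_over \<beta>) (trans_over \<alpha>)\<rparr>,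
         hcomp = \<lambda>\<beta> \<alpha>. \<lparr>source = cmp (source \<beta>) (source \<alpha>), target = cmp (target \<beta>) (target \<alpha>),
                        trans_over = hcomp_ntrans (trans_over \<beta>) (trans_over \<alpha>)\<rparr>\<rparr>)"

text \<open>The functor \<open>L\<^sup>P\<close>: its value on \<open>(f, v) : (x, u) \<rightarrow> (y, w)\<close> is the unique arrow over \<open>v\<close>
  whose composite with \<open>\<delta>\<^sup>x\<^sub>u\<close> is \<open>\<delta>\<^sup>y\<^sub>w f\<close>.\<close>

definition cleavage_action :: "'a elt cloven \<Rightarrow> 'a elt func" where
  "cleavage_action \<P> = (let P = proj \<P>; E = source P; \<delta> = \<lambda>s. clv \<P> (lft s) (rgt s) in
     mk_functor (comma P) E (\<lambda>s. push \<P> (lft s) (rgt s))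
       (\<lambda>t. THE h. h \<in> hom E (Cod E (\<delta> (tag_src t))) (Cod E (\<delta> (tag_tgt t))) \<and>
              amap P h = tag_snd t \<and>
              Cmp E h (\<delta> (tag_src t)) = Cmp E (\<delta> (tag_tgt t)) (tag_fst t)))"

definition cleavage_chi :: "'u cloven \<Rightarrow> 'u \<Rightarrow> 'u \<Rightarrow> 'u \<Rightarrow> 'u" where
  "cleavage_chi \<P> x u v = (let P = proj \<P>; E = source P; B = target P; \<delta> = clv \<P> in
     THE h. h \<in> hom E (push \<P> (push \<P> x u) v) (push \<P> x (Cmp B v u)) \<and> iso E h \<and>
       amap P h = Ide B (Cod B v) \<and>
       Cmp E h (Cmp E (\<delta> (push \<P> x u) v) (\<delta> x u)) = \<delta> x (Cmp B v u))"

definition comparison :: "'u cloven_mor \<Rightarrow> 'u \<Rightarrow> 'u \<Rightarrow> 'u" where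
  "comparison T x u =
    (let \<P> = source T; \<Q> = target T; F = fun_over T; Q = proj \<Q>; E' = source Q; B = target Q in
     THE h. h \<in> hom E' (push \<Q> (omap F x) u) (omap F (push \<P> x u)) \<and> iso E' h \<and>
       amap Q h = Ide B (Cod B u) \<and>
       Cmp E' h (clv \<Q> (omap F x) u) = amap F (clv \<P> x u))"

definition cloven_to_psalg :: "('a elt set \<Rightarrow> bool) \<Rightarrow> 'a elt cat \<Rightarrow> 'a elt cloven
    \<Rightarrow> ('a elt func, 'a elt func slice_mor, ('a elt func, 'a elt ntrans) slice_cell) psalg" where
  "cloven_to_psalg small B \<P> =
    (let K = CAT_over small B; P = proj \<P>;
         a = \<lparr>source = Cod_functor P, target = P, over1 = cleavage_action \<P>\<rparr>;
         i0 = id1 K P; i1 = a \<cdot>\<^bsub>K\<^esub> comma_unit P;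
         c0 = a \<cdot>\<^bsub>K\<^esub> comma_mor a; c1 = a \<cdot>\<^bsub>K\<^esub> comma_mult P
     in \<lparr>under = P,
         act = a,
         unitor = \<lparr>source = i0, target = i1,
           over2 = mk_ntrans (over1 i0) (over1 i1) (\<lambda>x. clv \<P> x (Ide B (omap P x)))\<rparr>,
         multor = \<lparr>source = c0, target = c1,
           over2 = mk_ntrans (over1 c0) (over1 c1)
             (\<lambda>s. cleavage_chi \<P> (lft (lft s)) (rgt (lft s)) (rgt s))\<rparr>\<rparr>)"

definition cloven_to_psmor :: "('a elt set \<Rightarrow> bool) \<Rightarrow> 'a elt cat \<Rightarrow> 'a elt cloven_mor
    \<Rightarrow> ('a elt func, 'a elt func slice_mor, ('a elt func, 'a elt ntrans) slice_cell) psmor" where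
  "cloven_to_psmor small B T =
    (let K = CAT_over small B; f = slice_of_mor T;
         A = cloven_to_psalg small B (source T); A' = cloven_to_psalg small B (target T);
         t0 = act A' \<cdot>\<^bsub>K\<^esub> comma_mor f; t1 = f \<cdot>\<^bsub>K\<^esub> act A
     in \<lparr>source = A, target = A', mor = f,
         mcell = \<lparr>source = t0, target = t1,
           over2 = mk_ntrans (over1 t0) (over1 t1) (\<lambda>s. comparison T (lft s) (rgt s))\<rparr>\<rparr>)"

definition ClCoFib_to_PsAlg :: "('a elt set \<Rightarrow> bool) \<Rightarrow> 'a elt cat
    \<Rightarrow> ('a elt cloven, 'a elt cloven_mor, 'a elt cloven_cell,
      ('a elt func, 'a elt func slice_mor, ('a elt func, 'a elt ntrans) slice_cell) psalg,
      ('a elt func, 'a elt func slice_mor, ('a elt func, 'a elt ntrans) slice_cell) psmor,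
      ('a elt func, 'a elt func slice_mor, ('a elt func, 'a elt ntrans) slice_cell) algtrans)
      two_fun" where
  "ClCoFib_to_PsAlg small B = \<lparr>
     map0 = cloven_to_psalg small B,
     map1 = cloven_to_psmor small B,
     map2 = \<lambda>\<alpha>. \<lparr>source = cloven_to_psmor small B (source \<alpha>),
                 target = cloven_to_psmor small B (target \<alpha>),
                 trans = slice_of_cell \<alpha>\<rparr>\<rparr>"

definition Fact_ps :: "('a elt set \<Rightarrow> bool) \<Rightarrow> 'a elt cat
    \<Rightarrow> ('a elt cloven, 'a elt cloven_mor, 'a elt cloven_cell,
      ('a elt cat, 'a elt func, 'a elt ntrans) psalg,
      ('a elt cat, 'a elt func, 'a elt ntrans) psmor,
      ('a elt cat, 'a elt func, 'a elt ntrans) algtrans) two_fun" where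
  "Fact_ps small B =
     restrict_scalars comma_monad (CAT small) square_monad (Dom_fun (CAT small)) kappa
       \<circ>\<^sub>2 ClCoFib_to_PsAlg small B"

section \<open>Selected factors and orthogonal factorization systems\<close>

text \<open>For a pseudoalgebra of the squaring 2-monad with action \<open>F\<close> and unit \<open>j\<close>, the factors selected
  at \<open>f : x \<rightarrow> y\<close> come from the squares \<open>(1\<^sub>x, f) : 1\<^sub>x \<rightarrow> f\<close> and \<open>(f, 1\<^sub>y) : f \<rightarrow> 1\<^sub>y\<close>.\<close>

definition left_factor ::
  "('a elt cat, 'a elt func, 'a elt ntrans) psalg \<Rightarrow> 'a elt \<Rightarrow> 'a elt" where
  "left_factor A f = (let E = under A; x = Dom E f in
     Cmp E (amap (act A) (square (Ide E x) f (Ide E x) f)) (component (unitor A) x))"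

definition right_factor ::
  "('a elt cat, 'a elt func, 'a elt ntrans) psalg \<Rightarrow> 'a elt \<Rightarrow> 'a elt" where
  "right_factor A f = (let E = under A; y = Cod E f in
     Cmp E (inv_arr E (component (unitor A) y)) (amap (act A) (square f (Ide E y) f (Ide E y))))"

definition left_class ::
  "('a elt cat, 'a elt func, 'a elt ntrans) psalg \<Rightarrow> 'a elt set" where
  "left_class A = {f \<in> Arr (under A). iso (under A) (right_factor A f)}"

definition right_class ::
  "('a elt cat, 'a elt func, 'a elt ntrans) psalg \<Rightarrow> 'a elt set" where
  "right_class A = {f \<in> Arr (under A). iso (under A) (left_factor A f)}"

definition iso_closed :: "'u cat \<Rightarrow> 'u set \<Rightarrow> bool" where
  "iso_closed E S \<longleftrightarrow> (\<forall>f \<in> S. \<forall>i. iso E i \<longrightarrow>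
     (Dom E i = Cod E f \<longrightarrow> Cmp E i f \<in> S) \<and> (Cod E i = Dom E f \<longrightarrow> Cmp E f i \<in> S))"

definition orthogonal_factorization_system :: "'u cat \<Rightarrow> 'u set \<Rightarrow> 'u set \<Rightarrow> bool" where
  "orthogonal_factorization_system E \<L> \<R> \<longleftrightarrow>
     \<L> \<subseteq> Arr E \<and> \<R> \<subseteq> Arr E \<and> iso_closed E \<L> \<and> iso_closed E \<R> \<and>
     (\<forall>f \<in> Arr E. \<exists>e \<in> \<L>. \<exists>m \<in> \<R>. Cod E e = Dom E m \<and> Cmp E m e = f) \<and>
     (\<forall>e \<in> \<L>. \<forall>m \<in> \<R>. \<forall>g \<in> hom E (Dom E e) (Dom E m). \<forall>h \<in> hom E (Cod E e) (Cod E m).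
        Cmp E m g = Cmp E h e \<longrightarrow>
        (\<exists>!d. d \<in> hom E (Cod E e) (Dom E m) \<and> Cmp E d e = g \<and> Cmp E m d = h))"

end

(*
A cleavage lets all the 2-cells in sight be recovered from cocartesian lifts: two arrows out of u_! x over
the same arrow of B agree once they agree after precomposition with \<delta>^x_u. This yields the coherence
laws for the unit, the multiplication cell and the comparison cell of a cloven cofibration. Conversely, an action
a with unit \<iota> of the comma 2-monad gives the cocartesian arrow \<delta>^x_u = a(1_x, u) \<iota>_x, where (1_x, u)
is an arrow from (x, 1) to (x, u) of the comma category, and the multiplication cell is forced by
\<chi> \<delta>^{u_! x}_v \<delta>^x_u = \<delta>^x_{vu}; hence nothing is lost in passing to pseudoalgebras.

For the factorization, (1_x, f) in the arrow category is sent by \<kappa> to (1_x, Pf), so the left factor is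
\<delta>^x_{Pf}, and the right factor is the arrow over an identity that \<delta>^x_{Pf} determines, namely \<nu>_f.
It is invertible iff f is cocartesian, and \<delta>^x_{Pf} is invertible iff Pf is.
*)
theory Submission
  imports Defs
begin

section \<open>2-categories, 2-functors and 2-monads\<close>

text \<open>The obstacle is strictness: functors, cells and whole pseudoalgebras must be literally
  equal, while their data are fixed only by universal properties. In the abstract part every law is
  an equation between right-nested composites with naturality oriented one way, so that pasting
  becomes normalization; laws are therefore also kept in a form that applies in front of a further
  factor. In the concrete part the comparison cell of a composite is not computed: the cell of a
  pseudomorphism is forced by its unit law and by naturality along (1_x, u) : (x, 1) -> (x, u), so
  an identity or a composite is recognised from its underlying functor. The same rigidity gives the
  bijection on 1-cells. The laws of the 2-category of cloven cofibrations are then reflected from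
  the pseudoalgebras. For an abstract pseudoalgebra, uniqueness of lifts along a(1_x, u) \<iota>_x
  rests on the identity a(\<delta>^x_u, 1) = \<iota>: it gives \<iota> k = a(k \<delta>^x_u, P k)
  for every k out of u_!x.\<close>

lemma two_fun_simps [simp]:
  "map0 id_two_fun X = X" "map1 id_two_fun f = f" "map2 id_two_fun \<alpha> = \<alpha>"
  "map0 (G \<circ>\<^sub>2 F) X = map0 G (map0 F X)" "map1 (G \<circ>\<^sub>2 F) f = map1 G (map1 F f)"
  "map2 (G \<circ>\<^sub>2 F) \<alpha> = map2 G (map2 F \<alpha>)"
  by (simp_all add: id_two_fun_def comp_two_fun_def)

text \<open>Source and target equations replace membership in hom sets, so that an instance is
  checked by rewriting boundaries. For vertical composition the premises also supply the equality of
  the 0-dimensional boundaries; it follows from the parallelism condition, and supplying it spares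
  each instance that derivation.\<close>

lemma two_categoryI:
  fixes K :: "('o, 'm, 'c) two_cat" (structure)
  assumes "\<And>f. f \<in> cells1 K \<Longrightarrow> src1 K f \<in> cells0 K"
    "\<And>f. f \<in> cells1 K \<Longrightarrow> tgt1 K f \<in> cells0 K"
    "\<And>\<alpha>. \<alpha> \<in> cells2 K \<Longrightarrow> src2 K \<alpha> \<in> cells1 K"
    "\<And>\<alpha>. \<alpha> \<in> cells2 K \<Longrightarrow> tgt2 K \<alpha> \<in> cells1 K"
    "\<And>\<alpha>. \<alpha> \<in> cells2 K \<Longrightarrow> src1 K (tgt2 K \<alpha>) = src1 K (src2 K \<alpha>) \<and> tgt1 K (tgt2 K \<alpha>) = tgt1 K (src2 K \<alpha>)"
    "\<And>X. X \<in> cells0 K \<Longrightarrow> id1 K X \<in> cells1 K \<and> src1 K (id1 K X) = X \<and> tgt1 K (id1 K X) = X"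
    "\<And>f. f \<in> cells1 K \<Longrightarrow> id2 K f \<in> cells2 K \<and> src2 K (id2 K f) = f \<and> tgt2 K (id2 K f) = f"
    "\<And>f g. f \<in> cells1 K \<Longrightarrow> g \<in> cells1 K \<Longrightarrow> tgt1 K f = src1 K g
      \<Longrightarrow> g \<cdot> f \<in> cells1 K \<and> src1 K (g \<cdot> f) = src1 K f \<and> tgt1 K (g \<cdot> f) = tgt1 K g"
    "\<And>\<alpha> \<beta>. \<alpha> \<in> cells2 K \<Longrightarrow> \<beta> \<in> cells2 K \<Longrightarrow> tgt2 K \<alpha> = src2 K \<beta>
      \<Longrightarrow> src1 K (src2 K \<beta>) = src1 K (src2 K \<alpha>) \<Longrightarrow> tgt1 K (src2 K \<beta>) = tgt1 K (src2 K \<alpha>)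
      \<Longrightarrow> \<beta> \<bullet> \<alpha> \<in> cells2 K \<and> src2 K (\<beta> \<bullet> \<alpha>) = src2 K \<alpha> \<and> tgt2 K (\<beta> \<bullet> \<alpha>) = tgt2 K \<beta>"
    "\<And>\<alpha> \<beta>. \<alpha> \<in> cells2 K \<Longrightarrow> \<beta> \<in> cells2 K \<Longrightarrow> tgt1 K (src2 K \<alpha>) = src1 K (src2 K \<beta>)
      \<Longrightarrow> \<beta> \<star> \<alpha> \<in> cells2 K \<and> src2 K (\<beta> \<star> \<alpha>) = src2 K \<beta> \<cdot> src2 K \<alpha>
        \<and> tgt2 K (\<beta> \<star> \<alpha>) = tgt2 K \<beta> \<cdot> tgt2 K \<alpha>"
    "\<And>f. f \<in> cells1 K \<Longrightarrow> id1 K (tgt1 K f) \<cdot> f = f \<and> f \<cdot> id1 K (src1 K f) = f"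
    "\<And>f g h. f \<in> cells1 K \<Longrightarrow> g \<in> cells1 K \<Longrightarrow> h \<in> cells1 K \<Longrightarrow> tgt1 K f = src1 K g
      \<Longrightarrow> tgt1 K g = src1 K h \<Longrightarrow> h \<cdot> g \<cdot> f = h \<cdot> (g \<cdot> f)"
    "\<And>\<alpha>. \<alpha> \<in> cells2 K \<Longrightarrow> id2 K (tgt2 K \<alpha>) \<bullet> \<alpha> = \<alpha>"
    "\<And>\<alpha>. \<alpha> \<in> cells2 K \<Longrightarrow> \<alpha> \<bullet> id2 K (src2 K \<alpha>) = \<alpha>"
    "\<And>\<alpha> \<beta> \<gamma>. \<alpha> \<in> cells2 K \<Longrightarrow> \<beta> \<in> cells2 K \<Longrightarrow> \<gamma> \<in> cells2 K \<Longrightarrow> tgt2 K \<alpha> = src2 K \<beta>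
      \<Longrightarrow> tgt2 K \<beta> = src2 K \<gamma>
      \<Longrightarrow> src1 K (src2 K \<beta>) = src1 K (src2 K \<alpha>) \<Longrightarrow> tgt1 K (src2 K \<beta>) = tgt1 K (src2 K \<alpha>)
      \<Longrightarrow> src1 K (src2 K \<gamma>) = src1 K (src2 K \<alpha>) \<Longrightarrow> tgt1 K (src2 K \<gamma>) = tgt1 K (src2 K \<alpha>)
      \<Longrightarrow> \<gamma> \<bullet> \<beta> \<bullet> \<alpha> = \<gamma> \<bullet> (\<beta> \<bullet> \<alpha>)"
    "\<And>\<alpha>. \<alpha> \<in> cells2 K \<Longrightarrow> id2 K (id1 K (tgt1 K (src2 K \<alpha>))) \<star> \<alpha> = \<alpha>
      \<and> \<alpha> \<star> id2 K (id1 K (src1 K (src2 K \<alpha>))) = \<alpha>"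
    "\<And>\<alpha> \<beta> \<gamma>. \<alpha> \<in> cells2 K \<Longrightarrow> \<beta> \<in> cells2 K \<Longrightarrow> \<gamma> \<in> cells2 K
      \<Longrightarrow> tgt1 K (src2 K \<alpha>) = src1 K (src2 K \<beta>) \<Longrightarrow> tgt1 K (src2 K \<beta>) = src1 K (src2 K \<gamma>)
      \<Longrightarrow> \<gamma> \<star> \<beta> \<star> \<alpha> = \<gamma> \<star> (\<beta> \<star> \<alpha>)"
    "\<And>f g. f \<in> cells1 K \<Longrightarrow> g \<in> cells1 K \<Longrightarrow> tgt1 K f = src1 K g
      \<Longrightarrow> id2 K g \<star> id2 K f = id2 K (g \<cdot> f)"
    "\<And>\<alpha> \<beta> \<alpha>' \<beta>'. \<alpha> \<in> cells2 K \<Longrightarrow> \<beta> \<in> cells2 K \<Longrightarrow> \<alpha>' \<in> cells2 K \<Longrightarrow> \<beta>' \<in> cells2 K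
      \<Longrightarrow> tgt2 K \<alpha> = src2 K \<alpha>' \<Longrightarrow> tgt2 K \<beta> = src2 K \<beta>' \<Longrightarrow> tgt1 K (src2 K \<alpha>) = src1 K (src2 K \<beta>)
      \<Longrightarrow> src1 K (src2 K \<alpha>') = src1 K (src2 K \<alpha>) \<Longrightarrow> tgt1 K (src2 K \<alpha>') = tgt1 K (src2 K \<alpha>)
      \<Longrightarrow> src1 K (src2 K \<beta>') = src1 K (src2 K \<beta>) \<Longrightarrow> tgt1 K (src2 K \<beta>') = tgt1 K (src2 K \<beta>)
      \<Longrightarrow> (\<beta>' \<bullet> \<beta>) \<star> (\<alpha>' \<bullet> \<alpha>) = (\<beta>' \<star> \<alpha>') \<bullet> (\<beta> \<star> \<alpha>)"
  shows "two_category K"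
proof (unfold_locales, goal_cases)
  case (22 \<alpha> f f' \<alpha>' f'' \<beta> g g' \<beta>' g'')
  then show ?case
    using assms(5)[of \<alpha>] assms(5)[of \<beta>] by (intro assms(19)) (auto simp: hom2_def)
next
  case (10 \<alpha> f g \<beta> h)
  then show ?case using assms(5)[of \<alpha>] assms(9)[of \<alpha> \<beta>] by (auto simp: hom2_def)
next
  case (17 \<alpha> f g \<beta> h \<gamma> k)
  then show ?case
    using assms(5)[of \<alpha>] assms(5)[of \<beta>] by (intro assms(15)) (auto simp: hom2_def)
qed (use assms in \<open>auto simp: hom1_def hom2_def\<close>)

section \<open>Calculus of cells in a strict 2-category\<close>

context two_category
begin

lemma cells_of_id1 [simp]:
  assumes "X \<in> cells0 K"
  shows "id1 K X \<in> cells1 K" "src1 K (id1 K X) = X" "tgt1 K (id1 K X) = X"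
  using id1_hom[OF assms] by (auto simp: hom1_def)

lemma cells_of_id2 [simp]:
  assumes "f \<in> cells1 K"
  shows "id2 K f \<in> cells2 K" "src2 K (id2 K f) = f" "tgt2 K (id2 K f) = f"
  using id2_hom[OF assms] by (auto simp: hom2_def)

lemma cells_of_comp1 [simp]:
  assumes "f \<in> cells1 K" "g \<in> cells1 K" "tgt1 K f = src1 K g"
  shows "g \<cdot> f \<in> cells1 K" "src1 K (g \<cdot> f) = src1 K f" "tgt1 K (g \<cdot> f) = tgt1 K g"
  using comp1_hom[of f "src1 K f" "src1 K g" g "tgt1 K g"] assms by (auto simp: hom1_def)

lemma cells_of_vcomp [simp]:
  assumes "\<alpha> \<in> cells2 K" "\<beta> \<in> cells2 K" "tgt2 K \<alpha> = src2 K \<beta>"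
  shows "\<beta> \<bullet> \<alpha> \<in> cells2 K" "src2 K (\<beta> \<bullet> \<alpha>) = src2 K \<alpha>" "tgt2 K (\<beta> \<bullet> \<alpha>) = tgt2 K \<beta>"
  using vcomp_hom[of \<alpha> "src2 K \<alpha>" "src2 K \<beta>" \<beta> "tgt2 K \<beta>"] assms by (auto simp: hom2_def)

lemma cells_of_hcomp [simp]:
  assumes "\<alpha> \<in> cells2 K" "\<beta> \<in> cells2 K" "tgt1 K (src2 K \<alpha>) = src1 K (src2 K \<beta>)"
  shows "\<beta> \<star> \<alpha> \<in> cells2 K" "src2 K (\<beta> \<star> \<alpha>) = src2 K \<beta> \<cdot> src2 K \<alpha>"
    "tgt2 K (\<beta> \<star> \<alpha>) = tgt2 K \<beta> \<cdot> tgt2 K \<alpha>"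
  using hcomp_hom[of \<alpha> "src2 K \<alpha>" "tgt2 K \<alpha>" \<beta> "src2 K \<beta>" "tgt2 K \<beta>"] assms
  by (auto simp: hom2_def)

lemma cells_in [simp]:
  "f \<in> cells1 K \<Longrightarrow> src1 K f \<in> cells0 K" "f \<in> cells1 K \<Longrightarrow> tgt1 K f \<in> cells0 K"
  "\<alpha> \<in> cells2 K \<Longrightarrow> src2 K \<alpha> \<in> cells1 K" "\<alpha> \<in> cells2 K \<Longrightarrow> tgt2 K \<alpha> \<in> cells1 K"
  by (simp_all add: src1_in tgt1_in src2_in tgt2_in)

text \<open>The boundary of a target 1-cell is always replaced by that of the source 1-cell, which
  gives each 2-cell one canonical pair of 0-dimensional ends.\<close>

lemma parallel [simp]:
  assumes "\<alpha> \<in> cells2 K"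
  shows "src1 K (tgt2 K \<alpha>) = src1 K (src2 K \<alpha>)" "tgt1 K (tgt2 K \<alpha>) = tgt1 K (src2 K \<alpha>)"
  using parallel_src[OF assms] parallel_tgt[OF assms] by simp_all

lemma comp1_ids [simp]:
  assumes "f \<in> cells1 K"
  shows "tgt1 K f = Y \<Longrightarrow> id1 K Y \<cdot> f = f" "src1 K f = X \<Longrightarrow> f \<cdot> id1 K X = f"
  using assms comp1_id_left[of f "src1 K f" "tgt1 K f"] comp1_id_right[of f "src1 K f" "tgt1 K f"]
  by (auto simp: hom1_def)

text \<open>Right-nesting is the normal form, here for 1-cells and below for both compositions of
  2-cells. Pasting equations are later proved by bringing both sides into this form.\<close>

lemma comp1_assoc' [simp]:
  assumes "f \<in> cells1 K" "g \<in> cells1 K" "h \<in> cells1 K" "tgt1 K f = src1 K g" "tgt1 K g = src1 K h"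
  shows "h \<cdot> g \<cdot> f = h \<cdot> (g \<cdot> f)"
  using comp1_assoc[of f "src1 K f" "src1 K g" g "src1 K h" h "tgt1 K h"] assms
  by (auto simp: hom1_def)

lemma vcomp_ids [simp]:
  assumes "\<alpha> \<in> cells2 K"
  shows "tgt2 K \<alpha> = g \<Longrightarrow> id2 K g \<bullet> \<alpha> = \<alpha>" "src2 K \<alpha> = f \<Longrightarrow> \<alpha> \<bullet> id2 K f = \<alpha>"
  using assms vcomp_id_left[of \<alpha> "src2 K \<alpha>" "tgt2 K \<alpha>"] vcomp_id_right[of \<alpha> "src2 K \<alpha>" "tgt2 K \<alpha>"]
  by (auto simp: hom2_def)

lemma vcomp_assoc' [simp]:
  assumes "\<alpha> \<in> cells2 K" "\<beta> \<in> cells2 K" "\<gamma> \<in> cells2 K"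
    "tgt2 K \<alpha> = src2 K \<beta>" "tgt2 K \<beta> = src2 K \<gamma>"
  shows "\<gamma> \<bullet> \<beta> \<bullet> \<alpha> = \<gamma> \<bullet> (\<beta> \<bullet> \<alpha>)"
  using vcomp_assoc[of \<alpha> "src2 K \<alpha>" "src2 K \<beta>" \<beta> "src2 K \<gamma>" \<gamma> "tgt2 K \<gamma>"] assms
  by (auto simp: hom2_def)

lemma hcomp_ids [simp]:
  assumes "\<alpha> \<in> cells2 K"
  shows "tgt1 K (src2 K \<alpha>) = Y \<Longrightarrow> id2 K (id1 K Y) \<star> \<alpha> = \<alpha>"
    "src1 K (src2 K \<alpha>) = X \<Longrightarrow> \<alpha> \<star> id2 K (id1 K X) = \<alpha>"
  using assms hcomp_id_left[of \<alpha> "src2 K \<alpha>" "tgt2 K \<alpha>"] hcomp_id_right[of \<alpha> "src2 K \<alpha>" "tgt2 K \<alpha>"]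
  by (auto simp: hom1_def hom2_def)

lemma hcomp_assoc' [simp]:
  assumes "\<alpha> \<in> cells2 K" "\<beta> \<in> cells2 K" "\<gamma> \<in> cells2 K"
    "tgt1 K (src2 K \<alpha>) = src1 K (src2 K \<beta>)" "tgt1 K (src2 K \<beta>) = src1 K (src2 K \<gamma>)"
  shows "\<gamma> \<star> \<beta> \<star> \<alpha> = \<gamma> \<star> (\<beta> \<star> \<alpha>)"
  using hcomp_assoc[of \<alpha> "src2 K \<alpha>" "tgt2 K \<alpha>" \<beta> "src2 K \<beta>" "tgt2 K \<beta>" \<gamma> "src2 K \<gamma>" "tgt2 K \<gamma>"] assms
  by (auto simp: hom2_def)

lemma hcomp_id2' [simp]:
  assumes "f \<in> cells1 K" "g \<in> cells1 K" "tgt1 K f = src1 K g"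
  shows "id2 K g \<star> id2 K f = id2 K (g \<cdot> f)"
  using hcomp_id2[of f "src1 K f" "src1 K g" g "tgt1 K g"] assms by (auto simp: hom1_def)

text \<open>Right-nesting keeps two successive left whiskerings apart, so their identities never
  meet directly; this rule merges them into one whiskering. Successive right whiskerings merge
  through associativity alone.\<close>

lemma hcomp_id2_id2 [simp]:
  assumes "\<alpha> \<in> cells2 K" "f \<in> cells1 K" "g \<in> cells1 K" "tgt1 K (src2 K \<alpha>) = src1 K f" "tgt1 K f = src1 K g"
  shows "id2 K g \<star> (id2 K f \<star> \<alpha>) = id2 K (g \<cdot> f) \<star> \<alpha>"
  using assms hcomp_assoc'[of \<alpha> "id2 K f" "id2 K g"] by simp

lemma interchange':
  assumes "\<alpha> \<in> cells2 K" "\<beta> \<in> cells2 K" "\<alpha>' \<in> cells2 K" "\<beta>' \<in> cells2 K"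
    "tgt2 K \<alpha> = src2 K \<alpha>'" "tgt2 K \<beta> = src2 K \<beta>'" "tgt1 K (src2 K \<alpha>) = src1 K (src2 K \<beta>)"
  shows "(\<beta>' \<bullet> \<beta>) \<star> (\<alpha>' \<bullet> \<alpha>) = (\<beta>' \<star> \<alpha>') \<bullet> (\<beta> \<star> \<alpha>)"
  using interchange[of \<alpha> "src2 K \<alpha>" "src2 K \<alpha>'" \<alpha>' "tgt2 K \<alpha>'" \<beta> "src2 K \<beta>" "src2 K \<beta>'" \<beta>' "tgt2 K \<beta>'"]
    assms by (auto simp: hom2_def)

text \<open>Interchange has no preferred direction in general. With an identity as one factor it
  does: whiskering is distributed over vertical composition.\<close>

lemma whisker_vcomp [simp]:
  assumes "\<alpha> \<in> cells2 K" "\<beta> \<in> cells2 K" "tgt2 K \<alpha> = src2 K \<beta>" "f \<in> cells1 K"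
  shows "tgt1 K (src2 K \<alpha>) = src1 K f \<Longrightarrow> id2 K f \<star> (\<beta> \<bullet> \<alpha>) = (id2 K f \<star> \<beta>) \<bullet> (id2 K f \<star> \<alpha>)"
    "tgt1 K f = src1 K (src2 K \<alpha>) \<Longrightarrow> (\<beta> \<bullet> \<alpha>) \<star> id2 K f = (\<beta> \<star> id2 K f) \<bullet> (\<alpha> \<star> id2 K f)"
  using interchange'[of \<alpha> "id2 K f" \<beta> "id2 K f"] interchange'[of "id2 K f" \<alpha> "id2 K f" \<beta>] assms
  by auto

lemma hcomp_left_right:
  assumes "\<alpha> \<in> cells2 K" "\<beta> \<in> cells2 K" "tgt1 K (src2 K \<alpha>) = src1 K (src2 K \<beta>)"
  shows "\<beta> \<star> \<alpha> = (\<beta> \<star> id2 K (tgt2 K \<alpha>)) \<bullet> (id2 K (src2 K \<beta>) \<star> \<alpha>)"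
    "\<beta> \<star> \<alpha> = (id2 K (tgt2 K \<beta>) \<star> \<alpha>) \<bullet> (\<beta> \<star> id2 K (src2 K \<alpha>))"
  using interchange'[of \<alpha> "id2 K (src2 K \<beta>)" "id2 K (tgt2 K \<alpha>)" \<beta>]
    interchange'[of "id2 K (src2 K \<alpha>)" \<beta> \<alpha> "id2 K (tgt2 K \<beta>)"] assms
  by auto

text \<open>The two decompositions of the horizontal composite are equated: cells acting on
  different factors may be applied in either order. This is the one pasting move that normalization
  cannot choose by itself.\<close>

lemma whisker_exchange:
  assumes "\<alpha> \<in> cells2 K" "\<beta> \<in> cells2 K" "tgt1 K (src2 K \<alpha>) = src1 K (src2 K \<beta>)"
    "src2 K \<alpha> = f" "tgt2 K \<alpha> = f'" "src2 K \<beta> = g" "tgt2 K \<beta> = g'"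
  shows "(id2 K g' \<star> \<alpha>) \<bullet> (\<beta> \<star> id2 K f) = (\<beta> \<star> id2 K f') \<bullet> (id2 K g \<star> \<alpha>)"
  using hcomp_left_right[OF assms(1-3)] assms by simp

lemma invertible2I:
  assumes "\<alpha> \<in> cells2 K" "\<beta> \<in> cells2 K" "src2 K \<beta> = tgt2 K \<alpha>" "tgt2 K \<beta> = src2 K \<alpha>"
    "\<beta> \<bullet> \<alpha> = id2 K (src2 K \<alpha>)" "\<alpha> \<bullet> \<beta> = id2 K (tgt2 K \<alpha>)"
  shows "invertible2 K \<alpha>"
  using assms by (auto simp: invertible2_def hom2_def)

lemma invertible2E:
  assumes "invertible2 K \<alpha>"
  obtains \<beta> where "\<alpha> \<in> cells2 K" "\<beta> \<in> cells2 K" "src2 K \<beta> = tgt2 K \<alpha>" "tgt2 K \<beta> = src2 K \<alpha>"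
    "\<beta> \<bullet> \<alpha> = id2 K (src2 K \<alpha>)" "\<alpha> \<bullet> \<beta> = id2 K (tgt2 K \<alpha>)"
  using assms by (auto simp: invertible2_def hom2_def)

lemma invertible2_id2 [simp]: "f \<in> cells1 K \<Longrightarrow> invertible2 K (id2 K f)"
  by (rule invertible2I[of _ "id2 K f"]) simp_all

lemma invertible2_vcomp [simp]:
  assumes "invertible2 K \<alpha>" "invertible2 K \<beta>" "tgt2 K \<alpha> = src2 K \<beta>"
  shows "invertible2 K (\<beta> \<bullet> \<alpha>)"
proof -
  obtain \<alpha>' where a: "\<alpha> \<in> cells2 K" "\<alpha>' \<in> cells2 K" "src2 K \<alpha>' = tgt2 K \<alpha>" "tgt2 K \<alpha>' = src2 K \<alpha>"
    "\<alpha>' \<bullet> \<alpha> = id2 K (src2 K \<alpha>)" "\<alpha> \<bullet> \<alpha>' = id2 K (tgt2 K \<alpha>)" using assms(1) by (rule invertible2E)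
  obtain \<beta>' where b: "\<beta> \<in> cells2 K" "\<beta>' \<in> cells2 K" "src2 K \<beta>' = tgt2 K \<beta>" "tgt2 K \<beta>' = src2 K \<beta>"
    "\<beta>' \<bullet> \<beta> = id2 K (src2 K \<beta>)" "\<beta> \<bullet> \<beta>' = id2 K (tgt2 K \<beta>)" using assms(2) by (rule invertible2E)
  \<comment> \<open>The inverse of \<beta> \<alpha> is \<alpha>' \<beta>'; these two equations
    cancel the inner pair in each of the composites to be checked.\<close>
  have 1: "\<beta>' \<bullet> (\<beta> \<bullet> \<alpha>) = \<alpha>" using vcomp_assoc'[of \<alpha> \<beta> \<beta>'] a b assms(3) by simp
  have 2: "\<alpha> \<bullet> (\<alpha>' \<bullet> \<beta>') = \<beta>'" using vcomp_assoc'[of \<beta>' \<alpha>' \<alpha>] a b assms(3) by simp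
  show ?thesis
    by (rule invertible2I[of _ "\<alpha>' \<bullet> \<beta>'"]) (use a b assms(3) 1 2 in simp_all)
qed

lemma invertible2_hcomp [simp]:
  assumes "invertible2 K \<alpha>" "invertible2 K \<beta>" "tgt1 K (src2 K \<alpha>) = src1 K (src2 K \<beta>)"
  shows "invertible2 K (\<beta> \<star> \<alpha>)"
proof -
  obtain \<alpha>' where a: "\<alpha> \<in> cells2 K" "\<alpha>' \<in> cells2 K" "src2 K \<alpha>' = tgt2 K \<alpha>" "tgt2 K \<alpha>' = src2 K \<alpha>"
    "\<alpha>' \<bullet> \<alpha> = id2 K (src2 K \<alpha>)" "\<alpha> \<bullet> \<alpha>' = id2 K (tgt2 K \<alpha>)" using assms(1) by (rule invertible2E)
  obtain \<beta>' where b: "\<beta> \<in> cells2 K" "\<beta>' \<in> cells2 K" "src2 K \<beta>' = tgt2 K \<beta>" "tgt2 K \<beta>' = src2 K \<beta>"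
    "\<beta>' \<bullet> \<beta> = id2 K (src2 K \<beta>)" "\<beta> \<bullet> \<beta>' = id2 K (tgt2 K \<beta>)" using assms(2) by (rule invertible2E)
  show ?thesis
    by (rule invertible2I[of _ "\<beta>' \<star> \<alpha>'"])
      (use a b assms(3) interchange'[of \<alpha> \<beta> \<alpha>' \<beta>'] interchange'[of \<alpha>' \<beta>' \<alpha> \<beta>] in simp_all)
qed

end

context two_functor
begin

lemma map0_cells [simp]: "X \<in> cells0 C \<Longrightarrow> map0 F X \<in> cells0 D"
  by (rule map0_in)

lemma map1_cells [simp]:
  assumes "f \<in> cells1 C"
  shows "map1 F f \<in> cells1 D" "src1 D (map1 F f) = map0 F (src1 C f)"
    "tgt1 D (map1 F f) = map0 F (tgt1 C f)"
  using map1_hom[of f "src1 C f" "tgt1 C f"] assms by (auto simp: hom1_def)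

lemma map2_cells [simp]:
  assumes "\<alpha> \<in> cells2 C"
  shows "map2 F \<alpha> \<in> cells2 D" "src2 D (map2 F \<alpha>) = map1 F (src2 C \<alpha>)"
    "tgt2 D (map2 F \<alpha>) = map1 F (tgt2 C \<alpha>)"
  using map2_hom[of \<alpha> "src2 C \<alpha>" "tgt2 C \<alpha>"] assms by (auto simp: hom2_def)

lemma map_ids [simp]:
  "X \<in> cells0 C \<Longrightarrow> map1 F (id1 C X) = id1 D (map0 F X)"
  "f \<in> cells1 C \<Longrightarrow> map2 F (id2 C f) = id2 D (map1 F f)"
  by (simp_all add: map1_id map2_id)

lemma map1_comp' [simp]:
  "f \<in> cells1 C \<Longrightarrow> g \<in> cells1 C \<Longrightarrow> tgt1 C f = src1 C g
    \<Longrightarrow> map1 F (g \<cdot>\<^bsub>C\<^esub> f) = map1 F g \<cdot>\<^bsub>D\<^esub> map1 F f"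
  using map1_comp[of f "src1 C f" "src1 C g" g "tgt1 C g"] by (auto simp: hom1_def)

lemma map2_vcomp' [simp]:
  "\<alpha> \<in> cells2 C \<Longrightarrow> \<beta> \<in> cells2 C \<Longrightarrow> tgt2 C \<alpha> = src2 C \<beta>
    \<Longrightarrow> map2 F (\<beta> \<bullet>\<^bsub>C\<^esub> \<alpha>) = map2 F \<beta> \<bullet>\<^bsub>D\<^esub> map2 F \<alpha>"
  using map2_vcomp[of \<alpha> "src2 C \<alpha>" "src2 C \<beta>" \<beta> "tgt2 C \<beta>"] by (auto simp: hom2_def)

lemma map2_hcomp' [simp]:
  "\<alpha> \<in> cells2 C \<Longrightarrow> \<beta> \<in> cells2 C \<Longrightarrow> tgt1 C (src2 C \<alpha>) = src1 C (src2 C \<beta>)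
    \<Longrightarrow> map2 F (\<beta> \<star>\<^bsub>C\<^esub> \<alpha>) = map2 F \<beta> \<star>\<^bsub>D\<^esub> map2 F \<alpha>"
  using map2_hcomp[of \<alpha> "src2 C \<alpha>" "tgt2 C \<alpha>" \<beta> "src2 C \<beta>" "tgt2 C \<beta>"] by (auto simp: hom2_def)

lemma map2_invertible2 [simp]:
  assumes "invertible2 C \<alpha>"
  shows "invertible2 D (map2 F \<alpha>)"
proof -
  obtain \<alpha>' where a: "\<alpha> \<in> cells2 C" "\<alpha>' \<in> cells2 C" "src2 C \<alpha>' = tgt2 C \<alpha>" "tgt2 C \<alpha>' = src2 C \<alpha>"
    "\<alpha>' \<bullet>\<^bsub>C\<^esub> \<alpha> = id2 C (src2 C \<alpha>)" "\<alpha> \<bullet>\<^bsub>C\<^esub> \<alpha>' = id2 C (tgt2 C \<alpha>)" using assms by (rule dom.invertible2E)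
  then show ?thesis
    by (intro cod.invertible2I[of _ "map2 F \<alpha>'"]) (simp_all flip: map2_vcomp')
qed

end

lemma two_functor_comp:
  assumes "two_functor C D F" "two_functor D E G"
  shows "two_functor C E (G \<circ>\<^sub>2 F)"
proof -
  interpret F: two_functor C D F by fact
  interpret G: two_functor D E G by fact
  show ?thesis
    by unfold_locales (auto simp: hom1_def hom2_def)
qed

lemma two_functor_id:
  assumes "two_category K"
  shows "two_functor K K id_two_fun"
proof -
  interpret two_category K by fact
  show ?thesis
    by unfold_locales (auto simp: hom1_def hom2_def)
qed

context two_natural
begin

lemma component_cells [simp]:
  assumes "X \<in> cells0 C"
  shows "t X \<in> cells1 D" "src1 D (t X) = map0 F X" "tgt1 D (t X) = map0 G X"
  using component_hom[OF assms] by (auto simp: hom1_def)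

text \<open>The orientation moves the component of the transformation to the outside. Used
  consistently for unit, multiplication and \<lambda>, it sends the structure cells to the left end
  of every composite.\<close>

lemma natural1':
  "f \<in> cells1 C \<Longrightarrow> src1 C f = X \<Longrightarrow> tgt1 C f = Y
    \<Longrightarrow> map1 G f \<cdot>\<^bsub>D\<^esub> t X = t Y \<cdot>\<^bsub>D\<^esub> map1 F f"
  using natural1[of f X Y] by (auto simp: hom1_def)

text \<open>In a right-nested composite the redex of naturality is followed by a further 1-cell;
  this form still applies there. \<open>natural2_comp\<close> does the same for whiskered
  2-cells.\<close>

lemma natural1_comp:
  assumes "f \<in> cells1 C" "src1 C f = X" "tgt1 C f = Y" "h \<in> cells1 D" "tgt1 D h = map0 F X"
  shows "map1 G f \<cdot>\<^bsub>D\<^esub> (t X \<cdot>\<^bsub>D\<^esub> h) = t Y \<cdot>\<^bsub>D\<^esub> (map1 F f \<cdot>\<^bsub>D\<^esub> h)"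
  using assms natural1'[OF assms(1-3)] src.cod.comp1_assoc'[of h "t X" "map1 G f"]
    src.cod.comp1_assoc'[of h "map1 F f" "t Y"] by auto

lemma natural2':
  "\<alpha> \<in> cells2 C \<Longrightarrow> src1 C (src2 C \<alpha>) = X \<Longrightarrow> tgt1 C (src2 C \<alpha>) = Y
    \<Longrightarrow> map2 G \<alpha> \<star>\<^bsub>D\<^esub> id2 D (t X) = id2 D (t Y) \<star>\<^bsub>D\<^esub> map2 F \<alpha>"
  using natural2[of \<alpha> "src2 C \<alpha>" "tgt2 C \<alpha>" X Y] by (auto simp: hom1_def hom2_def)

lemma natural2_comp:
  assumes "\<alpha> \<in> cells2 C" "src1 C (src2 C \<alpha>) = X" "tgt1 C (src2 C \<alpha>) = Y"
    "h \<in> cells1 D" "tgt1 D h = map0 F X"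
  shows "map2 G \<alpha> \<star>\<^bsub>D\<^esub> id2 D (t X \<cdot>\<^bsub>D\<^esub> h) = id2 D (t Y) \<star>\<^bsub>D\<^esub> (map2 F \<alpha> \<star>\<^bsub>D\<^esub> id2 D h)"
proof -
  have "map2 G \<alpha> \<star>\<^bsub>D\<^esub> id2 D (t X \<cdot>\<^bsub>D\<^esub> h) = map2 G \<alpha> \<star>\<^bsub>D\<^esub> (id2 D (t X) \<star>\<^bsub>D\<^esub> id2 D h)"
    using assms by auto
  also have "\<dots> = (map2 G \<alpha> \<star>\<^bsub>D\<^esub> id2 D (t X)) \<star>\<^bsub>D\<^esub> id2 D h"
    using assms by (intro src.cod.hcomp_assoc'[symmetric]) auto
  also have "\<dots> = (id2 D (t Y) \<star>\<^bsub>D\<^esub> map2 F \<alpha>) \<star>\<^bsub>D\<^esub> id2 D h"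
    using natural2'[OF assms(1-3)] by simp
  also have "\<dots> = id2 D (t Y) \<star>\<^bsub>D\<^esub> (map2 F \<alpha> \<star>\<^bsub>D\<^esub> id2 D h)"
    using assms by (intro src.cod.hcomp_assoc') auto
  finally show ?thesis .
qed

end

text \<open>Turns a composite equation into one that can be used in front of a further cell \<xi>,
  where right-nesting has separated \<beta> from \<alpha>.\<close>

lemma (in two_category) vcomp_reassoc:
  assumes "\<beta> \<bullet> \<alpha> = \<gamma>" "\<alpha> \<in> cells2 K" "\<beta> \<in> cells2 K" "tgt2 K \<alpha> = src2 K \<beta>"
    "\<xi> \<in> cells2 K" "tgt2 K \<xi> = src2 K \<alpha>"
  shows "\<beta> \<bullet> (\<alpha> \<bullet> \<xi>) = \<gamma> \<bullet> \<xi>"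
  using assms vcomp_assoc'[of \<xi> \<alpha> \<beta>] by simp

lemma psmor_eqI:
  fixes F G :: "('o, 'm, 'c) psmor"
  shows "source F = source G \<Longrightarrow> target F = target G \<Longrightarrow> mor F = mor G \<Longrightarrow> mcell F = mcell G \<Longrightarrow> F = G"
  by simp

lemma algtrans_eqI:
  fixes \<sigma> \<tau> :: "('o, 'm, 'c) algtrans"
  shows "source \<sigma> = source \<tau> \<Longrightarrow> target \<sigma> = target \<tau> \<Longrightarrow> trans \<sigma> = trans \<tau> \<Longrightarrow> \<sigma> = \<tau>"
  by simp

section \<open>Pseudoalgebras of a 2-monad and their 2-category\<close>

context two_monad
begin

abbreviation "T0 \<equiv> map0 (endo T)"
abbreviation "T1 \<equiv> map1 (endo T)"
abbreviation "T2 \<equiv> map2 (endo T)"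

lemma eta_natural [simp]:
  "f \<in> cells1 K \<Longrightarrow> src1 K f = X \<Longrightarrow> T1 f \<cdot>\<^bsub>K\<^esub> eta T X = eta T (tgt1 K f) \<cdot>\<^bsub>K\<^esub> f"
  "f \<in> cells1 K \<Longrightarrow> src1 K f = X \<Longrightarrow> h \<in> cells1 K \<Longrightarrow> tgt1 K h = X
    \<Longrightarrow> T1 f \<cdot>\<^bsub>K\<^esub> (eta T X \<cdot>\<^bsub>K\<^esub> h) = eta T (tgt1 K f) \<cdot>\<^bsub>K\<^esub> (f \<cdot>\<^bsub>K\<^esub> h)"
  "\<alpha> \<in> cells2 K \<Longrightarrow> src1 K (src2 K \<alpha>) = X
    \<Longrightarrow> T2 \<alpha> \<star>\<^bsub>K\<^esub> id2 K (eta T X) = id2 K (eta T (tgt1 K (src2 K \<alpha>))) \<star>\<^bsub>K\<^esub> \<alpha>"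
  "\<alpha> \<in> cells2 K \<Longrightarrow> src1 K (src2 K \<alpha>) = X \<Longrightarrow> h \<in> cells1 K \<Longrightarrow> tgt1 K h = X
    \<Longrightarrow> T2 \<alpha> \<star>\<^bsub>K\<^esub> id2 K (eta T X \<cdot>\<^bsub>K\<^esub> h)
      = id2 K (eta T (tgt1 K (src2 K \<alpha>))) \<star>\<^bsub>K\<^esub> (\<alpha> \<star>\<^bsub>K\<^esub> id2 K h)"
  using unit.natural1'[of f X] unit.natural1_comp[of f X _ h]
    unit.natural2'[of \<alpha> X] unit.natural2_comp[of \<alpha> X _ h]
  by simp_all

lemma mu_natural [simp]:
  "f \<in> cells1 K \<Longrightarrow> src1 K f = X \<Longrightarrow> T1 f \<cdot>\<^bsub>K\<^esub> mu T X = mu T (tgt1 K f) \<cdot>\<^bsub>K\<^esub> T1 (T1 f)"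
  "f \<in> cells1 K \<Longrightarrow> src1 K f = X \<Longrightarrow> h \<in> cells1 K \<Longrightarrow> tgt1 K h = T0 (T0 X)
    \<Longrightarrow> T1 f \<cdot>\<^bsub>K\<^esub> (mu T X \<cdot>\<^bsub>K\<^esub> h) = mu T (tgt1 K f) \<cdot>\<^bsub>K\<^esub> (T1 (T1 f) \<cdot>\<^bsub>K\<^esub> h)"
  "\<alpha> \<in> cells2 K \<Longrightarrow> src1 K (src2 K \<alpha>) = X
    \<Longrightarrow> T2 \<alpha> \<star>\<^bsub>K\<^esub> id2 K (mu T X) = id2 K (mu T (tgt1 K (src2 K \<alpha>))) \<star>\<^bsub>K\<^esub> T2 (T2 \<alpha>)"
  "\<alpha> \<in> cells2 K \<Longrightarrow> src1 K (src2 K \<alpha>) = X \<Longrightarrow> h \<in> cells1 K \<Longrightarrow> tgt1 K h = T0 (T0 X)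
    \<Longrightarrow> T2 \<alpha> \<star>\<^bsub>K\<^esub> id2 K (mu T X \<cdot>\<^bsub>K\<^esub> h)
      = id2 K (mu T (tgt1 K (src2 K \<alpha>))) \<star>\<^bsub>K\<^esub> (T2 (T2 \<alpha>) \<star>\<^bsub>K\<^esub> id2 K h)"
  using mult.natural1'[of f X] mult.natural1_comp[of f X _ h]
    mult.natural2'[of \<alpha> X] mult.natural2_comp[of \<alpha> X _ h]
  by simp_all

lemma pseudoalgebra_cells [simp]:
  assumes "pseudoalgebra K T A"
  shows "under A \<in> cells0 K" "act A \<in> cells1 K" "src1 K (act A) = T0 (under A)"
    "tgt1 K (act A) = under A" "unitor A \<in> cells2 K" "src2 K (unitor A) = id1 K (under A)"
    "tgt2 K (unitor A) = act A \<cdot>\<^bsub>K\<^esub> eta T (under A)" "invertible2 K (unitor A)"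
    "multor A \<in> cells2 K" "src2 K (multor A) = act A \<cdot>\<^bsub>K\<^esub> T1 (act A)"
    "tgt2 K (multor A) = act A \<cdot>\<^bsub>K\<^esub> mu T (under A)" "invertible2 K (multor A)"
  using assms by (auto simp: pseudoalgebra_def Let_def hom1_def hom2_def)

lemma pseudomorphism_cells [simp]:
  assumes "pseudomorphism K T F"
  shows "pseudoalgebra K T (source F)" "pseudoalgebra K T (target F)"
    "mor F \<in> cells1 K" "src1 K (mor F) = under (source F)" "tgt1 K (mor F) = under (target F)"
    "mcell F \<in> cells2 K" "src2 K (mcell F) = act (target F) \<cdot>\<^bsub>K\<^esub> T1 (mor F)"
    "tgt2 K (mcell F) = mor F \<cdot>\<^bsub>K\<^esub> act (source F)" "invertible2 K (mcell F)"
  using assms by (auto simp: pseudomorphism_def Let_def hom1_def hom2_def)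

text \<open>The defining condition brackets its threefold composite to the left. The multiplication
  law is restated here in the right-nested normal form.\<close>

lemma pseudomorphism_axioms:
  assumes "pseudomorphism K T F"
  shows "(mcell F \<star>\<^bsub>K\<^esub> id2 K (eta T (under (source F)))) \<bullet>\<^bsub>K\<^esub> (unitor (target F) \<star>\<^bsub>K\<^esub> id2 K (mor F))
      = id2 K (mor F) \<star>\<^bsub>K\<^esub> unitor (source F)"
    and "(mcell F \<star>\<^bsub>K\<^esub> id2 K (mu T (under (source F))))
        \<bullet>\<^bsub>K\<^esub> (multor (target F) \<star>\<^bsub>K\<^esub> id2 K (T1 (T1 (mor F))))
      = (id2 K (mor F) \<star>\<^bsub>K\<^esub> multor (source F)) \<bullet>\<^bsub>K\<^esub> ((mcell F \<star>\<^bsub>K\<^esub> id2 K (T1 (act (source F))))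
        \<bullet>\<^bsub>K\<^esub> (id2 K (act (target F)) \<star>\<^bsub>K\<^esub> T2 (mcell F)))"
proof -
  note assms [simp]
  show "(mcell F \<star>\<^bsub>K\<^esub> id2 K (eta T (under (source F)))) \<bullet>\<^bsub>K\<^esub> (unitor (target F) \<star>\<^bsub>K\<^esub> id2 K (mor F))
      = id2 K (mor F) \<star>\<^bsub>K\<^esub> unitor (source F)"
    using assms by (simp only: pseudomorphism_def Let_def) 
  have "(mcell F \<star>\<^bsub>K\<^esub> id2 K (mu T (under (source F))))
        \<bullet>\<^bsub>K\<^esub> (multor (target F) \<star>\<^bsub>K\<^esub> id2 K (T1 (T1 (mor F))))
      = (id2 K (mor F) \<star>\<^bsub>K\<^esub> multor (source F)) \<bullet>\<^bsub>K\<^esub> (mcell F \<star>\<^bsub>K\<^esub> id2 K (T1 (act (source F))))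
        \<bullet>\<^bsub>K\<^esub> (id2 K (act (target F)) \<star>\<^bsub>K\<^esub> T2 (mcell F))"
    using assms by (simp only: pseudomorphism_def Let_def) 
  then show "(mcell F \<star>\<^bsub>K\<^esub> id2 K (mu T (under (source F))))
        \<bullet>\<^bsub>K\<^esub> (multor (target F) \<star>\<^bsub>K\<^esub> id2 K (T1 (T1 (mor F))))
      = (id2 K (mor F) \<star>\<^bsub>K\<^esub> multor (source F)) \<bullet>\<^bsub>K\<^esub> ((mcell F \<star>\<^bsub>K\<^esub> id2 K (T1 (act (source F))))
        \<bullet>\<^bsub>K\<^esub> (id2 K (act (target F)) \<star>\<^bsub>K\<^esub> T2 (mcell F)))"
    by simp
qed

lemma pseudomorphismI:
  assumes "pseudoalgebra K T (source F)" "pseudoalgebra K T (target F)"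
    "mor F \<in> cells1 K" "src1 K (mor F) = under (source F)" "tgt1 K (mor F) = under (target F)"
    "mcell F \<in> cells2 K" "src2 K (mcell F) = act (target F) \<cdot>\<^bsub>K\<^esub> T1 (mor F)"
    "tgt2 K (mcell F) = mor F \<cdot>\<^bsub>K\<^esub> act (source F)" "invertible2 K (mcell F)"
    "(mcell F \<star>\<^bsub>K\<^esub> id2 K (eta T (under (source F)))) \<bullet>\<^bsub>K\<^esub> (unitor (target F) \<star>\<^bsub>K\<^esub> id2 K (mor F))
      = id2 K (mor F) \<star>\<^bsub>K\<^esub> unitor (source F)"
    "(mcell F \<star>\<^bsub>K\<^esub> id2 K (mu T (under (source F))))
        \<bullet>\<^bsub>K\<^esub> (multor (target F) \<star>\<^bsub>K\<^esub> id2 K (T1 (T1 (mor F))))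
      = (id2 K (mor F) \<star>\<^bsub>K\<^esub> multor (source F)) \<bullet>\<^bsub>K\<^esub> ((mcell F \<star>\<^bsub>K\<^esub> id2 K (T1 (act (source F))))
        \<bullet>\<^bsub>K\<^esub> (id2 K (act (target F)) \<star>\<^bsub>K\<^esub> T2 (mcell F)))"
  shows "pseudomorphism K T F"
proof -
  have "(id2 K (mor F) \<star>\<^bsub>K\<^esub> multor (source F)) \<bullet>\<^bsub>K\<^esub> ((mcell F \<star>\<^bsub>K\<^esub> id2 K (T1 (act (source F))))
        \<bullet>\<^bsub>K\<^esub> (id2 K (act (target F)) \<star>\<^bsub>K\<^esub> T2 (mcell F)))
     = (id2 K (mor F) \<star>\<^bsub>K\<^esub> multor (source F)) \<bullet>\<^bsub>K\<^esub> (mcell F \<star>\<^bsub>K\<^esub> id2 K (T1 (act (source F))))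
        \<bullet>\<^bsub>K\<^esub> (id2 K (act (target F)) \<star>\<^bsub>K\<^esub> T2 (mcell F))"
    using assms(1-9) by simp
  then show ?thesis
    using assms unfolding pseudomorphism_def Let_def hom1_def hom2_def by auto
qed

lemma algebra_transformation_cells [simp]:
  assumes "algebra_transformation K T \<tau>"
  shows "pseudomorphism K T (source \<tau>)" "pseudomorphism K T (target \<tau>)"
    "source (target \<tau>) = source (source \<tau>)" "target (target \<tau>) = target (source \<tau>)"
    "trans \<tau> \<in> cells2 K" "src2 K (trans \<tau>) = mor (source \<tau>)" "tgt2 K (trans \<tau>) = mor (target \<tau>)"
  using assms by (auto simp: algebra_transformation_def Let_def hom2_def)

lemma algebra_transformation_axiom:
  assumes "algebra_transformation K T \<tau>"
  shows "(trans \<tau> \<star>\<^bsub>K\<^esub> id2 K (act (source (source \<tau>)))) \<bullet>\<^bsub>K\<^esub> mcell (source \<tau>)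
    = mcell (target \<tau>) \<bullet>\<^bsub>K\<^esub> (id2 K (act (target (source \<tau>))) \<star>\<^bsub>K\<^esub> T2 (trans \<tau>))"
  using assms unfolding algebra_transformation_def Let_def by blast

lemma algebra_transformationI:
  assumes "pseudomorphism K T (source \<tau>)" "pseudomorphism K T (target \<tau>)"
    "source (source \<tau>) = source (target \<tau>)" "target (source \<tau>) = target (target \<tau>)"
    "trans \<tau> \<in> cells2 K" "src2 K (trans \<tau>) = mor (source \<tau>)" "tgt2 K (trans \<tau>) = mor (target \<tau>)"
    "(trans \<tau> \<star>\<^bsub>K\<^esub> id2 K (act (source (source \<tau>)))) \<bullet>\<^bsub>K\<^esub> mcell (source \<tau>)
    = mcell (target \<tau>) \<bullet>\<^bsub>K\<^esub> (id2 K (act (target (source \<tau>))) \<star>\<^bsub>K\<^esub> T2 (trans \<tau>))"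
  shows "algebra_transformation K T \<tau>"
  using assms unfolding algebra_transformation_def Let_def hom2_def by blast

lemma PsAlg_simps [simp]:
  "cells0 (PsAlg K T) = {A. pseudoalgebra K T A}"
  "cells1 (PsAlg K T) = {F. pseudomorphism K T F}"
  "cells2 (PsAlg K T) = {\<tau>. algebra_transformation K T \<tau>}"
  "src1 (PsAlg K T) = source" "tgt1 (PsAlg K T) = target"
  "src2 (PsAlg K T) = source" "tgt2 (PsAlg K T) = target"
  by (simp_all add: PsAlg_def)

lemma PsAlg_ops:
  "id1 (PsAlg K T) A = \<lparr>source = A, target = A, mor = id1 K (under A), mcell = id2 K (act A)\<rparr>"
  "id2 (PsAlg K T) F = \<lparr>source = F, target = F, trans = id2 K (mor F)\<rparr>"
  "G \<cdot>\<^bsub>PsAlg K T\<^esub> F = \<lparr>source = source F, target = target G, mor = mor G \<cdot>\<^bsub>K\<^esub> mor F,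
    mcell = (id2 K (mor G) \<star>\<^bsub>K\<^esub> mcell F) \<bullet>\<^bsub>K\<^esub> (mcell G \<star>\<^bsub>K\<^esub> id2 K (T1 (mor F)))\<rparr>"
  "\<tau> \<bullet>\<^bsub>PsAlg K T\<^esub> \<sigma> = \<lparr>source = source \<sigma>, target = target \<tau>, trans = trans \<tau> \<bullet>\<^bsub>K\<^esub> trans \<sigma>\<rparr>"
  "\<tau> \<star>\<^bsub>PsAlg K T\<^esub> \<sigma> = \<lparr>source = source \<tau> \<cdot>\<^bsub>PsAlg K T\<^esub> source \<sigma>,
    target = target \<tau> \<cdot>\<^bsub>PsAlg K T\<^esub> target \<sigma>, trans = trans \<tau> \<star>\<^bsub>K\<^esub> trans \<sigma>\<rparr>"
  by (simp_all add: PsAlg_def)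

lemma PsAlg_sel [simp]:
  "source (id1 (PsAlg K T) A) = A" "target (id1 (PsAlg K T) A) = A"
  "mor (id1 (PsAlg K T) A) = id1 K (under A)" "mcell (id1 (PsAlg K T) A) = id2 K (act A)"
  "source (id2 (PsAlg K T) F) = F" "target (id2 (PsAlg K T) F) = F" "trans (id2 (PsAlg K T) F) = id2 K (mor F)"
  "source (G \<cdot>\<^bsub>PsAlg K T\<^esub> F) = source F" "target (G \<cdot>\<^bsub>PsAlg K T\<^esub> F) = target G"
  "mor (G \<cdot>\<^bsub>PsAlg K T\<^esub> F) = mor G \<cdot>\<^bsub>K\<^esub> mor F"
  "mcell (G \<cdot>\<^bsub>PsAlg K T\<^esub> F)
    = (id2 K (mor G) \<star>\<^bsub>K\<^esub> mcell F) \<bullet>\<^bsub>K\<^esub> (mcell G \<star>\<^bsub>K\<^esub> id2 K (T1 (mor F)))"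
  "source (\<tau> \<bullet>\<^bsub>PsAlg K T\<^esub> \<sigma>) = source \<sigma>" "target (\<tau> \<bullet>\<^bsub>PsAlg K T\<^esub> \<sigma>) = target \<tau>"
  "trans (\<tau> \<bullet>\<^bsub>PsAlg K T\<^esub> \<sigma>) = trans \<tau> \<bullet>\<^bsub>K\<^esub> trans \<sigma>"
  "source (\<tau> \<star>\<^bsub>PsAlg K T\<^esub> \<sigma>) = source \<tau> \<cdot>\<^bsub>PsAlg K T\<^esub> source \<sigma>"
  "target (\<tau> \<star>\<^bsub>PsAlg K T\<^esub> \<sigma>) = target \<tau> \<cdot>\<^bsub>PsAlg K T\<^esub> target \<sigma>"
  "trans (\<tau> \<star>\<^bsub>PsAlg K T\<^esub> \<sigma>) = trans \<tau> \<star>\<^bsub>K\<^esub> trans \<sigma>"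
  by (simp_all add: PsAlg_ops)

lemma pseudomorphism_id1 [simp]:
  assumes [simp]: "pseudoalgebra K T A"
  shows "pseudomorphism K T (id1 (PsAlg K T) A)"
  by (rule pseudomorphismI) simp_all

text \<open>Paste the two coherence diagrams: the law of \<open>G\<close> is whiskered on the right
  with f (for the unit) or with the twice applied monad on f (for the multiplication), the law of
  \<open>F\<close> on the left with g. They meet in the structure cell of the middle
  algebra.\<close>

lemma pseudomorphism_comp1 [simp]:
  assumes F [simp]: "pseudomorphism K T F" and G [simp]: "pseudomorphism K T G"
    and FG [simp]: "target F = source G"
  shows "pseudomorphism K T (G \<cdot>\<^bsub>PsAlg K T\<^esub> F)"
proof (rule pseudomorphismI)
  let ?X = "under (source F)" and ?f = "mor F" and ?g = "mor G" and ?\<phi> = "mcell F" and ?\<psi> = "mcell G"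
    and ?a = "act (source F)" and ?b = "act (source G)" and ?c = "act (target G)"
  have "((?\<psi> \<star>\<^bsub>K\<^esub> id2 K (eta T (under (source G)))) \<bullet>\<^bsub>K\<^esub> (unitor (target G) \<star>\<^bsub>K\<^esub> id2 K ?g)) \<star>\<^bsub>K\<^esub> id2 K ?f
      = (id2 K ?g \<star>\<^bsub>K\<^esub> unitor (source G)) \<star>\<^bsub>K\<^esub> id2 K ?f"
    by (simp only: pseudomorphism_axioms(1)[OF G])
  then have H1: "(?\<psi> \<star>\<^bsub>K\<^esub> id2 K (eta T (under (source G)) \<cdot>\<^bsub>K\<^esub> ?f)) \<bullet>\<^bsub>K\<^esub> (unitor (target G) \<star>\<^bsub>K\<^esub> id2 K (?g \<cdot>\<^bsub>K\<^esub> ?f))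
      = id2 K ?g \<star>\<^bsub>K\<^esub> (unitor (source G) \<star>\<^bsub>K\<^esub> id2 K ?f)"
    by simp
  have "id2 K ?g \<star>\<^bsub>K\<^esub> ((?\<phi> \<star>\<^bsub>K\<^esub> id2 K (eta T ?X)) \<bullet>\<^bsub>K\<^esub> (unitor (target F) \<star>\<^bsub>K\<^esub> id2 K ?f))
     = id2 K ?g \<star>\<^bsub>K\<^esub> (id2 K ?f \<star>\<^bsub>K\<^esub> unitor (source F))"
    by (simp only: pseudomorphism_axioms(1)[OF F])
  then have H2: "(id2 K ?g \<star>\<^bsub>K\<^esub> (?\<phi> \<star>\<^bsub>K\<^esub> id2 K (eta T ?X))) \<bullet>\<^bsub>K\<^esub> (id2 K ?g \<star>\<^bsub>K\<^esub> (unitor (source G) \<star>\<^bsub>K\<^esub> id2 K ?f))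
     = id2 K (?g \<cdot>\<^bsub>K\<^esub> ?f) \<star>\<^bsub>K\<^esub> unitor (source F)"
    by simp
  show "(mcell (G \<cdot>\<^bsub>PsAlg K T\<^esub> F) \<star>\<^bsub>K\<^esub> id2 K (eta T (under (source (G \<cdot>\<^bsub>PsAlg K T\<^esub> F)))))
       \<bullet>\<^bsub>K\<^esub> (unitor (target (G \<cdot>\<^bsub>PsAlg K T\<^esub> F)) \<star>\<^bsub>K\<^esub> id2 K (mor (G \<cdot>\<^bsub>PsAlg K T\<^esub> F)))
      = id2 K (mor (G \<cdot>\<^bsub>PsAlg K T\<^esub> F)) \<star>\<^bsub>K\<^esub> unitor (source (G \<cdot>\<^bsub>PsAlg K T\<^esub> F))"
    by (simp add: H1 H2)
  let ?Tf = "T1 (T1 ?f)"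
  have "((?\<psi> \<star>\<^bsub>K\<^esub> id2 K (mu T (under (source G)))) \<bullet>\<^bsub>K\<^esub> (multor (target G) \<star>\<^bsub>K\<^esub> id2 K (T1 (T1 ?g)))) \<star>\<^bsub>K\<^esub> id2 K ?Tf
      = ((id2 K ?g \<star>\<^bsub>K\<^esub> multor (source G)) \<bullet>\<^bsub>K\<^esub> ((?\<psi> \<star>\<^bsub>K\<^esub> id2 K (T1 ?b)) \<bullet>\<^bsub>K\<^esub> (id2 K ?c \<star>\<^bsub>K\<^esub> T2 ?\<psi>))) \<star>\<^bsub>K\<^esub> id2 K ?Tf"
    by (simp only: pseudomorphism_axioms(2)[OF G])
  then have M1: "(?\<psi> \<star>\<^bsub>K\<^esub> id2 K (mu T (under (source G)) \<cdot>\<^bsub>K\<^esub> ?Tf)) \<bullet>\<^bsub>K\<^esub> (multor (target G) \<star>\<^bsub>K\<^esub> id2 K (T1 (T1 ?g) \<cdot>\<^bsub>K\<^esub> ?Tf))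
      = (id2 K ?g \<star>\<^bsub>K\<^esub> (multor (source G) \<star>\<^bsub>K\<^esub> id2 K ?Tf)) \<bullet>\<^bsub>K\<^esub>
        ((?\<psi> \<star>\<^bsub>K\<^esub> id2 K (T1 ?b \<cdot>\<^bsub>K\<^esub> ?Tf)) \<bullet>\<^bsub>K\<^esub> (id2 K ?c \<star>\<^bsub>K\<^esub> (T2 ?\<psi> \<star>\<^bsub>K\<^esub> id2 K ?Tf)))"
    by simp
  have "id2 K ?g \<star>\<^bsub>K\<^esub> ((?\<phi> \<star>\<^bsub>K\<^esub> id2 K (mu T ?X)) \<bullet>\<^bsub>K\<^esub> (multor (target F) \<star>\<^bsub>K\<^esub> id2 K ?Tf))
      = id2 K ?g \<star>\<^bsub>K\<^esub> ((id2 K ?f \<star>\<^bsub>K\<^esub> multor (source F)) \<bullet>\<^bsub>K\<^esub> ((?\<phi> \<star>\<^bsub>K\<^esub> id2 K (T1 ?a)) \<bullet>\<^bsub>K\<^esub> (id2 K (act (target F)) \<star>\<^bsub>K\<^esub> T2 ?\<phi>)))"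
    by (simp only: pseudomorphism_axioms(2)[OF F])
  then have M2: "(id2 K ?g \<star>\<^bsub>K\<^esub> (?\<phi> \<star>\<^bsub>K\<^esub> id2 K (mu T ?X))) \<bullet>\<^bsub>K\<^esub> (id2 K ?g \<star>\<^bsub>K\<^esub> (multor (source G) \<star>\<^bsub>K\<^esub> id2 K ?Tf))
      = (id2 K (?g \<cdot>\<^bsub>K\<^esub> ?f) \<star>\<^bsub>K\<^esub> multor (source F)) \<bullet>\<^bsub>K\<^esub>
        ((id2 K ?g \<star>\<^bsub>K\<^esub> (?\<phi> \<star>\<^bsub>K\<^esub> id2 K (T1 ?a))) \<bullet>\<^bsub>K\<^esub> (id2 K (?g \<cdot>\<^bsub>K\<^esub> ?b) \<star>\<^bsub>K\<^esub> T2 ?\<phi>))"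
    by simp
  \<comment> \<open>The cell of \<open>G\<close> and the image under the monad of the cell of
    \<open>F\<close> act on different factors, so they may be exchanged. This is what brings the two
    halves of the multiplication diagram into contact.\<close>
  have M3: "(id2 K (?g \<cdot>\<^bsub>K\<^esub> ?b) \<star>\<^bsub>K\<^esub> T2 ?\<phi>) \<bullet>\<^bsub>K\<^esub> (?\<psi> \<star>\<^bsub>K\<^esub> id2 K (T1 ?b \<cdot>\<^bsub>K\<^esub> ?Tf))
     = (?\<psi> \<star>\<^bsub>K\<^esub> id2 K (T1 ?f \<cdot>\<^bsub>K\<^esub> T1 ?a)) \<bullet>\<^bsub>K\<^esub> (id2 K (?c \<cdot>\<^bsub>K\<^esub> T1 ?g) \<star>\<^bsub>K\<^esub> T2 ?\<phi>)"
    by (rule endo.dom.whisker_exchange) simp_all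
  note M2' = endo.dom.vcomp_reassoc[OF M2] and M3' = endo.dom.vcomp_reassoc[OF M3]
  show "(mcell (G \<cdot>\<^bsub>PsAlg K T\<^esub> F) \<star>\<^bsub>K\<^esub> id2 K (mu T (under (source (G \<cdot>\<^bsub>PsAlg K T\<^esub> F))))) \<bullet>\<^bsub>K\<^esub>
      (multor (target (G \<cdot>\<^bsub>PsAlg K T\<^esub> F)) \<star>\<^bsub>K\<^esub> id2 K (T1 (T1 (mor (G \<cdot>\<^bsub>PsAlg K T\<^esub> F)))))
    = (id2 K (mor (G \<cdot>\<^bsub>PsAlg K T\<^esub> F)) \<star>\<^bsub>K\<^esub> multor (source (G \<cdot>\<^bsub>PsAlg K T\<^esub> F))) \<bullet>\<^bsub>K\<^esub>
      ((mcell (G \<cdot>\<^bsub>PsAlg K T\<^esub> F) \<star>\<^bsub>K\<^esub> id2 K (T1 (act (source (G \<cdot>\<^bsub>PsAlg K T\<^esub> F))))) \<bullet>\<^bsub>K\<^esub>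
       (id2 K (act (target (G \<cdot>\<^bsub>PsAlg K T\<^esub> F))) \<star>\<^bsub>K\<^esub> T2 (mcell (G \<cdot>\<^bsub>PsAlg K T\<^esub> F))))"
    by (simp add: M1 M2' M3')
qed simp_all

lemma algebra_transformation_id2 [simp]:
  assumes [simp]: "pseudomorphism K T F"
  shows "algebra_transformation K T (id2 (PsAlg K T) F)"
  by (rule algebra_transformationI) simp_all

lemma algebra_transformation_vcomp [simp]:
  assumes S [simp]: "algebra_transformation K T \<sigma>" and T [simp]: "algebra_transformation K T \<tau>"
    and ST [simp]: "target \<sigma> = source \<tau>"
  shows "algebra_transformation K T (\<tau> \<bullet>\<^bsub>PsAlg K T\<^esub> \<sigma>)"
proof (rule algebra_transformationI)
  have E [simp]: "source (source \<sigma>) = source (source \<tau>)" "target (source \<sigma>) = target (source \<tau>)"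
    using algebra_transformation_cells(3,4)[OF S] by simp_all
  note A = algebra_transformation_axiom[OF S] algebra_transformation_axiom[OF T]
  note A' = endo.dom.vcomp_reassoc[OF A(2)]
  show "(trans (\<tau> \<bullet>\<^bsub>PsAlg K T\<^esub> \<sigma>) \<star>\<^bsub>K\<^esub> id2 K (act (source (source (\<tau> \<bullet>\<^bsub>PsAlg K T\<^esub> \<sigma>))))) \<bullet>\<^bsub>K\<^esub>
      mcell (source (\<tau> \<bullet>\<^bsub>PsAlg K T\<^esub> \<sigma>)) =
    mcell (target (\<tau> \<bullet>\<^bsub>PsAlg K T\<^esub> \<sigma>)) \<bullet>\<^bsub>K\<^esub>
      (id2 K (act (target (source (\<tau> \<bullet>\<^bsub>PsAlg K T\<^esub> \<sigma>)))) \<star>\<^bsub>K\<^esub> T2 (trans (\<tau> \<bullet>\<^bsub>PsAlg K T\<^esub> \<sigma>)))"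
    using A by (simp add: A')
qed (use algebra_transformation_cells(3,4)[OF S] in simp_all)

text \<open>Split the horizontal composite into two whiskerings and apply one algebra-transformation
  equation to each. Two exchanges move the cells between them into place.\<close>

lemma algebra_transformation_hcomp [simp]:
  assumes S [simp]: "algebra_transformation K T \<sigma>" and T [simp]: "algebra_transformation K T \<tau>"
    and ST [simp]: "target (source \<sigma>) = source (source \<tau>)"
  shows "algebra_transformation K T (\<tau> \<star>\<^bsub>PsAlg K T\<^esub> \<sigma>)"
proof (rule algebra_transformationI)
  let ?f = "mor (source \<sigma>)" and ?f' = "mor (target \<sigma>)" and ?g = "mor (source \<tau>)" and ?g' = "mor (target \<tau>)"
  let ?\<alpha> = "trans \<sigma>" and ?\<beta> = "trans \<tau>" and ?a = "act (source (source \<sigma>))"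
    and ?b = "act (source (source \<tau>))" and ?c = "act (target (source \<tau>))"
  have eq: "?\<beta> \<star>\<^bsub>K\<^esub> ?\<alpha> = (?\<beta> \<star>\<^bsub>K\<^esub> id2 K ?f') \<bullet>\<^bsub>K\<^esub> (id2 K ?g \<star>\<^bsub>K\<^esub> ?\<alpha>)"
    using endo.dom.hcomp_left_right(1)[of ?\<alpha> ?\<beta>] by simp
  have "id2 K ?g \<star>\<^bsub>K\<^esub> ((?\<alpha> \<star>\<^bsub>K\<^esub> id2 K ?a) \<bullet>\<^bsub>K\<^esub> mcell (source \<sigma>))
      = id2 K ?g \<star>\<^bsub>K\<^esub> (mcell (target \<sigma>) \<bullet>\<^bsub>K\<^esub> (id2 K (act (target (source \<sigma>))) \<star>\<^bsub>K\<^esub> T2 ?\<alpha>))"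
    by (simp only: algebra_transformation_axiom[OF S])
  then have H1: "(id2 K ?g \<star>\<^bsub>K\<^esub> (?\<alpha> \<star>\<^bsub>K\<^esub> id2 K ?a)) \<bullet>\<^bsub>K\<^esub> (id2 K ?g \<star>\<^bsub>K\<^esub> mcell (source \<sigma>))
      = (id2 K ?g \<star>\<^bsub>K\<^esub> mcell (target \<sigma>)) \<bullet>\<^bsub>K\<^esub> (id2 K (?g \<cdot>\<^bsub>K\<^esub> ?b) \<star>\<^bsub>K\<^esub> T2 ?\<alpha>)"
    by simp
  have "((?\<beta> \<star>\<^bsub>K\<^esub> id2 K ?b) \<bullet>\<^bsub>K\<^esub> mcell (source \<tau>)) \<star>\<^bsub>K\<^esub> id2 K (T1 ?f')
      = (mcell (target \<tau>) \<bullet>\<^bsub>K\<^esub> (id2 K ?c \<star>\<^bsub>K\<^esub> T2 ?\<beta>)) \<star>\<^bsub>K\<^esub> id2 K (T1 ?f')"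
    by (simp only: algebra_transformation_axiom[OF T])
  then have H2: "(?\<beta> \<star>\<^bsub>K\<^esub> id2 K (?b \<cdot>\<^bsub>K\<^esub> T1 ?f')) \<bullet>\<^bsub>K\<^esub> (mcell (source \<tau>) \<star>\<^bsub>K\<^esub> id2 K (T1 ?f'))
     = (mcell (target \<tau>) \<star>\<^bsub>K\<^esub> id2 K (T1 ?f')) \<bullet>\<^bsub>K\<^esub> (id2 K ?c \<star>\<^bsub>K\<^esub> (T2 ?\<beta> \<star>\<^bsub>K\<^esub> id2 K (T1 ?f')))"
    by simp
  \<comment> \<open>The exchanges: \<open>X1\<close> carries the image of \<alpha> past the cell of
    the source of \<tau>, \<open>X2\<close> carries \<beta> past the cell of the target of
    \<sigma>.\<close>
  have X1: "(id2 K (?g \<cdot>\<^bsub>K\<^esub> ?b) \<star>\<^bsub>K\<^esub> T2 ?\<alpha>) \<bullet>\<^bsub>K\<^esub> (mcell (source \<tau>) \<star>\<^bsub>K\<^esub> id2 K (T1 ?f))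
     = (mcell (source \<tau>) \<star>\<^bsub>K\<^esub> id2 K (T1 ?f')) \<bullet>\<^bsub>K\<^esub> (id2 K (?c \<cdot>\<^bsub>K\<^esub> T1 ?g) \<star>\<^bsub>K\<^esub> T2 ?\<alpha>)"
    by (rule endo.dom.whisker_exchange) simp_all
  have X2: "(?\<beta> \<star>\<^bsub>K\<^esub> id2 K (?f' \<cdot>\<^bsub>K\<^esub> ?a)) \<bullet>\<^bsub>K\<^esub> (id2 K ?g \<star>\<^bsub>K\<^esub> mcell (target \<sigma>))
     = (id2 K ?g' \<star>\<^bsub>K\<^esub> mcell (target \<sigma>)) \<bullet>\<^bsub>K\<^esub> (?\<beta> \<star>\<^bsub>K\<^esub> id2 K (?b \<cdot>\<^bsub>K\<^esub> T1 ?f'))"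
    by (rule endo.dom.whisker_exchange[symmetric]) simp_all
  note R = endo.dom.vcomp_reassoc[OF H1] endo.dom.vcomp_reassoc[OF H2] endo.dom.vcomp_reassoc[OF X2]
  show "(trans (\<tau> \<star>\<^bsub>PsAlg K T\<^esub> \<sigma>) \<star>\<^bsub>K\<^esub> id2 K (act (source (source (\<tau> \<star>\<^bsub>PsAlg K T\<^esub> \<sigma>))))) \<bullet>\<^bsub>K\<^esub>
      mcell (source (\<tau> \<star>\<^bsub>PsAlg K T\<^esub> \<sigma>)) =
    mcell (target (\<tau> \<star>\<^bsub>PsAlg K T\<^esub> \<sigma>)) \<bullet>\<^bsub>K\<^esub>
      (id2 K (act (target (source (\<tau> \<star>\<^bsub>PsAlg K T\<^esub> \<sigma>)))) \<star>\<^bsub>K\<^esub> T2 (trans (\<tau> \<star>\<^bsub>PsAlg K T\<^esub> \<sigma>)))"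
    by (simp add: eq H1 R X1 X2)
qed (simp_all)

lemma PsAlg_comp1_id [simp]:
  assumes [simp]: "pseudomorphism K T F"
  shows "target F = A \<Longrightarrow> id1 (PsAlg K T) A \<cdot>\<^bsub>PsAlg K T\<^esub> F = F"
    "source F = A \<Longrightarrow> F \<cdot>\<^bsub>PsAlg K T\<^esub> id1 (PsAlg K T) A = F"
  by (rule psmor_eqI; auto)+

lemma PsAlg_comp1_assoc [simp]:
  assumes [simp]: "pseudomorphism K T F" "pseudomorphism K T G" "pseudomorphism K T H"
    "target F = source G" "target G = source H"
  shows "H \<cdot>\<^bsub>PsAlg K T\<^esub> G \<cdot>\<^bsub>PsAlg K T\<^esub> F = H \<cdot>\<^bsub>PsAlg K T\<^esub> (G \<cdot>\<^bsub>PsAlg K T\<^esub> F)"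
  by (rule psmor_eqI) simp_all

text \<open>Pseudomorphisms and algebra transformations are equal when their boundaries and data
  are, so each law is inherited from the underlying 2-category once closure under the operations is
  known.\<close>

lemma two_category_PsAlg: "two_category (PsAlg K T)"
  by (rule two_categoryI) (auto intro!: algtrans_eqI simp: endo.dom.interchange')

end

section \<open>Restriction of scalars\<close>

lemma two_functorI:
  assumes "two_category C" "two_category D"
    and "\<And>X. X \<in> cells0 C \<Longrightarrow> map0 F X \<in> cells0 D"
    and "\<And>f. f \<in> cells1 C \<Longrightarrow> map1 F f \<in> cells1 D \<and> src1 D (map1 F f) = map0 F (src1 C f)
      \<and> tgt1 D (map1 F f) = map0 F (tgt1 C f)"
    and "\<And>\<alpha>. \<alpha> \<in> cells2 C \<Longrightarrow> map2 F \<alpha> \<in> cells2 D \<and> src2 D (map2 F \<alpha>) = map1 F (src2 C \<alpha>)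
      \<and> tgt2 D (map2 F \<alpha>) = map1 F (tgt2 C \<alpha>)"
    and "\<And>X. X \<in> cells0 C \<Longrightarrow> map1 F (id1 C X) = id1 D (map0 F X)"
    and "\<And>f. f \<in> cells1 C \<Longrightarrow> map2 F (id2 C f) = id2 D (map1 F f)"
    and "\<And>f g. f \<in> cells1 C \<Longrightarrow> g \<in> cells1 C \<Longrightarrow> tgt1 C f = src1 C g
      \<Longrightarrow> map1 F (g \<cdot>\<^bsub>C\<^esub> f) = map1 F g \<cdot>\<^bsub>D\<^esub> map1 F f"
    and "\<And>\<alpha> \<beta>. \<alpha> \<in> cells2 C \<Longrightarrow> \<beta> \<in> cells2 C \<Longrightarrow> tgt2 C \<alpha> = src2 C \<beta>
      \<Longrightarrow> map2 F (\<beta> \<bullet>\<^bsub>C\<^esub> \<alpha>) = map2 F \<beta> \<bullet>\<^bsub>D\<^esub> map2 F \<alpha>"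
    and "\<And>\<alpha> \<beta>. \<alpha> \<in> cells2 C \<Longrightarrow> \<beta> \<in> cells2 C \<Longrightarrow> tgt1 C (src2 C \<alpha>) = src1 C (src2 C \<beta>)
      \<Longrightarrow> map2 F (\<beta> \<star>\<^bsub>C\<^esub> \<alpha>) = map2 F \<beta> \<star>\<^bsub>D\<^esub> map2 F \<alpha>"
  shows "two_functor C D F"
  by (intro two_functor.intro two_functor_axioms.intro assms(1,2))
    (use assms(3-) in \<open>auto simp: hom1_def hom2_def\<close>)

lemma (in two_monad) pseudoalgebra_axioms:
  assumes "pseudoalgebra K T A"
  shows "(multor A \<star>\<^bsub>K\<^esub> id2 K (T1 (eta T (under A)))) \<bullet>\<^bsub>K\<^esub> (id2 K (act A) \<star>\<^bsub>K\<^esub> T2 (unitor A)) = id2 K (act A)"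
    "(multor A \<star>\<^bsub>K\<^esub> id2 K (eta T (T0 (under A)))) \<bullet>\<^bsub>K\<^esub> (unitor A \<star>\<^bsub>K\<^esub> id2 K (act A)) = id2 K (act A)"
    "(multor A \<star>\<^bsub>K\<^esub> id2 K (T1 (mu T (under A)))) \<bullet>\<^bsub>K\<^esub> (id2 K (act A) \<star>\<^bsub>K\<^esub> T2 (multor A))
      = (multor A \<star>\<^bsub>K\<^esub> id2 K (mu T (T0 (under A)))) \<bullet>\<^bsub>K\<^esub> (multor A \<star>\<^bsub>K\<^esub> id2 K (T1 (T1 (act A))))"
  using assms unfolding pseudoalgebra_def Let_def by blast+

lemma pseudoalgebraI:
  assumes "under A \<in> cells0 K" "act A \<in> cells1 K" "src1 K (act A) = map0 (endo T) (under A)"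
    "tgt1 K (act A) = under A" "unitor A \<in> cells2 K" "src2 K (unitor A) = id1 K (under A)"
    "tgt2 K (unitor A) = act A \<cdot>\<^bsub>K\<^esub> eta T (under A)" "invertible2 K (unitor A)"
    "multor A \<in> cells2 K" "src2 K (multor A) = act A \<cdot>\<^bsub>K\<^esub> map1 (endo T) (act A)"
    "tgt2 K (multor A) = act A \<cdot>\<^bsub>K\<^esub> mu T (under A)" "invertible2 K (multor A)"
    "(multor A \<star>\<^bsub>K\<^esub> id2 K (map1 (endo T) (eta T (under A)))) \<bullet>\<^bsub>K\<^esub>
      (id2 K (act A) \<star>\<^bsub>K\<^esub> map2 (endo T) (unitor A)) = id2 K (act A)"
    "(multor A \<star>\<^bsub>K\<^esub> id2 K (eta T (map0 (endo T) (under A)))) \<bullet>\<^bsub>K\<^esub> (unitor A \<star>\<^bsub>K\<^esub> id2 K (act A)) = id2 K (act A)"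
    "(multor A \<star>\<^bsub>K\<^esub> id2 K (map1 (endo T) (mu T (under A)))) \<bullet>\<^bsub>K\<^esub>
      (id2 K (act A) \<star>\<^bsub>K\<^esub> map2 (endo T) (multor A))
      = (multor A \<star>\<^bsub>K\<^esub> id2 K (mu T (map0 (endo T) (under A)))) \<bullet>\<^bsub>K\<^esub>
        (multor A \<star>\<^bsub>K\<^esub> id2 K (map1 (endo T) (map1 (endo T) (act A))))"
  shows "pseudoalgebra K T A"
  using assms unfolding pseudoalgebra_def Let_def hom1_def hom2_def by blast

context colax_monad_morphism
begin

abbreviation "RS \<equiv> restrict_scalars T L R V lam"

lemma restrict_sel [simp]:
  "under (map0 RS A) = map0 V (under A)"
  "act (map0 RS A) = map1 V (act A) \<cdot>\<^bsub>L\<^esub> lam (under A)"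
  "unitor (map0 RS A) = map2 V (unitor A)"
  "multor (map0 RS A) = map2 V (multor A) \<star>\<^bsub>L\<^esub>
     id2 L (lam (map0 (endo T) (under A)) \<cdot>\<^bsub>L\<^esub> map1 (endo R) (lam (under A)))"
  "source (map1 RS F) = map0 RS (source F)" "target (map1 RS F) = map0 RS (target F)"
  "mor (map1 RS F) = map1 V (mor F)"
  "mcell (map1 RS F) = map2 V (mcell F) \<star>\<^bsub>L\<^esub> id2 L (lam (under (source F)))"
  "source (map2 RS \<tau>) = map1 RS (source \<tau>)" "target (map2 RS \<tau>) = map1 RS (target \<tau>)"
  "trans (map2 RS \<tau>) = map2 V (trans \<tau>)"
  by (simp_all add: restrict_scalars_def Let_def)

lemma lam_natural [simp]:
  "f \<in> cells1 K \<Longrightarrow> src1 K f = X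
    \<Longrightarrow> map1 V (dom.T1 f) \<cdot>\<^bsub>L\<^esub> lam X = lam (tgt1 K f) \<cdot>\<^bsub>L\<^esub> cod.T1 (map1 V f)"
  "f \<in> cells1 K \<Longrightarrow> src1 K f = X \<Longrightarrow> h \<in> cells1 L \<Longrightarrow> tgt1 L h = cod.T0 (map0 V X)
    \<Longrightarrow> map1 V (dom.T1 f) \<cdot>\<^bsub>L\<^esub> (lam X \<cdot>\<^bsub>L\<^esub> h) = lam (tgt1 K f) \<cdot>\<^bsub>L\<^esub> (cod.T1 (map1 V f) \<cdot>\<^bsub>L\<^esub> h)"
  "\<alpha> \<in> cells2 K \<Longrightarrow> src1 K (src2 K \<alpha>) = X
    \<Longrightarrow> map2 V (dom.T2 \<alpha>) \<star>\<^bsub>L\<^esub> id2 L (lam X) = id2 L (lam (tgt1 K (src2 K \<alpha>))) \<star>\<^bsub>L\<^esub> cod.T2 (map2 V \<alpha>)"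
  "\<alpha> \<in> cells2 K \<Longrightarrow> src1 K (src2 K \<alpha>) = X \<Longrightarrow> h \<in> cells1 L \<Longrightarrow> tgt1 L h = cod.T0 (map0 V X)
    \<Longrightarrow> map2 V (dom.T2 \<alpha>) \<star>\<^bsub>L\<^esub> id2 L (lam X \<cdot>\<^bsub>L\<^esub> h)
      = id2 L (lam (tgt1 K (src2 K \<alpha>))) \<star>\<^bsub>L\<^esub> (cod.T2 (map2 V \<alpha>) \<star>\<^bsub>L\<^esub> id2 L h)"
  using nat.natural1'[of f X] nat.natural1_comp[of f X _ h]
    nat.natural2'[of \<alpha> X] nat.natural2_comp[of \<alpha> X _ h]
  by simp_all

text \<open>In the multiplication laws \<lambda> also occurs under \<open>endo R\<close>. The
  2-functor is distributed over composites, so naturality of \<lambda> has to be available for the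
  distributed image as well.\<close>

lemma map_lam_natural [simp]:
  assumes "f \<in> cells1 K" "src1 K f = X"
  shows "cod.T1 (map1 V (dom.T1 f)) \<cdot>\<^bsub>L\<^esub> cod.T1 (lam X)
      = cod.T1 (lam (tgt1 K f)) \<cdot>\<^bsub>L\<^esub> cod.T1 (cod.T1 (map1 V f))"
    "h \<in> cells1 L \<Longrightarrow> tgt1 L h = cod.T0 (cod.T0 (map0 V X))
      \<Longrightarrow> cod.T1 (map1 V (dom.T1 f)) \<cdot>\<^bsub>L\<^esub> (cod.T1 (lam X) \<cdot>\<^bsub>L\<^esub> h)
        = cod.T1 (lam (tgt1 K f)) \<cdot>\<^bsub>L\<^esub> (cod.T1 (cod.T1 (map1 V f)) \<cdot>\<^bsub>L\<^esub> h)"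
proof -
  have [simp]: "X \<in> cells0 K" using assms by auto
  have "cod.T1 (map1 V (dom.T1 f) \<cdot>\<^bsub>L\<^esub> lam X) = cod.T1 (lam (tgt1 K f) \<cdot>\<^bsub>L\<^esub> cod.T1 (map1 V f))"
    using lam_natural(1)[OF assms] by simp
  then show eq: "cod.T1 (map1 V (dom.T1 f)) \<cdot>\<^bsub>L\<^esub> cod.T1 (lam X)
      = cod.T1 (lam (tgt1 K f)) \<cdot>\<^bsub>L\<^esub> cod.T1 (cod.T1 (map1 V f))"
    using assms by (simp del: lam_natural)
  assume h: "h \<in> cells1 L" "tgt1 L h = cod.T0 (cod.T0 (map0 V X))"
  have "(cod.T1 (map1 V (dom.T1 f)) \<cdot>\<^bsub>L\<^esub> cod.T1 (lam X)) \<cdot>\<^bsub>L\<^esub> h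
      = (cod.T1 (lam (tgt1 K f)) \<cdot>\<^bsub>L\<^esub> cod.T1 (cod.T1 (map1 V f))) \<cdot>\<^bsub>L\<^esub> h"
    by (simp only: eq)
  then show "cod.T1 (map1 V (dom.T1 f)) \<cdot>\<^bsub>L\<^esub> (cod.T1 (lam X) \<cdot>\<^bsub>L\<^esub> h)
        = cod.T1 (lam (tgt1 K f)) \<cdot>\<^bsub>L\<^esub> (cod.T1 (cod.T1 (map1 V f)) \<cdot>\<^bsub>L\<^esub> h)"
    using assms h by simp
qed

text \<open>The counterpart for V: naturality of the unit and the multiplication of
  \<open>T\<close>, read after V has been distributed over composites.\<close>

lemma map_unit_mult_natural [simp]:
  assumes "f \<in> cells1 K" "src1 K f = X"
  shows "map1 V (dom.T1 f) \<cdot>\<^bsub>L\<^esub> map1 V (eta T X) = map1 V (eta T (tgt1 K f)) \<cdot>\<^bsub>L\<^esub> map1 V f"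
    "map1 V (dom.T1 f) \<cdot>\<^bsub>L\<^esub> map1 V (mu T X) = map1 V (mu T (tgt1 K f)) \<cdot>\<^bsub>L\<^esub> map1 V (dom.T1 (dom.T1 f))"
    "h \<in> cells1 L \<Longrightarrow> tgt1 L h = map0 V X \<Longrightarrow> map1 V (dom.T1 f) \<cdot>\<^bsub>L\<^esub> (map1 V (eta T X) \<cdot>\<^bsub>L\<^esub> h)
      = map1 V (eta T (tgt1 K f)) \<cdot>\<^bsub>L\<^esub> (map1 V f \<cdot>\<^bsub>L\<^esub> h)"
    "h \<in> cells1 L \<Longrightarrow> tgt1 L h = map0 V (dom.T0 (dom.T0 X)) \<Longrightarrow> map1 V (dom.T1 f) \<cdot>\<^bsub>L\<^esub> (map1 V (mu T X) \<cdot>\<^bsub>L\<^esub> h)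
      = map1 V (mu T (tgt1 K f)) \<cdot>\<^bsub>L\<^esub> (map1 V (dom.T1 (dom.T1 f)) \<cdot>\<^bsub>L\<^esub> h)"
proof -
  have [simp]: "X \<in> cells0 K" using assms by auto
  have "map1 V (dom.T1 f \<cdot>\<^bsub>K\<^esub> eta T X) = map1 V (eta T (tgt1 K f) \<cdot>\<^bsub>K\<^esub> f)"
    "map1 V (dom.T1 f \<cdot>\<^bsub>K\<^esub> mu T X) = map1 V (mu T (tgt1 K f) \<cdot>\<^bsub>K\<^esub> dom.T1 (dom.T1 f))"
    using assms by simp_all
  then show eq: "map1 V (dom.T1 f) \<cdot>\<^bsub>L\<^esub> map1 V (eta T X) = map1 V (eta T (tgt1 K f)) \<cdot>\<^bsub>L\<^esub> map1 V f"
    "map1 V (dom.T1 f) \<cdot>\<^bsub>L\<^esub> map1 V (mu T X) = map1 V (mu T (tgt1 K f)) \<cdot>\<^bsub>L\<^esub> map1 V (dom.T1 (dom.T1 f))"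
    using assms by (simp_all del: dom.eta_natural dom.mu_natural)
  show "map1 V (dom.T1 f) \<cdot>\<^bsub>L\<^esub> (map1 V (eta T X) \<cdot>\<^bsub>L\<^esub> h)
      = map1 V (eta T (tgt1 K f)) \<cdot>\<^bsub>L\<^esub> (map1 V f \<cdot>\<^bsub>L\<^esub> h)"
    if "h \<in> cells1 L" "tgt1 L h = map0 V X"
    using assms that by (subst cod.endo.dom.comp1_assoc'[symmetric]) (simp_all add: eq)
  show "map1 V (dom.T1 f) \<cdot>\<^bsub>L\<^esub> (map1 V (mu T X) \<cdot>\<^bsub>L\<^esub> h)
      = map1 V (mu T (tgt1 K f)) \<cdot>\<^bsub>L\<^esub> (map1 V (dom.T1 (dom.T1 f)) \<cdot>\<^bsub>L\<^esub> h)"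
    if "h \<in> cells1 L" "tgt1 L h = map0 V (dom.T0 (dom.T0 X))"
    using assms that by (subst cod.endo.dom.comp1_assoc'[symmetric]) (simp_all add: eq)
qed

lemma lam_unit [simp]:
  assumes "X \<in> cells0 K" "V0 = map0 V X"
  shows "lam X \<cdot>\<^bsub>L\<^esub> eta R V0 = map1 V (eta T X)"
    "h \<in> cells1 L \<Longrightarrow> tgt1 L h = map0 V X \<Longrightarrow> lam X \<cdot>\<^bsub>L\<^esub> (eta R V0 \<cdot>\<^bsub>L\<^esub> h) = map1 V (eta T X) \<cdot>\<^bsub>L\<^esub> h"
    "cod.T1 (lam X) \<cdot>\<^bsub>L\<^esub> cod.T1 (eta R V0) = cod.T1 (map1 V (eta T X))"
proof -
  show eq: "lam X \<cdot>\<^bsub>L\<^esub> eta R V0 = map1 V (eta T X)" using assms colax_unit by simp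
  show "lam X \<cdot>\<^bsub>L\<^esub> (eta R V0 \<cdot>\<^bsub>L\<^esub> h) = map1 V (eta T X) \<cdot>\<^bsub>L\<^esub> h"
    if "h \<in> cells1 L" "tgt1 L h = map0 V X"
    using that assms by (subst cod.endo.dom.comp1_assoc'[symmetric]) (simp_all add: eq[unfolded assms(2)])
  show "cod.T1 (lam X) \<cdot>\<^bsub>L\<^esub> cod.T1 (eta R V0) = cod.T1 (map1 V (eta T X))"
    using assms by (simp flip: eq[unfolded assms(2)])
qed

text \<open>As for the unit, the compatibility is recorded plainly, in front of a further 1-cell,
  and under \<open>endo R\<close>; the last form is the one met by the associativity law of a
  restricted pseudoalgebra.\<close>

lemma lam_mult [simp]:
  assumes "X \<in> cells0 K" "V0 = map0 V X"
  shows "lam X \<cdot>\<^bsub>L\<^esub> mu R V0 = map1 V (mu T X) \<cdot>\<^bsub>L\<^esub> (lam (dom.T0 X) \<cdot>\<^bsub>L\<^esub> cod.T1 (lam X))"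
    "h \<in> cells1 L \<Longrightarrow> tgt1 L h = cod.T0 (cod.T0 (map0 V X)) \<Longrightarrow> lam X \<cdot>\<^bsub>L\<^esub> (mu R V0 \<cdot>\<^bsub>L\<^esub> h)
      = map1 V (mu T X) \<cdot>\<^bsub>L\<^esub> (lam (dom.T0 X) \<cdot>\<^bsub>L\<^esub> (cod.T1 (lam X) \<cdot>\<^bsub>L\<^esub> h))"
    "cod.T1 (lam X) \<cdot>\<^bsub>L\<^esub> cod.T1 (mu R V0)
      = cod.T1 (map1 V (mu T X)) \<cdot>\<^bsub>L\<^esub> (cod.T1 (lam (dom.T0 X)) \<cdot>\<^bsub>L\<^esub> cod.T1 (cod.T1 (lam X)))"
proof -
  show eq: "lam X \<cdot>\<^bsub>L\<^esub> mu R V0 = map1 V (mu T X) \<cdot>\<^bsub>L\<^esub> (lam (dom.T0 X) \<cdot>\<^bsub>L\<^esub> cod.T1 (lam X))"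
    using assms colax_mult by simp
  show "lam X \<cdot>\<^bsub>L\<^esub> (mu R V0 \<cdot>\<^bsub>L\<^esub> h)
      = map1 V (mu T X) \<cdot>\<^bsub>L\<^esub> (lam (dom.T0 X) \<cdot>\<^bsub>L\<^esub> (cod.T1 (lam X) \<cdot>\<^bsub>L\<^esub> h))"
    if "h \<in> cells1 L" "tgt1 L h = cod.T0 (cod.T0 (map0 V X))"
    using that assms by (subst cod.endo.dom.comp1_assoc'[symmetric]) (simp_all add: eq[unfolded assms(2)])
  have "cod.T1 (lam X \<cdot>\<^bsub>L\<^esub> mu R V0) = cod.T1 (map1 V (mu T X) \<cdot>\<^bsub>L\<^esub> (lam (dom.T0 X) \<cdot>\<^bsub>L\<^esub> cod.T1 (lam X)))"
    by (simp only: eq)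
  then show "cod.T1 (lam X) \<cdot>\<^bsub>L\<^esub> cod.T1 (mu R V0)
      = cod.T1 (map1 V (mu T X)) \<cdot>\<^bsub>L\<^esub> (cod.T1 (lam (dom.T0 X)) \<cdot>\<^bsub>L\<^esub> cod.T1 (cod.T1 (lam X)))"
    using assms by simp
qed

text \<open>Apply V to each law of the given pseudoalgebra and whisker the result with the matching
  iterate of \<lambda>. Naturality of \<lambda> and its compatibility with units and multiplications
  then turn both sides into those of the restricted law.\<close>

lemma restrict_pseudoalgebra [simp]:
  assumes A [simp]: "pseudoalgebra K T A"
  shows "pseudoalgebra L R (map0 RS A)"
proof (rule pseudoalgebraI)
  let ?X = "under A" and ?a = "act A" and ?\<chi> = "multor A" and ?\<iota> = "unitor A"
  let ?\<chi>V = "map2 V ?\<chi>" and ?l = "lam ?X" and ?lT = "lam (dom.T0 ?X)"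
  have "map2 V ((?\<chi> \<star>\<^bsub>K\<^esub> id2 K (dom.T1 (eta T ?X))) \<bullet>\<^bsub>K\<^esub> (id2 K ?a \<star>\<^bsub>K\<^esub> dom.T2 ?\<iota>)) \<star>\<^bsub>L\<^esub> id2 L ?l
      = map2 V (id2 K ?a) \<star>\<^bsub>L\<^esub> id2 L ?l"
    by (simp only: dom.pseudoalgebra_axioms[OF A])
  then show "(multor (map0 RS A) \<star>\<^bsub>L\<^esub> id2 L (cod.T1 (eta R (under (map0 RS A))))) \<bullet>\<^bsub>L\<^esub>
      (id2 L (act (map0 RS A)) \<star>\<^bsub>L\<^esub> cod.T2 (unitor (map0 RS A))) = id2 L (act (map0 RS A))"
    by simp
  have "map2 V ((?\<chi> \<star>\<^bsub>K\<^esub> id2 K (eta T (dom.T0 ?X))) \<bullet>\<^bsub>K\<^esub> (?\<iota> \<star>\<^bsub>K\<^esub> id2 K ?a)) \<star>\<^bsub>L\<^esub> id2 L ?l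
      = map2 V (id2 K ?a) \<star>\<^bsub>L\<^esub> id2 L ?l"
    by (simp only: dom.pseudoalgebra_axioms[OF A])
  then show "(multor (map0 RS A) \<star>\<^bsub>L\<^esub> id2 L (eta R (cod.T0 (under (map0 RS A))))) \<bullet>\<^bsub>L\<^esub>
      (unitor (map0 RS A) \<star>\<^bsub>L\<^esub> id2 L (act (map0 RS A))) = id2 L (act (map0 RS A))"
    by simp
  \<comment> \<open>The associativity law lives on a threefold application of the monad, hence the
    threefold iterate of \<lambda>, from \<open>R\<close> applied three times to V X into V of
    \<open>T\<close> applied three times to X.\<close>
  have "map2 V ((?\<chi> \<star>\<^bsub>K\<^esub> id2 K (dom.T1 (mu T ?X))) \<bullet>\<^bsub>K\<^esub> (id2 K ?a \<star>\<^bsub>K\<^esub> dom.T2 ?\<chi>))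
        \<star>\<^bsub>L\<^esub> id2 L (lam (dom.T0 (dom.T0 ?X)) \<cdot>\<^bsub>L\<^esub> (cod.T1 ?lT \<cdot>\<^bsub>L\<^esub> cod.T1 (cod.T1 ?l)))
      = map2 V ((?\<chi> \<star>\<^bsub>K\<^esub> id2 K (mu T (dom.T0 ?X))) \<bullet>\<^bsub>K\<^esub> (?\<chi> \<star>\<^bsub>K\<^esub> id2 K (dom.T1 (dom.T1 ?a))))
        \<star>\<^bsub>L\<^esub> id2 L (lam (dom.T0 (dom.T0 ?X)) \<cdot>\<^bsub>L\<^esub> (cod.T1 ?lT \<cdot>\<^bsub>L\<^esub> cod.T1 (cod.T1 ?l)))"
    by (simp only: dom.pseudoalgebra_axioms[OF A])
  then show "(multor (map0 RS A) \<star>\<^bsub>L\<^esub> id2 L (cod.T1 (mu R (under (map0 RS A))))) \<bullet>\<^bsub>L\<^esub>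
      (id2 L (act (map0 RS A)) \<star>\<^bsub>L\<^esub> cod.T2 (multor (map0 RS A)))
    = (multor (map0 RS A) \<star>\<^bsub>L\<^esub> id2 L (mu R (cod.T0 (under (map0 RS A))))) \<bullet>\<^bsub>L\<^esub>
      (multor (map0 RS A) \<star>\<^bsub>L\<^esub> id2 L (cod.T1 (cod.T1 (act (map0 RS A)))))"
    by simp
qed simp_all

text \<open>The unit law only needs V, because \<lambda> absorbs the unit of \<open>R\<close>. The
  multiplication law is whiskered with the twofold iterate of \<lambda>.\<close>

lemma restrict_pseudomorphism [simp]:
  assumes F [simp]: "pseudomorphism K T F"
  shows "pseudomorphism L R (map1 RS F)"
proof (rule cod.pseudomorphismI)
  let ?X = "under (source F)" and ?f = "mor F" and ?\<phi> = "mcell F"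
    and ?a = "act (source F)" and ?b = "act (target F)"
  have "map2 V ((?\<phi> \<star>\<^bsub>K\<^esub> id2 K (eta T ?X)) \<bullet>\<^bsub>K\<^esub> (unitor (target F) \<star>\<^bsub>K\<^esub> id2 K ?f))
      = map2 V (id2 K ?f \<star>\<^bsub>K\<^esub> unitor (source F))"
    by (simp only: dom.pseudomorphism_axioms[OF F])
  then show "(mcell (map1 RS F) \<star>\<^bsub>L\<^esub> id2 L (eta R (under (source (map1 RS F))))) \<bullet>\<^bsub>L\<^esub>
      (unitor (target (map1 RS F)) \<star>\<^bsub>L\<^esub> id2 L (mor (map1 RS F)))
      = id2 L (mor (map1 RS F)) \<star>\<^bsub>L\<^esub> unitor (source (map1 RS F))"
    by simp
  have "map2 V ((?\<phi> \<star>\<^bsub>K\<^esub> id2 K (mu T ?X)) \<bullet>\<^bsub>K\<^esub> (multor (target F) \<star>\<^bsub>K\<^esub> id2 K (dom.T1 (dom.T1 ?f))))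
        \<star>\<^bsub>L\<^esub> id2 L (lam (dom.T0 ?X) \<cdot>\<^bsub>L\<^esub> cod.T1 (lam ?X))
      = map2 V ((id2 K ?f \<star>\<^bsub>K\<^esub> multor (source F)) \<bullet>\<^bsub>K\<^esub> ((?\<phi> \<star>\<^bsub>K\<^esub> id2 K (dom.T1 ?a)) \<bullet>\<^bsub>K\<^esub>
          (id2 K ?b \<star>\<^bsub>K\<^esub> dom.T2 ?\<phi>)))
        \<star>\<^bsub>L\<^esub> id2 L (lam (dom.T0 ?X) \<cdot>\<^bsub>L\<^esub> cod.T1 (lam ?X))"
    by (simp only: dom.pseudomorphism_axioms[OF F])
  then show "(mcell (map1 RS F) \<star>\<^bsub>L\<^esub> id2 L (mu R (under (source (map1 RS F))))) \<bullet>\<^bsub>L\<^esub>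
      (multor (target (map1 RS F)) \<star>\<^bsub>L\<^esub> id2 L (cod.T1 (cod.T1 (mor (map1 RS F)))))
    = (id2 L (mor (map1 RS F)) \<star>\<^bsub>L\<^esub> multor (source (map1 RS F))) \<bullet>\<^bsub>L\<^esub>
      ((mcell (map1 RS F) \<star>\<^bsub>L\<^esub> id2 L (cod.T1 (act (source (map1 RS F))))) \<bullet>\<^bsub>L\<^esub>
       (id2 L (act (target (map1 RS F))) \<star>\<^bsub>L\<^esub> cod.T2 (mcell (map1 RS F))))"
    by simp
qed simp_all

lemma restrict_algebra_transformation [simp]:
  assumes T [simp]: "algebra_transformation K T \<tau>"
  shows "algebra_transformation L R (map2 RS \<tau>)"
proof (rule cod.algebra_transformationI)
  have "map2 V ((trans \<tau> \<star>\<^bsub>K\<^esub> id2 K (act (source (source \<tau>)))) \<bullet>\<^bsub>K\<^esub> mcell (source \<tau>))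
        \<star>\<^bsub>L\<^esub> id2 L (lam (under (source (source \<tau>))))
      = map2 V (mcell (target \<tau>) \<bullet>\<^bsub>K\<^esub> (id2 K (act (target (source \<tau>))) \<star>\<^bsub>K\<^esub> dom.T2 (trans \<tau>)))
        \<star>\<^bsub>L\<^esub> id2 L (lam (under (source (source \<tau>))))"
    by (simp only: dom.algebra_transformation_axiom[OF T])
  then show "(trans (map2 RS \<tau>) \<star>\<^bsub>L\<^esub> id2 L (act (source (source (map2 RS \<tau>))))) \<bullet>\<^bsub>L\<^esub>
      mcell (source (map2 RS \<tau>))
    = mcell (target (map2 RS \<tau>)) \<bullet>\<^bsub>L\<^esub>
      (id2 L (act (target (source (map2 RS \<tau>)))) \<star>\<^bsub>L\<^esub> cod.T2 (trans (map2 RS \<tau>)))"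
    by simp
qed simp_all

lemma two_functor_restrict_scalars: "two_functor (PsAlg K T) (PsAlg L R) RS"
proof (rule two_functorI[OF dom.two_category_PsAlg cod.two_category_PsAlg], goal_cases)
  \<comment> \<open>Proved separately because it is used twice: for composites of 1-cells, and for
    the boundaries of horizontal composites of 2-cells.\<close>
  have comp: "map1 RS (G \<cdot>\<^bsub>PsAlg K T\<^esub> F) = map1 RS G \<cdot>\<^bsub>PsAlg L R\<^esub> map1 RS F"
    if [simp]: "pseudomorphism K T F" "pseudomorphism K T G" "target F = source G" for F G
    by (rule psmor_eqI) simp_all
  {
    case (6 F G)
    then show ?case by (simp add: comp)
  next
    case (8 \<alpha> \<beta>)
    then show ?case by (intro algtrans_eqI) (auto simp: comp)
  }
qed (auto intro!: algtrans_eqI psmor_eqI)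

end

text \<open>The 2-category laws of \<open>C\<close> are conclusions. From closure, boundary
  equations and compatibility of \<open>F\<close> with the operations, each law holds in
  \<open>D\<close> after applying \<open>F\<close>, and injectivity of \<open>F\<close> on cells
  reflects it back. This is how cloven cofibrations are seen to form a 2-category.\<close>

lemma two_isomorphismI:
  fixes C :: "('o, 'm, 'c) two_cat" and D :: "('o2, 'm2, 'c2) two_cat"
  assumes D: "two_category D"
    and bij0: "bij_betw (map0 F) (cells0 C) (cells0 D)"
    and bij1: "bij_betw (map1 F) (cells1 C) (cells1 D)"
    and bij2: "bij_betw (map2 F) (cells2 C) (cells2 D)"
    and c1: "\<And>f. f \<in> cells1 C \<Longrightarrow> src1 C f \<in> cells0 C \<and> tgt1 C f \<in> cells0 C"
    and c2: "\<And>\<alpha>. \<alpha> \<in> cells2 C \<Longrightarrow> src2 C \<alpha> \<in> cells1 C \<and> tgt2 C \<alpha> \<in> cells1 C"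
    and id1: "\<And>X. X \<in> cells0 C \<Longrightarrow> id1 C X \<in> cells1 C \<and> src1 C (id1 C X) = X \<and> tgt1 C (id1 C X) = X"
    and id2: "\<And>f. f \<in> cells1 C \<Longrightarrow> id2 C f \<in> cells2 C \<and> src2 C (id2 C f) = f \<and> tgt2 C (id2 C f) = f"
    and comp1: "\<And>f g. f \<in> cells1 C \<Longrightarrow> g \<in> cells1 C \<Longrightarrow> tgt1 C f = src1 C g
      \<Longrightarrow> g \<cdot>\<^bsub>C\<^esub> f \<in> cells1 C \<and> src1 C (g \<cdot>\<^bsub>C\<^esub> f) = src1 C f \<and> tgt1 C (g \<cdot>\<^bsub>C\<^esub> f) = tgt1 C g"
    and vcomp: "\<And>\<alpha> \<beta>. \<alpha> \<in> cells2 C \<Longrightarrow> \<beta> \<in> cells2 C \<Longrightarrow> tgt2 C \<alpha> = src2 C \<beta>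
      \<Longrightarrow> \<beta> \<bullet>\<^bsub>C\<^esub> \<alpha> \<in> cells2 C \<and> src2 C (\<beta> \<bullet>\<^bsub>C\<^esub> \<alpha>) = src2 C \<alpha> \<and> tgt2 C (\<beta> \<bullet>\<^bsub>C\<^esub> \<alpha>) = tgt2 C \<beta>"
    and hcomp: "\<And>\<alpha> \<beta>. \<alpha> \<in> cells2 C \<Longrightarrow> \<beta> \<in> cells2 C \<Longrightarrow> tgt1 C (src2 C \<alpha>) = src1 C (src2 C \<beta>)
      \<Longrightarrow> \<beta> \<star>\<^bsub>C\<^esub> \<alpha> \<in> cells2 C \<and> src2 C (\<beta> \<star>\<^bsub>C\<^esub> \<alpha>) = src2 C \<beta> \<cdot>\<^bsub>C\<^esub> src2 C \<alpha>
        \<and> tgt2 C (\<beta> \<star>\<^bsub>C\<^esub> \<alpha>) = tgt2 C \<beta> \<cdot>\<^bsub>C\<^esub> tgt2 C \<alpha>"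
    and F1: "\<And>f. f \<in> cells1 C \<Longrightarrow> src1 D (map1 F f) = map0 F (src1 C f) \<and> tgt1 D (map1 F f) = map0 F (tgt1 C f)"
    and F2: "\<And>\<alpha>. \<alpha> \<in> cells2 C \<Longrightarrow> src2 D (map2 F \<alpha>) = map1 F (src2 C \<alpha>) \<and> tgt2 D (map2 F \<alpha>) = map1 F (tgt2 C \<alpha>)"
    and Fid1: "\<And>X. X \<in> cells0 C \<Longrightarrow> map1 F (id1 C X) = id1 D (map0 F X)"
    and Fid2: "\<And>f. f \<in> cells1 C \<Longrightarrow> map2 F (id2 C f) = id2 D (map1 F f)"
    and Fcomp1: "\<And>f g. f \<in> cells1 C \<Longrightarrow> g \<in> cells1 C \<Longrightarrow> tgt1 C f = src1 C g
      \<Longrightarrow> map1 F (g \<cdot>\<^bsub>C\<^esub> f) = map1 F g \<cdot>\<^bsub>D\<^esub> map1 F f"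
    and Fvcomp: "\<And>\<alpha> \<beta>. \<alpha> \<in> cells2 C \<Longrightarrow> \<beta> \<in> cells2 C \<Longrightarrow> tgt2 C \<alpha> = src2 C \<beta>
      \<Longrightarrow> map2 F (\<beta> \<bullet>\<^bsub>C\<^esub> \<alpha>) = map2 F \<beta> \<bullet>\<^bsub>D\<^esub> map2 F \<alpha>"
    and Fhcomp: "\<And>\<alpha> \<beta>. \<alpha> \<in> cells2 C \<Longrightarrow> \<beta> \<in> cells2 C \<Longrightarrow> tgt1 C (src2 C \<alpha>) = src1 C (src2 C \<beta>)
      \<Longrightarrow> map2 F (\<beta> \<star>\<^bsub>C\<^esub> \<alpha>) = map2 F \<beta> \<star>\<^bsub>D\<^esub> map2 F \<alpha>"
  shows "two_isomorphism C D F"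
proof -
  interpret D: two_category D by (rule D)
  have F_in [simp]: "\<And>X. X \<in> cells0 C \<Longrightarrow> map0 F X \<in> cells0 D" "\<And>f. f \<in> cells1 C \<Longrightarrow> map1 F f \<in> cells1 D"
    "\<And>\<alpha>. \<alpha> \<in> cells2 C \<Longrightarrow> map2 F \<alpha> \<in> cells2 D"
    using bij0 bij1 bij2 by (auto simp: bij_betw_def)
  note F_simps [simp] = c1 c2 id1 id2 comp1 vcomp hcomp F1 F2 Fid1 Fid2 Fcomp1 Fvcomp Fhcomp
  have eq0: "X = Y" if "map0 F X = map0 F Y" "X \<in> cells0 C" "Y \<in> cells0 C" for X Y
    using that bij0 by (auto simp: bij_betw_def inj_on_def)
  have eq1: "f = g" if "map1 F f = map1 F g" "f \<in> cells1 C" "g \<in> cells1 C" for f g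
    using that bij1 by (auto simp: bij_betw_def inj_on_def)
  have eq2: "\<alpha> = \<beta>" if "map2 F \<alpha> = map2 F \<beta>" "\<alpha> \<in> cells2 C" "\<beta> \<in> cells2 C" for \<alpha> \<beta>
    using that bij2 by (auto simp: bij_betw_def inj_on_def)
  \<comment> \<open>Even the parallelism of source and target of a 2-cell of \<open>C\<close> is
    reflected from \<open>D\<close>, through injectivity on 0-cells.\<close>
  have par [simp]: "src1 C (tgt2 C \<alpha>) = src1 C (src2 C \<alpha>)" "tgt1 C (tgt2 C \<alpha>) = tgt1 C (src2 C \<alpha>)"
    if [simp]: "\<alpha> \<in> cells2 C" for \<alpha>
  proof (rule_tac [!] eq0)
    have "src1 D (tgt2 D (map2 F \<alpha>)) = src1 D (src2 D (map2 F \<alpha>))"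
      "tgt1 D (tgt2 D (map2 F \<alpha>)) = tgt1 D (src2 D (map2 F \<alpha>))"
      by (rule D.parallel; simp)+
    then show "map0 F (src1 C (tgt2 C \<alpha>)) = map0 F (src1 C (src2 C \<alpha>))"
      "map0 F (tgt1 C (tgt2 C \<alpha>)) = map0 F (tgt1 C (src2 C \<alpha>))"
      by (simp_all del: D.parallel)
  qed simp_all
  have C: "two_category C"
    by (rule two_categoryI) (auto intro!: eq1 eq2 simp: D.interchange')
  have "two_functor C D F"
    by (rule two_functorI[OF C D]) auto
  then show ?thesis
    by (intro two_isomorphism.intro two_isomorphism_axioms.intro bij0 bij1 bij2)
qed

section \<open>Slice 2-categories\<close>

lemma slice_mor_eqI:
  fixes S T :: "'m slice_mor"
  shows "source S = source T \<Longrightarrow> target S = target T \<Longrightarrow> over1 S = over1 T \<Longrightarrow> S = T"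
  by simp

lemma slice_cell_eqI:
  fixes \<alpha> \<beta> :: "('m, 'c) slice_cell"
  shows "source \<alpha> = source \<beta> \<Longrightarrow> target \<alpha> = target \<beta> \<Longrightarrow> over2 \<alpha> = over2 \<beta> \<Longrightarrow> \<alpha> = \<beta>"
  by simp

lemma Slice_sel [simp]:
  "src1 (Slice K B) = source" "tgt1 (Slice K B) = target"
  "src2 (Slice K B) = source" "tgt2 (Slice K B) = target"
  "source (id1 (Slice K B) P) = P" "target (id1 (Slice K B) P) = P"
  "over1 (id1 (Slice K B) P) = id1 K (src1 K P)"
  "source (id2 (Slice K B) T) = T" "target (id2 (Slice K B) T) = T"
  "over2 (id2 (Slice K B) T) = id2 K (over1 T)"
  "source (S \<cdot>\<^bsub>Slice K B\<^esub> T) = source T" "target (S \<cdot>\<^bsub>Slice K B\<^esub> T) = target S"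
  "over1 (S \<cdot>\<^bsub>Slice K B\<^esub> T) = over1 S \<cdot>\<^bsub>K\<^esub> over1 T"
  "source (\<beta> \<bullet>\<^bsub>Slice K B\<^esub> \<alpha>) = source \<alpha>" "target (\<beta> \<bullet>\<^bsub>Slice K B\<^esub> \<alpha>) = target \<beta>"
  "over2 (\<beta> \<bullet>\<^bsub>Slice K B\<^esub> \<alpha>) = over2 \<beta> \<bullet>\<^bsub>K\<^esub> over2 \<alpha>"
  "source (\<beta> \<star>\<^bsub>Slice K B\<^esub> \<alpha>) = source \<beta> \<cdot>\<^bsub>Slice K B\<^esub> source \<alpha>"
  "target (\<beta> \<star>\<^bsub>Slice K B\<^esub> \<alpha>) = target \<beta> \<cdot>\<^bsub>Slice K B\<^esub> target \<alpha>"
  "over2 (\<beta> \<star>\<^bsub>Slice K B\<^esub> \<alpha>) = over2 \<beta> \<star>\<^bsub>K\<^esub> over2 \<alpha>"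
  by (simp_all add: Slice_def Let_def)

lemma Slice_cells:
  "cells0 (Slice K B) = {P \<in> cells1 K. tgt1 K P = B}"
  "T \<in> cells1 (Slice K B) \<longleftrightarrow> source T \<in> cells1 K \<and> tgt1 K (source T) = B \<and>
     target T \<in> cells1 K \<and> tgt1 K (target T) = B \<and> over1 T \<in> cells1 K \<and>
     src1 K (over1 T) = src1 K (source T) \<and> tgt1 K (over1 T) = src1 K (target T) \<and>
     target T \<cdot>\<^bsub>K\<^esub> over1 T = source T"
  "\<alpha> \<in> cells2 (Slice K B) \<longleftrightarrow> source \<alpha> \<in> cells1 (Slice K B) \<and> target \<alpha> \<in> cells1 (Slice K B) \<and>
     source (target \<alpha>) = source (source \<alpha>) \<and> target (target \<alpha>) = target (source \<alpha>) \<and>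
     over2 \<alpha> \<in> cells2 K \<and> src2 K (over2 \<alpha>) = over1 (source \<alpha>) \<and> tgt2 K (over2 \<alpha>) = over1 (target \<alpha>) \<and>
     id2 K (target (source \<alpha>)) \<star>\<^bsub>K\<^esub> over2 \<alpha> = id2 K (source (source \<alpha>))"
  unfolding Slice_def Let_def hom1_def hom2_def two_cat.simps mem_Collect_eq
  by (rule refl, blast, rule iffI)
    ((elim conjE, intro conjI, (assumption | (rule sym, assumption))+)+)

context two_category
begin

text \<open>Reassociate: the projection whiskered with \<beta> is the identity of the source
  projection of \<beta>, which is the projection occurring in the condition on \<alpha>.\<close>

lemma hcomp_over_base:
  assumes "\<alpha> \<in> cells2 (Slice K B)" "\<beta> \<in> cells2 (Slice K B)" "target (source \<alpha>) = source (source \<beta>)"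
  shows "id2 K (target (source \<beta>)) \<star> (over2 \<beta> \<star> over2 \<alpha>) = id2 K (source (source \<alpha>))"
proof -
  have "id2 K (target (source \<beta>)) \<star> (over2 \<beta> \<star> over2 \<alpha>) = id2 K (target (source \<beta>)) \<star> over2 \<beta> \<star> over2 \<alpha>"
    using assms by (intro hcomp_assoc'[symmetric]) (auto simp: Slice_cells)
  then show ?thesis using assms by (simp add: Slice_cells)
qed

lemma comp1_over_base:
  assumes "S \<in> cells1 (Slice K B)" "T \<in> cells1 (Slice K B)" "target T = source S"
  shows "target S \<cdot> (over1 S \<cdot> over1 T) = source T"
  using assms comp1_assoc'[of "over1 T" "over1 S" "target S"] by (auto simp: Slice_cells)

lemma two_category_Slice: "two_category (Slice K B)"
proof (rule two_categoryI, goal_cases)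
  case (19 \<alpha> \<beta> \<alpha>' \<beta>')
  then show ?case by (intro slice_cell_eqI) (simp_all add: Slice_cells interchange')
next
  case (8 T S)
  then show ?case using comp1_over_base[of S B T] by (auto simp: Slice_cells)
next
  case (10 \<alpha> \<beta>)
  then have "source \<beta> \<cdot>\<^bsub>Slice K B\<^esub> source \<alpha> \<in> cells1 (Slice K B)" "target \<beta> \<cdot>\<^bsub>Slice K B\<^esub> target \<alpha> \<in> cells1 (Slice K B)"
    using comp1_over_base[of "source \<beta>" B "source \<alpha>"] comp1_over_base[of "target \<beta>" B "target \<alpha>"]
    by (auto simp: Slice_cells)
  with 10 show ?case using hcomp_over_base[of \<alpha> B \<beta>] by (simp add: Slice_cells(3)) (simp add: Slice_cells)
qed (auto intro!: slice_cell_eqI slice_mor_eqI simp: Slice_cells)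

text \<open>An inverse formed in the ambient 2-category automatically lies over the base, since a
  one-sided inverse of an identity is an identity.\<close>

lemma invertible2_Slice:
  assumes "\<alpha> \<in> cells2 (Slice K B)"
  shows "invertible2 (Slice K B) \<alpha> \<longleftrightarrow> invertible2 K (over2 \<alpha>)"
proof
  interpret S: two_category "Slice K B" by (rule two_category_Slice)
  assume "invertible2 (Slice K B) \<alpha>"
  then obtain \<beta> where b: "\<beta> \<in> cells2 (Slice K B)" "source \<beta> = target \<alpha>" "target \<beta> = source \<alpha>"
    "\<beta> \<bullet>\<^bsub>Slice K B\<^esub> \<alpha> = id2 (Slice K B) (source \<alpha>)" "\<alpha> \<bullet>\<^bsub>Slice K B\<^esub> \<beta> = id2 (Slice K B) (target \<alpha>)"
    by (auto elim: S.invertible2E)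
  have "over2 \<beta> \<bullet> over2 \<alpha> = id2 K (over1 (source \<alpha>))" "over2 \<alpha> \<bullet> over2 \<beta> = id2 K (over1 (target \<alpha>))"
    using arg_cong[OF b(4), of over2] arg_cong[OF b(5), of over2] by simp_all
  then show "invertible2 K (over2 \<alpha>)"
    using assms b by (intro invertible2I[of _ "over2 \<beta>"]) (auto simp: Slice_cells)
next
  interpret S: two_category "Slice K B" by (rule two_category_Slice)
  assume "invertible2 K (over2 \<alpha>)"
  then obtain \<beta> where b: "\<beta> \<in> cells2 K" "src2 K \<beta> = over1 (target \<alpha>)" "tgt2 K \<beta> = over1 (source \<alpha>)"
    "\<beta> \<bullet> over2 \<alpha> = id2 K (over1 (source \<alpha>))" "over2 \<alpha> \<bullet> \<beta> = id2 K (over1 (target \<alpha>))"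
    using assms by (auto elim!: invertible2E simp: Slice_cells)
  let ?P = "target (source \<alpha>)"
  have "target (target \<alpha>) \<cdot> over1 (target \<alpha>) = source (target \<alpha>)" "source (target \<alpha>) = source (source \<alpha>)"
    "target (target \<alpha>) = ?P"
    using assms unfolding Slice_cells by blast+
  then have over: "?P \<cdot> over1 (target \<alpha>) = source (source \<alpha>)" by simp
  \<comment> \<open>Insert the whiskering of \<open>over2 \<alpha>\<close>, which is an identity,
    and then let \<beta> cancel it.\<close>
  have "id2 K ?P \<star> \<beta> = (id2 K ?P \<star> \<beta>) \<bullet> (id2 K ?P \<star> over2 \<alpha>)"
    using assms b over by (simp add: Slice_cells)
  also have "\<dots> = id2 K ?P \<star> (\<beta> \<bullet> over2 \<alpha>)"
    using assms b by (intro whisker_vcomp(1)[symmetric]) (auto simp: Slice_cells)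
  also have "\<dots> = id2 K (source (source \<alpha>))"
    using assms b over by (simp add: Slice_cells)
  finally have "\<lparr>source = target \<alpha>, target = source \<alpha>, over2 = \<beta>\<rparr> \<in> cells2 (Slice K B)"
    using assms b over by (simp add: Slice_cells)
  then show "invertible2 (Slice K B) \<alpha>"
    using assms b by (intro S.invertible2I[of _ "\<lparr>source = target \<alpha>, target = source \<alpha>, over2 = \<beta>\<rparr>"])
      (auto intro!: slice_cell_eqI simp: Slice_cells)
qed

lemma two_functor_Dom_fun: "two_functor (Slice K B) K (Dom_fun K)"
  by (rule two_functorI[OF two_category_Slice two_category_axioms]) (auto simp: Slice_cells Dom_fun_def)

end

lemma two_naturalI:
  assumes "two_functor C D F" "two_functor C D G"
    and "\<And>X. X \<in> cells0 C \<Longrightarrow> t X \<in> cells1 D \<and> src1 D (t X) = map0 F X \<and> tgt1 D (t X) = map0 G X"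
    and "\<And>f. f \<in> cells1 C \<Longrightarrow> t (tgt1 C f) \<cdot>\<^bsub>D\<^esub> map1 F f = map1 G f \<cdot>\<^bsub>D\<^esub> t (src1 C f)"
    and "\<And>\<alpha>. \<alpha> \<in> cells2 C \<Longrightarrow> id2 D (t (tgt1 C (src2 C \<alpha>))) \<star>\<^bsub>D\<^esub> map2 F \<alpha>
      = map2 G \<alpha> \<star>\<^bsub>D\<^esub> id2 D (t (src1 C (src2 C \<alpha>)))"
  shows "two_natural C D F G t"
  by (intro two_natural.intro two_natural_axioms.intro assms(1,2))
    (use assms(3-) in \<open>auto simp: hom1_def hom2_def\<close>)

section \<open>The 2-category of categories\<close>

lemma category_Dom_Cod [simp]:
  "category C \<Longrightarrow> f \<in> Arr C \<Longrightarrow> Dom C f \<in> Obj C"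
  "category C \<Longrightarrow> f \<in> Arr C \<Longrightarrow> Cod C f \<in> Obj C"
  by (simp_all add: category.Dom_in category.Cod_in)

lemma category_Ide [simp]:
  assumes "category C" "x \<in> Obj C"
  shows "Ide C x \<in> Arr C" "Dom C (Ide C x) = x" "Cod C (Ide C x) = x"
  using category.Ide_hom[OF assms] by (simp_all add: hom_def)

lemma category_Cmp [simp]:
  assumes "category C" "f \<in> Arr C" "g \<in> Arr C" "Cod C f = Dom C g"
  shows "Cmp C g f \<in> Arr C" "Dom C (Cmp C g f) = Dom C f" "Cod C (Cmp C g f) = Cod C g"
  using category.Cmp_hom[of C f "Dom C f" "Dom C g" g "Cod C g"] assms by (simp_all add: hom_def)

lemma category_Cmp_Ide [simp]:
  assumes "category C" "f \<in> Arr C"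
  shows "Cod C f = y \<Longrightarrow> Cmp C (Ide C y) f = f" "Dom C f = x \<Longrightarrow> Cmp C f (Ide C x) = f"
  using category.Cmp_id_left[of C f "Dom C f" y] category.Cmp_id_right[of C f x "Cod C f"] assms
  by (simp_all add: hom_def)

lemma category_Cmp_assoc [simp]:
  assumes "category C" "f \<in> Arr C" "g \<in> Arr C" "h \<in> Arr C" "Cod C f = Dom C g" "Cod C g = Dom C h"
  shows "Cmp C (Cmp C h g) f = Cmp C h (Cmp C g f)"
  using category.Cmp_assoc[of C f "Dom C f" "Dom C g" g "Dom C h" h "Cod C h"] assms
  by (simp add: hom_def)

text \<open>The analogue of \<open>vcomp_reassoc\<close> inside a category: an equation for a
  composite becomes usable in front of a further arrow.\<close>

lemma Cmp_reassoc:
  assumes "Cmp C g f = k" "category C" "f \<in> Arr C" "g \<in> Arr C" "h \<in> Arr C" "Cod C f = Dom C g"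
    "Cod C h = Dom C f"
  shows "Cmp C g (Cmp C f h) = Cmp C k h"
  using assms category_Cmp_assoc[of C h f g] by simp

lemma is_functor_category [simp]:
  "is_functor F \<Longrightarrow> category (source F)" "is_functor F \<Longrightarrow> category (target F)"
  by (simp_all add: is_functor_def)

lemma is_functor_omap [simp]:
  "is_functor F \<Longrightarrow> D = target F \<Longrightarrow> x \<in> Obj (source F) \<Longrightarrow> omap F x \<in> Obj D"
  by (simp add: is_functor.omap_in)

lemma is_functor_amap [simp]:
  assumes "is_functor F" "D = target F" "f \<in> Arr (source F)"
  shows "amap F f \<in> Arr D" "Dom D (amap F f) = omap F (Dom (source F) f)"
    "Cod D (amap F f) = omap F (Cod (source F) f)"
  using is_functor.amap_hom[OF assms(1), of f "Dom (source F) f" "Cod (source F) f"] assms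
  by (simp_all add: hom_def)

lemma is_functor_Ide [simp]:
  "is_functor F \<Longrightarrow> C = source F \<Longrightarrow> x \<in> Obj C \<Longrightarrow> amap F (Ide C x) = Ide (target F) (omap F x)"
  by (simp add: is_functor.amap_id)

lemma is_functor_Cmp [simp]:
  assumes "is_functor F" "C = source F" "f \<in> Arr C" "g \<in> Arr C" "Cod C f = Dom C g"
  shows "amap F (Cmp C g f) = Cmp (target F) (amap F g) (amap F f)"
  using is_functor.amap_comp[OF assms(1), of f "Dom C f" "Dom C g" g "Cod C g"] assms
  by (simp add: hom_def)

lemma functor_eqI:
  fixes F G :: "'u func"
  assumes F: "is_functor F" and G: "is_functor G" and st: "source F = source G" "target F = target G"
    and om: "\<And>x. x \<in> Obj (source F) \<Longrightarrow> omap F x = omap G x"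
    and am: "\<And>f. f \<in> Arr (source F) \<Longrightarrow> amap F f = amap G f"
  shows "F = G"
proof -
  have "omap F = omap G"
    by (rule extensionalityI[of _ "Obj (source F)"])
      (use is_functor.omap_ext[OF F] is_functor.omap_ext[OF G] st om in auto)
  moreover have "amap F = amap G"
    by (rule extensionalityI[of _ "Arr (source F)"])
      (use is_functor.amap_ext[OF F] is_functor.amap_ext[OF G] st am in auto)
  ultimately show ?thesis using st by simp
qed

lemma mk_functor_sel [simp]:
  "source (mk_functor C D ob ar) = C" "target (mk_functor C D ob ar) = D"
  "x \<in> Obj C \<Longrightarrow> omap (mk_functor C D ob ar) x = ob x"
  "f \<in> Arr C \<Longrightarrow> amap (mk_functor C D ob ar) f = ar f"
  by (simp_all add: mk_functor_def)

lemma is_functor_mk_functor: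
  assumes "category C" "category D"
    and "\<And>x. x \<in> Obj C \<Longrightarrow> ob x \<in> Obj D"
    and "\<And>f. f \<in> Arr C \<Longrightarrow> ar f \<in> Arr D \<and> Dom D (ar f) = ob (Dom C f) \<and> Cod D (ar f) = ob (Cod C f)"
    and "\<And>x. x \<in> Obj C \<Longrightarrow> ar (Ide C x) = Ide D (ob x)"
    and "\<And>f g. f \<in> Arr C \<Longrightarrow> g \<in> Arr C \<Longrightarrow> Cod C f = Dom C g \<Longrightarrow> ar (Cmp C g f) = Cmp D (ar g) (ar f)"
  shows "is_functor (mk_functor C D ob ar)"
  by (intro is_functor.intro is_functor_axioms.intro)
    (use assms in \<open>auto simp: hom_def mk_functor_def\<close>)

lemma id_functor_sel [simp]:
  "source (id_functor C) = C" "target (id_functor C) = C"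
  "x \<in> Obj C \<Longrightarrow> omap (id_functor C) x = x" "f \<in> Arr C \<Longrightarrow> amap (id_functor C) f = f"
  by (simp_all add: id_functor_def)

lemma is_functor_id_functor [simp]: "category C \<Longrightarrow> is_functor (id_functor C)"
  unfolding id_functor_def by (rule is_functor_mk_functor) auto

lemma comp_functor_sel [simp]:
  "source (comp_functor G F) = source F" "target (comp_functor G F) = target G"
  "x \<in> Obj (source F) \<Longrightarrow> omap (comp_functor G F) x = omap G (omap F x)"
  "f \<in> Arr (source F) \<Longrightarrow> amap (comp_functor G F) f = amap G (amap F f)"
  by (simp_all add: comp_functor_def)

lemma is_functor_comp_functor [simp]:
  assumes "is_functor F" "is_functor G" "target F = source G"
  shows "is_functor (comp_functor G F)"
  unfolding comp_functor_def by (rule is_functor_mk_functor) (use assms in auto)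

lemma is_ntrans_functor [simp]:
  assumes "is_ntrans \<alpha>"
  shows "is_functor (source \<alpha>)" "is_functor (target \<alpha>)"
    "source (target \<alpha>) = source (source \<alpha>)" "target (target \<alpha>) = target (source \<alpha>)"
  using assms by (simp_all add: is_ntrans_def is_ntrans_axioms_def)

lemma is_ntrans_component [simp]:
  assumes "is_ntrans \<alpha>" "D = target (source \<alpha>)" "x \<in> Obj (source (source \<alpha>))"
  shows "component \<alpha> x \<in> Arr D" "Dom D (component \<alpha> x) = omap (source \<alpha>) x"
    "Cod D (component \<alpha> x) = omap (target \<alpha>) x"
  using is_ntrans.component_hom[OF assms(1,3)] assms(2) by (simp_all add: hom_def)

lemma is_ntrans_naturality:
  assumes "is_ntrans \<alpha>" "f \<in> Arr (source (source \<alpha>))" "Dom (source (source \<alpha>)) f = x"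
    "Cod (source (source \<alpha>)) f = y"
  shows "Cmp (target (source \<alpha>)) (component \<alpha> y) (amap (source \<alpha>) f)
    = Cmp (target (source \<alpha>)) (amap (target \<alpha>) f) (component \<alpha> x)"
  using is_ntrans.naturality[OF assms(1), of f x y] assms by (simp add: hom_def)

lemma ntrans_eqI:
  fixes \<alpha> \<beta> :: "'u ntrans"
  assumes "is_ntrans \<alpha>" "is_ntrans \<beta>" and st: "source \<alpha> = source \<beta>" "target \<alpha> = target \<beta>"
    and eq: "\<And>x. x \<in> Obj (source (source \<alpha>)) \<Longrightarrow> component \<alpha> x = component \<beta> x"
  shows "\<alpha> = \<beta>"
proof -
  have "component \<alpha> = component \<beta>"
    by (rule extensionalityI[of _ "Obj (source (source \<alpha>))"])
      (use is_ntrans.component_ext[OF assms(1)] is_ntrans.component_ext[OF assms(2)] st eq in auto)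
  then show ?thesis using st by simp
qed

lemma mk_ntrans_sel [simp]:
  "source (mk_ntrans F G c) = F" "target (mk_ntrans F G c) = G"
  "x \<in> Obj (source F) \<Longrightarrow> component (mk_ntrans F G c) x = c x"
  by (simp_all add: mk_ntrans_def)

lemma is_ntrans_mk_ntrans:
  assumes "is_functor F" "is_functor G" "source G = source F" "target G = target F"
    and "\<And>x. x \<in> Obj (source F) \<Longrightarrow> c x \<in> Arr (target F) \<and> Dom (target F) (c x) = omap F x
      \<and> Cod (target F) (c x) = omap G x"
    and "\<And>f. f \<in> Arr (source F) \<Longrightarrow> Cmp (target F) (c (Cod (source F) f)) (amap F f)
      = Cmp (target F) (amap G f) (c (Dom (source F) f))"
  shows "is_ntrans (mk_ntrans F G c)"
  by (intro is_ntrans.intro is_ntrans_axioms.intro) (use assms in \<open>auto simp: hom_def mk_ntrans_def\<close>)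

lemma id_ntrans_sel [simp]:
  "source (id_ntrans F) = F" "target (id_ntrans F) = F"
  "x \<in> Obj (source F) \<Longrightarrow> component (id_ntrans F) x = Ide (target F) (omap F x)"
  by (simp_all add: id_ntrans_def)

lemma is_ntrans_id_ntrans [simp]: "is_functor F \<Longrightarrow> is_ntrans (id_ntrans F)"
  unfolding id_ntrans_def by (rule is_ntrans_mk_ntrans) auto

lemma vcomp_ntrans_sel [simp]:
  "source (vcomp_ntrans \<beta> \<alpha>) = source \<alpha>" "target (vcomp_ntrans \<beta> \<alpha>) = target \<beta>"
  "x \<in> Obj (source (source \<alpha>)) \<Longrightarrow>
    component (vcomp_ntrans \<beta> \<alpha>) x = Cmp (target (source \<alpha>)) (component \<beta> x) (component \<alpha> x)"
  by (simp_all add: vcomp_ntrans_def)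

lemma is_ntrans_vcomp_ntrans [simp]:
  assumes a: "is_ntrans \<alpha>" and b: "is_ntrans \<beta>" and ab: "target \<alpha> = source \<beta>"
  shows "is_ntrans (vcomp_ntrans \<beta> \<alpha>)"
proof -
  have s: "source (source \<beta>) = source (source \<alpha>)" "target (source \<beta>) = target (source \<alpha>)"
    using is_ntrans_functor(3,4)[OF a] ab by simp_all
  show ?thesis
    unfolding vcomp_ntrans_def
  proof (rule is_ntrans_mk_ntrans, goal_cases)
    case (6 f)
    let ?D = "target (source \<alpha>)" and ?x = "Dom (source (source \<alpha>)) f" and ?y = "Cod (source (source \<alpha>)) f"
    have "Cmp ?D (component \<alpha> ?y) (amap (source \<alpha>) f) = Cmp ?D (amap (source \<beta>) f) (component \<alpha> ?x)"
      using is_ntrans_naturality[OF a 6] ab by simp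
    moreover have "Cmp ?D (component \<beta> ?y) (amap (source \<beta>) f) = Cmp ?D (amap (target \<beta>) f) (component \<beta> ?x)"
      using is_ntrans_naturality[OF b] 6 s by simp
    ultimately show ?case using a b ab s 6 Cmp_reassoc[of ?D "component \<beta> ?y" "amap (source \<beta>) f"]
      by simp
  qed (use a b ab s in simp_all)
qed

lemma hcomp_ntrans_sel [simp]:
  "source (hcomp_ntrans \<beta> \<alpha>) = comp_functor (source \<beta>) (source \<alpha>)"
  "target (hcomp_ntrans \<beta> \<alpha>) = comp_functor (target \<beta>) (target \<alpha>)"
  "x \<in> Obj (source (source \<alpha>)) \<Longrightarrow> component (hcomp_ntrans \<beta> \<alpha>) x
    = Cmp (target (source \<beta>)) (component \<beta> (omap (target \<alpha>) x)) (amap (source \<beta>) (component \<alpha> x))"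
  by (simp_all add: hcomp_ntrans_def)

lemma is_ntrans_hcomp_ntrans [simp]:
  assumes a: "is_ntrans \<alpha>" and b: "is_ntrans \<beta>" and ab: "target (source \<alpha>) = source (source \<beta>)"
  shows "is_ntrans (hcomp_ntrans \<beta> \<alpha>)"
  unfolding hcomp_ntrans_def
proof (rule is_ntrans_mk_ntrans, goal_cases)
  case (6 f)
  let ?D = "target (source \<alpha>)" and ?E = "target (source \<beta>)"
    and ?x = "Dom (source (source \<alpha>)) f" and ?y = "Cod (source (source \<alpha>)) f"
  have f: "f \<in> Arr (source (source \<alpha>))" using 6 by simp
  have "Cmp ?D (component \<alpha> ?y) (amap (source \<alpha>) f) = Cmp ?D (amap (target \<alpha>) f) (component \<alpha> ?x)"
    using is_ntrans_naturality[OF a f] by simp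
  \<comment> \<open>The naturality square of \<alpha> is carried along the source functor of \<beta>
    and then placed next to a naturality square of \<beta>.\<close>
  then have "amap (source \<beta>) (Cmp ?D (component \<alpha> ?y) (amap (source \<alpha>) f))
      = amap (source \<beta>) (Cmp ?D (amap (target \<alpha>) f) (component \<alpha> ?x))" by simp
  then have 1: "Cmp ?E (amap (source \<beta>) (component \<alpha> ?y)) (amap (source \<beta>) (amap (source \<alpha>) f))
      = Cmp ?E (amap (source \<beta>) (amap (target \<alpha>) f)) (amap (source \<beta>) (component \<alpha> ?x))"
    using a b ab f by simp
  have 2: "Cmp ?E (component \<beta> (omap (target \<alpha>) ?y)) (amap (source \<beta>) (amap (target \<alpha>) f))
      = Cmp ?E (amap (target \<beta>) (amap (target \<alpha>) f)) (component \<beta> (omap (target \<alpha>) ?x))"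
    using a b ab f by (intro is_ntrans_naturality) simp_all
  show ?case using a b ab f Cmp_reassoc[OF 2] 1 by simp
qed (use a b ab in simp_all)

lemma CAT_sel [simp]:
  "src1 (CAT small) = source" "tgt1 (CAT small) = target"
  "src2 (CAT small) = source" "tgt2 (CAT small) = target"
  "id1 (CAT small) C = id_functor C" "id2 (CAT small) F = id_ntrans F"
  "G \<cdot>\<^bsub>CAT small\<^esub> F = comp_functor G F"
  "\<beta> \<bullet>\<^bsub>CAT small\<^esub> \<alpha> = vcomp_ntrans \<beta> \<alpha>" "\<beta> \<star>\<^bsub>CAT small\<^esub> \<alpha> = hcomp_ntrans \<beta> \<alpha>"
  by (simp_all add: CAT_def Let_def)

lemma CAT_cells:
  "C \<in> cells0 (CAT small) \<longleftrightarrow> category C \<and> locally_small small C"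
  "F \<in> cells1 (CAT small) \<longleftrightarrow> is_functor F \<and> locally_small small (source F) \<and> locally_small small (target F)"
  "\<alpha> \<in> cells2 (CAT small) \<longleftrightarrow> is_ntrans \<alpha> \<and> locally_small small (source (source \<alpha>))
    \<and> locally_small small (target (source \<alpha>))"
  by (auto simp: CAT_def Let_def)

lemma comp_functor_assoc:
  assumes "is_functor F" "is_functor G" "is_functor H" "target F = source G" "target G = source H"
  shows "comp_functor (comp_functor H G) F = comp_functor H (comp_functor G F)"
  by (rule functor_eqI) (use assms in simp_all)

lemma comp_functor_id [simp]:
  assumes "is_functor F"
  shows "target F = D \<Longrightarrow> comp_functor (id_functor D) F = F" "source F = C \<Longrightarrow> comp_functor F (id_functor C) = F"
  by (rule functor_eqI; use assms in auto)+

text \<open>At x the two sides differ only by the naturality square of \<beta> at the component of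
  \<alpha>' at x.\<close>

lemma hcomp_ntrans_interchange:
  assumes a: "is_ntrans \<alpha>" "is_ntrans \<alpha>'" and b: "is_ntrans \<beta>" "is_ntrans \<beta>'"
    and eq: "target \<alpha> = source \<alpha>'" "target \<beta> = source \<beta>'" "target (source \<alpha>) = source (source \<beta>)"
  shows "hcomp_ntrans (vcomp_ntrans \<beta>' \<beta>) (vcomp_ntrans \<alpha>' \<alpha>)
    = vcomp_ntrans (hcomp_ntrans \<beta>' \<alpha>') (hcomp_ntrans \<beta> \<alpha>)"
proof (rule ntrans_eqI)
  have s: "source (source \<alpha>') = source (source \<alpha>)" "target (source \<alpha>') = target (source \<alpha>)"
    "source (source \<beta>') = source (source \<beta>)" "target (source \<beta>') = target (source \<beta>)"
    using is_ntrans_functor(3,4)[OF a(1)] is_ntrans_functor(3,4)[OF b(1)] eq by simp_all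
  show "is_ntrans (hcomp_ntrans (vcomp_ntrans \<beta>' \<beta>) (vcomp_ntrans \<alpha>' \<alpha>))"
    "is_ntrans (vcomp_ntrans (hcomp_ntrans \<beta>' \<alpha>') (hcomp_ntrans \<beta> \<alpha>))"
    using a b eq s by simp_all
  fix x assume "x \<in> Obj (source (source (hcomp_ntrans (vcomp_ntrans \<beta>' \<beta>) (vcomp_ntrans \<alpha>' \<alpha>))))"
  then have x: "x \<in> Obj (source (source \<alpha>))" by simp
  let ?E = "target (source \<beta>)"
  have nat: "Cmp ?E (component \<beta> (omap (target \<alpha>') x)) (amap (source \<beta>) (component \<alpha>' x))
     = Cmp ?E (amap (target \<beta>) (component \<alpha>' x)) (component \<beta> (omap (source \<alpha>') x))"
    using a b eq s x by (intro is_ntrans_naturality) simp_all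
  show "component (hcomp_ntrans (vcomp_ntrans \<beta>' \<beta>) (vcomp_ntrans \<alpha>' \<alpha>)) x
     = component (vcomp_ntrans (hcomp_ntrans \<beta>' \<alpha>') (hcomp_ntrans \<beta> \<alpha>)) x"
    using a b eq s x Cmp_reassoc[OF nat] by simp
qed simp_all

lemma two_category_CAT: "two_category (CAT small)"
proof (rule two_categoryI, goal_cases)
  case (19 \<alpha> \<beta> \<alpha>' \<beta>')
  then show ?case by (simp add: CAT_cells hcomp_ntrans_interchange)
qed (auto intro!: functor_eqI ntrans_eqI simp: CAT_cells comp_functor_assoc)

section \<open>Categories whose arrows are tagged pairs\<close>

lemma tag_simps [simp]:
  "tag_src (tag s t c) = s" "tag_tgt (tag s t c) = t"
  "tag_fst (tag s t c) = lft c" "tag_snd (tag s t c) = rgt c"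
  "tag s t c = tag s' t' c' \<longleftrightarrow> s = s' \<and> t = t' \<and> c = c'"
  by (auto simp: tag_def tag_src_def tag_tgt_def tag_fst_def tag_snd_def)

lemma pair_category_Obj: "Obj (pair_category C D S p q Q) = S"
  by (simp add: pair_category_def Let_def)

lemma pair_category_Arr:
  "tag s t (Pair r v) \<in> Arr (pair_category C D S p q Q) \<longleftrightarrow> s \<in> S \<and> t \<in> S
    \<and> r \<in> Arr C \<and> Dom C r = p s \<and> Cod C r = p t \<and> v \<in> Arr D \<and> Dom D v = q s \<and> Cod D v = q t \<and> Q s t r v"
  by (auto simp: pair_category_def Let_def hom_def)

lemma pair_category_ArrE:
  assumes "a \<in> Arr (pair_category C D S p q Q)"
  obtains s t r v where "a = tag s t (Pair r v)" "tag s t (Pair r v) \<in> Arr (pair_category C D S p q Q)"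
  using assms by (auto simp: pair_category_def Let_def hom_def)

lemma pair_category_Dom_Cod:
  "a \<in> Arr (pair_category C D S p q Q) \<Longrightarrow> Dom (pair_category C D S p q Q) a = tag_src a"
  "a \<in> Arr (pair_category C D S p q Q) \<Longrightarrow> Cod (pair_category C D S p q Q) a = tag_tgt a"
  by (simp_all add: pair_category_def Let_def)

lemma pair_category_Ide:
  "s \<in> S \<Longrightarrow> Ide (pair_category C D S p q Q) s = tag s s (Pair (Ide C (p s)) (Ide D (q s)))"
  by (simp add: pair_category_def Let_def)

lemma pair_category_Cmp:
  "tag s t (Pair r v) \<in> Arr (pair_category C D S p q Q) \<Longrightarrow> tag t t' (Pair r' v') \<in> Arr (pair_category C D S p q Q)
    \<Longrightarrow> Cmp (pair_category C D S p q Q) (tag t t' (Pair r' v')) (tag s t (Pair r v))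
      = tag s t' (Pair (Cmp C r' r) (Cmp D v' v))"
  by (simp add: pair_category_def Let_def)

lemma categoryI:
  assumes "\<And>f. f \<in> Arr C \<Longrightarrow> Dom C f \<in> Obj C" "\<And>f. f \<in> Arr C \<Longrightarrow> Cod C f \<in> Obj C"
    and "\<And>x. x \<in> Obj C \<Longrightarrow> Ide C x \<in> Arr C \<and> Dom C (Ide C x) = x \<and> Cod C (Ide C x) = x"
    and "\<And>f g. f \<in> Arr C \<Longrightarrow> g \<in> Arr C \<Longrightarrow> Cod C f = Dom C g
      \<Longrightarrow> Cmp C g f \<in> Arr C \<and> Dom C (Cmp C g f) = Dom C f \<and> Cod C (Cmp C g f) = Cod C g"
    and "\<And>f. f \<in> Arr C \<Longrightarrow> Cmp C (Ide C (Cod C f)) f = f \<and> Cmp C f (Ide C (Dom C f)) = f"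
    and "\<And>f g h. f \<in> Arr C \<Longrightarrow> g \<in> Arr C \<Longrightarrow> h \<in> Arr C \<Longrightarrow> Cod C f = Dom C g \<Longrightarrow> Cod C g = Dom C h
      \<Longrightarrow> Cmp C (Cmp C h g) f = Cmp C h (Cmp C g f)"
    and "Dom C \<in> extensional (Arr C)" "Cod C \<in> extensional (Arr C)" "Ide C \<in> extensional (Obj C)"
    and "\<And>f g. \<not> (f \<in> Arr C \<and> g \<in> Arr C \<and> Cod C f = Dom C g) \<Longrightarrow> Cmp C g f = undefined"
  shows "category C"
  by unfold_locales (use assms in \<open>auto simp: hom_def\<close>)

text \<open>Serves arrow categories and comma categories at once. The relation Q must contain the
  identities and be closed under componentwise composition; all other laws are those of the two
  factors.\<close>

lemma category_pair_category:
  assumes C: "category C" and D: "category D"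
    and p: "\<And>s. s \<in> S \<Longrightarrow> p s \<in> Obj C" and q: "\<And>s. s \<in> S \<Longrightarrow> q s \<in> Obj D"
    and Q_id: "\<And>s. s \<in> S \<Longrightarrow> Q s s (Ide C (p s)) (Ide D (q s))"
    and Q_comp: "\<And>s t t' r v r' v'. s \<in> S \<Longrightarrow> t \<in> S \<Longrightarrow> t' \<in> S \<Longrightarrow> r \<in> hom C (p s) (p t) \<Longrightarrow> v \<in> hom D (q s) (q t)
      \<Longrightarrow> r' \<in> hom C (p t) (p t') \<Longrightarrow> v' \<in> hom D (q t) (q t') \<Longrightarrow> Q s t r v \<Longrightarrow> Q t t' r' v'
      \<Longrightarrow> Q s t' (Cmp C r' r) (Cmp D v' v)"
  shows "category (pair_category C D S p q Q)"
proof -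
  let ?P = "pair_category C D S p q Q"
  have tagE: thesis if arr: "a \<in> Arr ?P"
    and elim: "\<And>s t r v. a = tag s t (Pair r v) \<Longrightarrow> s \<in> S \<Longrightarrow> t \<in> S \<Longrightarrow> r \<in> Arr C \<Longrightarrow> Dom C r = p s \<Longrightarrow> Cod C r = p t
      \<Longrightarrow> v \<in> Arr D \<Longrightarrow> Dom D v = q s \<Longrightarrow> Cod D v = q t \<Longrightarrow> Q s t r v \<Longrightarrow> Dom ?P a = s \<Longrightarrow> Cod ?P a = t \<Longrightarrow> thesis"
    for a thesis
  proof -
    obtain s t r v where *: "a = tag s t (Pair r v)" "tag s t (Pair r v) \<in> Arr ?P"
      using arr by (rule pair_category_ArrE)
    show thesis
      by (rule elim[OF *(1)]) (use * in \<open>simp_all add: pair_category_Arr pair_category_Dom_Cod\<close>)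
  qed
  have comp: "Q s t' (Cmp C r' r) (Cmp D v' v)"
    if "s \<in> S" "t \<in> S" "t' \<in> S" "r \<in> Arr C" "Dom C r = p s" "Cod C r = p t" "v \<in> Arr D" "Dom D v = q s" "Cod D v = q t"
      "r' \<in> Arr C" "Dom C r' = p t" "Cod C r' = p t'" "v' \<in> Arr D" "Dom D v' = q t" "Cod D v' = q t'"
      "Q s t r v" "Q t t' r' v'" for s t t' r v r' v'
    using that by (intro Q_comp[of s t t']) (auto simp: hom_def)
  note simps = pair_category_Obj pair_category_Arr pair_category_Dom_Cod pair_category_Ide pair_category_Cmp
  show ?thesis
  proof (rule categoryI, goal_cases)
    case (4 a b)
    then show ?case
      by (elim tagE) (use C D comp in \<open>simp add: simps\<close>)
  next
    case (6 a b c)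
    show ?case
      by (rule tagE[OF 6(1)], rule tagE[OF 6(2)], rule tagE[OF 6(3)])
        (use C D comp 6 in \<open>simp add: simps\<close>)
  next
    case (1 a)
    then show ?case by (elim tagE) (simp add: simps)
  next
    case (2 a)
    then show ?case by (elim tagE) (simp add: simps)
  next
    case (3 x)
    then show ?case using C D p q Q_id by (simp add: simps)
  next
    case (5 a)
    then show ?case by (elim tagE) (use C D p q Q_id in \<open>simp add: simps\<close>)
  next
    case (10 f g)
    then show ?case
      using pair_category_Dom_Cod[of f C D S p q Q] pair_category_Dom_Cod[of g C D S p q Q]
      by (auto simp: pair_category_def Let_def split: if_splits)
  qed (simp_all add: pair_category_def Let_def)
qed

text \<open>A hom set sits inside the tagged pairs of two hom sets. The three closure properties of
  smallness enter in turn: pairs, images, subsets.\<close>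

lemma locally_small_pair_category:
  assumes small: "smallness small" and C: "locally_small small C" and D: "locally_small small D"
    and p: "\<And>s. s \<in> S \<Longrightarrow> p s \<in> Obj C" and q: "\<And>s. s \<in> S \<Longrightarrow> q s \<in> Obj D"
  shows "locally_small small (pair_category C D S p q Q)"
  unfolding locally_small_def
proof (intro ballI)
  fix s t assume "s \<in> Obj (pair_category C D S p q Q)" "t \<in> Obj (pair_category C D S p q Q)"
  then have st: "s \<in> S" "t \<in> S" by (simp_all add: pair_category_Obj)
  let ?H = "{Pair r v | r v. r \<in> hom C (p s) (p t) \<and> v \<in> hom D (q s) (q t)}"
  have "small (hom C (p s) (p t))" "small (hom D (q s) (q t))"
    using C D p q st by (auto simp: locally_small_def)
  then have "small ?H"
    using small[unfolded smallness_def, THEN conjunct2, THEN conjunct2] by blast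
  then have "small (tag s t ` ?H)"
    using small[unfolded smallness_def, THEN conjunct2, THEN conjunct1] by blast
  moreover have "hom (pair_category C D S p q Q) s t \<subseteq> tag s t ` ?H"
  proof
    fix a assume "a \<in> hom (pair_category C D S p q Q) s t"
    then have a: "a \<in> Arr (pair_category C D S p q Q)" "tag_src a = s" "tag_tgt a = t"
      using pair_category_Dom_Cod[of a C D S p q Q] by (auto simp: hom_def)
    obtain s' t' r v where *: "a = tag s' t' (Pair r v)" "tag s' t' (Pair r v) \<in> Arr (pair_category C D S p q Q)"
      using a(1) by (rule pair_category_ArrE)
    then show "a \<in> tag s t ` ?H"
      using a(2,3) by (auto simp: pair_category_Arr hom_def)
  qed
  ultimately show "small (hom (pair_category C D S p q Q) s t)"
    using small[unfolded smallness_def, THEN conjunct1] by blast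
qed

section \<open>The squaring 2-monad\<close>

text \<open>Membership of a tagged pair in the arrow category, flattened to conditions in E. As a
  single predicate it can be produced by functors and natural transformations and passed on without
  being unfolded.\<close>

definition commutative_square :: "'a elt cat \<Rightarrow> 'a elt \<Rightarrow> 'a elt \<Rightarrow> 'a elt \<Rightarrow> 'a elt \<Rightarrow> bool" where
  "commutative_square E f g r s \<longleftrightarrow> f \<in> Arr E \<and> g \<in> Arr E \<and> r \<in> Arr E \<and> Dom E r = Dom E f \<and>
     Cod E r = Dom E g \<and> s \<in> Arr E \<and> Dom E s = Cod E f \<and> Cod E s = Cod E g \<and> Cmp E s f = Cmp E g r"

lemma arrow_cat_simps [simp]:
  "tag f g (Pair r s) \<in> Arr (arrow_cat E) \<longleftrightarrow> commutative_square E f g r s"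
  "Obj (arrow_cat E) = Arr E"
  "a \<in> Arr (arrow_cat E) \<Longrightarrow> Dom (arrow_cat E) a = tag_src a"
  "a \<in> Arr (arrow_cat E) \<Longrightarrow> Cod (arrow_cat E) a = tag_tgt a"
  "f \<in> Arr E \<Longrightarrow> Ide (arrow_cat E) f = tag f f (Pair (Ide E (Dom E f)) (Ide E (Cod E f)))"
  "commutative_square E f g r s \<Longrightarrow> commutative_square E g h r' s'
    \<Longrightarrow> Cmp (arrow_cat E) (tag g h (Pair r' s')) (tag f g (Pair r s)) = tag f h (Pair (Cmp E r' r) (Cmp E s' s))"
  unfolding arrow_cat_def
  by (simp_all add: commutative_square_def pair_category_Obj pair_category_Arr pair_category_Dom_Cod
      pair_category_Ide pair_category_Cmp)

lemma arrow_cat_ArrE: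
  assumes "a \<in> Arr (arrow_cat E)"
  obtains f g r s where "a = tag f g (Pair r s)" "commutative_square E f g r s"
    "f \<in> Arr E" "g \<in> Arr E" "r \<in> Arr E" "s \<in> Arr E" "Dom E r = Dom E f" "Cod E r = Dom E g"
    "Dom E s = Cod E f" "Cod E s = Cod E g"
proof -
  obtain f g r s where "a = tag f g (Pair r s)" "tag f g (Pair r s) \<in> Arr (arrow_cat E)"
    using assms unfolding arrow_cat_def by (rule pair_category_ArrE)
  then show thesis using that by (auto simp: commutative_square_def)
qed

lemma paste_squares:
  assumes "category E" "f \<in> Arr E" "g \<in> Arr E" "h \<in> Arr E" "r \<in> Arr E" "s \<in> Arr E" "r' \<in> Arr E" "s' \<in> Arr E"
    "Dom E r = Dom E f" "Cod E r = Dom E g" "Dom E s = Cod E f" "Cod E s = Cod E g"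
    "Dom E r' = Dom E g" "Cod E r' = Dom E h" "Dom E s' = Cod E g" "Cod E s' = Cod E h"
    "Cmp E s f = Cmp E g r" "Cmp E s' g = Cmp E h r'"
  shows "Cmp E (Cmp E s' s) f = Cmp E h (Cmp E r' r)"
  using assms Cmp_reassoc[of E s' g "Cmp E h r'" r] by simp

lemma category_arrow_cat [simp]:
  assumes "category E"
  shows "category (arrow_cat E)"
  unfolding arrow_cat_def
proof (rule category_pair_category, goal_cases)
  case (6 s t t' r v r' v')
  then show ?case using assms by (intro paste_squares[of E s t t']) (auto simp: hom_def)
qed (use assms in auto)

lemma locally_small_arrow_cat:
  "smallness small \<Longrightarrow> category E \<Longrightarrow> locally_small small E \<Longrightarrow> locally_small small (arrow_cat E)"
  unfolding arrow_cat_def by (rule locally_small_pair_category) auto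

lemma functor_square [simp]:
  assumes "is_functor F" "D = target F" "commutative_square (source F) f g r s"
  shows "commutative_square D (amap F f) (amap F g) (amap F r) (amap F s)"
  using assms is_functor_Cmp[of F "source F" f s] is_functor_Cmp[of F "source F" r g]
  by (simp add: commutative_square_def)

lemma arrow_functor_sel [simp]:
  "source (arrow_functor F) = arrow_cat (source F)" "target (arrow_functor F) = arrow_cat (target F)"
  "f \<in> Arr (source F) \<Longrightarrow> omap (arrow_functor F) f = amap F f"
  "commutative_square (source F) f g r s
    \<Longrightarrow> amap (arrow_functor F) (tag f g (Pair r s)) = tag (amap F f) (amap F g) (Pair (amap F r) (amap F s))"
  unfolding arrow_functor_def by (simp_all add: square_def)

lemma is_functor_arrow_functor [simp]:
  assumes "is_functor F"
  shows "is_functor (arrow_functor F)"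
  unfolding arrow_functor_def square_def
proof (rule is_functor_mk_functor, goal_cases)
  case (4 f)
  then show ?case using assms by (auto elim!: arrow_cat_ArrE)
next
  case (6 f g)
  then show ?case using assms by (auto elim!: arrow_cat_ArrE)
qed (use assms in auto)

lemma naturality_square [simp]:
  assumes "is_ntrans \<alpha>" "D = target (source \<alpha>)" "F = source \<alpha>" "G = target \<alpha>" "f \<in> Arr (source F)"
    "x = Dom (source F) f" "y = Cod (source F) f"
  shows "commutative_square D (amap F f) (amap G f) (component \<alpha> x) (component \<alpha> y)"
  using assms is_ntrans_naturality[OF assms(1), of f] by (simp add: commutative_square_def)

lemma arrow_ntrans_sel [simp]:
  "source (arrow_ntrans \<alpha>) = arrow_functor (source \<alpha>)" "target (arrow_ntrans \<alpha>) = arrow_functor (target \<alpha>)"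
  "f \<in> Arr (source (source \<alpha>)) \<Longrightarrow> component (arrow_ntrans \<alpha>) f
    = tag (amap (source \<alpha>) f) (amap (target \<alpha>) f)
        (Pair (component \<alpha> (Dom (source (source \<alpha>)) f)) (component \<alpha> (Cod (source (source \<alpha>)) f)))"
  unfolding arrow_ntrans_def Let_def by (simp_all add: square_def)

lemma is_ntrans_arrow_ntrans [simp]:
  assumes a: "is_ntrans \<alpha>"
  shows "is_ntrans (arrow_ntrans \<alpha>)"
  unfolding arrow_ntrans_def square_def Let_def
proof (rule is_ntrans_mk_ntrans, goal_cases)
  case (6 f)
  then show ?case using a
    by (auto elim!: arrow_cat_ArrE simp: is_ntrans_naturality)
qed (use a in simp_all)

lemma two_functor_arrow:
  assumes "smallness small"
  shows "two_functor (CAT small) (CAT small) (endo square_monad)"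
proof (rule two_functorI[OF two_category_CAT two_category_CAT], goal_cases)
  case (6 f g)
  then show ?case unfolding square_monad_def
    by (auto intro!: functor_eqI elim!: arrow_cat_ArrE simp: CAT_cells)
next
  case (4 X)
  then show ?case unfolding square_monad_def
    by (auto intro!: functor_eqI elim!: arrow_cat_ArrE simp: CAT_cells)
next
  case (5 f)
  then show ?case unfolding square_monad_def
    by (auto intro!: ntrans_eqI simp: CAT_cells)
next
  case (7 \<alpha> \<beta>)
  then have "source (source \<beta>) = source (source \<alpha>)" "target (source \<beta>) = target (source \<alpha>)"
    using is_ntrans_functor(3,4)[of \<alpha>] by (auto simp: CAT_cells)
  with 7 show ?case unfolding square_monad_def
    by (auto intro!: ntrans_eqI simp: CAT_cells)
next
  case (8 \<alpha> \<beta>)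
  have "arrow_functor (comp_functor (source \<beta>) (source \<alpha>)) = comp_functor (arrow_functor (source \<beta>)) (arrow_functor (source \<alpha>))"
    "arrow_functor (comp_functor (target \<beta>) (target \<alpha>)) = comp_functor (arrow_functor (target \<beta>)) (arrow_functor (target \<alpha>))"
    using 8 by (auto intro!: functor_eqI elim!: arrow_cat_ArrE simp: CAT_cells)
  with 8 show ?case unfolding square_monad_def
    by (auto intro!: ntrans_eqI simp: CAT_cells)
qed (auto simp: square_monad_def CAT_cells locally_small_arrow_cat assms)

lemma commutative_square_Arr:
  "commutative_square E f g r s \<Longrightarrow> f \<in> Arr E \<and> g \<in> Arr E \<and> r \<in> Arr E \<and> s \<in> Arr E \<and>
    Dom E r = Dom E f \<and> Cod E r = Dom E g \<and> Dom E s = Cod E f \<and> Cod E s = Cod E g"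
  by (simp add: commutative_square_def)

lemma commutative_square_eq: "commutative_square E f g r s \<Longrightarrow> Cmp E s f = Cmp E g r"
  by (simp add: commutative_square_def)

lemma commutative_square_Ide [simp]:
  "category E \<Longrightarrow> f \<in> Arr E \<Longrightarrow> x = Dom E f \<Longrightarrow> y = Cod E f \<Longrightarrow> commutative_square E (Ide E x) (Ide E y) f f"
  "category E \<Longrightarrow> f \<in> Arr E \<Longrightarrow> x = Dom E f \<Longrightarrow> y = Cod E f \<Longrightarrow> commutative_square E f f (Ide E x) (Ide E y)"
  by (simp_all add: commutative_square_def)

lemma square_monad_sel [simp]:
  "map0 (endo square_monad) = arrow_cat" "map1 (endo square_monad) = arrow_functor"
  "map2 (endo square_monad) = arrow_ntrans"
  by (simp_all add: square_monad_def)

lemma square_unit_sel [simp]: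
  "source (eta square_monad E) = E" "target (eta square_monad E) = arrow_cat E"
  "x \<in> Obj E \<Longrightarrow> omap (eta square_monad E) x = Ide E x"
  "f \<in> Arr E \<Longrightarrow> amap (eta square_monad E) f = tag (Ide E (Dom E f)) (Ide E (Cod E f)) (Pair f f)"
  by (simp_all add: square_monad_def square_def)

lemma is_functor_square_unit [simp]:
  "category E \<Longrightarrow> is_functor (eta square_monad E)"
  unfolding square_monad_def two_mon.simps square_def by (rule is_functor_mk_functor) auto

lemma diagonal_tag [simp]: "diagonal E (tag f g (Pair r s)) = Cmp E s f"
  by (simp add: diagonal_def)

lemma square_mult_sel [simp]:
  "source (mu square_monad E) = arrow_cat (arrow_cat E)" "target (mu square_monad E) = arrow_cat E"
  "\<sigma> \<in> Arr (arrow_cat E) \<Longrightarrow> omap (mu square_monad E) \<sigma> = diagonal E \<sigma>"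
  "commutative_square (arrow_cat E) \<sigma> \<tau> \<rho> \<rho>' \<Longrightarrow> amap (mu square_monad E) (tag \<sigma> \<tau> (Pair \<rho> \<rho>'))
    = tag (diagonal E \<sigma>) (diagonal E \<tau>) (Pair (tag_fst \<rho>) (tag_snd \<rho>'))"
  by (simp_all add: square_monad_def square_def)

text \<open>A morphism of squares is a commutative cube. Four of its faces are arrows of the arrow
  category; the remaining two are the last two equations.\<close>

lemma arrow_cat_arrow_cat_ArrE:
  assumes a: "a \<in> Arr (arrow_cat (arrow_cat E))"
  obtains f g r s f' g' r' s' p q p' q' where
    "a = tag (tag f g (Pair r s)) (tag f' g' (Pair r' s')) (Pair (tag f f' (Pair p q)) (tag g g' (Pair p' q')))"
    "commutative_square (arrow_cat E) (tag f g (Pair r s)) (tag f' g' (Pair r' s')) (tag f f' (Pair p q)) (tag g g' (Pair p' q'))"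
    "commutative_square E f g r s" "commutative_square E f' g' r' s'"
    "commutative_square E f f' p q" "commutative_square E g g' p' q'"
    "Cmp E p' r = Cmp E r' p" "Cmp E q' s = Cmp E s' q"
proof -
  obtain \<sigma> \<tau> \<rho> \<rho>' where 1: "a = tag \<sigma> \<tau> (Pair \<rho> \<rho>')" "commutative_square (arrow_cat E) \<sigma> \<tau> \<rho> \<rho>'"
    "\<sigma> \<in> Arr (arrow_cat E)" "\<tau> \<in> Arr (arrow_cat E)" "\<rho> \<in> Arr (arrow_cat E)" "\<rho>' \<in> Arr (arrow_cat E)"
    "Dom (arrow_cat E) \<rho> = Dom (arrow_cat E) \<sigma>" "Cod (arrow_cat E) \<rho> = Dom (arrow_cat E) \<tau>"
    "Dom (arrow_cat E) \<rho>' = Cod (arrow_cat E) \<sigma>" "Cod (arrow_cat E) \<rho>' = Cod (arrow_cat E) \<tau>"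
    using a by (rule arrow_cat_ArrE)
  have eq: "Cmp (arrow_cat E) \<rho>' \<sigma> = Cmp (arrow_cat E) \<tau> \<rho>"
    using 1(2) by (simp add: commutative_square_def)
  obtain f g r s where 2: "\<sigma> = tag f g (Pair r s)" "commutative_square E f g r s"
    using 1(3) by (rule arrow_cat_ArrE)
  obtain f' g' r' s' where 3: "\<tau> = tag f' g' (Pair r' s')" "commutative_square E f' g' r' s'"
    using 1(4) by (rule arrow_cat_ArrE)
  obtain f1 g1 p q where 4: "\<rho> = tag f1 g1 (Pair p q)" "commutative_square E f1 g1 p q"
    using 1(5) by (rule arrow_cat_ArrE)
  obtain f2 g2 p' q' where 5: "\<rho>' = tag f2 g2 (Pair p' q')" "commutative_square E f2 g2 p' q'"
    using 1(6) by (rule arrow_cat_ArrE)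
  have "f1 = f" "g1 = f'" "f2 = g" "g2 = g'"
    using 1 2 3 4 5 by simp_all
  with 1 2 3 4 5 eq that[of f g r s f' g' r' s' p q p' q'] show thesis by simp
qed

text \<open>The long sides are diagonals of opposite faces of a cube. Move q' past s by the last
  equation, then q past f by the square from f to f'.\<close>

lemma diagonal_square [simp]:
  assumes "category E" "commutative_square E f g r s" "commutative_square E f' g' r' s'"
    "commutative_square E f f' p q" "commutative_square E g g' p' q'" "Cmp E q' s = Cmp E s' q"
  shows "commutative_square E (Cmp E s f) (Cmp E s' f') p q'"
proof -
  note a = assms(2-5)[THEN commutative_square_Arr]
  note eq = commutative_square_eq[OF assms(4)]
  have "Cmp E q' (Cmp E s f) = Cmp E (Cmp E s' q) f" using assms(1,6) a Cmp_reassoc[OF assms(6), of f] by simp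
  also have "\<dots> = Cmp E s' (Cmp E f' p)" using assms(1) a eq by simp
  also have "\<dots> = Cmp E (Cmp E s' f') p"
    using assms(1) a by (intro category_Cmp_assoc[symmetric]) simp_all
  finally show ?thesis using assms(1) a by (simp add: commutative_square_def)
qed

lemma is_functor_square_mult [simp]:
  assumes E: "category E"
  shows "is_functor (mu square_monad E)"
  unfolding square_monad_def two_mon.simps square_def
proof (rule is_functor_mk_functor, goal_cases)
  case (3 x)
  then show ?case using E by (auto elim!: arrow_cat_ArrE)
next
  case (4 f)
  then show ?case by (rule arrow_cat_arrow_cat_ArrE) (use E in simp)
next
  case (5 x)
  then have "x \<in> Arr (arrow_cat E)" by simp
  then show ?case by (rule arrow_cat_ArrE) (use E in simp)
next
  case (6 f g)
  show ?case
  proof (rule arrow_cat_arrow_cat_ArrE[OF 6(1)], rule arrow_cat_arrow_cat_ArrE[OF 6(2)], goal_cases)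
    case 1
    then show ?case using E 6 by simp
  qed
qed (use E in auto)

lemma two_natural_square_unit:
  assumes "smallness small"
  shows "two_natural (CAT small) (CAT small) id_two_fun (endo square_monad) (eta square_monad)"
proof (rule two_naturalI[OF two_functor_id[OF two_category_CAT] two_functor_arrow[OF assms]], goal_cases)
  case (1 X)
  then show ?case using assms by (simp add: CAT_cells locally_small_arrow_cat)
next
  case (2 f)
  then show ?case by (auto intro!: functor_eqI simp: CAT_cells)
next
  case (3 \<alpha>)
  \<comment> \<open>The two whiskered transformations can be compared only between literally equal
    functors, so naturality on 1-cells is first applied to both ends of \<alpha>.\<close>
  then have "comp_functor (eta square_monad (target F)) F = comp_functor (arrow_functor F) (eta square_monad (source F))"
    if "F = source \<alpha> \<or> F = target \<alpha>" for F
    using that by (auto intro!: functor_eqI simp: CAT_cells)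
  from this[of "source \<alpha>"] this[of "target \<alpha>"] 3 show ?case
    by (auto intro!: ntrans_eqI simp: CAT_cells)
qed

lemma two_natural_square_mult:
  fixes small :: "'a elt set \<Rightarrow> bool"
  assumes "smallness small"
  shows "two_natural (CAT small) (CAT small) (endo square_monad \<circ>\<^sub>2 endo square_monad) (endo square_monad) (mu square_monad)"
proof (rule two_naturalI[OF two_functor_comp[OF two_functor_arrow[OF assms] two_functor_arrow[OF assms]]
      two_functor_arrow[OF assms]], goal_cases)
  case (1 X)
  then show ?case using assms by (simp add: CAT_cells locally_small_arrow_cat)
next
  have nat: "comp_functor (mu square_monad (target F)) (arrow_functor (arrow_functor F))
     = comp_functor (arrow_functor F) (mu square_monad (source F))" if F: "is_functor F"
    for F :: "'a elt func"
  proof (rule functor_eqI, goal_cases)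
    case (5 x)
    then have "x \<in> Arr (arrow_cat (source F))" by simp
    then show ?case by (rule arrow_cat_ArrE) (use F in simp)
  next
    case (6 f)
    then have "f \<in> Arr (arrow_cat (arrow_cat (source F)))" by simp
    then show ?case
    proof (rule arrow_cat_arrow_cat_ArrE, goal_cases)
      case (1 f g r s f' g' r' s' p q p' q')
      \<comment> \<open>The functor on arrow categories preserves commutative squares of squares, so
        the image of a cube is again a cube and its diagonal can be evaluated.\<close>
      have "commutative_square (arrow_cat (target F))
          (amap (arrow_functor F) (tag f g (Pair r s))) (amap (arrow_functor F) (tag f' g' (Pair r' s')))
          (amap (arrow_functor F) (tag f f' (Pair p q))) (amap (arrow_functor F) (tag g g' (Pair p' q')))"
        using F 1(2) by (intro functor_square) simp_all
      then show ?case
        using F 1 1(3-6)[THEN commutative_square_Arr] by simp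
    qed
  qed (use F in simp_all)
  {
    case (2 f)
    then show ?case using nat by (simp add: CAT_cells)
  next
    case (3 \<alpha>)
    then have \<alpha>: "is_ntrans \<alpha>" by (simp add: CAT_cells)
    show ?case unfolding CAT_sel two_fun_simps square_monad_sel
    proof (rule ntrans_eqI, goal_cases)
      case (5 x)
      then have x: "x \<in> Arr (arrow_cat (source (source \<alpha>)))" using \<alpha> by simp
      then show ?case
      proof (rule arrow_cat_ArrE, goal_cases)
        case (1 f g r s)
        have "commutative_square (arrow_cat (target (source \<alpha>)))
            (amap (arrow_functor (source \<alpha>)) x) (amap (arrow_functor (target \<alpha>)) x)
            (component (arrow_ntrans \<alpha>) f) (component (arrow_ntrans \<alpha>) g)"
          using \<alpha> x 1 by (intro naturality_square) simp_all
        moreover have "commutative_square (target (source \<alpha>))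
            (amap (source \<alpha>) (Cmp (source (source \<alpha>)) s f)) (amap (target \<alpha>) (Cmp (source (source \<alpha>)) s f))
            (component \<alpha> (Dom (source (source \<alpha>)) f)) (component \<alpha> (Cod (source (source \<alpha>)) g))"
          using \<alpha> x 1 by (intro naturality_square) simp_all
        ultimately show ?case using \<alpha> 1 by simp
      qed
    qed (use \<alpha> nat[of "source \<alpha>"] nat[of "target \<alpha>"] in simp_all)
  }
qed

text \<open>A diagonal is read along the codomain side of a square. After composing squares, the
  later one therefore contributes only its terminal component.\<close>

lemma diagonal_Cmp:
  assumes X: "category X" and f: "f \<in> Arr (arrow_cat X)" and s: "s \<in> Arr (arrow_cat X)"
    and fs: "Dom (arrow_cat X) s = Cod (arrow_cat X) f"
  shows "diagonal X (Cmp (arrow_cat X) s f) = Cmp X (tag_snd s) (diagonal X f)"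
proof (rule arrow_cat_ArrE[OF f], rule arrow_cat_ArrE[OF s], goal_cases)
  case 1
  then show ?case using X fs by simp
qed

text \<open>Both degenerate squares on an arrow f have diagonal f, which gives the unit laws.
  Associativity on objects says that two successive collapses of a cube reach its long diagonal in
  either order; on arrows only the components at the initial and terminal vertices survive.\<close>

lemma two_monad_square_monad:
  assumes "smallness small"
  shows "two_monad (CAT small) square_monad"
proof (intro two_monad.intro two_monad_axioms.intro two_functor_arrow two_natural_square_unit two_natural_square_mult assms, goal_cases)
  case (1 X)
  then have X: "category X" by (simp add: CAT_cells)
  show ?case unfolding CAT_sel square_monad_sel
  proof (rule functor_eqI, goal_cases)
    case (5 x)
    then have "x \<in> Arr X" using X by simp
    then show ?case using X by simp
  next
    case (6 f)
    then have "f \<in> Arr (arrow_cat X)" by simp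
    then show ?case
    proof (rule arrow_cat_ArrE, goal_cases)
      case (1 u v r s)
      then have "commutative_square (arrow_cat X) (Ide (arrow_cat X) u) (Ide (arrow_cat X) v) f f"
        using X by (intro commutative_square_Ide) simp_all
      then show ?case using X 1 by simp
    qed
  qed (use X in simp_all)
next
  case (2 X)
  then have X: "category X" by (simp add: CAT_cells)
  show ?case unfolding CAT_sel square_monad_sel
  proof (rule functor_eqI, goal_cases)
    case (5 x)
    then have "x \<in> Arr X" using X by simp
    then show ?case using X by simp
  next
    case (6 f)
    then have "f \<in> Arr (arrow_cat X)" by simp
    then show ?case
    proof (rule arrow_cat_ArrE, goal_cases)
      case (1 u v r s)
      let ?\<eta> = "amap (eta square_monad X)"
      \<comment> \<open>Applying the unit functor to the given square yields a square in the arrow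
        category, which is the cube on which the multiplication is evaluated.\<close>
      have "commutative_square (arrow_cat X) (?\<eta> u) (?\<eta> v) (?\<eta> r) (?\<eta> s)"
        using X 1 by (intro functor_square) simp_all
      then show ?case using X 1 by simp
    qed
  qed (use X in simp_all)
next
  case (3 X)
  then have X: "category X" by (simp add: CAT_cells)
  show ?case unfolding CAT_sel square_monad_sel
  proof (rule functor_eqI, goal_cases)
    case (5 x)
    then have "x \<in> Arr (arrow_cat (arrow_cat X))" by simp
    then show ?case
    proof (rule arrow_cat_ArrE, goal_cases)
      case (1 f g r s)
      have "commutative_square X (diagonal X f) (diagonal X g) (tag_fst r) (tag_snd s)"
        using is_functor_amap(1)[of "mu square_monad X" "arrow_cat X" x] X 1 by simp
      then show ?case using X 1 by (simp add: diagonal_Cmp)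
    qed
  next
    case (6 f)
    then have f: "f \<in> Arr (arrow_cat (arrow_cat (arrow_cat X)))" by simp
    then show ?case
    proof (rule arrow_cat_arrow_cat_ArrE, goal_cases)
      case (1 f g r s f' g' r' s' p q p' q')
      let ?\<mu> = "amap (mu square_monad X)" and ?\<nu> = "amap (mu square_monad (arrow_cat X))"
      note a = 1(3-6)[THEN commutative_square_Arr]
      have s: "commutative_square (arrow_cat X) (?\<mu> (tag f g (Pair r s))) (?\<mu> (tag f' g' (Pair r' s')))
          (?\<mu> (tag f f' (Pair p q))) (?\<mu> (tag g g' (Pair p' q')))"
        using X 1(2) by (intro functor_square) simp_all
      \<comment> \<open>\<open>diagonal_square\<close> one dimension higher, with the arrow category
        in the role of the category.\<close>
      have d: "commutative_square (arrow_cat X) (Cmp (arrow_cat X) s f) (Cmp (arrow_cat X) s' f') p q'"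
        using X 1 by (intro diagonal_square) simp_all
      show ?case using X 1 a s d by (simp add: diagonal_Cmp)
    qed
  qed (use X in simp_all)
qed

section \<open>Comma categories\<close>

text \<open>Membership of a tagged pair in the comma category, with source (x, u), target (y, w) and
  arrow (f, v), flattened to conditions in the two categories.\<close>

definition comma_square :: "'a elt func \<Rightarrow> 'a elt \<Rightarrow> 'a elt \<Rightarrow> 'a elt \<Rightarrow> 'a elt \<Rightarrow> 'a elt \<Rightarrow> 'a elt \<Rightarrow> bool" where
  "comma_square P x u y w f v \<longleftrightarrow> x \<in> Obj (source P) \<and> u \<in> Arr (target P) \<and> Dom (target P) u = omap P x \<and>
     y \<in> Obj (source P) \<and> w \<in> Arr (target P) \<and> Dom (target P) w = omap P y \<and>
     f \<in> Arr (source P) \<and> Dom (source P) f = x \<and> Cod (source P) f = y \<and>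
     v \<in> Arr (target P) \<and> Dom (target P) v = Cod (target P) u \<and> Cod (target P) v = Cod (target P) w \<and>
     Cmp (target P) v u = Cmp (target P) w (amap P f)"

lemma comma_Obj_Pair [simp]:
  "Pair x u \<in> Obj (comma P) \<longleftrightarrow> x \<in> Obj (source P) \<and> u \<in> Arr (target P) \<and> Dom (target P) u = omap P x"
  by (auto simp: comma_def Let_def pair_category_Obj)

lemma comma_ObjE:
  assumes "s \<in> Obj (comma P)"
  obtains x u where "s = Pair x u" "x \<in> Obj (source P)" "u \<in> Arr (target P)" "Dom (target P) u = omap P x"
  using assms by (auto simp: comma_def Let_def pair_category_Obj)

lemma comma_simps [simp]:
  "tag (Pair x u) (Pair y w) (Pair f v) \<in> Arr (comma P) \<longleftrightarrow> comma_square P x u y w f v"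
  "a \<in> Arr (comma P) \<Longrightarrow> Dom (comma P) a = tag_src a"
  "a \<in> Arr (comma P) \<Longrightarrow> Cod (comma P) a = tag_tgt a"
  "Pair x u \<in> Obj (comma P)
    \<Longrightarrow> Ide (comma P) (Pair x u) = tag (Pair x u) (Pair x u) (Pair (Ide (source P) x) (Ide (target P) (Cod (target P) u)))"
  "comma_square P x u y w f v \<Longrightarrow> comma_square P y w z t f' v'
    \<Longrightarrow> Cmp (comma P) (tag (Pair y w) (Pair z t) (Pair f' v')) (tag (Pair x u) (Pair y w) (Pair f v))
      = tag (Pair x u) (Pair z t) (Pair (Cmp (source P) f' f) (Cmp (target P) v' v))"
  unfolding comma_def Let_def comma_square_def
  by (auto simp: pair_category_Obj pair_category_Arr pair_category_Dom_Cod pair_category_Ide pair_category_Cmp)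

lemma comma_ArrE:
  assumes "a \<in> Arr (comma P)"
  obtains x u y w f v where "a = tag (Pair x u) (Pair y w) (Pair f v)" "comma_square P x u y w f v"
    "x \<in> Obj (source P)" "u \<in> Arr (target P)" "Dom (target P) u = omap P x"
    "y \<in> Obj (source P)" "w \<in> Arr (target P)" "Dom (target P) w = omap P y"
    "f \<in> Arr (source P)" "Dom (source P) f = x" "Cod (source P) f = y"
    "v \<in> Arr (target P)" "Dom (target P) v = Cod (target P) u" "Cod (target P) v = Cod (target P) w"
proof -
  obtain s t f v where a: "a = tag s t (Pair f v)" "tag s t (Pair f v) \<in> Arr (comma P)"
    using assms unfolding comma_def Let_def by (rule pair_category_ArrE)
  then have st: "s \<in> Obj (comma P)" "t \<in> Obj (comma P)"
    unfolding comma_def Let_def by (simp_all add: pair_category_Arr pair_category_Obj)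
  from st(1) obtain x u where s: "s = Pair x u" by (rule comma_ObjE)
  from st(2) obtain y w where t: "t = Pair y w" by (rule comma_ObjE)
  have sq: "comma_square P x u y w f v" using a s t by simp
  show thesis
    by (rule that[of x u y w f v]) (use a s t sq in \<open>auto simp: comma_square_def\<close>)
qed

lemma comma_square_eq: "comma_square P x u y w f v \<Longrightarrow> Cmp (target P) v u = Cmp (target P) w (amap P f)"
  by (simp add: comma_square_def)

lemma comma_square_Arr:
  "comma_square P x u y w f v \<Longrightarrow> x \<in> Obj (source P) \<and> u \<in> Arr (target P) \<and> Dom (target P) u = omap P x \<and>
     y \<in> Obj (source P) \<and> w \<in> Arr (target P) \<and> Dom (target P) w = omap P y \<and>
     f \<in> Arr (source P) \<and> Dom (source P) f = x \<and> Cod (source P) f = y \<and>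
     v \<in> Arr (target P) \<and> Dom (target P) v = Cod (target P) u \<and> Cod (target P) v = Cod (target P) w"
  by (simp add: comma_square_def)

lemma category_comma [simp]:
  assumes P: "is_functor P"
  shows "category (comma P)"
  unfolding comma_def Let_def
proof (rule category_pair_category, goal_cases)
  case (5 s)
  then show ?case using P by auto
next
  case (6 s t t' r v r' v')
  let ?B = "target P"
  have s: "rgt s \<in> Arr ?B" "Dom ?B (rgt s) = omap P (lft s)" "rgt t \<in> Arr ?B" "Dom ?B (rgt t) = omap P (lft t)"
    "rgt t' \<in> Arr ?B" "Dom ?B (rgt t') = omap P (lft t')"
    using 6(1-3) by auto
  have "Cmp ?B (Cmp ?B v' v) (rgt s) = Cmp ?B v' (Cmp ?B (rgt t) (amap P r))"
    using P s 6(4-8) by (simp add: hom_def)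
  also have "\<dots> = Cmp ?B (rgt t') (amap P (Cmp (source P) r' r))"
    using P s 6(4-7) Cmp_reassoc[OF 6(9), of "amap P r"] by (simp add: hom_def)
  finally show ?case .
qed (use P in auto)

lemma locally_small_comma:
  "smallness small \<Longrightarrow> is_functor P \<Longrightarrow> locally_small small (source P) \<Longrightarrow> locally_small small (target P)
    \<Longrightarrow> locally_small small (comma P)"
  unfolding comma_def Let_def by (rule locally_small_pair_category) auto

lemma comma_square_Cmp:
  assumes "is_functor P" "comma_square P x u y w f v" "comma_square P y w z t f' v'"
  shows "comma_square P x u z t (Cmp (source P) f' f) (Cmp (target P) v' v)"
  using assms category_Cmp(1)[of "comma P" "tag (Pair x u) (Pair y w) (Pair f v)" "tag (Pair y w) (Pair z t) (Pair f' v')"]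
  by simp

lemma Cod_functor_sel [simp]:
  "source (Cod_functor P) = comma P" "target (Cod_functor P) = target P"
  "Pair x u \<in> Obj (comma P) \<Longrightarrow> omap (Cod_functor P) (Pair x u) = Cod (target P) u"
  "a \<in> Arr (comma P) \<Longrightarrow> amap (Cod_functor P) a = tag_snd a"
  unfolding Cod_functor_def by (simp_all del: comma_Obj_Pair)

lemma is_functor_Cod_functor [simp]:
  assumes P: "is_functor P"
  shows "is_functor (Cod_functor P)"
  unfolding Cod_functor_def
proof (rule is_functor_mk_functor, goal_cases)
  case (3 x)
  then show ?case using P by (auto elim!: comma_ObjE)
next
  case (4 f)
  then show ?case by (rule comma_ArrE) (use P in simp)
next
  case (5 x)
  then show ?case by (rule comma_ObjE) (use P in simp)
next
  case (6 f g)
  show ?case by (rule comma_ArrE[OF 6(1)], rule comma_ArrE[OF 6(2)]) (use P 6 in simp)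
qed (use P in simp_all)

section \<open>Functors and transformations over a base\<close>

text \<open>A 1-cell of the slice over an unspecified base, without the size condition;
  \<open>CAT_over_cells\<close> adds both back.\<close>

definition over_functor :: "'u func slice_mor \<Rightarrow> bool" where
  "over_functor T \<longleftrightarrow> is_functor (source T) \<and> is_functor (target T) \<and> is_functor (over1 T) \<and>
     source (over1 T) = source (source T) \<and> target (over1 T) = source (target T) \<and>
     target (target T) = target (source T) \<and> comp_functor (target T) (over1 T) = source T"

lemma over_functor_simps [simp]:
  assumes "over_functor T"
  shows "is_functor (source T)" "is_functor (target T)" "is_functor (over1 T)"
    "source (over1 T) = source (source T)" "target (over1 T) = source (target T)"
    "target (target T) = target (source T)" "comp_functor (target T) (over1 T) = source T"
  using assms by (simp_all add: over_functor_def)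

lemma over_functor_maps [simp]:
  assumes "over_functor T" "P = target T"
  shows "x \<in> Obj (source (source T)) \<Longrightarrow> omap P (omap (over1 T) x) = omap (source T) x"
    "f \<in> Arr (source (source T)) \<Longrightarrow> amap P (amap (over1 T) f) = amap (source T) f"
  using assms comp_functor_sel(3)[of x "over1 T" "target T"] comp_functor_sel(4)[of f "over1 T" "target T"] by simp_all

lemma over_functorI:
  assumes "is_functor (source T)" "is_functor (target T)" "is_functor (over1 T)"
    "source (over1 T) = source (source T)" "target (over1 T) = source (target T)" "target (target T) = target (source T)"
    "\<And>x. x \<in> Obj (source (source T)) \<Longrightarrow> omap (target T) (omap (over1 T) x) = omap (source T) x"
    "\<And>f. f \<in> Arr (source (source T)) \<Longrightarrow> amap (target T) (amap (over1 T) f) = amap (source T) f"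
  shows "over_functor T"
  unfolding over_functor_def using assms by (auto intro!: functor_eqI)

text \<open>The last clause is the slice condition read componentwise: whiskering with the
  projection yields an identity transformation exactly when every component is vertical.\<close>

definition over_cell :: "('u func, 'u ntrans) slice_cell \<Rightarrow> bool" where
  "over_cell \<beta> \<longleftrightarrow> over_functor (source \<beta>) \<and> over_functor (target \<beta>) \<and>
     source (target \<beta>) = source (source \<beta>) \<and> target (target \<beta>) = target (source \<beta>) \<and>
     is_ntrans (over2 \<beta>) \<and> source (over2 \<beta>) = over1 (source \<beta>) \<and> target (over2 \<beta>) = over1 (target \<beta>) \<and>
     (\<forall>x \<in> Obj (source (source (source \<beta>))).
        amap (target (source \<beta>)) (component (over2 \<beta>) x) = Ide (target (source (source \<beta>))) (omap (source (source \<beta>)) x))"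

lemma over_cell_simps [simp]:
  assumes "over_cell \<beta>"
  shows "over_functor (source \<beta>)" "over_functor (target \<beta>)"
    "source (target \<beta>) = source (source \<beta>)" "target (target \<beta>) = target (source \<beta>)"
    "is_ntrans (over2 \<beta>)" "source (over2 \<beta>) = over1 (source \<beta>)" "target (over2 \<beta>) = over1 (target \<beta>)"
    "P = target (source \<beta>) \<Longrightarrow> x \<in> Obj (source (source (source \<beta>)))
      \<Longrightarrow> amap P (component (over2 \<beta>) x) = Ide (target (source (source \<beta>))) (omap (source (source \<beta>)) x)"
  using assms by (auto simp: over_cell_def)

lemma over_cellI:
  assumes "over_functor (source \<beta>)" "over_functor (target \<beta>)"
    "source (target \<beta>) = source (source \<beta>)" "target (target \<beta>) = target (source \<beta>)"
    "is_ntrans (over2 \<beta>)" "source (over2 \<beta>) = over1 (source \<beta>)" "target (over2 \<beta>) = over1 (target \<beta>)"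
    "\<And>x. x \<in> Obj (source (source (source \<beta>)))
      \<Longrightarrow> amap (target (source \<beta>)) (component (over2 \<beta>) x) = Ide (target (source (source \<beta>))) (omap (source (source \<beta>)) x)"
  shows "over_cell \<beta>"
  unfolding over_cell_def using assms by blast

lemma CAT_over_cells:
  "P \<in> cells0 (CAT_over small B) \<longleftrightarrow> is_functor P \<and> target P = B \<and> locally_small small (source P) \<and> locally_small small B"
  "T \<in> cells1 (CAT_over small B) \<longleftrightarrow> over_functor T \<and> target (source T) = B \<and>
     locally_small small (source (source T)) \<and> locally_small small (source (target T)) \<and> locally_small small B"
  "\<beta> \<in> cells2 (CAT_over small B) \<longleftrightarrow> over_cell \<beta> \<and> target (source (source \<beta>)) = B \<and>
     locally_small small (source (source (source \<beta>))) \<and> locally_small small (source (target (source \<beta>))) \<and> locally_small small B"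
proof -
  show "P \<in> cells0 (CAT_over small B) \<longleftrightarrow> is_functor P \<and> target P = B \<and> locally_small small (source P) \<and> locally_small small B"
    by (auto simp: Slice_cells CAT_cells)
  show T: "T \<in> cells1 (CAT_over small B) \<longleftrightarrow> over_functor T \<and> target (source T) = B \<and>
     locally_small small (source (source T)) \<and> locally_small small (source (target T)) \<and> locally_small small B" for T
    unfolding Slice_cells(2) CAT_cells CAT_sel over_functor_def
    by (rule iffI) ((elim conjE, intro conjI, simp_all)+)
  show "\<beta> \<in> cells2 (CAT_over small B) \<longleftrightarrow> over_cell \<beta> \<and> target (source (source \<beta>)) = B \<and>
     locally_small small (source (source (source \<beta>))) \<and> locally_small small (source (target (source \<beta>))) \<and> locally_small small B"
    (is "?l \<longleftrightarrow> ?r")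
  proof
    assume \<beta>: ?l
    then have f: "over_functor (source \<beta>)" "over_functor (target \<beta>)" "target (source (source \<beta>)) = B"
      "locally_small small (source (source (source \<beta>)))" "locally_small small (source (target (source \<beta>)))" "locally_small small B"
      and st: "source (target \<beta>) = source (source \<beta>)" "target (target \<beta>) = target (source \<beta>)"
      and n: "is_ntrans (over2 \<beta>)" "source (over2 \<beta>) = over1 (source \<beta>)" "target (over2 \<beta>) = over1 (target \<beta>)"
      and e: "hcomp_ntrans (id_ntrans (target (source \<beta>))) (over2 \<beta>) = id_ntrans (source (source \<beta>))"
      unfolding Slice_cells(3) T by (simp_all add: CAT_cells)
    have B: "category B"
      using f(1,3) is_functor_category(2)[of "source (source \<beta>)"] by simp
    have "amap (target (source \<beta>)) (component (over2 \<beta>) x) = Ide B (omap (source (source \<beta>)) x)"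
      if "x \<in> Obj (source (source (source \<beta>)))" for x
      using arg_cong[OF e, of "\<lambda>\<alpha>. component \<alpha> x"] that f st n B by simp
    then show ?r unfolding over_cell_def using f st n by blast
  next
    assume r: ?r
    then have B: "category B" "target (source (source \<beta>)) = B"
      using is_functor_category(2)[of "source (source \<beta>)"] by simp_all
    have "hcomp_ntrans (id_ntrans (target (source \<beta>))) (over2 \<beta>) = id_ntrans (source (source \<beta>))"
    proof (rule ntrans_eqI, goal_cases)
      case 4
      then show ?case using r over_functor_simps(7)[of "target \<beta>"] by simp
    qed (use r B in simp_all)
    then show ?l using r B unfolding Slice_cells(3) T by (simp add: CAT_cells)
  qed
qed

section \<open>The comma 2-monad\<close>

lemma over_functor_comma_square [simp]:
  assumes T: "over_functor T" and P: "P = target T" and sq: "comma_square (source T) x u y w f v"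
  shows "comma_square P (omap (over1 T) x) u (omap (over1 T) y) w (amap (over1 T) f) v"
  using comma_square_Arr[OF sq] comma_square_eq[OF sq] T P unfolding comma_square_def by simp

lemma comma_functor_sel [simp]:
  "source (comma_functor T) = comma (source T)" "target (comma_functor T) = comma (target T)"
  "Pair x u \<in> Obj (comma (source T)) \<Longrightarrow> omap (comma_functor T) (Pair x u) = Pair (omap (over1 T) x) u"
  "comma_square (source T) x u y w f v \<Longrightarrow> amap (comma_functor T) (tag (Pair x u) (Pair y w) (Pair f v))
    = tag (Pair (omap (over1 T) x) u) (Pair (omap (over1 T) y) w) (Pair (amap (over1 T) f) v)"
  unfolding comma_functor_def by (simp_all add: comma_map_obj_def del: comma_Obj_Pair)

lemma is_functor_comma_functor [simp]:
  assumes T: "over_functor T"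
  shows "is_functor (comma_functor T)"
  unfolding comma_functor_def comma_map_obj_def
proof (rule is_functor_mk_functor, goal_cases)
  case (3 x)
  then show ?case using T by (auto elim!: comma_ObjE)
next
  case (4 f)
  then show ?case by (rule comma_ArrE) (use T in simp)
next
  case (5 x)
  then show ?case by (rule comma_ObjE) (use T in simp)
next
  case (6 f g)
  show ?case by (rule comma_ArrE[OF 6(1)], rule comma_ArrE[OF 6(2)]) (use T 6 in simp)
qed (use T in simp_all)

lemma comma_mor_sel [simp]:
  "source (comma_mor T) = Cod_functor (source T)" "target (comma_mor T) = Cod_functor (target T)"
  "over1 (comma_mor T) = comma_functor T"
  by (simp_all add: comma_mor_def)

lemma over_functor_comma_mor [simp]:
  assumes T: "over_functor T"
  shows "over_functor (comma_mor T)"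
proof (rule over_functorI, goal_cases)
  case (7 x)
  then have "x \<in> Obj (comma (source T))" by simp
  then show ?case by (rule comma_ObjE) (use T in simp)
next
  case (8 f)
  then have "f \<in> Arr (comma (source T))" by simp
  then show ?case by (rule comma_ArrE) (use T in simp)
qed (use T in simp_all)

lemma comma_cell_sel [simp]:
  "source (comma_cell \<beta>) = comma_mor (source \<beta>)" "target (comma_cell \<beta>) = comma_mor (target \<beta>)"
  "source (over2 (comma_cell \<beta>)) = comma_functor (source \<beta>)" "target (over2 (comma_cell \<beta>)) = comma_functor (target \<beta>)"
  "Pair x u \<in> Obj (comma (source (source \<beta>))) \<Longrightarrow> component (over2 (comma_cell \<beta>)) (Pair x u)
    = tag (Pair (omap (over1 (source \<beta>)) x) u) (Pair (omap (over1 (target \<beta>)) x) u)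
        (Pair (component (over2 \<beta>) x) (Ide (target (source (source \<beta>))) (Cod (target (source (source \<beta>))) u)))"
  unfolding comma_cell_def Let_def by (simp_all add: comma_map_obj_def del: comma_Obj_Pair)

text \<open>The component at x is vertical, so it forms an arrow of the comma category together with
  an identity on the base side.\<close>

lemma over_cell_comma_square [simp]:
  assumes "over_cell \<beta>" "F = over1 (source \<beta>)" "G = over1 (target \<beta>)" "P = target (source \<beta>)"
    "x \<in> Obj (source (source (source \<beta>)))" "u \<in> Arr (target (source (source \<beta>)))"
    "Dom (target (source (source \<beta>))) u = omap (source (source \<beta>)) x"
    "B = target (source (source \<beta>))" "b = Cod B u"
  shows "comma_square P (omap F x) u (omap G x) u (component (over2 \<beta>) x) (Ide B b)"
proof -
  \<comment> \<open>The target functor of the cell also lies strictly over the base, so its value at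
    x has the same image and u can be attached to it.\<close>
  have "omap (target (source \<beta>)) (omap (over1 (target \<beta>)) x) = omap (source (source \<beta>)) x"
    using assms over_functor_maps(1)[of "target \<beta>" "target (target \<beta>)" x] by simp
  then show ?thesis using assms unfolding comma_square_def by simp
qed

lemma over_cell_comma_cell [simp]:
  assumes b: "over_cell \<beta>"
  shows "over_cell (comma_cell \<beta>)"
proof -
  have "is_ntrans (over2 (comma_cell \<beta>))"
    unfolding comma_cell_def Let_def slice_cell.simps comma_map_obj_def
  proof (rule is_ntrans_mk_ntrans, goal_cases)
    case (5 x)
    then have "x \<in> Obj (comma (source (source \<beta>)))" by simp
    then show ?case by (rule comma_ObjE) (use b in simp)
  next
    case (6 f)
    then have "f \<in> Arr (comma (source (source \<beta>)))" by simp
    then show ?case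
    proof (rule comma_ArrE, goal_cases)
      case (1 x u y w f v)
      have "comma_square (target (source \<beta>)) (omap (over1 (target \<beta>)) x) u (omap (over1 (target \<beta>)) y) w (amap (over1 (target \<beta>)) f) v"
        using 1 b by (intro over_functor_comma_square) simp_all
      then show ?case using 1 b is_ntrans_naturality[of "over2 \<beta>" f x y] by simp
    qed
  qed (use b in simp_all)
  moreover have "amap (Cod_functor (target (source \<beta>))) (component (over2 (comma_cell \<beta>)) s)
      = Ide (target (source (source \<beta>))) (omap (Cod_functor (source (source \<beta>))) s)"
    if "s \<in> Obj (comma (source (source \<beta>)))" for s
    using that by (rule comma_ObjE) (use b in simp)
  ultimately show ?thesis using b by (intro over_cellI) simp_all
qed

lemma comma_mor_comp1:
  assumes "over_functor S" "over_functor T" "target T = source S"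
  shows "comma_functor (S \<cdot>\<^bsub>CAT_over small B\<^esub> T) = comp_functor (comma_functor S) (comma_functor T)"
proof -
  have tS: "target (source S) = target (source T)" using assms over_functor_simps(6)[of T] by simp
  have ST: "over_functor (S \<cdot>\<^bsub>CAT_over small B\<^esub> T)"
    by (rule over_functorI) (use assms over_functor_simps(6)[OF assms(1)] over_functor_simps(6)[OF assms(2)] in simp_all)
  show ?thesis
  proof (rule functor_eqI, goal_cases)
    case (5 x)
    then have "x \<in> Obj (comma (source T))" by simp
    then show ?case by (rule comma_ObjE) (use assms tS in simp)
  next
    case (6 f)
    then have "f \<in> Arr (comma (source T))" by simp
    then show ?case 
    proof (rule comma_ArrE, goal_cases)
      case (1 x u y w f v)
      have "comma_square (source S) (omap (over1 T) x) u (omap (over1 T) y) w (amap (over1 T) f) v"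
        using 1 assms by (intro over_functor_comma_square) simp_all
      then show ?case using 1 assms tS by simp
    qed
  qed (use assms ST in simp_all)
qed

lemma comma_monad_sel [simp]:
  "map0 (endo comma_monad) = Cod_functor" "map1 (endo comma_monad) = comma_mor" "map2 (endo comma_monad) = comma_cell"
  "eta comma_monad = comma_unit" "mu comma_monad = comma_mult"
  by (simp_all add: comma_monad_def)

lemma two_category_CAT_over: "two_category (CAT_over small B)"
  by (rule two_category.two_category_Slice[OF two_category_CAT])

lemma two_functor_comma:
  fixes B :: "'a elt cat"
  assumes small: "smallness small"
  shows "two_functor (CAT_over small B) (CAT_over small B) (endo comma_monad)"
proof (rule two_functorI[OF two_category_CAT_over two_category_CAT_over], goal_cases)
  case (1 P)
  then show ?case using small by (auto simp: CAT_over_cells locally_small_comma)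
next
  case (2 T)
  then show ?case using small over_functor_simps(6)[of T] by (auto simp: CAT_over_cells locally_small_comma)
next
  case (3 \<beta>)
  then show ?case using small over_functor_simps(6)[of "source \<beta>"] by (auto simp: CAT_over_cells locally_small_comma)
next
  case (4 P)
  then have P: "is_functor P" by (simp add: CAT_over_cells)
  have o: "over_functor (id1 (CAT_over small B) P)" by (rule over_functorI) (use P in simp_all)
  have "comma_functor (id1 (CAT_over small B) P) = id_functor (comma P)"
  proof (rule functor_eqI, goal_cases)
    case (5 x)
    then have "x \<in> Obj (comma P)" by simp
    then show ?case by (rule comma_ObjE) (use P in simp)
  next
    case (6 f)
    then have "f \<in> Arr (comma P)" by simp
    then show ?case by (rule comma_ArrE) (use P in simp)
  qed (use P o in simp_all)
  then show ?case by (intro slice_mor_eqI) simp_all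
next
  case (5 T)
  then have T: "over_functor T" by (simp add: CAT_over_cells)
  have o: "over_cell (id2 (CAT_over small B) T)" using T by (intro over_cellI) simp_all
  have "over2 (comma_cell (id2 (CAT_over small B) T)) = id_ntrans (comma_functor T)"
  proof (rule ntrans_eqI, goal_cases)
    case (5 x)
    then have "x \<in> Obj (comma (source T))" by simp
    then show ?case by (rule comma_ObjE) (use T in simp)
  qed (use T o over_cell_comma_cell[OF o] in simp_all)
  then show ?case by (intro slice_cell_eqI) simp_all
next
  case (6 T S)
  then show ?case by (intro slice_mor_eqI) (simp_all add: CAT_over_cells comma_mor_comp1)
next
  case (7 \<alpha> \<beta>)
  then have ab: "over_cell \<alpha>" "over_cell \<beta>" "target \<alpha> = source \<beta>" by (simp_all add: CAT_over_cells)
  have st: "source (source \<beta>) = source (source \<alpha>)" "target (source \<beta>) = target (source \<alpha>)"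
    using over_cell_simps(3,4)[OF ab(1)] ab(3) by simp_all
  interpret two_category "CAT_over small B" by (rule two_category_CAT_over)
  have o: "over_cell (\<beta> \<bullet>\<^bsub>CAT_over small B\<^esub> \<alpha>)"
    using cells_of_vcomp(1)[of \<alpha> \<beta>] 7 by (simp add: CAT_over_cells(3))
  have "over2 (comma_cell (\<beta> \<bullet>\<^bsub>CAT_over small B\<^esub> \<alpha>)) = vcomp_ntrans (over2 (comma_cell \<beta>)) (over2 (comma_cell \<alpha>))"
  proof (rule ntrans_eqI, goal_cases)
    case (5 x)
    then have "x \<in> Obj (comma (source (source \<alpha>)))" by simp
    then show ?case
    proof (rule comma_ObjE, goal_cases)
      case (1 x u)
      let ?B = "target (source (source \<alpha>))"
      have "comma_square (target (source \<alpha>)) (omap (over1 (source \<alpha>)) x) u (omap (over1 (source \<beta>)) x) u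
          (component (over2 \<alpha>) x) (Ide ?B (Cod ?B u))"
        using 1 ab by (intro over_cell_comma_square) simp_all
      moreover have "comma_square (target (source \<alpha>)) (omap (over1 (source \<beta>)) x) u (omap (over1 (target \<beta>)) x) u
          (component (over2 \<beta>) x) (Ide ?B (Cod ?B u))"
        using 1 ab st by (intro over_cell_comma_square) simp_all
      ultimately show ?case using 1 ab st by simp
    qed
  qed (use ab o over_cell_comma_cell[OF o] over_cell_comma_cell[of \<alpha>] over_cell_comma_cell[of \<beta>] in simp_all)
  then show ?case by (intro slice_cell_eqI) simp_all
next
  case (8 \<alpha> \<beta>)
  then have ab: "over_cell \<alpha>" "over_cell \<beta>" "target (source \<alpha>) = source (source \<beta>)" by (simp_all add: CAT_over_cells)
  interpret two_category "CAT_over small B" by (rule two_category_CAT_over)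
  have o: "over_cell (\<beta> \<star>\<^bsub>CAT_over small B\<^esub> \<alpha>)"
    using cells_of_hcomp(1)[of \<alpha> \<beta>] 8 by (simp add: CAT_over_cells(3))
  have c: "comma_functor (source \<beta> \<cdot>\<^bsub>CAT_over small B\<^esub> source \<alpha>) = comp_functor (comma_functor (source \<beta>)) (comma_functor (source \<alpha>))"
    "comma_functor (target \<beta> \<cdot>\<^bsub>CAT_over small B\<^esub> target \<alpha>) = comp_functor (comma_functor (target \<beta>)) (comma_functor (target \<alpha>))"
    using ab by (simp_all add: comma_mor_comp1)
  have "over2 (comma_cell (\<beta> \<star>\<^bsub>CAT_over small B\<^esub> \<alpha>)) = hcomp_ntrans (over2 (comma_cell \<beta>)) (over2 (comma_cell \<alpha>))"
  proof (rule ntrans_eqI, goal_cases)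
    case (5 x)
    then have "x \<in> Obj (comma (source (source \<alpha>)))" by simp
    then show ?case
    proof (rule comma_ObjE, goal_cases)
      case (1 x u)
      let ?B = "target (source (source \<alpha>))"
      have "comma_square (target (source \<alpha>)) (omap (over1 (source \<alpha>)) x) u (omap (over1 (target \<alpha>)) x) u
          (component (over2 \<alpha>) x) (Ide ?B (Cod ?B u))"
        using 1 ab by (intro over_cell_comma_square) simp_all
      then have a: "comma_square (source (source \<beta>)) (omap (over1 (source \<alpha>)) x) u (omap (over1 (target \<alpha>)) x) u
          (component (over2 \<alpha>) x) (Ide ?B (Cod ?B u))" using ab by simp
      have tB: "target (source (source \<beta>)) = ?B" using ab over_functor_simps(6)[of "source \<alpha>"] by simp
      \<comment> \<open>Strictness over the base again: moving along \<alpha> leaves the image of x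
        unchanged, so the same u is available for \<beta>.\<close>
      have om: "omap (source (source \<beta>)) (omap (over1 (target \<alpha>)) x) = omap (source (source \<alpha>)) x"
        using 1 ab over_functor_maps(1)[of "target \<alpha>" "target (target \<alpha>)" x] by simp
      have b: "comma_square (target (source \<beta>)) (omap (over1 (source \<beta>)) (omap (over1 (target \<alpha>)) x)) u
          (omap (over1 (target \<beta>)) (omap (over1 (target \<alpha>)) x)) u
          (component (over2 \<beta>) (omap (over1 (target \<alpha>)) x)) (Ide ?B (Cod ?B u))"
        using 1 ab tB om by (intro over_cell_comma_square) simp_all
      show ?case using 1 ab a b tB om over_functor_comma_square[OF _ refl a] by simp
    qed
  qed (use ab c o over_cell_comma_cell[OF o] over_cell_comma_cell[of \<alpha>] over_cell_comma_cell[of \<beta>] in simp_all)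
  then show ?case using 8 by (intro slice_cell_eqI) (simp_all add: comma_mor_def c CAT_over_cells)
qed

lemma comma_square_unit [simp]:
  assumes "is_functor P" "f \<in> Arr (source P)" "x = Dom (source P) f" "y = Cod (source P) f" "B = target P"
    "x' = omap P x" "y' = omap P y"
  shows "comma_square P x (Ide B x') y (Ide B y') f (amap P f)"
  using assms by (simp add: comma_square_def)

lemma comma_square_Ide [simp]:
  assumes "is_functor P" "x \<in> Obj (source P)" "u \<in> Arr (target P)" "Dom (target P) u = omap P x"
    "C = source P" "B = target P" "b = Cod B u"
  shows "comma_square P x u x u (Ide C x) (Ide B b)"
  using assms by (simp add: comma_square_def)

lemma comma_unit_sel [simp]:
  "source (comma_unit P) = P" "target (comma_unit P) = Cod_functor P"
  "source (over1 (comma_unit P)) = source P" "target (over1 (comma_unit P)) = comma P"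
  "x \<in> Obj (source P) \<Longrightarrow> omap (over1 (comma_unit P)) x = Pair x (Ide (target P) (omap P x))"
  "f \<in> Arr (source P) \<Longrightarrow> amap (over1 (comma_unit P)) f
    = tag (Pair (Dom (source P) f) (Ide (target P) (omap P (Dom (source P) f))))
        (Pair (Cod (source P) f) (Ide (target P) (omap P (Cod (source P) f)))) (Pair f (amap P f))"
  by (simp_all add: comma_unit_def comma_unit_obj_def)

lemma over_functor_comma_unit [simp]:
  assumes P: "is_functor P"
  shows "over_functor (comma_unit P)"
proof -
  have "is_functor (over1 (comma_unit P))"
    unfolding comma_unit_def slice_mor.simps comma_unit_obj_def
    by (rule is_functor_mk_functor) (use P in simp_all)
  then show ?thesis by (intro over_functorI) (use P in simp_all)
qed

lemma comma_mult_obj_Pair [simp]: "comma_mult_obj P (Pair (Pair x u) v) = Pair x (Cmp (target P) v u)"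
  by (simp add: comma_mult_obj_def)

lemma comma_mult_sel [simp]:
  "source (comma_mult P) = Cod_functor (Cod_functor P)" "target (comma_mult P) = Cod_functor P"
  "source (over1 (comma_mult P)) = comma (Cod_functor P)" "target (over1 (comma_mult P)) = comma P"
  "s \<in> Obj (comma (Cod_functor P)) \<Longrightarrow> omap (over1 (comma_mult P)) s = comma_mult_obj P s"
  "comma_square (Cod_functor P) s v t w \<rho> r \<Longrightarrow> amap (over1 (comma_mult P)) (tag (Pair s v) (Pair t w) (Pair \<rho> r))
    = tag (comma_mult_obj P (Pair s v)) (comma_mult_obj P (Pair t w)) (Pair (tag_fst \<rho>) r)"
  by (simp_all add: comma_mult_def)

lemma comma_comma_ObjE:
  assumes "s \<in> Obj (comma (Cod_functor P))"
  obtains x u v where "s = Pair (Pair x u) v" "x \<in> Obj (source P)" "u \<in> Arr (target P)" "Dom (target P) u = omap P x"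
    "v \<in> Arr (target P)" "Dom (target P) v = Cod (target P) u"
proof -
  obtain s' v where s: "s = Pair s' v" "s' \<in> Obj (comma P)" "v \<in> Arr (target P)" "Dom (target P) v = omap (Cod_functor P) s'"
    using comma_ObjE[OF assms] by (metis Cod_functor_sel(1,2))
  from s(2) obtain x u where "s' = Pair x u" "x \<in> Obj (source P)" "u \<in> Arr (target P)" "Dom (target P) u = omap P x"
    by (rule comma_ObjE)
  with s that[of x u v] show thesis by simp
qed

lemma comma_comma_ArrE:
  assumes "a \<in> Arr (comma (Cod_functor P))"
  obtains x u v y w t f r s where
    "a = tag (Pair (Pair x u) v) (Pair (Pair y w) t) (Pair (tag (Pair x u) (Pair y w) (Pair f r)) s)"
    "comma_square (Cod_functor P) (Pair x u) v (Pair y w) t (tag (Pair x u) (Pair y w) (Pair f r)) s"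
    "comma_square P x u y w f r"
    "x \<in> Obj (source P)" "u \<in> Arr (target P)" "Dom (target P) u = omap P x" "v \<in> Arr (target P)" "Dom (target P) v = Cod (target P) u"
    "y \<in> Obj (source P)" "w \<in> Arr (target P)" "Dom (target P) w = omap P y" "t \<in> Arr (target P)" "Dom (target P) t = Cod (target P) w"
    "f \<in> Arr (source P)" "Dom (source P) f = x" "Cod (source P) f = y"
    "r \<in> Arr (target P)" "Dom (target P) r = Cod (target P) u" "Cod (target P) r = Cod (target P) w"
    "s \<in> Arr (target P)" "Dom (target P) s = Cod (target P) v" "Cod (target P) s = Cod (target P) t"
    "Cmp (target P) s v = Cmp (target P) t r"
proof -
  obtain \<sigma> v \<tau> t \<rho> s where a: "a = tag (Pair \<sigma> v) (Pair \<tau> t) (Pair \<rho> s)" "comma_square (Cod_functor P) \<sigma> v \<tau> t \<rho> s"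
    using assms by (rule comma_ArrE)
  note c = comma_square_Arr[OF a(2)] comma_square_eq[OF a(2)]
  from c have "\<rho> \<in> Arr (comma P)" by simp
  then obtain x u y w f r where \<rho>: "\<rho> = tag (Pair x u) (Pair y w) (Pair f r)" "comma_square P x u y w f r"
    by (rule comma_ArrE)
  have "\<sigma> = Pair x u" "\<tau> = Pair y w" using c \<rho> by auto
  with a c \<rho> that[of x u v y w t f r s] show thesis using comma_square_Arr[OF \<rho>(2)] by simp
qed

text \<open>Paste the square s v = t r in the base onto r u = w (P f). The middle arrow r disappears
  from the outer square.\<close>

lemma comma_square_mult [simp]:
  assumes P: "is_functor P" and sq: "comma_square P x u y w f r" and B: "B = target P"
    and "v \<in> Arr B" "Dom B v = Cod B u" "t \<in> Arr B" "Dom B t = Cod B w" "s \<in> Arr B" "Dom B s = Cod B v" "Cod B s = Cod B t"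
    and eq: "Cmp B s v = Cmp B t r"
  shows "comma_square P x (Cmp B v u) y (Cmp B t w) f s"
proof -
  note c = comma_square_Arr[OF sq] comma_square_eq[OF sq]
  have "Cmp B s (Cmp B v u) = Cmp B t (Cmp B r u)"
    using P assms(3-) c Cmp_reassoc[OF eq, of u] by simp
  also have "\<dots> = Cmp B (Cmp B t w) (amap P f)"
    using P assms(3-10) c by simp
  finally show ?thesis using P assms(3-10) c unfolding comma_square_def by simp
qed

lemma over_functor_comma_mult [simp]:
  assumes P: "is_functor P"
  shows "over_functor (comma_mult P)"
proof -
  have "is_functor (over1 (comma_mult P))"
    unfolding comma_mult_def slice_mor.simps
  proof (rule is_functor_mk_functor, goal_cases)
    case (3 x)
    then show ?case by (rule comma_comma_ObjE) (use P in simp)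
  next
    case (4 f)
    then show ?case by (rule comma_comma_ArrE) (use P in simp)
  next
    case (5 x)
    then show ?case by (rule comma_comma_ObjE) (use P in simp)
  next
    case (6 f g)
    show ?case by (rule comma_comma_ArrE[OF 6(1)], rule comma_comma_ArrE[OF 6(2)]) (use P 6 in simp)
  qed (use P in simp_all)
  then show ?thesis
  proof (intro over_functorI, goal_cases)
    case (7 x)
    then have "x \<in> Obj (comma (Cod_functor P))" by simp
    then show ?case by (rule comma_comma_ObjE) (use P in simp)
  next
    case (8 f)
    then have "f \<in> Arr (comma (Cod_functor P))" by simp
    then show ?case by (rule comma_comma_ArrE) (use P in simp)
  qed (use P in simp_all)
qed

lemma two_natural_comma_unit:
  assumes small: "smallness small"
  shows "two_natural (CAT_over small B) (CAT_over small B) id_two_fun (endo comma_monad) (eta comma_monad)"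
proof (rule two_naturalI[OF two_functor_id[OF two_category_CAT_over] two_functor_comma[OF small]], goal_cases)
  case (1 P)
  then show ?case using small by (simp add: CAT_over_cells locally_small_comma)
next
  case (2 T)
  then have T: "over_functor T" by (simp add: CAT_over_cells)
  have "comp_functor (over1 (comma_unit (target T))) (over1 T) = comp_functor (comma_functor T) (over1 (comma_unit (source T)))"
    by (rule functor_eqI) (use T in simp_all)
  then show ?case by (intro slice_mor_eqI) simp_all
next
  case (3 \<beta>)
  then have b: "over_cell \<beta>" by (simp add: CAT_over_cells)
  have n: "comp_functor (over1 (comma_unit (target T))) (over1 T) = comp_functor (comma_functor T) (over1 (comma_unit (source T)))"
    if T: "over_functor T" for T :: "'a elt func slice_mor"
    by (rule functor_eqI) (use T in simp_all)
  have m: "comma_unit (target T) \<cdot>\<^bsub>CAT_over small B\<^esub> T = comma_mor T \<cdot>\<^bsub>CAT_over small B\<^esub> comma_unit (source T)"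
    if T: "over_functor T" for T :: "'a elt func slice_mor"
    using n[OF T] by (intro slice_mor_eqI) simp_all
  have "hcomp_ntrans (id_ntrans (over1 (comma_unit (target (source \<beta>))))) (over2 \<beta>)
      = hcomp_ntrans (over2 (comma_cell \<beta>)) (id_ntrans (over1 (comma_unit (source (source \<beta>)))))"
    by (rule ntrans_eqI) (use b n[of "source \<beta>"] n[of "target \<beta>"] in simp_all)
  then show ?case using m[of "source \<beta>"] m[of "target \<beta>"] b by (intro slice_cell_eqI) simp_all
qed

lemma two_natural_comma_mult:
  assumes small: "smallness small"
  shows "two_natural (CAT_over small B) (CAT_over small B) (endo comma_monad \<circ>\<^sub>2 endo comma_monad) (endo comma_monad) (mu comma_monad)"
proof -
  have n: "comp_functor (over1 (comma_mult (target T))) (comma_functor (comma_mor T)) = comp_functor (comma_functor T) (over1 (comma_mult (source T)))"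
    if T: "over_functor T" for T :: "'a elt func slice_mor"
  proof (rule functor_eqI, goal_cases)
    case (5 x)
    then have "x \<in> Obj (comma (Cod_functor (source T)))" by simp
    then show ?case by (rule comma_comma_ObjE) (use T in simp)
  next
    case (6 f)
    then have "f \<in> Arr (comma (Cod_functor (source T)))" by simp
    then show ?case
    proof (rule comma_comma_ArrE, goal_cases)
      case (1 x u v y w t f r s)
      have "comma_square (target (comma_mor T)) (omap (over1 (comma_mor T)) (Pair x u)) v (omap (over1 (comma_mor T)) (Pair y w)) t
          (amap (over1 (comma_mor T)) (tag (Pair x u) (Pair y w) (Pair f r))) s"
        using 1 T by (intro over_functor_comma_square) simp_all
      then show ?case using 1 T by simp
    qed
  qed (use T in simp_all)
  have m: "comma_mult (target T) \<cdot>\<^bsub>CAT_over small B\<^esub> comma_mor (comma_mor T) = comma_mor T \<cdot>\<^bsub>CAT_over small B\<^esub> comma_mult (source T)"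
    if T: "over_functor T" for T :: "'a elt func slice_mor"
    using n[OF T] by (intro slice_mor_eqI) simp_all
  show ?thesis
  proof (rule two_naturalI[OF two_functor_comp[OF two_functor_comma[OF small] two_functor_comma[OF small]]
      two_functor_comma[OF small]], goal_cases)
    case (1 P)
    then show ?case using small by (simp add: CAT_over_cells locally_small_comma)
  next
    case (2 T)
    then show ?case using m by (simp add: CAT_over_cells)
  next
    case (3 \<beta>)
    then have b: "over_cell \<beta>" by (simp add: CAT_over_cells)
    have "hcomp_ntrans (id_ntrans (over1 (comma_mult (target (source \<beta>))))) (over2 (comma_cell (comma_cell \<beta>)))
        = hcomp_ntrans (over2 (comma_cell \<beta>)) (id_ntrans (over1 (comma_mult (source (source \<beta>)))))"
    proof (rule ntrans_eqI, goal_cases)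
      case 1
      then show ?case using b over_cell_simps(5)[OF over_cell_comma_cell[OF over_cell_comma_cell[OF b]]] by simp
    next
      case 2
      then show ?case using b over_cell_simps(5)[OF over_cell_comma_cell[OF b]] by simp
    next
      case (5 x)
      then have "x \<in> Obj (comma (Cod_functor (source (source \<beta>))))" by simp
      then show ?case
      proof (rule comma_comma_ObjE, goal_cases)
        case (1 x u v)
        let ?B = "target (source (source \<beta>))"
        have "comma_square (target (source (comma_cell \<beta>))) (omap (over1 (source (comma_cell \<beta>))) (Pair x u)) v
            (omap (over1 (target (comma_cell \<beta>))) (Pair x u)) v (component (over2 (comma_cell \<beta>)) (Pair x u)) (Ide ?B (Cod ?B v))"
          using 1 b by (intro over_cell_comma_square) simp_all
        moreover have "comma_square (target (source \<beta>)) (omap (over1 (source \<beta>)) x) (Cmp ?B v u)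
            (omap (over1 (target \<beta>)) x) (Cmp ?B v u) (component (over2 \<beta>) x) (Ide ?B (Cod ?B v))"
          using 1 b by (intro over_cell_comma_square) simp_all
        ultimately show ?case using 1 b by simp
      qed
    qed (use b n[of "source \<beta>"] n[of "target \<beta>"] in simp_all)
    then show ?case using m[of "source \<beta>"] m[of "target \<beta>"] b by (intro slice_cell_eqI) simp_all
  qed
qed

text \<open>Multiplication composes the attached base arrows and keeps the object of E. The monad
  laws are thus the identity and associativity laws of the base, while arrows keep their innermost
  E-part and their outermost base part.\<close>

lemma two_monad_comma_monad:
  assumes small: "smallness small"
  shows "two_monad (CAT_over small B) comma_monad"
proof (intro two_monad.intro two_monad_axioms.intro two_functor_comma two_natural_comma_unit two_natural_comma_mult small, goal_cases)
  case (1 P)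
  then have P: "is_functor P" by (simp add: CAT_over_cells)
  have "comp_functor (over1 (comma_mult P)) (over1 (comma_unit (Cod_functor P))) = id_functor (comma P)"
  proof (rule functor_eqI, goal_cases)
    case (5 x)
    then have "x \<in> Obj (comma P)" using P by simp
    then show ?case by (rule comma_ObjE) (use P in simp)
  next
    case (6 f)
    then have "f \<in> Arr (comma P)" using P by simp
    then show ?case
    proof (rule comma_ArrE, goal_cases)
      case (1 x u y w f v)
      then have "comma_square (Cod_functor P) (Pair x u) (Ide (target (Cod_functor P)) (omap (Cod_functor P) (Pair x u)))
          (Pair y w) (Ide (target (Cod_functor P)) (omap (Cod_functor P) (Pair y w)))
          (tag (Pair x u) (Pair y w) (Pair f v)) (amap (Cod_functor P) (tag (Pair x u) (Pair y w) (Pair f v)))"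
        using P by (intro comma_square_unit) simp_all
      then show ?case using P 1 by simp
    qed
  qed (use P in simp_all)
  then show ?case by (intro slice_mor_eqI) simp_all
next
  case (2 P)
  then have P: "is_functor P" by (simp add: CAT_over_cells)
  have "comp_functor (over1 (comma_mult P)) (comma_functor (comma_unit P)) = id_functor (comma P)"
  proof (rule functor_eqI, goal_cases)
    case (5 x)
    then have "x \<in> Obj (comma P)" using P by simp
    then show ?case by (rule comma_ObjE) (use P in simp)
  next
    case (6 f)
    then have "f \<in> Arr (comma P)" using P by simp
    then show ?case
    proof (rule comma_ArrE, goal_cases)
      case (1 x u y w f v)
      have "comma_square (target (comma_unit P)) (omap (over1 (comma_unit P)) x) u (omap (over1 (comma_unit P)) y) w
          (amap (over1 (comma_unit P)) f) v"
        using P 1 by (intro over_functor_comma_square) simp_all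
      then show ?case using P 1 by simp
    qed
  qed (use P in simp_all)
  then show ?case by (intro slice_mor_eqI) simp_all
next
  case (3 P)
  then have P: "is_functor P" by (simp add: CAT_over_cells)
  have "comp_functor (over1 (comma_mult P)) (over1 (comma_mult (Cod_functor P)))
      = comp_functor (over1 (comma_mult P)) (comma_functor (comma_mult P))"
  proof (rule functor_eqI, goal_cases)
    case (5 x)
    then have "x \<in> Obj (comma (Cod_functor (Cod_functor P)))" by simp
    then show ?case
    proof (rule comma_comma_ObjE, goal_cases)
      case (1 s u v)
      from 1(2) have "s \<in> Obj (comma P)" by simp
      then show ?case by (rule comma_ObjE) (use P 1 in simp)
    qed
  next
    case (6 f)
    then have "f \<in> Arr (comma (Cod_functor (Cod_functor P)))" by simp
    then show ?case
    proof (rule comma_comma_ArrE, goal_cases)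
      case (1 x u v y w t f r s)
      from 1(14) have "f \<in> Arr (comma P)" by simp
      then show ?case
      proof (rule comma_ArrE, goal_cases)
        case a: (1 x' u' y' w' f' v')
        have xy: "x = Pair x' u'" "y = Pair y' w'" using 1(15,16) a by auto
        have "comma_square (target (comma_mult P)) (omap (over1 (comma_mult P)) (Pair x u)) v
            (omap (over1 (comma_mult P)) (Pair y w)) t
            (amap (over1 (comma_mult P)) (tag (Pair x u) (Pair y w) (Pair f r))) s"
          using P 1 by (intro over_functor_comma_square) simp_all
        \<comment> \<open>\<open>comma_square_mult\<close> one level up, for the projection of the
          comma category in place of P.\<close>
        moreover have "comma_square (Cod_functor P) x (Cmp (target P) v u) y (Cmp (target P) t w) f s"
          using P 1 by (intro comma_square_mult) simp_all
        ultimately show ?case using P 1 a xy by simp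
      qed
    qed
  qed (use P in simp_all)
  then show ?case by (intro slice_mor_eqI) simp_all
qed

section \<open>The colax monad morphism\<close>

lemma kappa_sel [simp]:
  "source (kappa P) = arrow_cat (source P)" "target (kappa P) = comma P"
  "f \<in> Arr (source P) \<Longrightarrow> omap (kappa P) f = Pair (Dom (source P) f) (amap P f)"
  "commutative_square (source P) f g r s \<Longrightarrow> amap (kappa P) (tag f g (Pair r s))
    = tag (Pair (Dom (source P) f) (amap P f)) (Pair (Dom (source P) g) (amap P g)) (Pair r (amap P s))"
  by (simp_all add: kappa_def kappa_obj_def)

text \<open>P carries the commutative square to one in the base; its left side r is kept upstairs,
  its right side is replaced by the image.\<close>

lemma comma_square_kappa [simp]:
  assumes P: "is_functor P" and sq: "commutative_square (source P) f g r s" and x: "x = Dom (source P) f" "y = Dom (source P) g"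
  shows "comma_square P x (amap P f) y (amap P g) r (amap P s)"
  using P commutative_square_Arr[OF sq] commutative_square_eq[OF sq] x
    is_functor_Cmp[of P "source P" f s] is_functor_Cmp[of P "source P" r g]
  by (simp add: comma_square_def)

lemma is_functor_kappa [simp]:
  assumes P: "is_functor P"
  shows "is_functor (kappa P)"
  unfolding kappa_def kappa_obj_def
proof (rule is_functor_mk_functor, goal_cases)
  case (4 f)
  then show ?case by (rule arrow_cat_ArrE) (use P in simp)
next
  case (6 f g)
  show ?case by (rule arrow_cat_ArrE[OF 6(1)], rule arrow_cat_ArrE[OF 6(2)]) (use P 6 in simp)
qed (use P in simp_all)

lemma Dom_fun_sel [simp]:
  "map0 (Dom_fun K) = src1 K" "map1 (Dom_fun K) = over1" "map2 (Dom_fun K) = over2"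
  by (simp_all add: Dom_fun_def)

text \<open>Writing T also for its underlying functor, both ways send f : x -> y to (T x, P f): on
  one side the image is that of T f under the target projection, and T lies over the base.\<close>

lemma kappa_natural:
  assumes T: "over_functor T"
  shows "comp_functor (kappa (target T)) (arrow_functor (over1 T)) = comp_functor (comma_functor T) (kappa (source T))"
proof (rule functor_eqI, goal_cases)
  case (6 f)
  then have "f \<in> Arr (arrow_cat (source (source T)))" using T by simp
  then show ?case
  proof (rule arrow_cat_ArrE, goal_cases)
    case (1 f g r s)
    have "commutative_square (source (target T)) (amap (over1 T) f) (amap (over1 T) g) (amap (over1 T) r) (amap (over1 T) s)"
      using T 1 by (intro functor_square) simp_all
    then show ?case using T 1 by simp
  qed
qed (use T in simp_all)

lemma two_functor_Dom_fun_CAT: "two_functor (CAT_over small B) (CAT small) (Dom_fun (CAT small))"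
  by (rule two_category.two_functor_Dom_fun[OF two_category_CAT])

lemma two_natural_kappa:
  assumes small: "smallness small"
  shows "two_natural (CAT_over small B) (CAT small) (endo square_monad \<circ>\<^sub>2 Dom_fun (CAT small))
    (Dom_fun (CAT small) \<circ>\<^sub>2 endo comma_monad) kappa"
proof (rule two_naturalI[OF two_functor_comp[OF two_functor_Dom_fun_CAT two_functor_arrow[OF small]]
      two_functor_comp[OF two_functor_comma[OF small] two_functor_Dom_fun_CAT]], goal_cases)
  case (1 P)
  then show ?case using small by (simp add: CAT_over_cells CAT_cells locally_small_comma locally_small_arrow_cat)
next
  case (2 T)
  then show ?case by (simp add: CAT_over_cells kappa_natural)
next
  case (3 \<beta>)
  then have b: "over_cell \<beta>" by (simp add: CAT_over_cells)
  have "hcomp_ntrans (id_ntrans (kappa (target (source \<beta>)))) (arrow_ntrans (over2 \<beta>))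
      = hcomp_ntrans (over2 (comma_cell \<beta>)) (id_ntrans (kappa (source (source \<beta>))))"
  proof (rule ntrans_eqI, goal_cases)
    case (2)
    then show ?case using b over_cell_simps(5)[OF over_cell_comma_cell[OF b]] by simp
  next
    case (5 f)
    then have f: "f \<in> Arr (source (source (source \<beta>)))" using b by simp
    let ?x = "Dom (source (source (source \<beta>))) f" and ?y = "Cod (source (source (source \<beta>))) f"
    have "commutative_square (source (target (source \<beta>))) (amap (over1 (source \<beta>)) f) (amap (over1 (target \<beta>)) f)
        (component (over2 \<beta>) ?x) (component (over2 \<beta>) ?y)"
      using b f by (intro naturality_square) simp_all
    moreover have "comma_square (target (source \<beta>)) (omap (over1 (source \<beta>)) ?x) (amap (source (source \<beta>)) f)
       (omap (over1 (target \<beta>)) ?x) (amap (source (source \<beta>)) f) (component (over2 \<beta>) ?x)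
       (Ide (target (source (source \<beta>))) (omap (source (source \<beta>)) ?y))"
      using b f by (intro over_cell_comma_square) simp_all
    \<comment> \<open>The target functor of \<beta> lies over the base too, so both functors give f
      the same image and the two comma objects carry the same base arrow.\<close>
    moreover have "amap (target (source \<beta>)) (amap (over1 (target \<beta>)) f) = amap (source (source \<beta>)) f"
      using b f over_functor_maps(2)[of "target \<beta>" "target (target \<beta>)" f] by simp
    ultimately show ?case using b f by simp
  qed (use b kappa_natural[of "source \<beta>"] kappa_natural[of "target \<beta>"] in simp_all)
  then show ?case by simp
qed

text \<open>The unit law is P 1_x = 1_{P x}. For the multiplication, a square with first leg f and
  second leg s becomes ((x, P f), P s), whose multiplication is (x, P s P f); functoriality
  identifies it with the image of the diagonal s f.\<close>

lemma colax_monad_morphism_kappa: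
  assumes small: "smallness small"
  shows "colax_monad_morphism (CAT_over small B) comma_monad (CAT small) square_monad (Dom_fun (CAT small)) kappa"
proof (intro colax_monad_morphism.intro colax_monad_morphism_axioms.intro two_monad_comma_monad two_monad_square_monad
    two_functor_Dom_fun_CAT two_natural_kappa small, goal_cases)
  case (1 P)
  then have P: "is_functor P" by (simp add: CAT_over_cells)
  have "comp_functor (kappa P) (eta square_monad (source P)) = over1 (comma_unit P)"
    by (rule functor_eqI) (use P over_functor_simps(3)[OF over_functor_comma_unit[OF P]] in simp_all)
  then show ?case by simp
next
  case (2 P)
  then have P: "is_functor P" by (simp add: CAT_over_cells)
  have "comp_functor (kappa P) (mu square_monad (source P))
      = comp_functor (comp_functor (over1 (comma_mult P)) (kappa (Cod_functor P))) (arrow_functor (kappa P))"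
  proof (rule functor_eqI, goal_cases)
    case 2
    then show ?case using P over_functor_simps(3)[OF over_functor_comma_mult[OF P]] by simp
  next
    case (5 x)
    then have "x \<in> Arr (arrow_cat (source P))" by simp
    then show ?case by (rule arrow_cat_ArrE) (use P in simp)
  next
    case (6 f)
    then have "f \<in> Arr (arrow_cat (arrow_cat (source P)))" by simp
    then show ?case
    proof (rule arrow_cat_arrow_cat_ArrE, goal_cases)
      case (1 f g r s f' g' r' s' p q p' q')
      note a = 1(3-6)[THEN commutative_square_Arr]
      have k: "commutative_square (comma P) (amap (kappa P) (tag f g (Pair r s))) (amap (kappa P) (tag f' g' (Pair r' s')))
          (amap (kappa P) (tag f f' (Pair p q))) (amap (kappa P) (tag g g' (Pair p' q')))"
        using P 1(2) by (intro functor_square) simp_all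
      have d: "commutative_square (source P) (Cmp (source P) s f) (Cmp (source P) s' f') p q'"
        using P 1 by (intro diagonal_square) simp_all
      \<comment> \<open>The image cube is read through \<kappa> once more, now at the projection of
        the comma category, whose arrow map takes the base part.\<close>
      have "comma_square (Cod_functor P) (Dom (comma P) (amap (kappa P) (tag f g (Pair r s)))) (amap (Cod_functor P) (amap (kappa P) (tag f g (Pair r s))))
          (Dom (comma P) (amap (kappa P) (tag f' g' (Pair r' s')))) (amap (Cod_functor P) (amap (kappa P) (tag f' g' (Pair r' s'))))
          (amap (kappa P) (tag f f' (Pair p q))) (amap (Cod_functor P) (amap (kappa P) (tag g g' (Pair p' q'))))"
        using P k by (intro comma_square_kappa) simp_all
      then show ?case using P 1 a k d by simp
    qed
  qed (use P over_functor_simps(3)[OF over_functor_comma_mult[OF P]] in simp_all)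
  then show ?case by simp
qed

section \<open>Isomorphisms and cocartesian arrows\<close>

lemma isoI:
  assumes "f \<in> Arr C" "g \<in> Arr C" "Dom C g = Cod C f" "Cod C g = Dom C f"
    "Cmp C g f = Ide C (Dom C f)" "Cmp C f g = Ide C (Cod C f)"
  shows "iso C f"
  using assms by (auto simp: iso_def hom_def)

lemma inverse_unique:
  assumes "category C" "f \<in> Arr C" "g \<in> Arr C" "g' \<in> Arr C" "Dom C g = Cod C f" "Cod C g' = Dom C f"
    "Cod C g = Dom C f" "Dom C g' = Cod C f"
    "Cmp C g f = Ide C (Dom C f)" "Cmp C f g' = Ide C (Cod C f)"
  shows "g = g'"
proof -
  have "g = Cmp C g (Cmp C f g')" using assms by simp
  also have "\<dots> = Cmp C (Cmp C g f) g'" using assms by (intro category_Cmp_assoc[symmetric]) simp_all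
  also have "\<dots> = g'" using assms by simp
  finally show ?thesis .
qed

lemma iso_inv_arr:
  assumes C: "category C" and f: "iso C f"
  shows "f \<in> Arr C" "inv_arr C f \<in> Arr C" "Dom C (inv_arr C f) = Cod C f" "Cod C (inv_arr C f) = Dom C f"
    "Cmp C (inv_arr C f) f = Ide C (Dom C f)" "Cmp C f (inv_arr C f) = Ide C (Cod C f)"
proof -
  obtain g where g: "f \<in> Arr C" "g \<in> Arr C" "Dom C g = Cod C f" "Cod C g = Dom C f"
    "Cmp C g f = Ide C (Dom C f)" "Cmp C f g = Ide C (Cod C f)"
    using f by (auto simp: iso_def hom_def)
  have "inv_arr C f = g"
    unfolding inv_arr_def by (rule the_equality) (use g C inverse_unique[OF C g(1)] in \<open>auto simp: hom_def\<close>)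
  with g show "f \<in> Arr C" "inv_arr C f \<in> Arr C" "Dom C (inv_arr C f) = Cod C f" "Cod C (inv_arr C f) = Dom C f"
    "Cmp C (inv_arr C f) f = Ide C (Dom C f)" "Cmp C f (inv_arr C f) = Ide C (Cod C f)"
    by simp_all
qed

lemma inv_arr_eqI:
  assumes "category C" "f \<in> Arr C" "g \<in> Arr C" "Dom C g = Cod C f" "Cod C g = Dom C f"
    "Cmp C g f = Ide C (Dom C f)" "Cmp C f g = Ide C (Cod C f)"
  shows "inv_arr C f = g"
  using iso_inv_arr[OF assms(1) isoI[OF assms(2-)]] inverse_unique[OF assms(1), of f "inv_arr C f" g] assms by simp

lemma iso_Ide: "category C \<Longrightarrow> x \<in> Obj C \<Longrightarrow> iso C (Ide C x)"
  by (rule isoI[of _ _ "Ide C x"]) simp_all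

lemma inv_arr_Ide: "category C \<Longrightarrow> x \<in> Obj C \<Longrightarrow> inv_arr C (Ide C x) = Ide C x"
  by (rule inv_arr_eqI) simp_all

lemma iso_Cmp:
  assumes C: "category C" and f: "iso C f" and g: "iso C g" and fg: "Cod C f = Dom C g"
  shows "iso C (Cmp C g f)"
proof (rule isoI[of _ _ "Cmp C (inv_arr C f) (inv_arr C g)"])
  note i = iso_inv_arr[OF C f] iso_inv_arr[OF C g]
  show "Cmp C (Cmp C (inv_arr C f) (inv_arr C g)) (Cmp C g f) = Ide C (Dom C (Cmp C g f))"
    using C i fg Cmp_reassoc[OF i(11) C, of f] by simp
  show "Cmp C (Cmp C g f) (Cmp C (inv_arr C f) (inv_arr C g)) = Ide C (Cod C (Cmp C g f))"
    using C i fg Cmp_reassoc[OF i(6) C, of "inv_arr C g"] by simp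
qed (use C fg iso_inv_arr[OF C f] iso_inv_arr[OF C g] in simp_all)

lemma iso_cancel:
  assumes "category C" "iso C i" "f \<in> Arr C" "g \<in> Arr C" "Cod C f = Dom C i" "Cod C g = Dom C i" "Cmp C i f = Cmp C i g"
  shows "f = g"
proof -
  note i = iso_inv_arr[OF assms(1,2)]
  have "Cmp C (inv_arr C i) (Cmp C i f) = Cmp C (inv_arr C i) (Cmp C i g)" using assms by simp
  then show ?thesis
    using assms(1,3-6) i Cmp_reassoc[OF i(5) assms(1), of f] Cmp_reassoc[OF i(5) assms(1), of g] by simp
qed

lemma iso_amap:
  assumes F: "is_functor F" and f: "iso (source F) f"
  shows "iso (target F) (amap F f)"
proof -
  note i = iso_inv_arr[OF is_functor_category(1)[OF F] f]
  have "Cmp (target F) (amap F (inv_arr (source F) f)) (amap F f) = Ide (target F) (omap F (Dom (source F) f))"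
    "Cmp (target F) (amap F f) (amap F (inv_arr (source F) f)) = Ide (target F) (omap F (Cod (source F) f))"
    using F i is_functor_Cmp[OF F refl i(1,2)] is_functor_Cmp[OF F refl i(2,1)] by simp_all
  then show ?thesis
    using F i by (intro isoI[of _ _ "amap F (inv_arr (source F) f)"]) simp_all
qed

text \<open>Pointwise inverses are natural: the two sides of the required square agree after
  composition with the invertible component at the codomain.\<close>

lemma invertible2_CAT:
  assumes a: "\<alpha> \<in> cells2 (CAT small)"
  shows "invertible2 (CAT small) \<alpha> \<longleftrightarrow> (\<forall>x \<in> Obj (source (source \<alpha>)). iso (target (source \<alpha>)) (component \<alpha> x))"
proof
  interpret two_category "CAT small" by (rule two_category_CAT)
  have n: "is_ntrans \<alpha>" using a by (simp add: CAT_cells)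
  {
    assume "invertible2 (CAT small) \<alpha>"
    then obtain \<beta> where b: "\<beta> \<in> cells2 (CAT small)" "source \<beta> = target \<alpha>" "target \<beta> = source \<alpha>"
      "vcomp_ntrans \<beta> \<alpha> = id_ntrans (source \<alpha>)" "vcomp_ntrans \<alpha> \<beta> = id_ntrans (target \<alpha>)"
      by (auto elim: invertible2E)
    have nb: "is_ntrans \<beta>" using b by (simp add: CAT_cells)
    show "\<forall>x \<in> Obj (source (source \<alpha>)). iso (target (source \<alpha>)) (component \<alpha> x)"
    proof
      fix x assume x: "x \<in> Obj (source (source \<alpha>))"
      have "Cmp (target (source \<alpha>)) (component \<beta> x) (component \<alpha> x) = Ide (target (source \<alpha>)) (omap (source \<alpha>) x)"
        "Cmp (target (source \<alpha>)) (component \<alpha> x) (component \<beta> x) = Ide (target (source \<alpha>)) (omap (target \<alpha>) x)"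
        using arg_cong[OF b(4), of "\<lambda>\<gamma>. component \<gamma> x"] arg_cong[OF b(5), of "\<lambda>\<gamma>. component \<gamma> x"] x b(2,3) n by simp_all
      then show "iso (target (source \<alpha>)) (component \<alpha> x)"
        using n nb b x by (intro isoI[of _ _ "component \<beta> x"]) simp_all
    qed
  next
    assume i: "\<forall>x \<in> Obj (source (source \<alpha>)). iso (target (source \<alpha>)) (component \<alpha> x)"
    let ?E = "source (source \<alpha>)" and ?D = "target (source \<alpha>)"
    define \<beta> where "\<beta> = mk_ntrans (target \<alpha>) (source \<alpha>) (\<lambda>x. inv_arr ?D (component \<alpha> x))"
    have D: "category ?D" using n by simp
    note I = iso_inv_arr[OF D bspec[OF i]]
    have nb: "is_ntrans \<beta>"
      unfolding \<beta>_def
    proof (rule is_ntrans_mk_ntrans, goal_cases)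
      case (6 f)
      then have f: "f \<in> Arr ?E" using n by simp
      let ?x = "Dom ?E f" and ?y = "Cod ?E f"
      have xy: "?x \<in> Obj ?E" "?y \<in> Obj ?E" using f n by simp_all
      have nat: "Cmp ?D (component \<alpha> ?y) (amap (source \<alpha>) f) = Cmp ?D (amap (target \<alpha>) f) (component \<alpha> ?x)"
        using n f by (intro is_ntrans_naturality) simp_all
      \<comment> \<open>\<open>m1\<close> and \<open>m2\<close> compute the two sides after that
        composition; both become the value of the target functor at f.\<close>
      have m1: "Cmp ?D (component \<alpha> ?y) (Cmp ?D (amap (source \<alpha>) f) (inv_arr ?D (component \<alpha> ?x))) = amap (target \<alpha>) f"
        using n f I[OF xy(1)] Cmp_reassoc[OF nat D, of "inv_arr ?D (component \<alpha> ?x)"] by simp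
      have m2: "Cmp ?D (component \<alpha> ?y) (Cmp ?D (inv_arr ?D (component \<alpha> ?y)) (amap (target \<alpha>) f)) = amap (target \<alpha>) f"
        using n f D I[OF xy(2)] Cmp_reassoc[OF I(6)[OF xy(2)] D, of "amap (target \<alpha>) f"] by simp
      have "Cmp ?D (inv_arr ?D (component \<alpha> ?y)) (amap (target \<alpha>) f)
          = Cmp ?D (amap (source \<alpha>) f) (inv_arr ?D (component \<alpha> ?x))"
        by (rule iso_cancel[OF D bspec[OF i xy(2)]])
          (use n f D I(1-4)[OF xy(2)] I(1-4)[OF xy(1)] xy m1 m2 in simp_all)
      then show ?case using n by simp
    qed (use n I in simp_all)
    have st: "source \<beta> = target \<alpha>" "target \<beta> = source \<alpha>" by (simp_all add: \<beta>_def)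
    have c: "component \<beta> x = inv_arr ?D (component \<alpha> x)" if "x \<in> Obj ?E" for x using that n by (simp add: \<beta>_def)
    have "vcomp_ntrans \<beta> \<alpha> = id_ntrans (source \<alpha>)"
      by (rule ntrans_eqI) (use n nb st c I in simp_all)
    moreover have "vcomp_ntrans \<alpha> \<beta> = id_ntrans (target \<alpha>)"
      by (rule ntrans_eqI) (use n nb st c I in simp_all)
    ultimately show "invertible2 (CAT small) \<alpha>"
      using a nb st n by (intro invertible2I[of _ \<beta>]) (simp_all add: CAT_cells)
  }
qed

section \<open>Cocartesian arrows and isomorphisms\<close>

lemma cocartesian_lift:
  assumes "cocartesian P e" "category (source P)" "category (target P)"
    "g \<in> Arr (source P)" "Dom (source P) g = Dom (source P) e" "v \<in> Arr (target P)"
    "Dom (target P) v = omap P (Cod (source P) e)" "Cod (target P) v = omap P (Cod (source P) g)"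
    "amap P g = Cmp (target P) v (amap P e)"
  obtains h where "h \<in> Arr (source P)" "Dom (source P) h = Cod (source P) e" "Cod (source P) h = Cod (source P) g"
    "Cmp (source P) h e = g" "amap P h = v"
proof -
  have "\<exists>!h. h \<in> hom (source P) (Cod (source P) e) (Cod (source P) g) \<and> Cmp (source P) h e = g \<and> amap P h = v"
    using assms by (auto simp: cocartesian_def Let_def hom_def)
  then show thesis using that by (auto simp: hom_def)
qed

lemma cocartesian_Arr: "cocartesian P e \<Longrightarrow> e \<in> Arr (source P)"
  by (simp add: cocartesian_def Let_def)

text \<open>Both arrows solve the lifting problem posed by h e and P h.\<close>

lemma cocartesian_unique:
  assumes e: "cocartesian P e" and P: "is_functor P" and h: "h \<in> Arr (source P)" "h' \<in> Arr (source P)"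
    "Dom (source P) h = Cod (source P) e" "Dom (source P) h' = Cod (source P) e" "Cod (source P) h = Cod (source P) h'"
    "Cmp (source P) h e = Cmp (source P) h' e" "amap P h = amap P h'"
  shows "h = h'"
proof -
  let ?g = "Cmp (source P) h e"
  have e': "e \<in> Arr (source P)" using e by (rule cocartesian_Arr)
  have "\<exists>!k. k \<in> hom (source P) (Cod (source P) e) (Cod (source P) h) \<and> Cmp (source P) k e = ?g \<and> amap P k = amap P h"
    using e unfolding cocartesian_def Let_def
    by (elim conjE ballE[of _ _ "Cod (source P) h"] ballE[of _ _ ?g] ballE[of _ _ "amap P h"])
      (use P h e' in \<open>simp_all add: hom_def\<close>)
  then show ?thesis using h by (auto simp: hom_def)
qed

lemma cocartesianI:
  assumes "e \<in> Arr (source P)"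
    and "\<And>g v. g \<in> Arr (source P) \<Longrightarrow> Dom (source P) g = Dom (source P) e \<Longrightarrow> v \<in> Arr (target P)
      \<Longrightarrow> Dom (target P) v = omap P (Cod (source P) e) \<Longrightarrow> Cod (target P) v = omap P (Cod (source P) g)
      \<Longrightarrow> amap P g = Cmp (target P) v (amap P e)
      \<Longrightarrow> \<exists>h. h \<in> Arr (source P) \<and> Dom (source P) h = Cod (source P) e \<and> Cod (source P) h = Cod (source P) g
        \<and> Cmp (source P) h e = g \<and> amap P h = v"
    and "\<And>h h'. h \<in> Arr (source P) \<Longrightarrow> h' \<in> Arr (source P) \<Longrightarrow> Dom (source P) h = Cod (source P) e
      \<Longrightarrow> Dom (source P) h' = Cod (source P) e \<Longrightarrow> Cod (source P) h = Cod (source P) h'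
      \<Longrightarrow> Cmp (source P) h e = Cmp (source P) h' e \<Longrightarrow> amap P h = amap P h' \<Longrightarrow> h = h'"
  shows "cocartesian P e"
  unfolding cocartesian_def Let_def
proof (intro conjI ballI impI, goal_cases)
  case (2 z g v)
  then obtain h where "h \<in> Arr (source P) \<and> Dom (source P) h = Cod (source P) e \<and> Cod (source P) h = Cod (source P) g
        \<and> Cmp (source P) h e = g \<and> amap P h = v"
    using assms(2)[of g v] by (auto simp: hom_def)
  with 2 show ?case using assms(3) by (intro ex1I[of _ h]) (auto simp: hom_def)
qed (rule assms(1))

text \<open>The lift of g is g i^{-1}; its image is v because P i and P i^{-1} cancel.\<close>

lemma cocartesian_iso:
  assumes P: "is_functor P" and i: "iso (source P) i"
  shows "cocartesian P i"
proof (rule cocartesianI)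
  let ?E = "source P" and ?B = "target P"
  note E = is_functor_category[OF P]
  note I = iso_inv_arr[OF E(1) i]
  show "i \<in> Arr ?E" by (rule I)
  {
    fix g v assume g: "g \<in> Arr ?E" "Dom ?E g = Dom ?E i" "v \<in> Arr ?B" "Dom ?B v = omap P (Cod ?E i)"
      "Cod ?B v = omap P (Cod ?E g)" "amap P g = Cmp ?B v (amap P i)"
    have "Cmp ?B (amap P i) (amap P (inv_arr ?E i)) = Ide ?B (omap P (Cod ?E i))"
      using P I is_functor_Cmp[OF P refl I(2,1)] by simp
    then have "amap P (Cmp ?E g (inv_arr ?E i)) = v" using P g I by simp
    then show "\<exists>h. h \<in> Arr ?E \<and> Dom ?E h = Cod ?E i \<and> Cod ?E h = Cod ?E g \<and> Cmp ?E h i = g \<and> amap P h = v"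
      using P g I by (intro exI[of _ "Cmp ?E g (inv_arr ?E i)"]) simp
  next
    fix h h' assume h: "h \<in> Arr ?E" "h' \<in> Arr ?E" "Dom ?E h = Cod ?E i" "Dom ?E h' = Cod ?E i" "Cmp ?E h i = Cmp ?E h' i"
    have "h = Cmp ?E (Cmp ?E h i) (inv_arr ?E i)" using P h(1,3) I by simp
    also have "\<dots> = h'" unfolding h(5) using P h(2,4) I by simp
    finally show "h = h'" .
  }
qed

text \<open>Lift in two stages; uniqueness is likewise obtained by cancelling e and then d.\<close>

lemma cocartesian_Cmp:
  assumes P: "is_functor P" and e: "cocartesian P e" and d: "cocartesian P d" and ed: "Cod (source P) e = Dom (source P) d"
  shows "cocartesian P (Cmp (source P) d e)"
proof (rule cocartesianI)
  let ?E = "source P" and ?B = "target P"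
  note E = is_functor_category[OF P] cocartesian_Arr[OF e] cocartesian_Arr[OF d]
  show "Cmp ?E d e \<in> Arr ?E" using E ed by simp
  {
    fix g v assume g: "g \<in> Arr ?E" "Dom ?E g = Dom ?E (Cmp ?E d e)" "v \<in> Arr ?B" "Dom ?B v = omap P (Cod ?E (Cmp ?E d e))"
      "Cod ?B v = omap P (Cod ?E g)" "amap P g = Cmp ?B v (amap P (Cmp ?E d e))"
    \<comment> \<open>The first stage, along e, lies over v P d, so that the second stage, along d,
      can lie over v.\<close>
    obtain k where k: "k \<in> Arr ?E" "Dom ?E k = Cod ?E e" "Cod ?E k = Cod ?E g" "Cmp ?E k e = g" "amap P k = Cmp ?B v (amap P d)"
      by (rule cocartesian_lift[OF e E(1,2), of g "Cmp ?B v (amap P d)"]) (use P g E ed in simp_all)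
    obtain h where h: "h \<in> Arr ?E" "Dom ?E h = Cod ?E d" "Cod ?E h = Cod ?E k" "Cmp ?E h d = k" "amap P h = v"
      by (rule cocartesian_lift[OF d E(1,2), of k v]) (use P g E ed k in simp_all)
    then show "\<exists>h. h \<in> Arr ?E \<and> Dom ?E h = Cod ?E (Cmp ?E d e) \<and> Cod ?E h = Cod ?E g \<and> Cmp ?E h (Cmp ?E d e) = g \<and> amap P h = v"
      using E ed k Cmp_reassoc[OF h(4) E(1), of e] by (intro exI[of _ h]) simp
  next
    fix h h' assume h: "h \<in> Arr ?E" "h' \<in> Arr ?E" "Dom ?E h = Cod ?E (Cmp ?E d e)" "Dom ?E h' = Cod ?E (Cmp ?E d e)"
      "Cod ?E h = Cod ?E h'" "Cmp ?E h (Cmp ?E d e) = Cmp ?E h' (Cmp ?E d e)" "amap P h = amap P h'"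
    have "Cmp ?E h d = Cmp ?E h' d"
      by (rule cocartesian_unique[OF e P]) (use P h E ed in simp_all)
    show "h = h'"
      by (rule cocartesian_unique[OF d P]) (use P h E ed \<open>Cmp ?E h d = Cmp ?E h' d\<close> in simp_all)
  }
qed

text \<open>Lift the identity of the domain over the inverse of P e. This is a left inverse by
  construction, and a right inverse by uniqueness along e.\<close>

lemma iso_of_cocartesian:
  assumes P: "is_functor P" and e: "cocartesian P e" and i: "iso (target P) (amap P e)"
  shows "iso (source P) e"
proof -
  let ?E = "source P" and ?B = "target P"
  note E = is_functor_category[OF P] cocartesian_Arr[OF e]
  note I = iso_inv_arr[OF E(2) i]
  obtain h where h: "h \<in> Arr ?E" "Dom ?E h = Cod ?E e" "Cod ?E h = Cod ?E (Ide ?E (Dom ?E e))"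
    "Cmp ?E h e = Ide ?E (Dom ?E e)" "amap P h = inv_arr ?B (amap P e)"
    by (rule cocartesian_lift[OF e E(1,2), of "Ide ?E (Dom ?E e)" "inv_arr ?B (amap P e)"]) (use P E I in simp_all)
  have "Cmp ?E e h = Ide ?E (Cod ?E e)"
    by (rule cocartesian_unique[OF e P]) (use P E I h in simp_all)
  with h show ?thesis using E by (intro isoI[of _ _ h]) simp_all
qed

text \<open>Cocartesian arrows cancel on the right: from h e = d with e and d cocartesian, h is
  cocartesian too. It lies over an isomorphism, so it is one. This makes the multiplication cell,
  the comparison and \<nu> of a cocartesian arrow invertible.\<close>

lemma iso_of_cocartesian_factor:
  assumes P: "is_functor P" and e: "cocartesian P e" and d: "cocartesian P d" and h: "h \<in> Arr (source P)"
    "Dom (source P) h = Cod (source P) e" "Cmp (source P) h e = d" "iso (target P) (amap P h)"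
  shows "iso (source P) h"
proof -
  let ?E = "source P" and ?B = "target P"
  note E = is_functor_category[OF P] cocartesian_Arr[OF e] cocartesian_Arr[OF d]
  have "cocartesian P h"
  proof (rule cocartesianI)
    show "h \<in> Arr ?E" by (rule h)
    {
      fix g v assume g: "g \<in> Arr ?E" "Dom ?E g = Dom ?E h" "v \<in> Arr ?B" "Dom ?B v = omap P (Cod ?E h)"
        "Cod ?B v = omap P (Cod ?E g)" "amap P g = Cmp ?B v (amap P h)"
      have dd: "Dom ?E d = Dom ?E e" "Cod ?E d = Cod ?E h" using h E by auto
      have Pd: "amap P d = Cmp ?B (amap P h) (amap P e)" using h P E by auto
      \<comment> \<open>A problem for h is turned into one for d by composing with e; the solution
        is brought back by cancelling e.\<close>
      obtain k where k: "k \<in> Arr ?E" "Dom ?E k = Cod ?E d" "Cod ?E k = Cod ?E (Cmp ?E g e)" "Cmp ?E k d = Cmp ?E g e" "amap P k = v"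
        by (rule cocartesian_lift[OF d E(1,2), of "Cmp ?E g e" v]) (use P g E h(1,2,4) dd Pd in simp_all)
      have "Cmp ?E k h = g"
      proof (rule cocartesian_unique[OF e P])
        show "Cmp ?E (Cmp ?E k h) e = Cmp ?E g e" using k h E dd g by simp
      qed (use P k h(1,2) E dd g in simp_all)
      then show "\<exists>k. k \<in> Arr ?E \<and> Dom ?E k = Cod ?E h \<and> Cod ?E k = Cod ?E g \<and> Cmp ?E k h = g \<and> amap P k = v"
        using k dd g E h(1,2) by (intro exI[of _ k]) simp
    next
      fix k k' assume k: "k \<in> Arr ?E" "k' \<in> Arr ?E" "Dom ?E k = Cod ?E h" "Dom ?E k' = Cod ?E h"
        "Cod ?E k = Cod ?E k'" "Cmp ?E k h = Cmp ?E k' h" "amap P k = amap P k'"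
      have dd: "Dom ?E d = Dom ?E e" "Cod ?E d = Cod ?E h" using h E by auto
      have "Cmp ?E (Cmp ?E k h) e = Cmp ?E (Cmp ?E k' h) e" using k by simp
      then have "Cmp ?E k d = Cmp ?E k' d" using k(1-4) h(1-3) E by simp
      show "k = k'"
        by (rule cocartesian_unique[OF d P]) (use k dd \<open>Cmp ?E k d = Cmp ?E k' d\<close> in simp_all)
    }
  qed
  then show ?thesis using P h(4) by (intro iso_of_cocartesian)
qed

section \<open>The pseudoalgebra of a cloven cofibration\<close>

lemma cloven_functor [simp]: "cloven_cofibration \<P> \<Longrightarrow> is_functor (proj \<P>)"
  by (simp add: cloven_cofibration_def Let_def)

lemma clv_simps [simp]:
  assumes P: "cloven_cofibration \<P>" and x: "x \<in> Obj (source (proj \<P>))" and u: "u \<in> Arr (target (proj \<P>))"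
    "Dom (target (proj \<P>)) u = omap (proj \<P>) x"
  shows "cocartesian (proj \<P>) (clv \<P> x u)"
    "E = source (proj \<P>) \<Longrightarrow> clv \<P> x u \<in> Arr E" "E = source (proj \<P>) \<Longrightarrow> Dom E (clv \<P> x u) = x"
    "E = source (proj \<P>) \<Longrightarrow> Cod E (clv \<P> x u) = push \<P> x u" "E = source (proj \<P>) \<Longrightarrow> push \<P> x u \<in> Obj E"
    "Q = proj \<P> \<Longrightarrow> amap Q (clv \<P> x u) = u" "Q = proj \<P> \<Longrightarrow> omap Q (push \<P> x u) = Cod (target (proj \<P>)) u"
proof -
  let ?E = "source (proj \<P>)"
  have c: "cocartesian (proj \<P>) (clv \<P> x u)" "Dom ?E (clv \<P> x u) = x" "amap (proj \<P>) (clv \<P> x u) = u"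
    using P[unfolded cloven_cofibration_def Let_def, THEN conjunct2, rule_format, of x u] x u by simp_all
  have F: "is_functor (proj \<P>)" using P by simp
  note A = cocartesian_Arr[OF c(1)]
  show "cocartesian (proj \<P>) (clv \<P> x u)" by (rule c)
  have "push \<P> x u \<in> Obj ?E" using A F by (simp add: push_def)
  moreover have "omap (proj \<P>) (push \<P> x u) = Cod (target (proj \<P>)) u"
    using is_functor_amap(3)[OF F refl A] c by (simp add: push_def)
  ultimately show "E = ?E \<Longrightarrow> clv \<P> x u \<in> Arr E" "E = ?E \<Longrightarrow> Dom E (clv \<P> x u) = x"
    "E = ?E \<Longrightarrow> Cod E (clv \<P> x u) = push \<P> x u" "E = ?E \<Longrightarrow> push \<P> x u \<in> Obj E"
    "Q = proj \<P> \<Longrightarrow> amap Q (clv \<P> x u) = u" "Q = proj \<P> \<Longrightarrow> omap Q (push \<P> x u) = Cod (target (proj \<P>)) u"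
    using A c by (simp_all add: push_def)
qed

lemma clv_eqI:
  assumes "cloven_cofibration \<P>" "x \<in> Obj (source (proj \<P>))" "u \<in> Arr (target (proj \<P>))"
    "Dom (target (proj \<P>)) u = omap (proj \<P>) x"
    "h \<in> Arr (source (proj \<P>))" "h' \<in> Arr (source (proj \<P>))"
    "Dom (source (proj \<P>)) h = push \<P> x u" "Dom (source (proj \<P>)) h' = push \<P> x u"
    "Cod (source (proj \<P>)) h = Cod (source (proj \<P>)) h'"
    "Cmp (source (proj \<P>)) h (clv \<P> x u) = Cmp (source (proj \<P>)) h' (clv \<P> x u)"
    "amap (proj \<P>) h = amap (proj \<P>) h'"
  shows "h = h'"
  by (rule cocartesian_unique[OF clv_simps(1)[OF assms(1-4)] cloven_functor[OF assms(1)]]) (use assms in simp_all)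

lemma clv_lift:
  assumes P: "cloven_cofibration \<P>" and xu: "x \<in> Obj (source (proj \<P>))" "u \<in> Arr (target (proj \<P>))"
    "Dom (target (proj \<P>)) u = omap (proj \<P>) x"
    and g: "g \<in> Arr (source (proj \<P>))" "Dom (source (proj \<P>)) g = x" "v \<in> Arr (target (proj \<P>))"
    "Dom (target (proj \<P>)) v = Cod (target (proj \<P>)) u" "Cod (target (proj \<P>)) v = omap (proj \<P>) (Cod (source (proj \<P>)) g)"
    "amap (proj \<P>) g = Cmp (target (proj \<P>)) v u"
  obtains h where "h \<in> Arr (source (proj \<P>))" "Dom (source (proj \<P>)) h = push \<P> x u"
    "Cod (source (proj \<P>)) h = Cod (source (proj \<P>)) g" "Cmp (source (proj \<P>)) h (clv \<P> x u) = g" "amap (proj \<P>) h = v"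
  by (rule cocartesian_lift[OF clv_simps(1)[OF P xu], of g v]) (use assms that in simp_all)

lemma cleavage_action_sel [simp]:
  "source (cleavage_action \<P>) = comma (proj \<P>)" "target (cleavage_action \<P>) = source (proj \<P>)"
  "Pair x u \<in> Obj (comma (proj \<P>)) \<Longrightarrow> omap (cleavage_action \<P>) (Pair x u) = push \<P> x u"
  unfolding cleavage_action_def Let_def by (simp_all del: comma_Obj_Pair)

lemma cleavage_action_arrow [simp]:
  assumes P: "cloven_cofibration \<P>" and sq: "comma_square (proj \<P>) x u y w f v" and E: "E = source (proj \<P>)"
  defines "h \<equiv> amap (cleavage_action \<P>) (tag (Pair x u) (Pair y w) (Pair f v))"
  shows "h \<in> Arr E" "Dom E h = push \<P> x u" "Cod E h = push \<P> y w" "Q = proj \<P> \<Longrightarrow> amap Q h = v"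
    "Cmp E h (clv \<P> x u) = Cmp E (clv \<P> y w) f"
proof -
  let ?E = "source (proj \<P>)" and ?B = "target (proj \<P>)" and ?P = "proj \<P>"
  note c = comma_square_Arr[OF sq] comma_square_eq[OF sq]
  obtain k where k: "k \<in> Arr ?E" "Dom ?E k = push \<P> x u" "Cod ?E k = push \<P> y w"
    "Cmp ?E k (clv \<P> x u) = Cmp ?E (clv \<P> y w) f" "amap ?P k = v"
    by (rule clv_lift[OF P, of x u "Cmp ?E (clv \<P> y w) f" v]) (use P c in simp_all)
  have "h = (THE h. h \<in> hom ?E (Cod ?E (clv \<P> x u)) (Cod ?E (clv \<P> y w)) \<and> amap ?P h = v \<and>
      Cmp ?E h (clv \<P> x u) = Cmp ?E (clv \<P> y w) f)"
    unfolding h_def cleavage_action_def Let_def using sq by simp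
  also have "\<dots> = k"
  proof (rule the_equality)
    fix h assume h: "h \<in> hom ?E (Cod ?E (clv \<P> x u)) (Cod ?E (clv \<P> y w)) \<and> amap ?P h = v \<and>
      Cmp ?E h (clv \<P> x u) = Cmp ?E (clv \<P> y w) f"
    show "h = k" by (rule clv_eqI[OF P, of x u]) (use P c k h in \<open>simp_all add: hom_def\<close>)
  qed (use P c k in \<open>simp add: hom_def\<close>)
  finally have "h = k" .
  with k E show "h \<in> Arr E" "Dom E h = push \<P> x u" "Cod E h = push \<P> y w" "Q = proj \<P> \<Longrightarrow> amap Q h = v"
    "Cmp E h (clv \<P> x u) = Cmp E (clv \<P> y w) f" by simp_all
qed

text \<open>The defining equation of the action in front of a further arrow k, for use in
  right-nested composites. \<open>cleavage_chi_clv\<close> and \<open>comparison_clv\<close> have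
  the same purpose.\<close>

lemma cleavage_action_clv [simp]:
  assumes P: "cloven_cofibration \<P>" and sq: "comma_square (proj \<P>) x u y w f v" and E: "E = source (proj \<P>)"
    and k: "k \<in> Arr E" "Cod E k = x"
  shows "Cmp E (amap (cleavage_action \<P>) (tag (Pair x u) (Pair y w) (Pair f v))) (Cmp E (clv \<P> x u) k)
    = Cmp E (clv \<P> y w) (Cmp E f k)"
  using Cmp_reassoc[OF cleavage_action_arrow(5)[OF P sq E], of k] comma_square_Arr[OF sq] P E k
    cleavage_action_arrow[OF P sq E] by simp

text \<open>The value at an identity or a composite and the expected arrow lie over the same base
  arrow and agree on the chosen lift.\<close>

lemma is_functor_cleavage_action [simp]:
  assumes P: "cloven_cofibration \<P>"
  shows "is_functor (cleavage_action \<P>)"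
proof -
  let ?E = "source (proj \<P>)" and ?P = "proj \<P>"
  have "is_functor (mk_functor (comma ?P) ?E (omap (cleavage_action \<P>)) (amap (cleavage_action \<P>)))"
  proof (rule is_functor_mk_functor, goal_cases)
    case (3 x)
    then show ?case by (rule comma_ObjE) (use P in simp)
  next
    case (4 f)
    then show ?case by (rule comma_ArrE) (use P in simp)
  next
    case (5 x)
    then show ?case
    proof (rule comma_ObjE, goal_cases)
      case (1 x u)
      have "amap (cleavage_action \<P>) (tag (Pair x u) (Pair x u) (Pair (Ide ?E x) (Ide (target ?P) (Cod (target ?P) u)))) = Ide ?E (push \<P> x u)"
        by (rule clv_eqI[OF P, of x u]) (use P 1 in simp_all)
      then show ?case using P 1 by simp
    qed
  next
    case (6 f g)
    show ?case
    proof (rule comma_ArrE[OF 6(1)], rule comma_ArrE[OF 6(2)], goal_cases)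
      case (1 x u y w f' v y' w' z t g' s)
      have yw: "y' = y" "w' = w" using 1 6 by simp_all
      let ?L = "\<lambda>s t f. amap (cleavage_action \<P>) (tag s t f)"
      have sq: "comma_square ?P x u z t (Cmp ?E g' f') (Cmp (target ?P) s v)"
        using comma_square_Cmp[of ?P x u y w f' v z t g' s] P 1 yw by simp
      have "?L (Pair x u) (Pair z t) (Pair (Cmp ?E g' f') (Cmp (target ?P) s v))
          = Cmp ?E (?L (Pair y w) (Pair z t) (Pair g' s)) (?L (Pair x u) (Pair y w) (Pair f' v))"
        by (rule clv_eqI[OF P, of x u]) (use P 1 sq yw in simp_all)
      then show ?case using P 1 yw by simp
    qed
  qed (use P in simp_all)
  \<comment> \<open>The maps of \<open>cleavage_action\<close> are already restricted to their
    carriers, so rebuilding the functor from them changes nothing.\<close>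
  moreover have "mk_functor (comma ?P) ?E (omap (cleavage_action \<P>)) (amap (cleavage_action \<P>)) = cleavage_action \<P>"
    by (simp add: cleavage_action_def Let_def mk_functor_def)
  ultimately show ?thesis by simp
qed

lemma cleavage_action_Ide [simp]:
  assumes P: "cloven_cofibration \<P>" and xu: "x \<in> Obj (source (proj \<P>))" "u \<in> Arr (target (proj \<P>))"
    "Dom (target (proj \<P>)) u = omap (proj \<P>) x" and E: "E = source (proj \<P>)" and B: "B = target (proj \<P>)" "b = Cod B u"
  shows "amap (cleavage_action \<P>) (tag (Pair x u) (Pair x u) (Pair (Ide E x) (Ide B b))) = Ide E (push \<P> x u)"
  using is_functor_Ide[OF is_functor_cleavage_action[OF P] refl, of "Pair x u"] xu E B by simp

text \<open>The composite of two chosen lifts is cocartesian, so the chosen lift of v u factors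
  through it uniquely over an identity. The factor compares two cocartesian arrows and is therefore
  invertible.\<close>

lemma cleavage_chi_simps [simp]:
  assumes P: "cloven_cofibration \<P>" and xu: "x \<in> Obj (source (proj \<P>))" "u \<in> Arr (target (proj \<P>))"
    "Dom (target (proj \<P>)) u = omap (proj \<P>) x" and v: "v \<in> Arr (target (proj \<P>))" "Dom (target (proj \<P>)) v = Cod (target (proj \<P>)) u"
    and E: "E = source (proj \<P>)"
  shows "cleavage_chi \<P> x u v \<in> Arr E" "Dom E (cleavage_chi \<P> x u v) = push \<P> (push \<P> x u) v"
    "Cod E (cleavage_chi \<P> x u v) = push \<P> x (Cmp (target (proj \<P>)) v u)" "iso E (cleavage_chi \<P> x u v)"
    "Q = proj \<P> \<Longrightarrow> amap Q (cleavage_chi \<P> x u v) = Ide (target (proj \<P>)) (Cod (target (proj \<P>)) v)"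
    "Cmp E (cleavage_chi \<P> x u v) (Cmp E (clv \<P> (push \<P> x u) v) (clv \<P> x u)) = clv \<P> x (Cmp (target (proj \<P>)) v u)"
proof -
  let ?E = "source (proj \<P>)" and ?B = "target (proj \<P>)" and ?P = "proj \<P>"
  let ?d = "Cmp ?E (clv \<P> (push \<P> x u) v) (clv \<P> x u)" and ?e = "clv \<P> x (Cmp ?B v u)"
  let ?Q = "\<lambda>h. h \<in> hom ?E (push \<P> (push \<P> x u) v) (push \<P> x (Cmp ?B v u)) \<and> iso ?E h \<and>
       amap ?P h = Ide ?B (Cod ?B v) \<and> Cmp ?E h ?d = ?e"
  have d: "cocartesian ?P ?d" using assms by (intro cocartesian_Cmp) simp_all
  have vu: "Cmp ?B v u \<in> Arr ?B" "Dom ?B (Cmp ?B v u) = omap ?P x" using assms by simp_all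
  obtain h where h: "h \<in> Arr ?E" "Dom ?E h = push \<P> (push \<P> x u) v" "Cod ?E h = push \<P> x (Cmp ?B v u)"
    "Cmp ?E h ?d = ?e" "amap ?P h = Ide ?B (Cod ?B v)"
    by (rule cocartesian_lift[OF d, of ?e "Ide ?B (Cod ?B v)"]) (use assms vu in simp_all)
  have "iso ?E h"
    by (rule iso_of_cocartesian_factor[OF _ d, of ?e]) (use assms vu h in \<open>simp_all add: iso_Ide\<close>)
  with h have 1: "?Q h" by (simp add: hom_def)
  have "cleavage_chi \<P> x u v = h"
    unfolding cleavage_chi_def Let_def
  proof (rule the_equality[of ?Q, OF 1])
    fix k assume k: "?Q k"
    show "k = h" by (rule cocartesian_unique[OF d]) (use assms vu h k in \<open>simp_all add: hom_def\<close>)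
  qed
  with 1 E show "cleavage_chi \<P> x u v \<in> Arr E" "Dom E (cleavage_chi \<P> x u v) = push \<P> (push \<P> x u) v"
    "Cod E (cleavage_chi \<P> x u v) = push \<P> x (Cmp (target (proj \<P>)) v u)" "iso E (cleavage_chi \<P> x u v)"
    "Q = proj \<P> \<Longrightarrow> amap Q (cleavage_chi \<P> x u v) = Ide (target (proj \<P>)) (Cod (target (proj \<P>)) v)"
    "Cmp E (cleavage_chi \<P> x u v) (Cmp E (clv \<P> (push \<P> x u) v) (clv \<P> x u)) = clv \<P> x (Cmp (target (proj \<P>)) v u)"
    by (simp_all add: hom_def)
qed

lemma cleavage_chi_clv [simp]:
  assumes P: "cloven_cofibration \<P>" and xu: "x \<in> Obj (source (proj \<P>))" "u \<in> Arr (target (proj \<P>))"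
    "Dom (target (proj \<P>)) u = omap (proj \<P>) x" and v: "v \<in> Arr (target (proj \<P>))" "Dom (target (proj \<P>)) v = Cod (target (proj \<P>)) u"
    and E: "E = source (proj \<P>)" and k: "k \<in> Arr E" "Cod E k = x"
  shows "Cmp E (cleavage_chi \<P> x u v) (Cmp E (clv \<P> (push \<P> x u) v) (Cmp E (clv \<P> x u) k))
    = Cmp E (clv \<P> x (Cmp (target (proj \<P>)) v u)) k"
  using Cmp_reassoc[OF cleavage_chi_simps(6)[OF P xu v E], of k] P E k xu v by simp

lemma cloven_to_psalg_sel:
  "under (cloven_to_psalg small B \<P>) = proj \<P>"
  "act (cloven_to_psalg small B \<P>) = \<lparr>source = Cod_functor (proj \<P>), target = proj \<P>, over1 = cleavage_action \<P>\<rparr>"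
  "unitor (cloven_to_psalg small B \<P>) = \<lparr>source = id1 (CAT_over small B) (proj \<P>),
     target = act (cloven_to_psalg small B \<P>) \<cdot>\<^bsub>CAT_over small B\<^esub> comma_unit (proj \<P>),
     over2 = mk_ntrans (id_functor (source (proj \<P>))) (comp_functor (cleavage_action \<P>) (over1 (comma_unit (proj \<P>))))
       (\<lambda>x. clv \<P> x (Ide B (omap (proj \<P>) x)))\<rparr>"
  "multor (cloven_to_psalg small B \<P>) = \<lparr>source = act (cloven_to_psalg small B \<P>) \<cdot>\<^bsub>CAT_over small B\<^esub> comma_mor (act (cloven_to_psalg small B \<P>)),
     target = act (cloven_to_psalg small B \<P>) \<cdot>\<^bsub>CAT_over small B\<^esub> comma_mult (proj \<P>),
     over2 = mk_ntrans (comp_functor (cleavage_action \<P>) (comma_functor (act (cloven_to_psalg small B \<P>))))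
       (comp_functor (cleavage_action \<P>) (over1 (comma_mult (proj \<P>))))
       (\<lambda>s. cleavage_chi \<P> (lft (lft s)) (rgt (lft s)) (rgt s))\<rparr>"
  by (simp_all add: cloven_to_psalg_def Let_def)

text \<open>Reduces an equation of pasted cells over the base to its components, after the
  boundaries have been matched by the general 2-categorical laws.\<close>

lemma CAT_over_parallel_eqI:
  assumes "\<alpha> \<in> cells2 (CAT_over small B)" "\<beta> \<in> cells2 (CAT_over small B)" "source \<alpha> = source \<beta>" "target \<alpha> = target \<beta>"
    "\<And>x. x \<in> Obj (source (source (source \<alpha>))) \<Longrightarrow> component (over2 \<alpha>) x = component (over2 \<beta>) x"
  shows "\<alpha> = \<beta>"
proof (rule slice_cell_eqI[OF assms(3,4)], rule ntrans_eqI)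
  have "over_cell \<alpha>" "over_cell \<beta>" using assms(1,2) by (simp_all add: CAT_over_cells)
  then show "is_ntrans (over2 \<alpha>)" "is_ntrans (over2 \<beta>)" "source (over2 \<alpha>) = source (over2 \<beta>)" "target (over2 \<alpha>) = target (over2 \<beta>)"
    "\<And>x. x \<in> Obj (source (source (over2 \<alpha>))) \<Longrightarrow> component (over2 \<alpha>) x = component (over2 \<beta>) x"
    using assms(3-5) by simp_all
qed

lemma comma_square_vertical [simp]:
  assumes "is_functor P" "h \<in> Arr (source P)" "x = Dom (source P) h" "y = Cod (source P) h"
    "amap P h = Ide (target P) (omap P x)" "w \<in> Arr (target P)" "Dom (target P) w = omap P x" "B = target P" "b = Cod B w"
  shows "comma_square P x w y w h (Ide B b)"
proof -
  have "omap P y = omap P x"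
    using is_functor_amap(3)[OF assms(1) refl assms(2)] assms by simp
  then show ?thesis using assms by (simp add: comma_square_def)
qed

lemma invertible2_CAT_over:
  assumes "\<alpha> \<in> cells2 (CAT_over small B)"
    and "\<And>x. x \<in> Obj (source (source (source \<alpha>))) \<Longrightarrow> iso (source (target (source \<alpha>))) (component (over2 \<alpha>) x)"
  shows "invertible2 (CAT_over small B) \<alpha>"
proof -
  have a: "over_cell \<alpha>" "over2 \<alpha> \<in> cells2 (CAT small)"
    using assms(1) by (simp_all add: CAT_over_cells CAT_cells)
  show ?thesis
    unfolding two_category.invertible2_Slice[OF two_category_CAT assms(1)] invertible2_CAT[OF a(2)]
    using assms(2) a by simp
qed

lemma iso_of_invertible2_CAT_over:
  assumes "invertible2 (CAT_over small B) \<alpha>" "x \<in> Obj (source (source (source \<alpha>)))"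
  shows "iso (source (target (source \<alpha>))) (component (over2 \<alpha>) x)"
proof -
  have c: "\<alpha> \<in> cells2 (CAT_over small B)" using assms(1) by (simp add: invertible2_def)
  then have a: "over_cell \<alpha>" "over2 \<alpha> \<in> cells2 (CAT small)" by (simp_all add: CAT_over_cells CAT_cells)
  show ?thesis
    using assms(1) unfolding two_category.invertible2_Slice[OF two_category_CAT c] invertible2_CAT[OF a(2)]
    using assms(2) a by simp
qed

lemma clv_iso:
  assumes "cloven_cofibration \<P>" "x \<in> Obj (source (proj \<P>))" "u \<in> Arr (target (proj \<P>))"
    "Dom (target (proj \<P>)) u = omap (proj \<P>) x" "iso (target (proj \<P>)) u"
  shows "iso (source (proj \<P>)) (clv \<P> x u)"
  by (rule iso_of_cocartesian) (use assms in simp_all)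

text \<open>Each law equates two arrows out of an iterated pushforward over the same base arrow. It
  is tested on the chosen lifts, peeled off one pushforward at a time from the outermost
  inwards.\<close>

lemma pseudoalgebra_cloven:
  assumes small: "smallness small" and P: "cloven_cofibration \<P>" and PB: "proj \<P> \<in> cells0 (CAT_over small B)"
  shows "pseudoalgebra (CAT_over small B) comma_monad (cloven_to_psalg small B \<P>)"
proof -
  \<comment> \<open>The name keeps the slice 2-category opaque while the boundaries of pasted cells
    are computed from the 2-category laws. It is unfolded only to evaluate components.\<close>
  define K where "K = CAT_over small B"
  let ?P = "proj \<P>" and ?E = "source (proj \<P>)" and ?A = "cloven_to_psalg small B \<P>" and ?L = "cleavage_action \<P>"
  define a i c where "a = act ?A" and "i = unitor ?A" and "c = multor ?A"
  interpret M: two_monad K comma_monad unfolding K_def by (rule two_monad_comma_monad[OF small])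
  have PB': "target ?P = B" "locally_small small ?E" "locally_small small B" using PB by (simp_all add: CAT_over_cells)
  have B: "category B" using is_functor_category(2)[of ?P] P PB' by simp
  have a [simp]: "source a = Cod_functor ?P" "target a = ?P" "over1 a = ?L"
    by (simp_all add: a_def cloven_to_psalg_sel)
  have oa: "over_functor a"
  proof (rule over_functorI, goal_cases)
    case (7 x)
    then have "x \<in> Obj (comma ?P)" by simp
    then show ?case by (rule comma_ObjE) (use P in simp)
  next
    case (8 f)
    then have "f \<in> Arr (comma ?P)" by simp
    then show ?case by (rule comma_ArrE) (use P in simp)
  qed (use P in simp_all)
  have i: "source i = id1 K ?P" "target i = a \<cdot>\<^bsub>K\<^esub> comma_unit ?P"
    and i2: "source (over2 i) = id_functor ?E" "target (over2 i) = comp_functor ?L (over1 (comma_unit ?P))"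
    and ic: "\<And>x. x \<in> Obj ?E \<Longrightarrow> component (over2 i) x = clv \<P> x (Ide B (omap ?P x))"
    by (simp_all add: i_def a_def K_def cloven_to_psalg_sel)
  have c: "source c = a \<cdot>\<^bsub>K\<^esub> comma_mor a" "target c = a \<cdot>\<^bsub>K\<^esub> comma_mult ?P"
    and c2: "source (over2 c) = comp_functor ?L (comma_functor a)" "target (over2 c) = comp_functor ?L (over1 (comma_mult ?P))"
    by (simp_all add: c_def a_def K_def cloven_to_psalg_sel)
  have cc: "component (over2 c) (Pair (Pair x u) v) = cleavage_chi \<P> x u v"
    if "Pair (Pair x u) v \<in> Obj (comma (Cod_functor ?P))" for x u v
    using that by (simp add: c_def cloven_to_psalg_sel)
  have PK: "?P \<in> cells0 K" using PB by (simp add: K_def)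
  have aK: "a \<in> cells1 K"
    unfolding K_def CAT_over_cells using oa PB' P by (simp add: locally_small_comma small)
  have aK': "src1 K a = Cod_functor ?P" "tgt1 K a = ?P" by (simp_all add: K_def)
  have ni: "is_ntrans (over2 i)"
    unfolding i_def cloven_to_psalg_sel(3) slice_cell.simps
  proof (rule is_ntrans_mk_ntrans, goal_cases)
    case 2
    then show ?case using P over_functor_simps(3)[OF over_functor_comma_unit, of ?P] by simp
  qed (use P PB' B in simp_all)
  have oi: "over_cell i"
  proof (rule over_cellI, goal_cases)
    case 1
    show ?case unfolding i K_def by (rule over_functorI) (use P in simp_all)
  next
    case 2
    then show ?case
      using M.endo.dom.cells_of_comp1(1)[of "comma_unit ?P" a] M.unit.component_cells[OF PK] aK aK'
      unfolding i by (simp add: K_def CAT_over_cells)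
  qed (use P PB' B ni ic in \<open>simp_all add: i i2 K_def\<close>)
  have iK: "i \<in> cells2 K" unfolding K_def CAT_over_cells using oi PB' P by (simp add: i K_def)
  have nc: "is_ntrans (over2 c)"
    unfolding c_def cloven_to_psalg_sel(4) slice_cell.simps a_def[symmetric]
  proof (rule is_ntrans_mk_ntrans, goal_cases)
    case 1
    then show ?case using P oa by simp
  next
    case 2
    then show ?case using P over_functor_simps(3)[OF over_functor_comma_mult, of ?P] by simp
  next
    case (5 s)
    then have "s \<in> Obj (comma (Cod_functor ?P))" using oa by simp
    then show ?case by (rule comma_comma_ObjE) (use P in simp)
  next
    case (6 f)
    then have "f \<in> Arr (comma (Cod_functor ?P))" using oa by simp
    then show ?case
    proof (rule comma_comma_ArrE, goal_cases)
      case (1 x u v y w t f r s)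
      have sq: "comma_square ?P (omap (over1 a) (Pair x u)) v (omap (over1 a) (Pair y w)) t (amap (over1 a) (tag (Pair x u) (Pair y w) (Pair f r))) s"
        by (rule over_functor_comma_square[OF oa]) (use 1 P in simp_all)
      then have sq: "comma_square ?P (push \<P> x u) v (push \<P> y w) t (amap ?L (tag (Pair x u) (Pair y w) (Pair f r))) s"
        using 1 P by simp
      have sq2: "comma_square ?P x (Cmp (target ?P) v u) y (Cmp (target ?P) t w) f s"
        using 1 P by (intro comma_square_mult) simp_all
      have "Cmp ?E (cleavage_chi \<P> y w t) (amap ?L (tag (Pair (push \<P> x u) v) (Pair (push \<P> y w) t)
            (Pair (amap ?L (tag (Pair x u) (Pair y w) (Pair f r))) s)))
          = Cmp ?E (amap ?L (tag (Pair x (Cmp (target ?P) v u)) (Pair y (Cmp (target ?P) t w)) (Pair f s))) (cleavage_chi \<P> x u v)"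
      \<comment> \<open>Naturality of \<chi> starts at v_!u_!x: first \<delta>^{u_!x}_v is
        cancelled, then \<delta>^x_u.\<close>
      proof (rule clv_eqI[OF P, of "push \<P> x u" v], goal_cases)
        case 9
        show ?case
          by (rule clv_eqI[OF P, of x u]) (use 1 P sq sq2 in simp_all)
      qed (use 1 P sq sq2 in simp_all)
      then show ?case using 1 P by simp
    qed
  qed (use P PB' B in simp_all)
  have oc: "over_cell c"
  proof (rule over_cellI, goal_cases)
    case 1
    then show ?case
      using M.endo.dom.cells_of_comp1(1)[of "comma_mor a" a] M.endo.map1_cells[OF aK] aK aK'
      unfolding c by (simp add: K_def CAT_over_cells)
  next
    case 2
    then show ?case
      using M.endo.dom.cells_of_comp1(1)[of "comma_mult ?P" a] M.mult.component_cells[OF PK] aK aK'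
      unfolding c by (simp add: K_def CAT_over_cells)
  next
    case (8 s)
    then have "s \<in> Obj (comma (Cod_functor ?P))" by (simp add: c K_def)
    then show ?case by (rule comma_comma_ObjE) (use P PB' cc in \<open>simp add: c K_def\<close>)
  qed (use P PB' B nc in \<open>simp_all add: c c2 K_def\<close>)
  have cK: "c \<in> cells2 K" unfolding K_def CAT_over_cells using oc PB' P by (simp add: c K_def locally_small_comma small)
  have "src1 K a = M.T0 ?P" "src2 K i = id1 K ?P" "tgt2 K i = a \<cdot>\<^bsub>K\<^esub> eta comma_monad ?P"
    "src2 K c = a \<cdot>\<^bsub>K\<^esub> M.T1 a" "tgt2 K c = a \<cdot>\<^bsub>K\<^esub> mu comma_monad ?P"
    using i c by (simp_all add: K_def)
  note tys = PK aK aK'(2) iK cK this M.unit_left[OF PK] M.unit_right[OF PK] M.mult_assoc[OF PK]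
  show ?thesis
    unfolding K_def[symmetric]
  proof (rule pseudoalgebraI, unfold a_def[symmetric] i_def[symmetric] c_def[symmetric] cloven_to_psalg_sel(1), goal_cases)
    case 8
    show ?case unfolding K_def
    proof (rule invertible2_CAT_over)
      show "i \<in> cells2 (CAT_over small B)" using iK by (simp add: K_def)
      fix x assume "x \<in> Obj (source (source (source i)))"
      then have "x \<in> Obj ?E" by (simp add: i K_def)
      then show "iso (source (target (source i))) (component (over2 i) x)"
        using P PB' B by (simp add: i K_def ic clv_iso iso_Ide)
    qed
  next
    case 12
    show ?case unfolding K_def
    proof (rule invertible2_CAT_over)
      show "c \<in> cells2 (CAT_over small B)" using cK by (simp add: K_def)
      fix s assume "s \<in> Obj (source (source (source c)))"
      then have "s \<in> Obj (comma (Cod_functor ?P))" by (simp add: c K_def)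
      then show "iso (source (target (source c))) (component (over2 c) s)"
        by (rule comma_comma_ObjE) (use P PB' B in \<open>simp add: c K_def cc\<close>)
    qed
  next
    case 13
    let ?l = "(c \<star>\<^bsub>K\<^esub> id2 K (M.T1 (eta comma_monad ?P))) \<bullet>\<^bsub>K\<^esub> (id2 K a \<star>\<^bsub>K\<^esub> M.T2 i)"
    have t: "?l \<in> cells2 K" "src2 K ?l = a" "tgt2 K ?l = a" "id2 K a \<in> cells2 K" using tys by (simp_all del: comma_monad_sel)
    show ?case
    proof (rule CAT_over_parallel_eqI[of _ small B], goal_cases)
      case (5 s)
      then have "s \<in> Obj (comma ?P)" by (simp add: K_def i)
      then show ?case
      proof (rule comma_ObjE, goal_cases)
        case (1 x u)
        \<comment> \<open>First unit law: on \<delta>^x_u the action at (\<delta>_1, 1) yields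
          \<delta>_u \<delta>_1, which \<chi> sends to \<delta>_{u 1} = \<delta>_u.\<close>
        have "Cmp ?E (cleavage_chi \<P> x (Ide B (omap ?P x)) u)
            (amap ?L (tag (Pair x u) (Pair (push \<P> x (Ide B (omap ?P x))) u) (Pair (clv \<P> x (Ide B (omap ?P x))) (Ide B (Cod B u)))))
            = Ide ?E (push \<P> x u)"
          by (rule clv_eqI[OF P, of x u]) (use 1 P PB' B in simp_all)
        then show ?case using 1 P PB' B oi
          by (simp add: K_def i c i2 c2 ic cc)
      qed
    qed (use t in \<open>simp_all add: K_def\<close>)
  next
    case 14
    let ?l = "(c \<star>\<^bsub>K\<^esub> id2 K (eta comma_monad (M.T0 ?P))) \<bullet>\<^bsub>K\<^esub> (i \<star>\<^bsub>K\<^esub> id2 K a)"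
    have t: "?l \<in> cells2 K" "src2 K ?l = a" "tgt2 K ?l = a" "id2 K a \<in> cells2 K" using tys by (simp_all del: comma_monad_sel)
    show ?case
    proof (rule CAT_over_parallel_eqI[of _ small B], goal_cases)
      case (5 s)
      then have "s \<in> Obj (comma ?P)" by (simp add: K_def i)
      then show ?case
      proof (rule comma_ObjE, goal_cases)
        case (1 x u)
        \<comment> \<open>Second unit law: here the added identity comes after u, and \<chi> sends
          \<delta>_1 \<delta>_u to \<delta>_{1 u} = \<delta>_u.\<close>
        have "Cmp ?E (cleavage_chi \<P> x u (Ide B (Cod B u))) (clv \<P> (push \<P> x u) (Ide B (Cod B u))) = Ide ?E (push \<P> x u)"
          by (rule clv_eqI[OF P, of x u]) (use 1 P PB' B in simp_all)
        then show ?case using 1 P PB' B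
          by (simp add: K_def i c i2 c2 ic cc)
      qed
    qed (use t in \<open>simp_all add: K_def\<close>)
  next
    case 15
    let ?l = "(c \<star>\<^bsub>K\<^esub> id2 K (M.T1 (mu comma_monad ?P))) \<bullet>\<^bsub>K\<^esub> (id2 K a \<star>\<^bsub>K\<^esub> M.T2 c)"
      and ?r = "(c \<star>\<^bsub>K\<^esub> id2 K (mu comma_monad (M.T0 ?P))) \<bullet>\<^bsub>K\<^esub> (c \<star>\<^bsub>K\<^esub> id2 K (M.T1 (M.T1 a)))"
    have t: "?l \<in> cells2 K" "?r \<in> cells2 K" "src2 K ?l = src2 K ?r" "tgt2 K ?l = tgt2 K ?r" "src1 K (src2 K ?l) = M.T0 (M.T0 (M.T0 ?P))"
      using tys by (simp_all del: comma_monad_sel)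
    show ?case
    proof (rule CAT_over_parallel_eqI[of _ small B], goal_cases)
      case (5 s)
      then have "s \<in> Obj (comma (Cod_functor (Cod_functor ?P)))" by (simp add: K_def c)
      then show ?case
      proof (rule comma_comma_ObjE, goal_cases)
        case (1 t v w)
        from 1(2) have "t \<in> Obj (comma ?P)" by simp
        then show ?case
        proof (rule comma_ObjE, goal_cases)
          case xu: (1 x u)
          \<comment> \<open>Associativity: on \<delta>_w \<delta>_v \<delta>_u both sides become
            \<delta>_{w v u}, so three lifts are cancelled in turn.\<close>
          have "Cmp ?E (cleavage_chi \<P> x (Cmp B v u) w)
              (amap ?L (tag (Pair (push \<P> (push \<P> x u) v) w) (Pair (push \<P> x (Cmp B v u)) w) (Pair (cleavage_chi \<P> x u v) (Ide B (Cod B w)))))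
              = Cmp ?E (cleavage_chi \<P> x u (Cmp B w v)) (cleavage_chi \<P> (push \<P> x u) v w)"
          proof (rule clv_eqI[OF P, of "push \<P> (push \<P> x u) v" w], goal_cases)
            case 9
            show ?case
            proof (rule clv_eqI[OF P, of "push \<P> x u" v], goal_cases)
              case 9
              show ?case
                by (rule clv_eqI[OF P, of x u]) (use 1 xu P PB' B in simp_all)
            qed (use 1 xu P PB' B in simp_all)
          qed (use 1 xu P PB' B in simp_all)
          then show ?case using 1 xu P PB' B oc
            by (simp add: K_def i c i2 c2 ic cc)
        qed
      qed
    qed (use t in \<open>simp_all add: K_def\<close>)
  qed (use tys in \<open>simp_all del: comma_monad_sel\<close>)
qed

section \<open>Components of whiskered cells and the data of a cloven cofibration\<close>

lemma component_whisker:
  "is_ntrans \<beta> \<Longrightarrow> is_functor F \<Longrightarrow> target F = source (source \<beta>) \<Longrightarrow> x \<in> Obj (source F)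
    \<Longrightarrow> component (hcomp_ntrans \<beta> (id_ntrans F)) x = component \<beta> (omap F x)"
  "is_ntrans \<alpha> \<Longrightarrow> is_functor G \<Longrightarrow> target (source \<alpha>) = source G \<Longrightarrow> x \<in> Obj (source (source \<alpha>))
    \<Longrightarrow> component (hcomp_ntrans (id_ntrans G) \<alpha>) x = amap G (component \<alpha> x)"
  by simp_all

lemma CAT_over_component:
  "over_cell \<alpha> \<Longrightarrow> over_functor T \<Longrightarrow> target T = source (source \<alpha>) \<Longrightarrow> x \<in> Obj (source (source T))
    \<Longrightarrow> component (over2 (\<alpha> \<star>\<^bsub>CAT_over small B\<^esub> id2 (CAT_over small B) T)) x = component (over2 \<alpha>) (omap (over1 T) x)"
  "over_cell \<alpha> \<Longrightarrow> over_functor S \<Longrightarrow> target (source \<alpha>) = source S \<Longrightarrow> x \<in> Obj (source (source (source \<alpha>)))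
    \<Longrightarrow> component (over2 (id2 (CAT_over small B) S \<star>\<^bsub>CAT_over small B\<^esub> \<alpha>)) x = amap (over1 S) (component (over2 \<alpha>) x)"
  unfolding Slice_sel CAT_sel by (intro component_whisker; simp)+

lemma CAT_over_component_vcomp:
  "x \<in> Obj (source (source (over2 \<alpha>))) \<Longrightarrow> E = target (source (over2 \<alpha>))
    \<Longrightarrow> component (over2 (\<beta> \<bullet>\<^bsub>CAT_over small B\<^esub> \<alpha>)) x = Cmp E (component (over2 \<beta>) x) (component (over2 \<alpha>) x)"
  by simp

lemma act_cloven_sel [simp]:
  "under (cloven_to_psalg small B \<P>) = proj \<P>"
  "source (act (cloven_to_psalg small B \<P>)) = Cod_functor (proj \<P>)"
  "target (act (cloven_to_psalg small B \<P>)) = proj \<P>"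
  "over1 (act (cloven_to_psalg small B \<P>)) = cleavage_action \<P>"
  by (simp_all add: cloven_to_psalg_sel)

lemma unitor_cloven_sel [simp]:
  "source (unitor (cloven_to_psalg small B \<P>)) = id1 (CAT_over small B) (proj \<P>)"
  "target (unitor (cloven_to_psalg small B \<P>)) = act (cloven_to_psalg small B \<P>) \<cdot>\<^bsub>CAT_over small B\<^esub> comma_unit (proj \<P>)"
  "source (over2 (unitor (cloven_to_psalg small B \<P>))) = id_functor (source (proj \<P>))"
  "target (over2 (unitor (cloven_to_psalg small B \<P>))) = comp_functor (cleavage_action \<P>) (over1 (comma_unit (proj \<P>)))"
  "x \<in> Obj (source (proj \<P>)) \<Longrightarrow> component (over2 (unitor (cloven_to_psalg small B \<P>))) x = clv \<P> x (Ide B (omap (proj \<P>) x))"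
  by (simp_all add: cloven_to_psalg_sel)

lemma multor_cloven_sel [simp]:
  "source (multor (cloven_to_psalg small B \<P>))
    = act (cloven_to_psalg small B \<P>) \<cdot>\<^bsub>CAT_over small B\<^esub> comma_mor (act (cloven_to_psalg small B \<P>))"
  "target (multor (cloven_to_psalg small B \<P>)) = act (cloven_to_psalg small B \<P>) \<cdot>\<^bsub>CAT_over small B\<^esub> comma_mult (proj \<P>)"
  "source (over2 (multor (cloven_to_psalg small B \<P>)))
    = comp_functor (cleavage_action \<P>) (comma_functor (act (cloven_to_psalg small B \<P>)))"
  "target (over2 (multor (cloven_to_psalg small B \<P>))) = comp_functor (cleavage_action \<P>) (over1 (comma_mult (proj \<P>)))"
  "Pair (Pair x u) v \<in> Obj (comma (Cod_functor (proj \<P>)))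
    \<Longrightarrow> component (over2 (multor (cloven_to_psalg small B \<P>))) (Pair (Pair x u) v) = cleavage_chi \<P> x u v"
  by (simp_all add: cloven_to_psalg_sel)

lemma slice_of_mor_sel [simp]:
  "source (slice_of_mor T) = proj (source T)" "target (slice_of_mor T) = proj (target T)" "over1 (slice_of_mor T) = fun_over T"
  by (simp_all add: slice_of_mor_def)

section \<open>The pseudomorphism of a functor preserving cocartesian arrows\<close>

text \<open>A 1-cell of \<open>ClCoFib\<close> freed from the fixed base and the size condition,
  with preservation stated elementwise; \<open>ClCoFib_cells\<close> gives the translation.\<close>

definition cocartesian_functor :: "'u cloven_mor \<Rightarrow> bool" where
  "cocartesian_functor T \<longleftrightarrow> cloven_cofibration (source T) \<and> cloven_cofibration (target T) \<and> over_functor (slice_of_mor T) \<and>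
     (\<forall>e. cocartesian (proj (source T)) e \<longrightarrow> cocartesian (proj (target T)) (amap (fun_over T) e))"

lemma cocartesian_functor_simps [simp]:
  assumes "cocartesian_functor T"
  shows "cloven_cofibration (source T)" "cloven_cofibration (target T)" "over_functor (slice_of_mor T)"
    "cocartesian (proj (source T)) e \<Longrightarrow> cocartesian (proj (target T)) (amap (fun_over T) e)"
    "is_functor (fun_over T)" "source (fun_over T) = source (proj (source T))" "target (fun_over T) = source (proj (target T))"
    "target (proj (target T)) = target (proj (source T))"
    "Q = proj (target T) \<Longrightarrow> x \<in> Obj (source (proj (source T))) \<Longrightarrow> omap Q (omap (fun_over T) x) = omap (proj (source T)) x"
    "Q = proj (target T) \<Longrightarrow> f \<in> Arr (source (proj (source T))) \<Longrightarrow> amap Q (amap (fun_over T) f) = amap (proj (source T)) f"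
proof -
  have o: "over_functor (slice_of_mor T)" using assms by (simp add: cocartesian_functor_def)
  show "cloven_cofibration (source T)" "cloven_cofibration (target T)" "over_functor (slice_of_mor T)"
    "cocartesian (proj (source T)) e \<Longrightarrow> cocartesian (proj (target T)) (amap (fun_over T) e)"
    using assms by (simp_all add: cocartesian_functor_def)
  show "is_functor (fun_over T)" "source (fun_over T) = source (proj (source T))" "target (fun_over T) = source (proj (target T))"
    "target (proj (target T)) = target (proj (source T))"
    using over_functor_simps[OF o] by simp_all
  show "Q = proj (target T) \<Longrightarrow> x \<in> Obj (source (proj (source T))) \<Longrightarrow> omap Q (omap (fun_over T) x) = omap (proj (source T)) x"
    "Q = proj (target T) \<Longrightarrow> f \<in> Arr (source (proj (source T))) \<Longrightarrow> amap Q (amap (fun_over T) f) = amap (proj (source T)) f"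
    using over_functor_maps[OF o refl] by simp_all
qed

lemma cocartesian_functor_comma_square [simp]:
  "cocartesian_functor T \<Longrightarrow> Q = proj (target T) \<Longrightarrow> comma_square (proj (source T)) x u y w f v
    \<Longrightarrow> comma_square Q (omap (fun_over T) x) u (omap (fun_over T) y) w (amap (fun_over T) f) v"
  using over_functor_comma_square[OF cocartesian_functor_simps(3) refl] by simp

text \<open>The comparison exists because the chosen lift at the image of x is cocartesian. It is
  invertible because the image of \<delta>^x_u under the functor is cocartesian too; this is where
  preservation enters.\<close>

lemma comparison_simps [simp]:
  fixes T :: "'a elt cloven_mor"
  assumes T: "cocartesian_functor T" and xu: "x \<in> Obj (source (proj (source T)))" "u \<in> Arr (target (proj (source T)))"
    "Dom (target (proj (source T))) u = omap (proj (source T)) x" and E: "E = source (proj (target T))"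
  shows "comparison T x u \<in> Arr E" "Dom E (comparison T x u) = push (target T) (omap (fun_over T) x) u"
    "Cod E (comparison T x u) = omap (fun_over T) (push (source T) x u)" "iso E (comparison T x u)"
    "Q = proj (target T) \<Longrightarrow> amap Q (comparison T x u) = Ide (target (proj (source T))) (Cod (target (proj (source T))) u)"
    "Cmp E (comparison T x u) (clv (target T) (omap (fun_over T) x) u) = amap (fun_over T) (clv (source T) x u)"
proof -
  let ?E = "source (proj (target T))" and ?B = "target (proj (source T))" and ?Q = "proj (target T)" and ?F = "fun_over T"
  let ?d = "clv (target T) (omap ?F x) u" and ?e = "amap ?F (clv (source T) x u)"
  let ?R = "\<lambda>h. h \<in> hom ?E (push (target T) (omap ?F x) u) (omap ?F (push (source T) x u)) \<and> iso ?E h \<and>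
       amap ?Q h = Ide ?B (Cod ?B u) \<and> Cmp ?E h ?d = ?e"
  have d: "cocartesian ?Q ?d" "cocartesian ?Q ?e" using assms by simp_all
  obtain h where h: "h \<in> Arr ?E" "Dom ?E h = push (target T) (omap ?F x) u" "Cod ?E h = omap ?F (push (source T) x u)"
    "Cmp ?E h ?d = ?e" "amap ?Q h = Ide ?B (Cod ?B u)"
    by (rule clv_lift[of "target T" "omap ?F x" u ?e "Ide ?B (Cod ?B u)"])
      (use assms is_functor_category(2)[of "proj (source T)"] in simp_all)
  have "iso ?E h"
    by (rule iso_of_cocartesian_factor[OF _ d]) (use assms h is_functor_category(2)[of "proj (source T)"] in \<open>simp_all add: iso_Ide\<close>)
  with h have 1: "?R h" by (simp add: hom_def)
  have "comparison T x u = (THE h. ?R h)"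
    unfolding comparison_def Let_def using T by simp
  also have "\<dots> = h"
  proof (rule the_equality[of ?R, OF 1])
    fix k assume k: "?R k"
    show "k = h" by (rule cocartesian_unique[OF d(1)]) (use assms h k in \<open>simp_all add: hom_def\<close>)
  qed
  finally have "comparison T x u = h" .
  with 1 E show "comparison T x u \<in> Arr E" "Dom E (comparison T x u) = push (target T) (omap (fun_over T) x) u"
    "Cod E (comparison T x u) = omap (fun_over T) (push (source T) x u)" "iso E (comparison T x u)"
    "Q = proj (target T) \<Longrightarrow> amap Q (comparison T x u) = Ide (target (proj (source T))) (Cod (target (proj (source T))) u)"
    "Cmp E (comparison T x u) (clv (target T) (omap (fun_over T) x) u) = amap (fun_over T) (clv (source T) x u)"
    by (simp_all add: hom_def)
qed

lemma comparison_clv [simp]: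
  fixes T :: "'a elt cloven_mor"
  assumes T: "cocartesian_functor T" and xu: "x \<in> Obj (source (proj (source T)))" "u \<in> Arr (target (proj (source T)))"
    "Dom (target (proj (source T))) u = omap (proj (source T)) x" and E: "E = source (proj (target T))"
    and k: "k \<in> Arr E" "Cod E k = omap (fun_over T) x"
  shows "Cmp E (comparison T x u) (Cmp E (clv (target T) (omap (fun_over T) x) u) k)
    = Cmp E (amap (fun_over T) (clv (source T) x u)) k"
  using Cmp_reassoc[OF comparison_simps(6)[OF T xu E], of k] T E k xu by simp

text \<open>The defining equation of the action carried along the functor. It is kept separately
  because functors are distributed over composites, which hides the original equation;
  \<open>image_cleavage_chi_clv\<close> does this for \<chi>.\<close>

lemma image_cleavage_action_clv [simp]:
  assumes T: "cocartesian_functor T" and sq: "comma_square (proj (source T)) x u y w f v" and E: "E = source (proj (target T))"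
  shows "Cmp E (amap (fun_over T) (amap (cleavage_action (source T)) (tag (Pair x u) (Pair y w) (Pair f v))))
      (amap (fun_over T) (clv (source T) x u))
    = Cmp E (amap (fun_over T) (clv (source T) y w)) (amap (fun_over T) f)"
proof -
  let ?P = "proj (source T)"
  let ?h = "amap (cleavage_action (source T)) (tag (Pair x u) (Pair y w) (Pair f v))"
  have "amap (fun_over T) (Cmp (source ?P) ?h (clv (source T) x u)) = amap (fun_over T) (Cmp (source ?P) (clv (source T) y w) f)"
    using T sq by simp
  then show ?thesis using T sq comma_square_Arr[OF sq] E by (simp del: cleavage_action_arrow(5) add: cleavage_action_arrow(1-4))
qed

lemma image_cleavage_chi_clv [simp]:
  fixes T :: "'a elt cloven_mor"
  assumes T: "cocartesian_functor T" and xu: "x \<in> Obj (source (proj (source T)))" "u \<in> Arr (target (proj (source T)))"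
    "Dom (target (proj (source T))) u = omap (proj (source T)) x" and v: "v \<in> Arr (target (proj (source T)))"
    "Dom (target (proj (source T))) v = Cod (target (proj (source T))) u"
    and E: "E = source (proj (target T))"
  shows "Cmp E (amap (fun_over T) (cleavage_chi (source T) x u v))
      (Cmp E (amap (fun_over T) (clv (source T) (push (source T) x u) v)) (amap (fun_over T) (clv (source T) x u)))
    = amap (fun_over T) (clv (source T) x (Cmp (target (proj (source T))) v u))"
proof -
  let ?E = "source (proj (source T))"
  have "amap (fun_over T) (Cmp ?E (cleavage_chi (source T) x u v) (Cmp ?E (clv (source T) (push (source T) x u) v) (clv (source T) x u)))
     = amap (fun_over T) (clv (source T) x (Cmp (target (proj (source T))) v u))"
    using T xu v by simp
  then show ?thesis using T xu v E by (simp del: cleavage_chi_simps(6))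
qed

text \<open>The multiplication law of \<theta> at ((x, u), v), T being the functor. Both sides are
  vertical arrows out of v_!u_!(T x), and on \<delta>_v \<delta>_u both give T \<delta>_{v u}. The
  composite lift is cocartesian, so one uniqueness argument suffices.\<close>

lemma comparison_chi:
  fixes T :: "'a elt cloven_mor"
  assumes T: "cocartesian_functor T" and B: "target (proj (source T)) = B"
    and xu: "x \<in> Obj (source (proj (source T)))" "u \<in> Arr B" "Dom B u = omap (proj (source T)) x"
    and v: "v \<in> Arr B" "Dom B v = Cod B u"
    and E: "E = source (proj (target T))"
  shows "Cmp E (comparison T x (Cmp B v u)) (cleavage_chi (target T) (omap (fun_over T) x) u v)
    = Cmp E (amap (fun_over T) (cleavage_chi (source T) x u v)) (Cmp E (comparison T (push (source T) x u) v)
       (amap (cleavage_action (target T)) (tag (Pair (push (target T) (omap (fun_over T) x) u) v)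
          (Pair (omap (fun_over T) (push (source T) x u)) v) (Pair (comparison T x u) (Ide B (Cod B v))))))"
    (is "Cmp E ?\<theta>vu ?\<chi> = Cmp E ?F\<chi> (Cmp E ?\<theta>v ?l)")
proof -
  let ?F = "fun_over T" and ?P = "proj (source T)" and ?Q = "proj (target T)"
  have P: "cloven_cofibration (source T)" and Q: "cloven_cofibration (target T)" and tQ: "target ?Q = B"
    using T B by simp_all
  have cat: "category E" "category B" using T B E is_functor_category[of ?P] is_functor_category[of ?Q] by simp_all
  have vu: "Cmp B v u \<in> Arr B" "Dom B (Cmp B v u) = omap ?P x" "Cod B (Cmp B v u) = Cod B v"
    using cat xu v by simp_all
  have y: "push (source T) x u \<in> Obj (source ?P)" "omap ?P (push (source T) x u) = Cod B u"
    using P B xu by simp_all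
  have z: "omap ?F x \<in> Obj E" "omap ?Q (omap ?F x) = omap ?P x" using T xu E by simp_all
  have w: "push (target T) (omap ?F x) u \<in> Obj E" "omap ?Q (push (target T) (omap ?F x) u) = Cod B u"
    using Q tQ xu z E by simp_all
  define \<delta>u \<delta>v where "\<delta>u = clv (target T) (omap ?F x) u" and "\<delta>v = clv (target T) (push (target T) (omap ?F x) u) v"
  define \<theta> \<theta>v \<theta>vu \<chi> F\<chi> l where "\<theta> = comparison T x u" and "\<theta>v = ?\<theta>v" and "\<theta>vu = ?\<theta>vu" and "\<chi> = ?\<chi>"
    and "F\<chi> = ?F\<chi>" and "l = ?l"
  have c: "cocartesian ?Q \<delta>u" "cocartesian ?Q \<delta>v" "\<delta>u \<in> Arr E" "\<delta>v \<in> Arr E" "Dom E \<delta>u = omap ?F x"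
    "Cod E \<delta>u = push (target T) (omap ?F x) u" "Dom E \<delta>v = Cod E \<delta>u" "Cod E \<delta>v = push (target T) (push (target T) (omap ?F x) u) v"
    using Q tQ xu v z w E by (simp_all add: \<delta>u_def \<delta>v_def)
  have \<theta>: "\<theta> \<in> Arr E" "Dom E \<theta> = Cod E \<delta>u" "Cod E \<theta> = omap ?F (push (source T) x u)" "amap ?Q \<theta> = Ide B (Cod B u)"
    "Cmp E \<theta> \<delta>u = amap ?F (clv (source T) x u)"
    using comparison_simps[OF T, of x u E] B xu c E by (simp_all add: \<theta>_def \<delta>u_def)
  have \<theta>v: "\<theta>v \<in> Arr E" "Dom E \<theta>v = push (target T) (omap ?F (push (source T) x u)) v"
    "Cod E \<theta>v = omap ?F (push (source T) (push (source T) x u) v)" "amap ?Q \<theta>v = Ide B (Cod B v)"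
    "Cmp E \<theta>v (clv (target T) (omap ?F (push (source T) x u)) v) = amap ?F (clv (source T) (push (source T) x u) v)"
    using comparison_simps[OF T, of "push (source T) x u" v E] B y v E by (simp_all add: \<theta>v_def)
  have \<theta>vu: "\<theta>vu \<in> Arr E" "Dom E \<theta>vu = push (target T) (omap ?F x) (Cmp B v u)"
    "Cod E \<theta>vu = omap ?F (push (source T) x (Cmp B v u))" "amap ?Q \<theta>vu = Ide B (Cod B v)"
    "Cmp E \<theta>vu (clv (target T) (omap ?F x) (Cmp B v u)) = amap ?F (clv (source T) x (Cmp B v u))"
    using comparison_simps[OF T, of x "Cmp B v u" E] B xu vu E by (simp_all add: \<theta>vu_def)
  have \<chi>: "\<chi> \<in> Arr E" "Dom E \<chi> = Cod E \<delta>v" "Cod E \<chi> = Dom E \<theta>vu" "amap ?Q \<chi> = Ide B (Cod B v)"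
    "Cmp E \<chi> (Cmp E \<delta>v \<delta>u) = clv (target T) (omap ?F x) (Cmp B v u)"
    using cleavage_chi_simps[OF Q, of "omap ?F x" u v E] tQ xu v z c \<theta>vu E by (simp_all add: \<chi>_def \<delta>u_def \<delta>v_def)
  define k where "k = cleavage_chi (source T) x u v"
  have k: "k \<in> Arr (source ?P)" "Dom (source ?P) k = push (source T) (push (source T) x u) v"
    "Cod (source ?P) k = push (source T) x (Cmp B v u)" "amap ?P k = Ide B (Cod B v)"
    using cleavage_chi_simps[OF P, of x u v "source ?P"] B xu v by (simp_all add: k_def)
  have F\<chi>1: "F\<chi> \<in> Arr E" "Dom E F\<chi> = Cod E \<theta>v" "Cod E F\<chi> = Cod E \<theta>vu" "amap ?Q F\<chi> = Ide B (Cod B v)"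
    using T k \<theta>v(3) \<theta>vu(3) unfolding F\<chi>_def k_def[symmetric] E by simp_all
  have F\<chi>2: "Cmp E F\<chi> (Cmp E (amap ?F (clv (source T) (push (source T) x u) v)) (amap ?F (clv (source T) x u))) = amap ?F (clv (source T) x (Cmp B v u))"
    unfolding F\<chi>_def B[symmetric] by (rule image_cleavage_chi_clv[OF T]) (use B xu v E in simp_all)
  note F\<chi> = F\<chi>1 F\<chi>2
  have sq: "comma_square ?Q (push (target T) (omap ?F x) u) v (omap ?F (push (source T) x u)) v \<theta> (Ide B (Cod B v))"
    by (rule comma_square_vertical) (use cloven_functor[OF Q] tQ c(6) w(2) \<theta>(1-4) v in \<open>simp_all flip: E\<close>)
  have l: "l \<in> Arr E" "Dom E l = Cod E \<delta>v" "Cod E l = Dom E \<theta>v" "amap ?Q l = Ide B (Cod B v)"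
    "Cmp E l \<delta>v = Cmp E (clv (target T) (omap ?F (push (source T) x u)) v) \<theta>"
    using cleavage_action_arrow[OF Q sq E] c(6-8) \<theta>v(2) unfolding l_def \<theta>_def \<delta>v_def by simp_all
  let ?d = "clv (target T) (omap ?F (push (source T) x u)) v"
  have d: "?d \<in> Arr E" "Dom E ?d = Cod E \<theta>" "Cod E ?d = Dom E \<theta>v"
    using clv_simps(2-4)[OF Q, of "omap ?F (push (source T) x u)" v E] T tQ E v y \<theta>(3) \<theta>v(2) by simp_all
  \<comment> \<open>The inner comparison is moved past \<delta>_v by the defining equation of the
    action and then absorbed by \<delta>_u; \<open>L2\<close> repeats this with the outer
    comparison.\<close>
  have L: "Cmp E l (Cmp E \<delta>v \<delta>u) = Cmp E ?d (amap ?F (clv (source T) x u))"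
    using Cmp_reassoc[OF l(5), of \<delta>u] cat(1) c(3-8) d \<theta> l(1-3) by simp
  have Fc: "amap ?F (clv (source T) x u) \<in> Arr E" "Cod E (amap ?F (clv (source T) x u)) = Cod E \<theta>"
    using T P B xu E \<theta>(3) by simp_all
  have L2: "Cmp E \<theta>v (Cmp E l (Cmp E \<delta>v \<delta>u)) = Cmp E (amap ?F (clv (source T) (push (source T) x u) v)) (amap ?F (clv (source T) x u))"
    unfolding L using Cmp_reassoc[OF \<theta>v(5), of "amap ?F (clv (source T) x u)"] cat(1) \<theta>v(1-3) d Fc by simp
  have "Cmp E \<theta>vu \<chi> = Cmp E F\<chi> (Cmp E \<theta>v l)"
  proof (rule cocartesian_unique[OF cocartesian_Cmp[OF _ c(1,2)]])
    show "Cmp (source ?Q) (Cmp E \<theta>vu \<chi>) (Cmp (source ?Q) \<delta>v \<delta>u) = Cmp (source ?Q) (Cmp E F\<chi> (Cmp E \<theta>v l)) (Cmp (source ?Q) \<delta>v \<delta>u)"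
      unfolding E[symmetric] using cat(1) c(3-8) \<theta>vu(1-3,5) \<theta>v(1-3) F\<chi> \<chi>(1-3,5) l(1-3) L2 by simp
    show "amap ?Q (Cmp E \<theta>vu \<chi>) = amap ?Q (Cmp E F\<chi> (Cmp E \<theta>v l))"
      using Q tQ cat E \<theta>vu(1-4) \<theta>v(1-4) F\<chi>(1-4) \<chi>(1-4) l(1-4) v by simp
  qed (use Q cat c \<theta>vu(1-4) \<theta>v(1-4) F\<chi>(1-4) \<chi>(1-4) l(1-4) in \<open>simp_all flip: E\<close>)
  then show ?thesis by (simp only: \<theta>v_def \<theta>vu_def \<chi>_def F\<chi>_def l_def)
qed

lemma cloven_to_psmor_sel [simp]:
  "source (cloven_to_psmor small B T) = cloven_to_psalg small B (source T)"
  "target (cloven_to_psmor small B T) = cloven_to_psalg small B (target T)"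
  "mor (cloven_to_psmor small B T) = slice_of_mor T"
  "source (mcell (cloven_to_psmor small B T)) = act (cloven_to_psalg small B (target T)) \<cdot>\<^bsub>CAT_over small B\<^esub> comma_mor (slice_of_mor T)"
  "target (mcell (cloven_to_psmor small B T)) = slice_of_mor T \<cdot>\<^bsub>CAT_over small B\<^esub> act (cloven_to_psalg small B (source T))"
  "source (over2 (mcell (cloven_to_psmor small B T))) = comp_functor (cleavage_action (target T)) (comma_functor (slice_of_mor T))"
  "target (over2 (mcell (cloven_to_psmor small B T))) = comp_functor (fun_over T) (cleavage_action (source T))"
  "Pair x u \<in> Obj (comma (proj (source T))) \<Longrightarrow> component (over2 (mcell (cloven_to_psmor small B T))) (Pair x u) = comparison T x u"
  by (simp_all add: cloven_to_psmor_def Let_def del: comma_Obj_Pair)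

text \<open>The unit law is the defining equation of \<theta> at an identity base arrow. The
  multiplication law is \<open>comparison_chi\<close> once the components of the five pasted cells
  are identified.\<close>

lemma pseudomorphism_cloven:
  assumes small: "smallness small" and T: "cocartesian_functor T" and TB: "slice_of_mor T \<in> cells1 (CAT_over small B)"
  shows "pseudomorphism (CAT_over small B) comma_monad (cloven_to_psmor small B T)"
proof -
  define K where "K = CAT_over small B"
  let ?\<P> = "source T" and ?\<Q> = "target T" and ?F = "fun_over T"
  let ?P = "proj ?\<P>" and ?Q = "proj ?\<Q>" and ?A = "cloven_to_psalg small B ?\<P>" and ?A' = "cloven_to_psalg small B ?\<Q>"
  let ?E' = "source ?Q" and ?L = "cleavage_action ?\<P>" and ?L' = "cleavage_action ?\<Q>"
  define f \<phi> where "f = slice_of_mor T" and "\<phi> = mcell (cloven_to_psmor small B T)"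
  interpret M: two_monad K comma_monad unfolding K_def by (rule two_monad_comma_monad[OF small])
  have TB': "target ?P = B" "locally_small small (source ?P)" "locally_small small ?E'" "locally_small small B"
    using TB by (simp_all add: CAT_over_cells)
  have B: "category B" using is_functor_category(2)[of ?P] T TB' by simp
  have P: "cloven_cofibration ?\<P>" and Q: "cloven_cofibration ?\<Q>" using T by simp_all
  have tQ: "target ?Q = B" using T TB' by simp
  have PK: "?P \<in> cells0 (CAT_over small B)" "?Q \<in> cells0 (CAT_over small B)" using P Q TB' tQ by (simp_all add: CAT_over_cells)
  have A: "pseudoalgebra K comma_monad ?A" "pseudoalgebra K comma_monad ?A'"
    using pseudoalgebra_cloven[OF small P PK(1)] pseudoalgebra_cloven[OF small Q PK(2)] by (simp_all add: K_def)
  have of: "over_functor f" and fK: "f \<in> cells1 K" using T TB by (simp_all add: f_def K_def)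
  have f: "source f = ?P" "target f = ?Q" "over1 f = ?F" by (simp_all add: f_def)
  have f1: "src1 K f = ?P" "tgt1 K f = ?Q" using f by (simp_all add: K_def)
  note sel = cloven_to_psmor_sel(4-8)[where small=small and B=B and T=T, folded \<phi>_def f_def]
  have oA: "over_functor (act ?A)" "over_functor (act ?A')"
    using M.pseudoalgebra_cells(2)[OF A(1)] M.pseudoalgebra_cells(2)[OF A(2)] by (simp_all add: K_def CAT_over_cells)
  have "M.T1 f \<in> cells1 K" by (rule M.endo.map1_cells[OF fK])
  then have o0: "act ?A' \<cdot>\<^bsub>K\<^esub> M.T1 f \<in> cells1 K" "f \<cdot>\<^bsub>K\<^esub> act ?A \<in> cells1 K"
    using A fK f1 M.endo.map1_cells[OF fK] by (simp_all del: comma_monad_sel)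
  have n: "is_ntrans (over2 \<phi>)"
    unfolding \<phi>_def cloven_to_psmor_def Let_def psmor.simps slice_cell.simps
  proof (rule is_ntrans_mk_ntrans, goal_cases)
    case (5 s)
    then have "s \<in> Obj (comma ?P)" by simp
    then show ?case by (rule comma_ObjE) (use T P Q in simp)
  next
    case (6 k)
    then have "k \<in> Arr (comma ?P)" by simp
    then show ?case
    proof (rule comma_ArrE, goal_cases)
      case (1 x u y w k v)
      \<comment> \<open>Naturality of \<theta>: with T the functor, both sides give T \<delta>^y_w
        followed by precomposition with T k when tested on the chosen lift.\<close>
      have "Cmp ?E' (comparison T y w) (amap ?L' (tag (Pair (omap ?F x) u) (Pair (omap ?F y) w) (Pair (amap ?F k) v)))
          = Cmp ?E' (amap ?F (amap ?L (tag (Pair x u) (Pair y w) (Pair k v)))) (comparison T x u)"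
        by (rule clv_eqI[OF Q, of "omap ?F x" u]) (use 1 T P Q TB' B in simp_all)
      then show ?case using 1 T P Q by simp
    qed
  qed (use T P Q TB' B in simp_all)
  have o: "over_cell \<phi>"
  proof (rule over_cellI, goal_cases)
    case 1
    then show ?case using o0(1) unfolding sel by (simp add: K_def CAT_over_cells)
  next
    case 2
    then show ?case using o0(2) unfolding sel by (simp add: K_def CAT_over_cells)
  next
    case (8 s)
    then have "s \<in> Obj (comma ?P)" by (simp add: sel f)
    then show ?case by (rule comma_ObjE) (use T P TB' in \<open>simp add: sel f\<close>)
  qed (use P TB' B n in \<open>simp_all add: sel f\<close>)
  have \<phi>K: "\<phi> \<in> cells2 K" unfolding K_def CAT_over_cells using o TB' P by (simp add: sel f locally_small_comma small)
  have \<phi>1: "src2 K \<phi> = act ?A' \<cdot>\<^bsub>K\<^esub> M.T1 f" "tgt2 K \<phi> = f \<cdot>\<^bsub>K\<^esub> act ?A"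
    using sel by (simp_all add: K_def)
  note tys = A PK[folded K_def] fK f1 \<phi>K \<phi>1
  show ?thesis
    unfolding K_def[symmetric]
  proof (rule M.pseudomorphismI, unfold cloven_to_psmor_sel(1-3) f_def[symmetric] \<phi>_def[symmetric], goal_cases)
    case 9
    show ?case unfolding K_def
    proof (rule invertible2_CAT_over)
      show "\<phi> \<in> cells2 (CAT_over small B)" using \<phi>K by (simp add: K_def)
      fix s assume "s \<in> Obj (source (source (source \<phi>)))"
      then have "s \<in> Obj (comma ?P)" by (simp add: sel f)
      then show "iso (source (target (source \<phi>))) (component (over2 \<phi>) s)"
        by (rule comma_ObjE) (use T P Q in \<open>simp add: sel f\<close>)
    qed
  next
    case 10
    let ?l = "(\<phi> \<star>\<^bsub>K\<^esub> id2 K (eta comma_monad (under ?A))) \<bullet>\<^bsub>K\<^esub> (unitor ?A' \<star>\<^bsub>K\<^esub> id2 K f)" and ?r = "id2 K f \<star>\<^bsub>K\<^esub> unitor ?A"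
    have t: "?l \<in> cells2 K" "?r \<in> cells2 K" "src2 K ?l = src2 K ?r" "tgt2 K ?l = tgt2 K ?r"
      using tys by (simp_all del: comma_monad_sel unitor_cloven_sel multor_cloven_sel)
    show ?case
    proof (rule CAT_over_parallel_eqI[of _ small B], goal_cases)
      case (5 x)
      then have "x \<in> Obj (source ?P)" by (simp add: K_def f)
      then show ?case using T P Q TB' B of by (simp add: K_def sel f)
    qed (use t in \<open>simp_all add: K_def\<close>)
  next
    case 11
    let ?l = "(\<phi> \<star>\<^bsub>K\<^esub> id2 K (mu comma_monad (under ?A))) \<bullet>\<^bsub>K\<^esub> (multor ?A' \<star>\<^bsub>K\<^esub> id2 K (M.T1 (M.T1 f)))"
      and ?r = "(id2 K f \<star>\<^bsub>K\<^esub> multor ?A) \<bullet>\<^bsub>K\<^esub> ((\<phi> \<star>\<^bsub>K\<^esub> id2 K (M.T1 (act ?A))) \<bullet>\<^bsub>K\<^esub> (id2 K (act ?A') \<star>\<^bsub>K\<^esub> M.T2 \<phi>))"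
    have t: "?l \<in> cells2 K" "?r \<in> cells2 K" "src2 K ?l = src2 K ?r" "tgt2 K ?l = tgt2 K ?r"
      using tys by (simp_all del: comma_monad_sel unitor_cloven_sel multor_cloven_sel)
    show ?case
    proof (rule CAT_over_parallel_eqI[of _ small B], goal_cases)
      case (5 s)
      then have "s \<in> Obj (comma (Cod_functor ?P))" by (simp add: K_def f)
      then show ?case
      proof (rule comma_comma_ObjE, goal_cases)
        case (1 x u v)
        \<comment> \<open>The equation between explicit components; each of the following claims
          identifies one factor of the pasted cells with a factor occurring in it.\<close>
        have eq: "Cmp ?E' (comparison T x (Cmp B v u)) (cleavage_chi ?\<Q> (omap ?F x) u v)
            = Cmp ?E' (amap ?F (cleavage_chi ?\<P> x u v)) (Cmp ?E' (comparison T (push ?\<P> x u) v)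
               (amap ?L' (tag (Pair (push ?\<Q> (omap ?F x) u) v) (Pair (omap ?F (push ?\<P> x u)) v) (Pair (comparison T x u) (Ide B (Cod B v))))))"
          using 1 TB' by (intro comparison_chi[OF T]) simp_all
        let ?\<mu> = "comma_mult ?P"
        have s: "s \<in> Obj (comma (Cod_functor ?P))" using 1 by simp
        have o: "over_cell \<phi>" "over_cell (comma_cell \<phi>)" "over_cell (multor ?A)" "over_cell (multor ?A')"
          "over_functor f" "over_functor (act ?A)" "over_functor (act ?A')" "over_functor (comma_mor (act ?A))"
          "over_functor (comma_mor f)" "over_functor (comma_mor (comma_mor f))" "over_functor ?\<mu>"
          using o oA of P M.pseudoalgebra_cells(9)[OF A(1)] M.pseudoalgebra_cells(9)[OF A(2)] by (simp_all add: K_def CAT_over_cells)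
        have "component (over2 (multor ?A' \<star>\<^bsub>K\<^esub> id2 K (M.T1 (M.T1 f)))) s = cleavage_chi ?\<Q> (omap ?F x) u v"
          unfolding K_def comma_monad_sel
          by (subst CAT_over_component(1)) (use o s 1 f T P Q TB' tQ in simp_all)
        moreover have "component (over2 (\<phi> \<star>\<^bsub>K\<^esub> id2 K (mu comma_monad (under ?A)))) s = comparison T x (Cmp B v u)"
        proof -
          have "component (over2 (\<phi> \<star>\<^bsub>K\<^esub> id2 K (mu comma_monad (under ?A)))) s = component (over2 \<phi>) (omap (over1 ?\<mu>) s)"
            unfolding K_def comma_monad_sel act_cloven_sel
            by (rule CAT_over_component(1)) (use o(1,11) s f sel in simp_all)
          also have "omap (over1 ?\<mu>) s = Pair x (Cmp B v u)" using 1 s TB' by simp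
          also have "component (over2 \<phi>) (Pair x (Cmp B v u)) = comparison T x (Cmp B v u)"
            by (rule sel(5)) (use 1 TB' B in simp)
          finally show ?thesis .
        qed
        moreover have "component (over2 (id2 K f \<star>\<^bsub>K\<^esub> multor ?A)) s = amap ?F (cleavage_chi ?\<P> x u v)"
        proof -
          have "component (over2 (id2 K f \<star>\<^bsub>K\<^esub> multor ?A)) s = amap (over1 f) (component (over2 (multor ?A)) s)"
            unfolding K_def
            by (rule CAT_over_component(2)) (use o(3,5) s f in simp_all)
          then show ?thesis using s 1 f by simp
        qed
        moreover have "component (over2 (\<phi> \<star>\<^bsub>K\<^esub> id2 K (M.T1 (act ?A)))) s = comparison T (push ?\<P> x u) v"
        proof -
          have "component (over2 (\<phi> \<star>\<^bsub>K\<^esub> id2 K (M.T1 (act ?A)))) s = component (over2 \<phi>) (omap (over1 (comma_mor (act ?A))) s)"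
            unfolding K_def comma_monad_sel
            by (rule CAT_over_component(1)) (use o(1,8) s f sel in simp_all)
          also have "omap (over1 (comma_mor (act ?A))) s = Pair (push ?\<P> x u) v" using 1 s by simp
          also have "component (over2 \<phi>) (Pair (push ?\<P> x u) v) = comparison T (push ?\<P> x u) v"
            by (rule sel(5)) (use 1 P in simp)
          finally show ?thesis .
        qed
        moreover have "component (over2 (id2 K (act ?A') \<star>\<^bsub>K\<^esub> M.T2 \<phi>)) s
            = amap ?L' (tag (Pair (push ?\<Q> (omap ?F x) u) v) (Pair (omap ?F (push ?\<P> x u)) v) (Pair (comparison T x u) (Ide B (Cod B v))))"
        proof -
          have "component (over2 (id2 K (act ?A') \<star>\<^bsub>K\<^esub> M.T2 \<phi>)) s = amap (over1 (act ?A')) (component (over2 (comma_cell \<phi>)) s)"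
            unfolding K_def comma_monad_sel
            by (rule CAT_over_component(2)) (use o(2,7) s f sel in simp_all)
          moreover have "component (over2 (comma_cell \<phi>)) s = tag (Pair (push ?\<Q> (omap ?F x) u) v) (Pair (omap ?F (push ?\<P> x u)) v) (Pair (comparison T x u) (Ide B (Cod B v)))"
          proof -
            have xu: "Pair x u \<in> Obj (comma ?P)" using 1 by simp
            have "omap (over1 (source \<phi>)) (Pair x u) = push ?\<Q> (omap ?F x) u" "omap (over1 (target \<phi>)) (Pair x u) = omap ?F (push ?\<P> x u)"
              using xu T f o(5) unfolding sel by simp_all
            moreover have "component (over2 \<phi>) (Pair x u) = comparison T x u" by (rule sel(5)[OF xu])
            moreover have "source (source \<phi>) = Cod_functor ?P" using f by (simp add: sel)
            ultimately show ?thesis using s 1 TB' by simp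
          qed
          ultimately show ?thesis by simp
        qed
        ultimately show ?case
          using eq s by (simp add: K_def f sel)
      qed
    qed (use t in \<open>simp_all add: K_def\<close>)
  qed (use tys in \<open>simp_all del: comma_monad_sel\<close>)
qed

section \<open>The cleavage of a pseudoalgebra\<close>

text \<open>The \<open>undefined\<close> branch is the value that \<open>cloven_cofibration\<close>
  prescribes off the domain, so the result is an object of \<open>ClCoFib\<close> and not merely a
  cleavage on the relevant pairs.\<close>

definition psalg_cleavage :: "('a elt func, 'a elt func slice_mor, ('a elt func, 'a elt ntrans) slice_cell) psalg \<Rightarrow> 'a elt cloven" where
  "psalg_cleavage A = (let P = under A; E = source P; B = target P in
     \<lparr>proj = P, clv = (\<lambda>x u. if x \<in> Obj E \<and> u \<in> Arr B \<and> Dom B u = omap P x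
        then Cmp E (amap (over1 (act A)) (tag (Pair x (Ide B (omap P x))) (Pair x u) (Pair (Ide E x) u))) (component (over2 (unitor A)) x)
        else undefined)\<rparr>)"

text \<open>An arbitrary pseudoalgebra, with L, I and X standing for the action and the components
  of unit and multiplication. Cocartesian arrows have to be extracted from the algebra laws
  alone.\<close>

locale comma_pseudoalgebra =
  fixes small :: "'a elt set \<Rightarrow> bool" and B :: "'a elt cat" and A
  assumes small: "smallness small" and A: "pseudoalgebra (CAT_over small B) comma_monad A"
begin

abbreviation "P \<equiv> under A"
abbreviation "E \<equiv> source P"
abbreviation "L \<equiv> over1 (act A)"
abbreviation "I \<equiv> component (over2 (unitor A))"
abbreviation "X \<equiv> component (over2 (multor A))"

sublocale M: two_monad "CAT_over small B" comma_monad
  by (rule two_monad_comma_monad[OF small])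

lemma cells: "P \<in> cells0 (CAT_over small B)" "act A \<in> cells1 (CAT_over small B)" "unitor A \<in> cells2 (CAT_over small B)"
  "multor A \<in> cells2 (CAT_over small B)"
  using M.pseudoalgebra_cells[OF A] by blast+

lemma P [simp]: "is_functor P" "target P = B"
  using cells(1) by (simp_all add: CAT_over_cells)

lemma B [simp]: "category B"
  using is_functor_category(2)[OF P(1)] by simp

lemma act [simp]: "over_functor (act A)" "source (act A) = Cod_functor P" "target (act A) = P"
  using cells(2) M.pseudoalgebra_cells(3,4)[OF A] by (simp_all add: CAT_over_cells)

lemma L [simp]: "is_functor L" "source L = comma P" "target L = E"
  using over_functor_simps(3-5)[OF act(1)] by simp_all

lemma unitor [simp]: "over_cell (unitor A)" "source (unitor A) = id1 (CAT_over small B) P"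
  "target (unitor A) = act A \<cdot>\<^bsub>CAT_over small B\<^esub> comma_unit P"
  using cells(3) M.pseudoalgebra_cells(6,7)[OF A] by (simp_all add: CAT_over_cells)

lemma multor [simp]: "over_cell (multor A)" "source (multor A) = act A \<cdot>\<^bsub>CAT_over small B\<^esub> comma_mor (act A)"
  "target (multor A) = act A \<cdot>\<^bsub>CAT_over small B\<^esub> comma_mult P"
  using cells(4) M.pseudoalgebra_cells(10,11)[OF A] by (simp_all add: CAT_over_cells)

lemma amap_L [simp]:
  assumes sq: "comma_square P x u y w f v"
  shows "amap L (tag (Pair x u) (Pair y w) (Pair f v)) \<in> Arr E"
    "Dom E (amap L (tag (Pair x u) (Pair y w) (Pair f v))) = omap L (Pair x u)"
    "Cod E (amap L (tag (Pair x u) (Pair y w) (Pair f v))) = omap L (Pair y w)"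
    "amap P (amap L (tag (Pair x u) (Pair y w) (Pair f v))) = v"
  using sq is_functor_amap[OF L(1) refl, of "tag (Pair x u) (Pair y w) (Pair f v)"]
    over_functor_maps(2)[OF act(1) refl, of "tag (Pair x u) (Pair y w) (Pair f v)"] by simp_all

lemma amap_L_Cmp:
  assumes "comma_square P x u y w f v" "comma_square P y w z t f' v'"
  shows "Cmp E (amap L (tag (Pair y w) (Pair z t) (Pair f' v'))) (amap L (tag (Pair x u) (Pair y w) (Pair f v)))
    = amap L (tag (Pair x u) (Pair z t) (Pair (Cmp E f' f) (Cmp B v' v)))"
  using is_functor_Cmp[OF L(1) refl, of "tag (Pair x u) (Pair y w) (Pair f v)" "tag (Pair y w) (Pair z t) (Pair f' v')"] assms by simp

lemma amap_L_Ide: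
  assumes "x \<in> Obj E" "u \<in> Arr B" "Dom B u = omap P x"
  shows "amap L (tag (Pair x u) (Pair x u) (Pair (Ide E x) (Ide B (Cod B u)))) = Ide E (omap L (Pair x u))"
  using is_functor_Ide[OF L(1) refl, of "Pair x u"] assms by simp

lemma I [simp]:
  assumes "x \<in> Obj E"
  shows "I x \<in> Arr E" "Dom E (I x) = x" "Cod E (I x) = omap L (Pair x (Ide B (omap P x)))" "amap P (I x) = Ide B (omap P x)" "iso E (I x)"
  using assms is_ntrans_component[OF over_cell_simps(5)[OF unitor(1)] refl, of x] over_cell_simps(8)[OF unitor(1) refl, of x]
    iso_of_invertible2_CAT_over[OF M.pseudoalgebra_cells(8)[OF A], of x] by simp_all

lemma I_natural:
  assumes f: "f \<in> Arr E"
  shows "Cmp E (I (Cod E f)) f = Cmp E (amap L (tag (Pair (Dom E f) (Ide B (omap P (Dom E f)))) (Pair (Cod E f) (Ide B (omap P (Cod E f)))) (Pair f (amap P f)))) (I (Dom E f))"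
  using is_ntrans_naturality[OF over_cell_simps(5)[OF unitor(1)], of f] f by simp

lemma X [simp]:
  assumes "x \<in> Obj E" "u \<in> Arr B" "Dom B u = omap P x" "v \<in> Arr B" "Dom B v = Cod B u"
  shows "X (Pair (Pair x u) v) \<in> Arr E" "Dom E (X (Pair (Pair x u) v)) = omap L (Pair (omap L (Pair x u)) v)"
    "Cod E (X (Pair (Pair x u) v)) = omap L (Pair x (Cmp B v u))" "amap P (X (Pair (Pair x u) v)) = Ide B (Cod B v)"
    "iso E (X (Pair (Pair x u) v))"
  using assms is_ntrans_component[OF over_cell_simps(5)[OF multor(1)] refl, of "Pair (Pair x u) v"]
    over_cell_simps(8)[OF multor(1) refl, of "Pair (Pair x u) v"]
    iso_of_invertible2_CAT_over[OF M.pseudoalgebra_cells(12)[OF A], of "Pair (Pair x u) v"] by simp_all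

lemma X_natural:
  assumes sq: "comma_square (Cod_functor P) (Pair x u) v (Pair y w) t (tag (Pair x u) (Pair y w) (Pair f r)) s"
  shows "Cmp E (X (Pair (Pair y w) t)) (amap L (tag (Pair (omap L (Pair x u)) v) (Pair (omap L (Pair y w)) t)
        (Pair (amap L (tag (Pair x u) (Pair y w) (Pair f r))) s)))
    = Cmp E (amap L (tag (Pair x (Cmp B v u)) (Pair y (Cmp B t w)) (Pair f s))) (X (Pair (Pair x u) v))"
proof -
  let ?a = "tag (Pair (Pair x u) v) (Pair (Pair y w) t) (Pair (tag (Pair x u) (Pair y w) (Pair f r)) s)"
  note c = comma_square_Arr[OF sq]
  have sq': "comma_square P x u y w f r" using c by simp
  note c' = comma_square_Arr[OF sq']
  have "Cmp E (X (Pair (Pair y w) t)) (amap (comp_functor L (comma_functor (act A))) ?a)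
    = Cmp E (amap (comp_functor L (over1 (comma_mult P))) ?a) (X (Pair (Pair x u) v))"
    using is_ntrans_naturality[OF over_cell_simps(5)[OF multor(1)], of ?a "Pair (Pair x u) v" "Pair (Pair y w) t"] sq c by simp
  moreover have "amap (comp_functor L (comma_functor (act A))) ?a = amap L (tag (Pair (omap L (Pair x u)) v) (Pair (omap L (Pair y w)) t)
        (Pair (amap L (tag (Pair x u) (Pair y w) (Pair f r))) s))"
    using sq c by simp
  moreover have "amap (comp_functor L (over1 (comma_mult P))) ?a = amap L (tag (Pair x (Cmp B v u)) (Pair y (Cmp B t w)) (Pair f s))"
    using sq c by simp
  ultimately show ?thesis by simp
qed

text \<open>The first unit law at (x, u). Whiskering with the action sends the vertical component of
  the unit to an arrow between values of L, which gives the second factor.\<close>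

lemma unit_axiom1:
  assumes xu: "x \<in> Obj E" "u \<in> Arr B" "Dom B u = omap P x"
  shows "Cmp E (X (Pair (Pair x (Ide B (omap P x))) u))
      (amap L (tag (Pair x u) (Pair (omap L (Pair x (Ide B (omap P x)))) u) (Pair (I x) (Ide B (Cod B u))))) = Ide E (omap L (Pair x u))"
proof -
  let ?K = "CAT_over small B"
  let ?l = "multor A \<star>\<^bsub>?K\<^esub> id2 ?K (comma_mor (comma_unit P))" and ?r = "id2 ?K (act A) \<star>\<^bsub>?K\<^esub> comma_cell (unitor A)"
  have "Ide E (omap L (Pair x u)) = component (over2 (id2 ?K (act A))) (Pair x u)"
    using xu by simp
  also have "\<dots> = component (over2 (?l \<bullet>\<^bsub>?K\<^esub> ?r)) (Pair x u)"
    using M.pseudoalgebra_axioms(1)[OF A] by simp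
  also have "\<dots> = Cmp E (component (over2 ?l) (Pair x u)) (component (over2 ?r) (Pair x u))"
    by (rule CAT_over_component_vcomp) (use xu in simp_all)
  also have "component (over2 ?l) (Pair x u) = X (Pair (Pair x (Ide B (omap P x))) u)"
    by (subst CAT_over_component(1)) (use xu in simp_all)
  also have "component (over2 ?r) (Pair x u)
     = amap L (tag (Pair x u) (Pair (omap L (Pair x (Ide B (omap P x)))) u) (Pair (I x) (Ide B (Cod B u))))"
    by (subst CAT_over_component(2)) (use xu in simp_all)
  finally show ?thesis by simp
qed

lemma unit_axiom2:
  assumes xu: "x \<in> Obj E" "u \<in> Arr B" "Dom B u = omap P x"
  shows "Cmp E (X (Pair (Pair x u) (Ide B (Cod B u)))) (I (omap L (Pair x u))) = Ide E (omap L (Pair x u))"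
proof -
  let ?K = "CAT_over small B"
  let ?l = "multor A \<star>\<^bsub>?K\<^esub> id2 ?K (comma_unit (Cod_functor P))" and ?r = "unitor A \<star>\<^bsub>?K\<^esub> id2 ?K (act A)"
  have "Ide E (omap L (Pair x u)) = component (over2 (id2 ?K (act A))) (Pair x u)"
    using xu by simp
  also have "\<dots> = component (over2 (?l \<bullet>\<^bsub>?K\<^esub> ?r)) (Pair x u)"
    using M.pseudoalgebra_axioms(2)[OF A] by simp
  also have "\<dots> = Cmp E (component (over2 ?l) (Pair x u)) (component (over2 ?r) (Pair x u))"
    by (rule CAT_over_component_vcomp) (use xu in simp_all)
  also have "component (over2 ?l) (Pair x u) = X (Pair (Pair x u) (Ide B (Cod B u)))"
    by (subst CAT_over_component(1)) (use xu in simp_all)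
  also have "component (over2 ?r) (Pair x u) = I (omap L (Pair x u))"
    by (subst CAT_over_component(1)) (use xu in simp_all)
  finally show ?thesis by simp
qed

abbreviation \<delta> where "\<delta> x u \<equiv> clv (psalg_cleavage A) x u"

lemma proj_cleavage [simp]: "proj (psalg_cleavage A) = P"
  by (simp add: psalg_cleavage_def Let_def)

lemma square_of_arrow [simp]:
  assumes "x \<in> Obj E" "u \<in> Arr B" "Dom B u = omap P x"
  shows "comma_square P x (Ide B (omap P x)) x u (Ide E x) u"
  using assms by (simp add: comma_square_def)

lemma \<delta>_eq:
  assumes "x \<in> Obj E" "u \<in> Arr B" "Dom B u = omap P x"
  shows "\<delta> x u = Cmp E (amap L (tag (Pair x (Ide B (omap P x))) (Pair x u) (Pair (Ide E x) u))) (I x)"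
  using assms by (simp add: psalg_cleavage_def Let_def)

lemma \<delta>_simps:
  assumes "x \<in> Obj E" "u \<in> Arr B" "Dom B u = omap P x"
  shows "\<delta> x u \<in> Arr E" "Dom E (\<delta> x u) = x" "Cod E (\<delta> x u) = omap L (Pair x u)" "amap P (\<delta> x u) = u"
  using assms by (simp_all add: \<delta>_eq)

lemma \<delta>_square:
  assumes "x \<in> Obj E" "u \<in> Arr B" "Dom B u = omap P x"
  shows "comma_square P x u (omap L (Pair x u)) (Ide B (Cod B u)) (\<delta> x u) (Ide B (Cod B u))"
  using assms by (simp add: comma_square_def \<delta>_simps)

text \<open>In the comma category (f, v)(1_x, u) = (1_y, w)(f, P f), since v u = w P f. Apply the
  action and move \<iota> across by its naturality at f.\<close>

lemma action_\<delta>: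
  assumes sq: "comma_square P x u y w f v"
  shows "Cmp E (amap L (tag (Pair x u) (Pair y w) (Pair f v))) (\<delta> x u) = Cmp E (\<delta> y w) f"
proof -
  note c = comma_square_Arr[OF sq, simplified] comma_square_eq[OF sq, simplified]
  let ?h = "amap L (tag (Pair x u) (Pair y w) (Pair f v))"
  let ?a = "amap L (tag (Pair x (Ide B (omap P x))) (Pair x u) (Pair (Ide E x) u))"
  let ?b = "amap L (tag (Pair y (Ide B (omap P y))) (Pair y w) (Pair (Ide E y) w))"
  let ?k = "amap L (tag (Pair x (Ide B (omap P x))) (Pair y (Ide B (omap P y))) (Pair f (amap P f)))"
  have sqs: "comma_square P x (Ide B (omap P x)) x u (Ide E x) u" "comma_square P y (Ide B (omap P y)) y w (Ide E y) w"
    "comma_square P x (Ide B (omap P x)) y (Ide B (omap P y)) f (amap P f)"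
    using c by simp_all
  have 1: "Cmp E ?h ?a = Cmp E ?b ?k"
    using amap_L_Cmp[OF sqs(1) sq] amap_L_Cmp[OF sqs(3,2)] c by simp
  have 2: "Cmp E ?k (I x) = Cmp E (I y) f"
    using I_natural[of f] c by simp
  note t = amap_L[OF sqs(1)] amap_L[OF sqs(2)] amap_L[OF sqs(3)] amap_L[OF sq]
  have "Cmp E ?h (\<delta> x u) = Cmp E (Cmp E ?b ?k) (I x)"
    using \<delta>_eq[of x u] c t Cmp_reassoc[OF 1, of "I x"] by simp
  also have "\<dots> = Cmp E ?b (Cmp E (I y) f)" using c t by (simp add: 2)
  also have "\<dots> = Cmp E (\<delta> y w) f" using \<delta>_eq[of y w] c t by simp
  finally show ?thesis .
qed

text \<open>Write (\<delta>, 1) as (k, 1)(\<iota>_x, 1) with k = a(1_x, u). Naturality of \<chi>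
  removes k and leaves the composite of the first unit law, so \<chi> a(\<delta>, 1) = 1. The second
  unit law gives \<chi> \<iota> = 1, and \<chi> is invertible.\<close>

lemma action_of_\<delta>:
  assumes xu: "x \<in> Obj E" "u \<in> Arr B" "Dom B u = omap P x"
  shows "amap L (tag (Pair x u) (Pair (omap L (Pair x u)) (Ide B (Cod B u))) (Pair (\<delta> x u) (Ide B (Cod B u)))) = I (omap L (Pair x u))"
    (is "?l = _")
proof (rule iso_cancel[of E "X (Pair (Pair x u) (Ide B (Cod B u)))"])
  let ?e = "Ide B (omap P x)" and ?b = "Ide B (Cod B u)" and ?a = "omap L (Pair x (Ide B (omap P x)))"
  let ?k = "amap L (tag (Pair x ?e) (Pair x u) (Pair (Ide E x) u))"
  have a: "?a \<in> Obj E" "omap P ?a = omap P x" using xu by simp_all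
  have s1: "comma_square P x u ?a u (I x) ?b" using xu a by (intro comma_square_vertical) simp_all
  have s2: "comma_square P ?a u (omap L (Pair x u)) ?b ?k ?b" using xu a by (simp add: comma_square_def)
  have "?l = Cmp E (amap L (tag (Pair ?a u) (Pair (omap L (Pair x u)) ?b) (Pair ?k ?b))) (amap L (tag (Pair x u) (Pair ?a u) (Pair (I x) ?b)))"
    using amap_L_Cmp[OF s1 s2] xu by (simp add: \<delta>_eq)
  \<comment> \<open>The arrow at which \<chi> is taken natural: ((x, 1), u) -> ((x, u), 1) with
    parts (1_x, u) and an identity. Its image on the multiplied side is an identity, so only \<chi>
    itself remains there.\<close>
  moreover have "comma_square (Cod_functor P) (Pair x ?e) u (Pair x u) ?b (tag (Pair x ?e) (Pair x u) (Pair (Ide E x) u)) ?b"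
    using xu by (simp add: comma_square_def[of "Cod_functor P"])
  from X_natural[OF this] have "Cmp E (X (Pair (Pair x u) ?b)) (amap L (tag (Pair ?a u) (Pair (omap L (Pair x u)) ?b) (Pair ?k ?b)))
     = X (Pair (Pair x ?e) u)"
    using xu by (simp add: amap_L_Ide)
  ultimately have "Cmp E (X (Pair (Pair x u) ?b)) ?l = Cmp E (X (Pair (Pair x ?e) u)) (amap L (tag (Pair x u) (Pair ?a u) (Pair (I x) ?b)))"
    using Cmp_reassoc[of E "X (Pair (Pair x u) ?b)" "amap L (tag (Pair ?a u) (Pair (omap L (Pair x u)) ?b) (Pair ?k ?b))" "X (Pair (Pair x ?e) u)"
        "amap L (tag (Pair x u) (Pair ?a u) (Pair (I x) ?b))"] xu amap_L[OF s1] amap_L[OF s2] by simp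
  then show "Cmp E (X (Pair (Pair x u) ?b)) ?l = Cmp E (X (Pair (Pair x u) ?b)) (I (omap L (Pair x u)))"
    using unit_axiom1[OF xu] unit_axiom2[OF xu] by simp
qed (use xu \<delta>_square[OF xu] in simp_all)

text \<open>For existence, \<iota>_z^{-1} a(g, v) is a lift of g over v. For uniqueness,
  \<open>action_of_\<delta>\<close> makes \<iota> k depend only on k \<delta> and P k, and \<iota>
  is invertible.\<close>

lemma cocartesian_\<delta>:
  assumes xu: "x \<in> Obj E" "u \<in> Arr B" "Dom B u = omap P x"
  shows "cocartesian P (\<delta> x u)"
proof (rule cocartesianI)
  note d = \<delta>_simps[OF xu]
  show "\<delta> x u \<in> Arr E" by (rule d)
  {
    fix g v assume g: "g \<in> Arr E" "Dom E g = Dom E (\<delta> x u)" "v \<in> Arr (target P)" "Dom (target P) v = omap P (Cod E (\<delta> x u))"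
      "Cod (target P) v = omap P (Cod E g)" "amap P g = Cmp (target P) v (amap P (\<delta> x u))"
    let ?z = "Cod E g" and ?e = "Ide B (omap P (Cod E g))"
    have sq: "comma_square P x u ?z ?e g v" using g xu d by (simp add: comma_square_def)
    let ?l = "amap L (tag (Pair x u) (Pair ?z ?e) (Pair g v))"
    have z: "?z \<in> Obj E" using g by simp
    note i = iso_inv_arr[OF is_functor_category(1)[OF P(1)] I(5)[OF z]]
    \<comment> \<open>At an identity base arrow the action contributes an identity, so the candidate
      lift is \<iota> itself. This converts \<open>action_\<delta>\<close> for (g, v) into an
      equation with \<iota>_z g.\<close>
    have "\<delta> ?z ?e = I ?z"
      using z amap_L_Ide[of ?z ?e] by (simp add: \<delta>_eq)
    then have l: "Cmp E ?l (\<delta> x u) = Cmp E (I ?z) g" using action_\<delta>[OF sq] by simp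
    have Pi: "amap P (inv_arr E (I ?z)) = ?e"
    proof -
      have "amap P (Cmp E (I ?z) (inv_arr E (I ?z))) = ?e" unfolding i(6) using z by simp
      moreover have "amap P (Cmp E (I ?z) (inv_arr E (I ?z))) = amap P (inv_arr E (I ?z))" using i(2-4) z by simp
      ultimately show ?thesis by simp
    qed
    show "\<exists>h. h \<in> Arr E \<and> Dom E h = Cod E (\<delta> x u) \<and> Cod E h = Cod E g \<and> Cmp E h (\<delta> x u) = g \<and> amap P h = v"
      using amap_L[OF sq] i d xu z l Pi g Cmp_reassoc[OF i(5), of g]
      by (intro exI[of _ "Cmp E (inv_arr E (I ?z)) ?l"]) simp
  next
    fix h h' assume h: "h \<in> Arr E" "h' \<in> Arr E" "Dom E h = Cod E (\<delta> x u)" "Dom E h' = Cod E (\<delta> x u)" "Cod E h = Cod E h'"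
      "Cmp E h (\<delta> x u) = Cmp E h' (\<delta> x u)" "amap P h = amap P h'"
    let ?b = "Ide B (Cod B u)" and ?y = "omap L (Pair x u)"
    \<comment> \<open>Naturality of \<iota> at k produces a(k, P k) \<iota>; replacing this \<iota>
      by a(\<delta>, 1) merges the two values of the action into one that sees k only through k
      \<delta> and P k.\<close>
    have key: "Cmp E (I (Cod E k)) k = amap L (tag (Pair x u) (Pair (Cod E k) (Ide B (omap P (Cod E k)))) (Pair (Cmp E k (\<delta> x u)) (amap P k)))"
      if k: "k \<in> Arr E" "Dom E k = ?y" for k
    proof -
      have sq: "comma_square P ?y ?b (Cod E k) (Ide B (omap P (Cod E k))) k (amap P k)"
        using k xu by (simp add: comma_square_def)
      have "Cmp E (I (Cod E k)) k = Cmp E (amap L (tag (Pair ?y ?b) (Pair (Cod E k) (Ide B (omap P (Cod E k)))) (Pair k (amap P k)))) (I ?y)"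
        using I_natural[OF k(1)] k(2) xu by simp
      also have "\<dots> = amap L (tag (Pair x u) (Pair (Cod E k) (Ide B (omap P (Cod E k)))) (Pair (Cmp E k (\<delta> x u)) (amap P k)))"
        unfolding action_of_\<delta>[OF xu, symmetric] using amap_L_Cmp[OF \<delta>_square[OF xu] sq] k xu
          is_functor_amap(2)[OF P(1) refl k(1)] by simp
      finally show ?thesis .
    qed
    have "Cmp E (I (Cod E h')) h = Cmp E (I (Cod E h')) h'"
      using key[of h] key[of h'] h d by simp
    then show "h = h'"
      using h by (rule_tac iso_cancel[of E "I (Cod E h')"]) simp_all
  }
qed

lemma cloven_cleavage: "cloven_cofibration (psalg_cleavage A)"
  unfolding cloven_cofibration_def Let_def proj_cleavage
  using cocartesian_\<delta> \<delta>_simps by (auto simp: psalg_cleavage_def Let_def)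

text \<open>This equation characterises the multiplication cell of the cleavage. Naturality of
  \<chi> at an arrow ((x, u), 1) -> ((x, u), v) and the second unit law give \<chi>
  \<delta>^{u_!x}_v = a(1_x, v); \<open>action_\<delta>\<close> finishes.\<close>

lemma X_\<delta>:
  assumes xu: "x \<in> Obj E" "u \<in> Arr B" "Dom B u = omap P x" and v: "v \<in> Arr B" "Dom B v = Cod B u"
  shows "Cmp E (X (Pair (Pair x u) v)) (Cmp E (\<delta> (omap L (Pair x u)) v) (\<delta> x u)) = \<delta> x (Cmp B v u)"
proof -
  let ?y = "omap L (Pair x u)" and ?b = "Ide B (Cod B u)"
  have y: "?y \<in> Obj E" "omap P ?y = Cod B u" using xu by simp_all
  have sq: "comma_square P x u x (Cmp B v u) (Ide E x) v" using xu v by (simp add: comma_square_def)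
  let ?k = "amap L (tag (Pair x u) (Pair x (Cmp B v u)) (Pair (Ide E x) v))"
  have "comma_square (Cod_functor P) (Pair x u) ?b (Pair x u) v (tag (Pair x u) (Pair x u) (Pair (Ide E x) ?b)) v"
    using xu v by (simp add: comma_square_def[of "Cod_functor P"])
  from X_natural[OF this]
  have 1: "Cmp E (X (Pair (Pair x u) v)) (amap L (tag (Pair ?y ?b) (Pair ?y v) (Pair (Ide E ?y) v))) = Cmp E ?k (X (Pair (Pair x u) ?b))"
    using xu v by (simp add: amap_L_Ide)
  have s: "comma_square P ?y ?b ?y v (Ide E ?y) v" using y v xu by (simp add: comma_square_def)
  note ms = amap_L[OF s]
  have "\<delta> ?y v = Cmp E (amap L (tag (Pair ?y ?b) (Pair ?y v) (Pair (Ide E ?y) v))) (I ?y)"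
    using \<delta>_eq[of ?y v] y v by simp
  moreover have "Cmp E (X (Pair (Pair x u) v)) (Cmp E (amap L (tag (Pair ?y ?b) (Pair ?y v) (Pair (Ide E ?y) v))) (I ?y))
      = Cmp E (Cmp E ?k (X (Pair (Pair x u) ?b))) (I ?y)"
    by (rule Cmp_reassoc[OF 1]) (use X[OF xu v] ms I[OF y(1)] y(2) in simp_all)
  moreover have "Cmp E (Cmp E ?k (X (Pair (Pair x u) ?b))) (I ?y) = Cmp E ?k (Cmp E (X (Pair (Pair x u) ?b)) (I ?y))"
    using X[OF xu, of ?b] amap_L[OF sq] I[OF y(1)] y(2) xu v by (intro category_Cmp_assoc) simp_all
  moreover have "\<dots> = ?k" unfolding unit_axiom2[OF xu] using amap_L[OF sq] by simp
  \<comment> \<open>The arrow \<open>?k\<close> is the value of the action at (1_x, v) : (x, u) ->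
    (x, v u), so the remaining factor \<delta>^x_u is absorbed by
    \<open>action_\<delta>\<close>.\<close>
  ultimately have 2: "Cmp E (X (Pair (Pair x u) v)) (\<delta> ?y v) = ?k" by simp
  have vu: "Cmp B v u \<in> Arr B" "Dom B (Cmp B v u) = omap P x" using xu v by simp_all
  have "Cmp E (X (Pair (Pair x u) v)) (Cmp E (\<delta> ?y v) (\<delta> x u)) = Cmp E ?k (\<delta> x u)"
    using Cmp_reassoc[OF 2, of "\<delta> x u"] xu v y \<delta>_simps[OF xu] \<delta>_simps[of ?y v] by simp
  also have "\<dots> = \<delta> x (Cmp B v u)" using action_\<delta>[OF sq] \<delta>_simps[OF xu(1) vu] by simp
  finally show ?thesis .
qed

lemma push_cleavage [simp]:
  assumes "x \<in> Obj E" "u \<in> Arr B" "Dom B u = omap P x"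
  shows "push (psalg_cleavage A) x u = omap L (Pair x u)"
  using \<delta>_simps[OF assms] by (simp add: push_def)

text \<open>Surjectivity on objects. The unit is recovered as the lift of an identity, the action
  and the multiplication as the unique arrows with their values on chosen lifts.\<close>

lemma cloven_to_psalg_cleavage: "cloven_to_psalg small B (psalg_cleavage A) = A"
proof -
  let ?\<P> = "psalg_cleavage A" and ?A = "cloven_to_psalg small B (psalg_cleavage A)"
  have A': "pseudoalgebra (CAT_over small B) comma_monad ?A"
    using cells(1) cloven_cleavage by (intro pseudoalgebra_cloven small) simp_all
  have L': "cleavage_action ?\<P> = L"
  proof (rule functor_eqI, goal_cases)
    case 1
    then show ?case using cloven_cleavage by simp
  next
    case (5 s)
    then have "s \<in> Obj (comma P)" by simp
    then show ?case by (rule comma_ObjE) simp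
  next
    case (6 a)
    then have "a \<in> Arr (comma P)" by simp
    then show ?case
    proof (rule comma_ArrE, goal_cases)
      case (1 x u y w f v)
      have sq: "comma_square (proj ?\<P>) x u y w f v" using 1 by simp
      have "amap (cleavage_action ?\<P>) (tag (Pair x u) (Pair y w) (Pair f v)) = amap L (tag (Pair x u) (Pair y w) (Pair f v))"
        by (rule clv_eqI[OF cloven_cleavage, of x u])
          (use 1 cleavage_action_arrow[OF cloven_cleavage sq refl] action_\<delta>[OF 1(2)] in simp_all)
      then show ?case using 1 by simp
    qed
  qed simp_all
  have a: "act ?A = act A" by (rule slice_mor_eqI) (simp_all add: L')
  have i: "unitor ?A = unitor A"
  proof (rule CAT_over_parallel_eqI[OF M.pseudoalgebra_cells(5)[OF A'] cells(3)], goal_cases)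
    case (3 x)
    then have "x \<in> Obj E" by simp
    then show ?case using amap_L_Ide[of x "Ide B (omap P x)"] by (simp add: \<delta>_eq)
  qed (simp_all add: a)
  have c: "multor ?A = multor A"
  proof (rule CAT_over_parallel_eqI[OF M.pseudoalgebra_cells(9)[OF A'] cells(4)], goal_cases)
    case (3 s)
    then have "s \<in> Obj (comma (Cod_functor P))" by simp
    then show ?case
    proof (rule comma_comma_ObjE, goal_cases)
      case (1 x u v)
      have xuv: "x \<in> Obj E" "u \<in> Arr B" "Dom B u = omap P x" "v \<in> Arr B" "Dom B v = Cod B u" using 1 by simp_all
      have y: "omap L (Pair x u) \<in> Obj E" "omap P (omap L (Pair x u)) = Cod B u" using xuv(1-3) by simp_all
      have vu: "Cmp B v u \<in> Arr B" "Dom B (Cmp B v u) = omap P x" using xuv by simp_all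
      have p: "push ?\<P> x u = omap L (Pair x u)" "push ?\<P> (omap L (Pair x u)) v = omap L (Pair (omap L (Pair x u)) v)"
        "push ?\<P> x (Cmp B v u) = omap L (Pair x (Cmp B v u))"
        using push_cleavage[OF xuv(1-3)] push_cleavage[OF y(1) xuv(4)] push_cleavage[OF xuv(1) vu] xuv(5) y(2) by simp_all
      note chi = cleavage_chi_simps[OF cloven_cleavage, unfolded proj_cleavage P(2), OF xuv refl, unfolded p]
      have d: "cocartesian P (Cmp E (\<delta> (omap L (Pair x u)) v) (\<delta> x u))"
        using cocartesian_\<delta>[OF xuv(1-3)] cocartesian_\<delta>[OF y(1) xuv(4)] \<delta>_simps[OF xuv(1-3)] \<delta>_simps[OF y(1) xuv(4)] y(2) xuv(5)
        by (intro cocartesian_Cmp) simp_all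
      \<comment> \<open>Both arrows are vertical and agree on the composite of two chosen lifts, by
        the defining equation on one side and \<open>X_\<delta>\<close> on the other.\<close>
      have "cleavage_chi ?\<P> x u v = X (Pair (Pair x u) v)"
        by (rule cocartesian_unique[OF d P(1)])
          (use chi(1-3) chi(5)[OF refl] chi(6) X[OF xuv] X_\<delta>[OF xuv] \<delta>_simps[OF xuv(1-3)] \<delta>_simps[OF y(1) xuv(4)] y(2) xuv(5) in simp_all)
      then show ?case using 1 by simp
    qed
  qed (simp_all add: a)
  show ?thesis using a i c by (simp add: psalg.equality)
qed

end

section \<open>Cloven cofibrations are the pseudoalgebras of the comma 2-monad\<close>

lemma ClCoFib_sel [simp]:
  "src1 (ClCoFib small B) = source" "tgt1 (ClCoFib small B) = target"
  "src2 (ClCoFib small B) = source" "tgt2 (ClCoFib small B) = target"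
  "id1 (ClCoFib small B) \<P> = \<lparr>source = \<P>, target = \<P>, fun_over = id_functor (source (proj \<P>))\<rparr>"
  "id2 (ClCoFib small B) T = \<lparr>source = T, target = T, trans_over = id_ntrans (fun_over T)\<rparr>"
  "S \<cdot>\<^bsub>ClCoFib small B\<^esub> T = \<lparr>source = source T, target = target S, fun_over = comp_functor (fun_over S) (fun_over T)\<rparr>"
  "\<beta> \<bullet>\<^bsub>ClCoFib small B\<^esub> \<alpha> = \<lparr>source = source \<alpha>, target = target \<beta>, trans_over = vcomp_ntrans (trans_over \<beta>) (trans_over \<alpha>)\<rparr>"
  "\<beta> \<star>\<^bsub>ClCoFib small B\<^esub> \<alpha> = \<lparr>source = source \<beta> \<cdot>\<^bsub>ClCoFib small B\<^esub> source \<alpha>, target = target \<beta> \<cdot>\<^bsub>ClCoFib small B\<^esub> target \<alpha>,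
     trans_over = hcomp_ntrans (trans_over \<beta>) (trans_over \<alpha>)\<rparr>"
  by (simp_all add: ClCoFib_def Let_def)

lemma ClCoFib_cells:
  "\<P> \<in> cells0 (ClCoFib small B) \<longleftrightarrow> cloven_cofibration \<P> \<and> proj \<P> \<in> cells0 (CAT_over small B)"
  "T \<in> cells1 (ClCoFib small B) \<longleftrightarrow> cocartesian_functor T \<and> slice_of_mor T \<in> cells1 (CAT_over small B)"
  "\<alpha> \<in> cells2 (ClCoFib small B) \<longleftrightarrow> source \<alpha> \<in> cells1 (ClCoFib small B) \<and> target \<alpha> \<in> cells1 (ClCoFib small B) \<and>
     source (source \<alpha>) = source (target \<alpha>) \<and> target (source \<alpha>) = target (target \<alpha>) \<and>
     slice_of_cell \<alpha> \<in> cells2 (CAT_over small B)"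
proof -
  show "\<P> \<in> cells0 (ClCoFib small B) \<longleftrightarrow> cloven_cofibration \<P> \<and> proj \<P> \<in> cells0 (CAT_over small B)" for \<P> :: "'a cloven"
    by (simp add: ClCoFib_def Let_def)
  note c0 = this
  have "T \<in> cells1 (ClCoFib small B) \<longleftrightarrow> source T \<in> cells0 (ClCoFib small B) \<and> target T \<in> cells0 (ClCoFib small B) \<and>
      slice_of_mor T \<in> cells1 (CAT_over small B) \<and> amap (fun_over T) ` CoCart (proj (source T)) \<subseteq> CoCart (proj (target T))"
    by (simp add: ClCoFib_def Let_def)
  moreover have "proj (source T) \<in> cells0 (CAT_over small B)" "proj (target T) \<in> cells0 (CAT_over small B)"
    "over_functor (slice_of_mor T)" if "slice_of_mor T \<in> cells1 (CAT_over small B)"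
    using that over_functor_simps(1,2,6)[of "slice_of_mor T"] by (simp_all add: CAT_over_cells)
  ultimately show "T \<in> cells1 (ClCoFib small B) \<longleftrightarrow> cocartesian_functor T \<and> slice_of_mor T \<in> cells1 (CAT_over small B)"
    unfolding c0 cocartesian_functor_def CoCart_def by blast
  show "\<alpha> \<in> cells2 (ClCoFib small B) \<longleftrightarrow> source \<alpha> \<in> cells1 (ClCoFib small B) \<and> target \<alpha> \<in> cells1 (ClCoFib small B) \<and>
     source (source \<alpha>) = source (target \<alpha>) \<and> target (source \<alpha>) = target (target \<alpha>) \<and>
     slice_of_cell \<alpha> \<in> cells2 (CAT_over small B)"
    by (simp add: ClCoFib_def Let_def)
qed

lemma slice_of_cell_sel [simp]:
  "source (slice_of_cell \<alpha>) = slice_of_mor (source \<alpha>)" "target (slice_of_cell \<alpha>) = slice_of_mor (target \<alpha>)"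
  "over2 (slice_of_cell \<alpha>) = trans_over \<alpha>"
  by (simp_all add: slice_of_cell_def)

text \<open>The cleavage can be read off the pseudoalgebra: \<delta>^x_u is the action at (1_x, u)
  composed with \<delta>^x_1, and the latter is the unit. Off the domain both cleavages take the
  prescribed default value.\<close>

lemma cloven_to_psalg_inj:
  assumes P: "cloven_cofibration \<P>" and Q: "cloven_cofibration \<Q>" and t: "target (proj \<P>) = B"
    and eq: "cloven_to_psalg small B \<P> = cloven_to_psalg small B \<Q>"
  shows "\<P> = \<Q>"
proof -
  have p: "proj \<Q> = proj \<P>" using act_cloven_sel(1)[of small B] eq by metis
  have L: "cleavage_action \<Q> = cleavage_action \<P>" using act_cloven_sel(4)[of small B] eq by metis
  have B: "category B" using is_functor_category(2)[of "proj \<P>"] P t by simp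
  have "clv \<P> x u = clv \<Q> x u" for x u
  proof (cases "x \<in> Obj (source (proj \<P>)) \<and> u \<in> Arr B \<and> Dom B u = omap (proj \<P>) x")
    case True
    let ?e = "Ide B (omap (proj \<P>) x)"
    have sq: "comma_square (proj \<P>) x ?e x u (Ide (source (proj \<P>)) x) u"
      using True P t B by (simp add: comma_square_def)
    have i: "clv \<P> x ?e = clv \<Q> x ?e"
      using unitor_cloven_sel(5)[of x \<P> small B] unitor_cloven_sel(5)[of x \<Q> small B] True eq p by simp
    have "clv \<P> x u = Cmp (source (proj \<P>)) (amap (cleavage_action \<P>) (tag (Pair x ?e) (Pair x u) (Pair (Ide (source (proj \<P>)) x) u))) (clv \<P> x ?e)"
      using cleavage_action_arrow(5)[OF P sq refl] P True t by simp
    moreover have "clv \<Q> x u = Cmp (source (proj \<P>)) (amap (cleavage_action \<Q>) (tag (Pair x ?e) (Pair x u) (Pair (Ide (source (proj \<P>)) x) u))) (clv \<Q> x ?e)"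
      using cleavage_action_arrow(5)[OF Q, unfolded p, OF sq refl] clv_simps(2,3)[OF Q, unfolded p, of x u] P Q True t by simp
    ultimately show ?thesis using i L by simp
  next
    case False
    then have "clv \<P> x u = undefined" "clv \<Q> x u = undefined"
      using P[unfolded cloven_cofibration_def Let_def, THEN conjunct2, rule_format, of x u]
        Q[unfolded cloven_cofibration_def Let_def, THEN conjunct2, rule_format, of x u] t p by auto
    then show ?thesis by simp
  qed
  then have "clv \<P> = clv \<Q>" by blast
  with p show ?thesis by simp
qed

text \<open>The cell of an arbitrary pseudomorphism has the properties defining \<theta>. Its unit
  law fixes the value at (x, 1), and naturality along (1_x, u) transports this to (x, u).\<close>

lemma mcell_clv:
  assumes small: "smallness small" and F: "pseudomorphism (CAT_over small B) comma_monad F"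
    and st: "source F = cloven_to_psalg small B \<P>" "target F = cloven_to_psalg small B \<Q>"
    and P: "cloven_cofibration \<P>" and Q: "cloven_cofibration \<Q>"
    and xu: "x \<in> Obj (source (proj \<P>))" "u \<in> Arr B" "Dom B u = omap (proj \<P>) x"
  defines "\<phi> \<equiv> component (over2 (mcell F)) (Pair x u)"
  shows "\<phi> \<in> Arr (source (proj \<Q>))" "Dom (source (proj \<Q>)) \<phi> = push \<Q> (omap (over1 (mor F)) x) u"
    "Cod (source (proj \<Q>)) \<phi> = omap (over1 (mor F)) (push \<P> x u)" "amap (proj \<Q>) \<phi> = Ide B (Cod B u)" "iso (source (proj \<Q>)) \<phi>"
    "Cmp (source (proj \<Q>)) \<phi> (clv \<Q> (omap (over1 (mor F)) x) u) = amap (over1 (mor F)) (clv \<P> x u)"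
proof -
  let ?K = "CAT_over small B" and ?f = "mor F" and ?E = "source (proj \<P>)" and ?E' = "source (proj \<Q>)"
  let ?L = "cleavage_action \<P>" and ?L' = "cleavage_action \<Q>" and ?P = "proj \<P>" and ?Q = "proj \<Q>"
  interpret M: two_monad ?K comma_monad by (rule two_monad_comma_monad[OF small])
  have f: "over_functor ?f" "source ?f = ?P" "target ?f = ?Q" and t: "target ?P = B"
    using M.pseudomorphism_cells(3-5)[OF F] st by (simp_all add: CAT_over_cells)
  have tQ: "target ?Q = B" using over_functor_simps(6)[OF f(1)] f t by simp
  have B: "category B" using is_functor_category(2)[of ?P] P t by simp
  have m: "over_cell (mcell F)" "source (mcell F) = act (target F) \<cdot>\<^bsub>?K\<^esub> comma_mor ?f" "target (mcell F) = ?f \<cdot>\<^bsub>?K\<^esub> act (source F)"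
    using M.pseudomorphism_cells(6-8)[OF F] by (simp_all add: CAT_over_cells)
  have comp: "component (over2 (mcell F)) (Pair x w) \<in> Arr ?E' \<and> Dom ?E' (component (over2 (mcell F)) (Pair x w)) = push \<Q> (omap (over1 ?f) x) w \<and>
      Cod ?E' (component (over2 (mcell F)) (Pair x w)) = omap (over1 ?f) (push \<P> x w) \<and>
      amap ?Q (component (over2 (mcell F)) (Pair x w)) = Ide B (Cod B w) \<and> iso ?E' (component (over2 (mcell F)) (Pair x w))"
    if w: "w \<in> Arr B" "Dom B w = omap ?P x" for w
  proof -
    have s: "Pair x w \<in> Obj (comma ?P)" using xu w t by simp
    have o: "omap (over1 ?f) x \<in> Obj ?E'" "omap ?Q (omap (over1 ?f) x) = omap ?P x"
      using f xu over_functor_maps(1)[OF f(1) refl, of x] by simp_all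
    show ?thesis
      using is_ntrans_component[OF over_cell_simps(5)[OF m(1)] refl, of "Pair x w"]
        over_cell_simps(8)[OF m(1) refl, of "Pair x w"]
        iso_of_invertible2_CAT_over[OF M.pseudomorphism_cells(9)[OF F], of "Pair x w"] m f st s o t tQ w xu by simp
  qed
  from comp[OF xu(2,3)] show "\<phi> \<in> Arr ?E'" "Dom ?E' \<phi> = push \<Q> (omap (over1 ?f) x) u" "Cod ?E' \<phi> = omap (over1 ?f) (push \<P> x u)"
    "amap ?Q \<phi> = Ide B (Cod B u)" "iso ?E' \<phi>" by (simp_all add: \<phi>_def)
  let ?e = "Ide B (omap ?P x)" and ?y = "omap (over1 ?f) x"
  define \<phi>1 where "\<phi>1 = component (over2 (mcell F)) (Pair x ?e)"
  have e: "?e \<in> Arr B" "Dom B ?e = omap ?P x" using B is_functor_omap[of ?P B x] P t xu(1) by simp_all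
  have y: "?y \<in> Obj ?E'" "omap ?Q ?y = omap ?P x" using f xu over_functor_maps(1)[OF f(1) refl, of x] by simp_all
  \<comment> \<open>The unit law of the pseudomorphism evaluated at x, where the units of both
    pseudoalgebras are chosen lifts of an identity.\<close>
  have unit: "Cmp ?E' \<phi>1 (clv \<Q> ?y ?e) = amap (over1 ?f) (clv \<P> x ?e)"
  proof -
    let ?l = "mcell F \<star>\<^bsub>?K\<^esub> id2 ?K (comma_unit ?P)" and ?r = "unitor (target F) \<star>\<^bsub>?K\<^esub> id2 ?K ?f"
    have oA: "over_cell (unitor (source F))" "over_cell (unitor (target F))"
      using M.pseudoalgebra_cells(5)[OF M.pseudomorphism_cells(1)[OF F]] M.pseudoalgebra_cells(5)[OF M.pseudomorphism_cells(2)[OF F]]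
      by (simp_all add: CAT_over_cells)
    have "amap (over1 ?f) (clv \<P> x ?e) = component (over2 (id2 ?K ?f \<star>\<^bsub>?K\<^esub> unitor (source F))) x"
      by (subst CAT_over_component(2)) (use oA f xu st in simp_all)
    also have "\<dots> = component (over2 (?l \<bullet>\<^bsub>?K\<^esub> ?r)) x"
      using M.pseudomorphism_axioms(1)[OF F] st by simp
    also have "\<dots> = Cmp ?E' (component (over2 ?l) x) (component (over2 ?r) x)"
      by (rule CAT_over_component_vcomp) (use f xu st in simp_all)
    also have "component (over2 ?l) x = \<phi>1"
      unfolding \<phi>1_def by (subst CAT_over_component(1)) (use m f xu st t P in simp_all)
    also have "component (over2 ?r) x = clv \<Q> ?y ?e"
      by (subst CAT_over_component(1)) (use oA f xu y st in simp_all)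
    finally show ?thesis by simp
  qed
  let ?k = "tag (Pair x ?e) (Pair x u) (Pair (Ide ?E x) u)" and ?k' = "tag (Pair ?y ?e) (Pair ?y u) (Pair (Ide ?E' ?y) u)"
  have sq: "comma_square ?P x ?e x u (Ide ?E x) u" using xu P t B e category_Ide(3)[OF B, of "omap ?P x"] is_functor_omap[of ?P B x] by (simp add: comma_square_def)
  have sq': "comma_square ?Q ?y ?e ?y u (Ide ?E' ?y) u" using xu Q y tQ B e category_Ide(3)[OF B, of "omap ?P x"] is_functor_omap[of ?P B x] P t by (simp add: comma_square_def)
  have "amap (comma_functor ?f) ?k = ?k'"
    using comma_functor_sel(4)[of ?f x ?e x u "Ide ?E x" u] sq f xu over_functor_simps(3,4)[OF f(1)] by simp
  \<comment> \<open>Naturality along (1_x, u) : (x, 1) -> (x, u). On both sides the action at this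
    arrow turns the lift of the identity into the lift of u.\<close>
  then have nat: "Cmp ?E' \<phi> (amap ?L' ?k') = Cmp ?E' (amap (over1 ?f) (amap ?L ?k)) \<phi>1"
    using is_ntrans_naturality[OF over_cell_simps(5)[OF m(1)], of ?k "Pair x ?e" "Pair x u"] m f st sq
    by (simp add: \<phi>_def \<phi>1_def)
  have d': "Cmp ?E' (amap ?L' ?k') (clv \<Q> ?y ?e) = clv \<Q> ?y u"
    using cleavage_action_arrow(5)[OF Q sq' refl] Q y xu tQ by simp
  have d: "Cmp ?E (amap ?L ?k) (clv \<P> x ?e) = clv \<P> x u"
    using cleavage_action_arrow(5)[OF P sq refl] P xu t by simp
  note c1 = comp[OF e, folded \<phi>1_def] and cu = comp[OF xu(2,3), folded \<phi>_def]
  note l = cleavage_action_arrow(1-3)[OF P sq refl] and l' = cleavage_action_arrow(1-3)[OF Q sq' refl]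
  have cl: "clv \<P> x ?e \<in> Arr ?E" "Cod ?E (clv \<P> x ?e) = push \<P> x ?e" using P xu e t by simp_all
  have cl': "clv \<Q> ?y ?e \<in> Arr ?E'" "Cod ?E' (clv \<Q> ?y ?e) = push \<Q> ?y ?e" using Q y e tQ by simp_all
  have Fl: "amap (over1 ?f) (amap ?L ?k) \<in> Arr ?E'" "Dom ?E' (amap (over1 ?f) (amap ?L ?k)) = omap (over1 ?f) (push \<P> x ?e)"
    using is_functor_amap[OF over_functor_simps(3)[OF f(1)], of ?E' "amap ?L ?k"] l over_functor_simps(4,5)[OF f(1)] f by simp_all
  have E': "category ?E'" using Q by simp
  have "Cmp ?E' \<phi> (clv \<Q> ?y u) = Cmp ?E' \<phi> (Cmp ?E' (amap ?L' ?k') (clv \<Q> ?y ?e))" by (simp only: d')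
  also have "\<dots> = Cmp ?E' (Cmp ?E' (amap (over1 ?f) (amap ?L ?k)) \<phi>1) (clv \<Q> ?y ?e)"
    by (rule Cmp_reassoc[OF nat E']) (use cu l' cl' in simp_all)
  also have "\<dots> = Cmp ?E' (amap (over1 ?f) (amap ?L ?k)) (amap (over1 ?f) (clv \<P> x ?e))"
    unfolding unit[symmetric] by (rule category_Cmp_assoc) (use E' c1 Fl cl' in simp_all)
  also have "\<dots> = amap (over1 ?f) (Cmp ?E (amap ?L ?k) (clv \<P> x ?e))"
    using is_functor_Cmp[OF over_functor_simps(3)[OF f(1)], of ?E "clv \<P> x ?e" "amap ?L ?k"] l cl over_functor_simps(4,5)[OF f(1)] f by simp
  finally show "Cmp ?E' \<phi> (clv \<Q> ?y u) = amap (over1 ?f) (clv \<P> x u)" unfolding d .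
qed

text \<open>A cocartesian e is i \<delta>^x_u with i invertible. With T the functor, T e is T i
  composed with the invertible cell and a chosen lift of the target, all cocartesian. Preservation
  is thus a consequence of having an invertible cell.\<close>

lemma cocartesian_functor_of_psmor:
  assumes small: "smallness small" and F: "pseudomorphism (CAT_over small B) comma_monad F"
    and st: "source F = cloven_to_psalg small B (source T)" "target F = cloven_to_psalg small B (target T)"
    and P: "cloven_cofibration (source T)" and Q: "cloven_cofibration (target T)" and m: "mor F = slice_of_mor T"
  shows "cocartesian_functor T"
proof -
  let ?P = "proj (source T)" and ?Q = "proj (target T)" and ?F = "fun_over T"
  interpret M: two_monad "CAT_over small B" comma_monad by (rule two_monad_comma_monad[OF small])
  have o: "over_functor (slice_of_mor T)" and t: "target ?P = B"
    using M.pseudomorphism_cells(3)[OF F] m by (simp_all add: CAT_over_cells)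
  have f: "is_functor ?F" "source ?F = source ?P" "target ?F = source ?Q" "target ?Q = B"
    using over_functor_simps[OF o] t by simp_all
  have B: "category B" using is_functor_category(2)[of ?P] P t by simp
  have "cocartesian ?Q (amap ?F e)" if e: "cocartesian ?P e" for e
  proof -
    have ea: "e \<in> Arr (source ?P)" using e by (rule cocartesian_Arr)
    let ?x = "Dom (source ?P) e" and ?u = "amap ?P e"
    have xu: "?x \<in> Obj (source ?P)" "?u \<in> Arr B" "Dom B ?u = omap ?P ?x" "Cod B ?u = omap ?P (Cod (source ?P) e)" using P ea t by simp_all
    have xu': "?u \<in> Arr (target ?P)" "Dom (target ?P) ?u = omap ?P ?x" using xu t by simp_all
    note c = clv_simps[OF P xu(1) xu']
    obtain i where i: "i \<in> Arr (source ?P)" "Dom (source ?P) i = push (source T) ?x ?u" "Cod (source ?P) i = Cod (source ?P) e"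
      "Cmp (source ?P) i (clv (source T) ?x ?u) = e" "amap ?P i = Ide B (Cod B ?u)"
      by (rule clv_lift[OF P xu(1) xu', of e "Ide B (Cod B ?u)"]) (use P ea t xu B in simp_all)
    have "iso (source ?P) i"
      by (rule iso_of_cocartesian_factor[OF _ c(1) e]) (use P i c(4)[OF refl] t xu B ea is_functor_omap[of ?P B "Cod (source ?P) e"] in \<open>simp_all add: iso_Ide\<close>)
    then have Fi: "iso (source ?Q) (amap ?F i)" using iso_amap[OF f(1)] f by simp
    note \<phi> = mcell_clv[OF small F st P Q xu(1-3), unfolded m slice_of_mor_sel]
    let ?\<phi> = "component (over2 (mcell F)) (Pair ?x ?u)"
    have y: "omap ?F ?x \<in> Obj (source ?Q)" "omap ?Q (omap ?F ?x) = omap ?P ?x"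
      using f xu over_functor_maps(1)[OF o refl, of ?x] by simp_all
    have c': "cocartesian ?Q (clv (target T) (omap ?F ?x) ?u)" "Cod (source ?Q) (clv (target T) (omap ?F ?x) ?u) = push (target T) (omap ?F ?x) ?u"
      using Q y xu f by simp_all
    have "amap ?F e = Cmp (source ?Q) (amap ?F i) (amap ?F (clv (source T) ?x ?u))"
      using is_functor_Cmp[OF f(1), of "source ?P" "clv (source T) ?x ?u" i] i c f by simp
    also have "\<dots> = Cmp (source ?Q) (amap ?F i) (Cmp (source ?Q) ?\<phi> (clv (target T) (omap ?F ?x) ?u))" by (simp only: \<phi>(6))
    finally have "amap ?F e = Cmp (source ?Q) (amap ?F i) (Cmp (source ?Q) ?\<phi> (clv (target T) (omap ?F ?x) ?u))" .
    moreover have "cocartesian ?Q (Cmp (source ?Q) ?\<phi> (clv (target T) (omap ?F ?x) ?u))"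
      by (rule cocartesian_Cmp) (use Q c' \<phi> in \<open>simp_all add: cocartesian_iso\<close>)
    moreover have "Cod (source ?Q) (Cmp (source ?Q) ?\<phi> (clv (target T) (omap ?F ?x) ?u)) = Dom (source ?Q) (amap ?F i)"
      using Q c'(2) cocartesian_Arr[OF c'(1)] \<phi>(1-3) i f by simp
    ultimately show ?thesis
      using cocartesian_Cmp[of ?Q _ "amap ?F i"] cocartesian_iso[of ?Q, OF _ Fi] Q by simp
  qed
  then show ?thesis unfolding cocartesian_functor_def using P Q o by blast
qed

text \<open>A pseudomorphism is determined by its boundary and its underlying functor, since its
  cell must be \<theta>. Compatibility with identities and composites and surjectivity on 1-cells
  all follow from this.\<close>

lemma cloven_to_psmor_eqI:
  assumes small: "smallness small" and F: "pseudomorphism (CAT_over small B) comma_monad F"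
    and st: "source F = cloven_to_psalg small B (source T)" "target F = cloven_to_psalg small B (target T)"
    and P: "cloven_cofibration (source T)" and Q: "cloven_cofibration (target T)" and m: "mor F = slice_of_mor T"
  shows "cloven_to_psmor small B T = F"
proof (rule psmor_eqI)
  let ?P = "proj (source T)" and ?Q = "proj (target T)" and ?F = "fun_over T"
  interpret M: two_monad "CAT_over small B" comma_monad by (rule two_monad_comma_monad[OF small])
  have T: "cocartesian_functor T" using assms by (rule cocartesian_functor_of_psmor)
  have TK: "slice_of_mor T \<in> cells1 (CAT_over small B)" using M.pseudomorphism_cells(3)[OF F] m by simp
  then have t: "target ?P = B" by (simp add: CAT_over_cells)
  have F': "pseudomorphism (CAT_over small B) comma_monad (cloven_to_psmor small B T)"
    using small T TK by (rule pseudomorphism_cloven)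
  show "mcell (cloven_to_psmor small B T) = mcell F"
  proof (rule CAT_over_parallel_eqI[OF M.pseudomorphism_cells(6)[OF F'] M.pseudomorphism_cells(6)[OF F]])
    show "source (mcell (cloven_to_psmor small B T)) = source (mcell F)" "target (mcell (cloven_to_psmor small B T)) = target (mcell F)"
      using M.pseudomorphism_cells(7,8)[OF F] st m by simp_all
    fix s assume "s \<in> Obj (source (source (source (mcell (cloven_to_psmor small B T)))))"
    then have "s \<in> Obj (comma ?P)" by simp
    then show "component (over2 (mcell (cloven_to_psmor small B T))) s = component (over2 (mcell F)) s"
    proof (rule comma_ObjE, goal_cases)
      case (1 x u)
      have xu: "u \<in> Arr B" "Dom B u = omap ?P x" using 1 t by simp_all
      note \<phi> = mcell_clv[OF small F st P Q 1(2) xu, unfolded m slice_of_mor_sel]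
      have \<theta>: "comparison T x u \<in> Arr (source ?Q)" "Dom (source ?Q) (comparison T x u) = push (target T) (omap ?F x) u"
        "Cod (source ?Q) (comparison T x u) = omap ?F (push (source T) x u)" "amap ?Q (comparison T x u) = Ide B (Cod B u)"
        "Cmp (source ?Q) (comparison T x u) (clv (target T) (omap ?F x) u) = amap ?F (clv (source T) x u)"
        using comparison_simps[OF T 1(2-4) refl] t by simp_all
      have y: "omap ?F x \<in> Obj (source ?Q)" "omap ?Q (omap ?F x) = omap ?P x" "target ?Q = B"
        using T 1(2) t by simp_all
      \<comment> \<open>Both arrows are vertical with the same ends and send the chosen lift to the
        image of \<delta>^x_u.\<close>
      have "comparison T x u = component (over2 (mcell F)) (Pair x u)"
        by (rule clv_eqI[OF Q, of "omap ?F x" u]) (use y xu \<phi>(1-4,6) \<theta> in simp_all)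
      then show ?case using 1 by simp
    qed
  qed
qed (use st m in simp_all)

text \<open>Every 2-cell over the base between such functors respects \<theta>: tested on the chosen
  lift, the condition becomes naturality of the transformation at \<delta>^x_u.\<close>

lemma algebra_transformation_cloven:
  assumes small: "smallness small" and a: "\<alpha> \<in> cells2 (ClCoFib small B)"
  shows "algebra_transformation (CAT_over small B) comma_monad (map2 (ClCoFib_to_PsAlg small B) \<alpha>)"
proof -
  let ?K = "CAT_over small B"
  interpret M: two_monad ?K comma_monad by (rule two_monad_comma_monad[OF small])
  define T S \<beta> where "T = source \<alpha>" and "S = target \<alpha>" and "\<beta> = slice_of_cell \<alpha>"
  let ?\<tau> = "map2 (ClCoFib_to_PsAlg small B) \<alpha>" and ?P = "proj (source T)" and ?Q = "proj (target T)"
  have sel: "source ?\<tau> = cloven_to_psmor small B T" "target ?\<tau> = cloven_to_psmor small B S" "trans ?\<tau> = \<beta>"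
    by (simp_all add: ClCoFib_to_PsAlg_def T_def S_def \<beta>_def)
  have T: "cocartesian_functor T" "slice_of_mor T \<in> cells1 ?K" and S: "cocartesian_functor S" "slice_of_mor S \<in> cells1 ?K"
    and st: "source S = source T" "target S = target T" and \<beta>: "\<beta> \<in> cells2 ?K" "source \<beta> = slice_of_mor T" "target \<beta> = slice_of_mor S"
    using a by (simp_all add: ClCoFib_cells T_def S_def \<beta>_def)
  have o: "over_cell \<beta>" and t: "target ?P = B" using \<beta> by (simp_all add: CAT_over_cells)
  have B: "category B" using is_functor_category(2)[of ?P] T(1) t by simp
  have pT: "pseudomorphism ?K comma_monad (cloven_to_psmor small B T)" and pS: "pseudomorphism ?K comma_monad (cloven_to_psmor small B S)"
    using pseudomorphism_cloven[OF small] T S by blast+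
  define FT FS where "FT = cloven_to_psmor small B T" and "FS = cloven_to_psmor small B S"
  note p = pT[folded FT_def] pS[folded FS_def]
  have \<beta>K: "src2 ?K \<beta> = mor FT" "tgt2 ?K \<beta> = mor FS" using \<beta> by (simp_all add: FT_def FS_def)
  have stF: "source FS = source FT" "target FS = target FT" by (simp_all add: FT_def FS_def st)
  show ?thesis
  proof (rule M.algebra_transformationI, unfold sel FT_def[symmetric] FS_def[symmetric], goal_cases)
    case 8
    let ?l = "(\<beta> \<star>\<^bsub>?K\<^esub> id2 ?K (act (source FT))) \<bullet>\<^bsub>?K\<^esub> mcell FT" and ?r = "mcell FS \<bullet>\<^bsub>?K\<^esub> (id2 ?K (act (target FT)) \<star>\<^bsub>?K\<^esub> M.T2 \<beta>)"
    note [simp del] = Slice_sel comma_monad_sel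
    have c: "?l \<in> cells2 ?K" "?r \<in> cells2 ?K" "src2 ?K ?l = src2 ?K ?r" "tgt2 ?K ?l = tgt2 ?K ?r"
      using p \<beta>(1) \<beta>K stF by simp_all
    note [simp] = Slice_sel comma_monad_sel
    show ?case
    proof (rule CAT_over_parallel_eqI[OF c(1,2)])
      show "source ?l = source ?r" "target ?l = target ?r" using c(3,4) by (simp_all only: Slice_sel(3,4))
      fix s assume "s \<in> Obj (source (source (source ?l)))"
      then have "s \<in> Obj (comma ?P)" by (simp add: FT_def)
      then show "component (over2 ?l) s = component (over2 ?r) s"
      proof (rule comma_ObjE, goal_cases)
        case (1 x u)
        let ?E' = "source ?Q" and ?FT = "fun_over T" and ?FS = "fun_over S" and ?\<beta> = "component (over2 \<beta>)"
        have xu: "u \<in> Arr B" "Dom B u = omap ?P x" using 1 t by simp_all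
        have oA: "over_functor (act (source FT))" "over_functor (act (target FT))"
          using M.pseudoalgebra_cells(2)[OF M.pseudomorphism_cells(1)[OF p(1)]] M.pseudoalgebra_cells(2)[OF M.pseudomorphism_cells(2)[OF p(1)]]
          by (simp_all add: CAT_over_cells)
        have tQ: "target ?Q = B" using T(1) t by simp
        have P: "cloven_cofibration (source T)" and Q: "cloven_cofibration (target T)" using T by simp_all
        have y: "omap ?FT x \<in> Obj ?E'" "omap ?FS x \<in> Obj ?E'" "omap ?Q (omap ?FT x) = omap ?P x" "omap ?Q (omap ?FS x) = omap ?P x"
          using 1 T(1) S(1) st is_functor_omap[of ?FS ?E' x] cocartesian_functor_simps(6,7,9)[OF S(1)] by simp_all
        note clP = clv_simps(2-5)[OF P 1(2-4) refl]
        have clT: "clv (target T) (omap ?FT x) u \<in> Arr ?E'" "Dom ?E' (clv (target T) (omap ?FT x) u) = omap ?FT x"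
          "Cod ?E' (clv (target T) (omap ?FT x) u) = push (target T) (omap ?FT x) u"
          "clv (target T) (omap ?FS x) u \<in> Arr ?E'" "Dom ?E' (clv (target T) (omap ?FS x) u) = omap ?FS x"
          "Cod ?E' (clv (target T) (omap ?FS x) u) = push (target T) (omap ?FS x) u"
          using Q y xu tQ by simp_all
        have \<theta>T: "comparison T x u \<in> Arr ?E'" "Dom ?E' (comparison T x u) = push (target T) (omap ?FT x) u"
          "Cod ?E' (comparison T x u) = omap ?FT (push (source T) x u)" "amap ?Q (comparison T x u) = Ide B (Cod B u)"
          "Cmp ?E' (comparison T x u) (clv (target T) (omap ?FT x) u) = amap ?FT (clv (source T) x u)"
          using comparison_simps[OF T(1) 1(2-4) refl] t by simp_all
        have \<theta>S: "comparison S x u \<in> Arr ?E'" "Dom ?E' (comparison S x u) = push (target T) (omap ?FS x) u"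
          "Cod ?E' (comparison S x u) = omap ?FS (push (source T) x u)" "amap ?Q (comparison S x u) = Ide B (Cod B u)"
          "Cmp ?E' (comparison S x u) (clv (target T) (omap ?FS x) u) = amap ?FS (clv (source T) x u)"
          using comparison_simps[OF S(1), unfolded st, OF 1(2-4) refl] t by simp_all
        have b: "?\<beta> z \<in> Arr ?E'" "Dom ?E' (?\<beta> z) = omap ?FT z" "Cod ?E' (?\<beta> z) = omap ?FS z" "amap ?Q (?\<beta> z) = Ide B (omap ?P z)"
          if "z \<in> Obj (source ?P)" for z
          using that is_ntrans_component[OF over_cell_simps(5)[OF o], of ?E' z] over_cell_simps(6-8)[OF o] \<beta>(2,3) T(1) t by simp_all
        note bx = b[OF 1(2)] and bp = b[OF clP(4)]
        have sq: "comma_square ?Q (omap ?FT x) u (omap ?FS x) u (?\<beta> x) (Ide B (Cod B u))"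
          by (rule comma_square_vertical) (use Q y bx xu tQ in simp_all)
        note l = cleavage_action_arrow[OF Q sq refl]
        have nat: "Cmp ?E' (?\<beta> (push (source T) x u)) (amap ?FT (clv (source T) x u)) = Cmp ?E' (amap ?FS (clv (source T) x u)) (?\<beta> x)"
          using is_ntrans_naturality[OF over_cell_simps(5)[OF o], of "clv (source T) x u" x "push (source T) x u"]
            over_cell_simps(6,7)[OF o] \<beta>(2,3) clP T(1) by simp
        have E': "category ?E'" using Q by simp
        have Fc: "amap ?FT (clv (source T) x u) \<in> Arr ?E'" "amap ?FS (clv (source T) x u) \<in> Arr ?E'"
          using is_functor_amap(1)[of ?FT ?E'] is_functor_amap(1)[of ?FS ?E'] T(1) S(1) st clP(1) by simp_all
        have "Cmp ?E' (?\<beta> (push (source T) x u)) (comparison T x u)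
            = Cmp ?E' (comparison S x u) (amap (cleavage_action (target T)) (tag (Pair (omap ?FT x) u) (Pair (omap ?FS x) u) (Pair (?\<beta> x) (Ide B (Cod B u)))))"
        proof (rule clv_eqI[OF Q, of "omap ?FT x" u], goal_cases)
          case 9
          \<comment> \<open>Both sides, tested on the lift at the image of x, are brought to the
            image of \<delta>^x_u under the functor of S composed with the component at x.\<close>
          have "Cmp ?E' (Cmp ?E' (?\<beta> (push (source T) x u)) (comparison T x u)) (clv (target T) (omap ?FT x) u)
              = Cmp ?E' (amap ?FS (clv (source T) x u)) (?\<beta> x)"
            using E' bp(1-3) \<theta>T(1-3) clT(1-3) nat by (simp add: \<theta>T(5))
          moreover have "Cmp ?E' (Cmp ?E' (comparison S x u) (amap (cleavage_action (target T)) (tag (Pair (omap ?FT x) u) (Pair (omap ?FS x) u) (Pair (?\<beta> x) (Ide B (Cod B u)))))) (clv (target T) (omap ?FT x) u)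
              = Cmp ?E' (amap ?FS (clv (source T) x u)) (?\<beta> x)"
            using E' \<theta>S(1-3) clT bx(1-3) l(1-3,5) Cmp_reassoc[OF \<theta>S(5) E', of "?\<beta> x"] by simp
          ultimately show ?case by simp
        next
          case 10
          show ?case
            using Q E' bp \<theta>T(1-4) \<theta>S(1-4) l(1-3) l(4)[OF refl] is_functor_Cmp[of ?Q ?E'] clv_simps(7)[OF P 1(2-4) refl] t tQ xu B by simp
        qed (use y xu tQ E' bp(1-3) \<theta>T(1-3) \<theta>S(1-3) l(1-3) in simp_all)
        moreover have "component (over2 (\<beta> \<star>\<^bsub>?K\<^esub> id2 ?K (act (source FT)))) s = ?\<beta> (push (source T) x u)"
          by (subst CAT_over_component(1)) (use o oA \<beta>(2) 1 in \<open>simp_all add: FT_def\<close>)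
        moreover have "component (over2 (id2 ?K (act (target FT)) \<star>\<^bsub>?K\<^esub> M.T2 \<beta>)) s
            = amap (cleavage_action (target T)) (tag (Pair (omap ?FT x) u) (Pair (omap ?FS x) u) (Pair (?\<beta> x) (Ide B (Cod B u))))"
          unfolding comma_monad_sel
          by (subst CAT_over_component(2)) (use o oA \<beta>(2,3) 1 t in \<open>simp_all add: FT_def\<close>)
        moreover have "component (over2 (mcell FT)) s = comparison T x u" "component (over2 (mcell FS)) s = comparison S x u"
          using 1 st by (simp_all add: FT_def FS_def)
        moreover have "component (over2 ?l) s = Cmp ?E' (component (over2 (\<beta> \<star>\<^bsub>?K\<^esub> id2 ?K (act (source FT)))) s) (component (over2 (mcell FT)) s)"
          by (rule CAT_over_component_vcomp) (use 1 in \<open>simp_all add: FT_def\<close>)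
        moreover have "component (over2 ?r) s = Cmp ?E' (component (over2 (mcell FS)) s) (component (over2 (id2 ?K (act (target FT)) \<star>\<^bsub>?K\<^esub> M.T2 \<beta>)) s)"
          by (rule CAT_over_component_vcomp) (use 1 o \<beta>(2) in \<open>simp_all add: FT_def\<close>)
        ultimately show ?case by (simp only:)
      qed
    qed
  qed (use p stF \<beta> in \<open>simp_all add: FT_def FS_def\<close>)
qed

lemma ClCoFib_to_PsAlg_sel [simp]:
  "map0 (ClCoFib_to_PsAlg small B) = cloven_to_psalg small B"
  "map1 (ClCoFib_to_PsAlg small B) = cloven_to_psmor small B"
  "source (map2 (ClCoFib_to_PsAlg small B) \<alpha>) = cloven_to_psmor small B (source \<alpha>)"
  "target (map2 (ClCoFib_to_PsAlg small B) \<alpha>) = cloven_to_psmor small B (target \<alpha>)"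
  "trans (map2 (ClCoFib_to_PsAlg small B) \<alpha>) = slice_of_cell \<alpha>"
  by (simp_all add: ClCoFib_to_PsAlg_def)

lemma slice_of_ClCoFib_ops:
  "slice_of_mor (id1 (ClCoFib small B) \<P>) = id1 (CAT_over small B) (proj \<P>)"
  "slice_of_mor (S \<cdot>\<^bsub>ClCoFib small B\<^esub> T) = slice_of_mor S \<cdot>\<^bsub>CAT_over small B\<^esub> slice_of_mor T"
  "slice_of_cell (id2 (ClCoFib small B) T) = id2 (CAT_over small B) (slice_of_mor T)"
  "slice_of_cell (\<beta> \<bullet>\<^bsub>ClCoFib small B\<^esub> \<alpha>) = slice_of_cell \<beta> \<bullet>\<^bsub>CAT_over small B\<^esub> slice_of_cell \<alpha>"
  "slice_of_cell (\<beta> \<star>\<^bsub>ClCoFib small B\<^esub> \<alpha>) = slice_of_cell \<beta> \<star>\<^bsub>CAT_over small B\<^esub> slice_of_cell \<alpha>"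
  by (intro slice_mor_eqI slice_cell_eqI; simp)+

lemma ClCoFib_src_tgt:
  assumes "T \<in> cells1 (ClCoFib small B)"
  shows "source T \<in> cells0 (ClCoFib small B)" "target T \<in> cells0 (ClCoFib small B)"
  using assms cocartesian_functor_simps(8)[of T] by (simp_all add: ClCoFib_cells CAT_over_cells)

lemma ClCoFib_id1:
  assumes P: "\<P> \<in> cells0 (ClCoFib small B)"
  shows "id1 (ClCoFib small B) \<P> \<in> cells1 (ClCoFib small B)"
proof -
  interpret K: two_category "CAT_over small B" by (rule two_category_CAT_over)
  have K: "slice_of_mor (id1 (ClCoFib small B) \<P>) \<in> cells1 (CAT_over small B)"
    unfolding slice_of_ClCoFib_ops using P by (simp add: ClCoFib_cells)
  have "cocartesian_functor (id1 (ClCoFib small B) \<P>)"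
    unfolding cocartesian_functor_def using P K by (simp add: ClCoFib_cells CAT_over_cells cocartesian_Arr)
  with K show ?thesis by (simp add: ClCoFib_cells del: ClCoFib_sel)
qed

lemma ClCoFib_comp1:
  assumes T: "T \<in> cells1 (ClCoFib small B)" and S: "S \<in> cells1 (ClCoFib small B)" and TS: "target T = source S"
  shows "S \<cdot>\<^bsub>ClCoFib small B\<^esub> T \<in> cells1 (ClCoFib small B)"
proof -
  interpret K: two_category "CAT_over small B" by (rule two_category_CAT_over)
  have K: "slice_of_mor (S \<cdot>\<^bsub>ClCoFib small B\<^esub> T) \<in> cells1 (CAT_over small B)"
    unfolding slice_of_ClCoFib_ops using T S TS by (simp add: ClCoFib_cells)
  have TS': "cocartesian_functor T" "cocartesian_functor S" using T S by (simp_all add: ClCoFib_cells)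
  \<comment> \<open>Preservation is applied twice. The second application is stated for the image
    arrow, because the composite functor is evaluated only on arrows of its source.\<close>
  have "cocartesian (proj (target S)) (amap (comp_functor (fun_over S) (fun_over T)) e)" if e: "cocartesian (proj (source T)) e" for e
    using cocartesian_functor_simps(4)[OF TS'(2), of "amap (fun_over T) e"] cocartesian_functor_simps(4,6)[OF TS'(1)]
      cocartesian_Arr[OF e] e TS by simp
  moreover have "over_functor (slice_of_mor (S \<cdot>\<^bsub>ClCoFib small B\<^esub> T))" using K by (simp add: CAT_over_cells del: ClCoFib_sel)
  ultimately have "cocartesian_functor (S \<cdot>\<^bsub>ClCoFib small B\<^esub> T)"
    unfolding cocartesian_functor_def using cocartesian_functor_simps(1)[OF TS'(1)] cocartesian_functor_simps(2)[OF TS'(2)] by simp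
  with K show ?thesis by (simp add: ClCoFib_cells del: ClCoFib_sel)
qed

text \<open>The identity pseudomorphism has the identity as underlying functor, so uniqueness of the
  cell identifies it; no comparison is evaluated. Composites are treated in the same way
  below.\<close>

lemma cloven_to_psmor_id1:
  assumes small: "smallness small" and P: "\<P> \<in> cells0 (ClCoFib small B)"
  shows "cloven_to_psmor small B (id1 (ClCoFib small B) \<P>) = id1 (PsAlg (CAT_over small B) comma_monad) (cloven_to_psalg small B \<P>)"
proof -
  interpret M: two_monad "CAT_over small B" comma_monad by (rule two_monad_comma_monad[OF small])
  have A: "pseudoalgebra (CAT_over small B) comma_monad (cloven_to_psalg small B \<P>)"
    using P small by (simp add: ClCoFib_cells pseudoalgebra_cloven)
  show ?thesis
    by (rule cloven_to_psmor_eqI[OF small M.pseudomorphism_id1[OF A]])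
      (use P slice_of_ClCoFib_ops(1)[of small B \<P>] in \<open>simp_all add: ClCoFib_cells\<close>)
qed

lemma pseudomorphism_ClCoFib:
  assumes "smallness small" "T \<in> cells1 (ClCoFib small B)"
  shows "pseudomorphism (CAT_over small B) comma_monad (cloven_to_psmor small B T)"
  using assms by (intro pseudomorphism_cloven) (simp_all add: ClCoFib_cells)

lemma cloven_to_psmor_comp1:
  assumes small: "smallness small" and T: "T \<in> cells1 (ClCoFib small B)" and S: "S \<in> cells1 (ClCoFib small B)" and TS: "target T = source S"
  shows "cloven_to_psmor small B (S \<cdot>\<^bsub>ClCoFib small B\<^esub> T)
    = cloven_to_psmor small B S \<cdot>\<^bsub>PsAlg (CAT_over small B) comma_monad\<^esub> cloven_to_psmor small B T"
proof -
  interpret M: two_monad "CAT_over small B" comma_monad by (rule two_monad_comma_monad[OF small])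
  note p = pseudomorphism_ClCoFib[OF small T] pseudomorphism_ClCoFib[OF small S]
  have "pseudomorphism (CAT_over small B) comma_monad
      (cloven_to_psmor small B S \<cdot>\<^bsub>PsAlg (CAT_over small B) comma_monad\<^esub> cloven_to_psmor small B T)"
    using p TS by (intro M.pseudomorphism_comp1) simp_all
  then show ?thesis
    by (rule cloven_to_psmor_eqI[OF small])
      (use T S slice_of_ClCoFib_ops(2)[of small B S T] in \<open>simp_all add: ClCoFib_cells\<close>)
qed

lemma bij_betw_cloven_to_psalg:
  assumes small: "smallness small"
  shows "bij_betw (cloven_to_psalg small B) (cells0 (ClCoFib small B)) {A. pseudoalgebra (CAT_over small B) comma_monad A}"
  unfolding bij_betw_def
proof (intro conjI set_eqI iffI)
  show "inj_on (cloven_to_psalg small B) (cells0 (ClCoFib small B))"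
    by (rule inj_onI, rule cloven_to_psalg_inj[of _ _ B small]) (simp_all add: ClCoFib_cells CAT_over_cells)
next
  fix A assume "A \<in> cloven_to_psalg small B ` cells0 (ClCoFib small B)"
  then show "A \<in> {A. pseudoalgebra (CAT_over small B) comma_monad A}"
    using pseudoalgebra_cloven[OF small] by (auto simp: ClCoFib_cells)
next
  fix A assume "A \<in> {A. pseudoalgebra (CAT_over small B) comma_monad A}"
  then interpret comma_pseudoalgebra small B A using small by unfold_locales simp_all
  show "A \<in> cloven_to_psalg small B ` cells0 (ClCoFib small B)"
    using cloven_to_psalg_cleavage cloven_cleavage cells(1)
    by (intro image_eqI[of _ _ "psalg_cleavage A"]) (simp_all add: ClCoFib_cells)
qed

text \<open>Injectivity is inherited from objects and underlying functors. For surjectivity the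
  underlying functor of a pseudomorphism preserves cocartesian arrows, and its cell is
  forced.\<close>

lemma bij_betw_cloven_to_psmor:
  assumes small: "smallness small"
  shows "bij_betw (cloven_to_psmor small B) (cells1 (ClCoFib small B)) {F. pseudomorphism (CAT_over small B) comma_monad F}"
  unfolding bij_betw_def
proof (intro conjI set_eqI iffI)
  note b0 = bij_betw_cloven_to_psalg[OF small, of B]
  interpret M: two_monad "CAT_over small B" comma_monad by (rule two_monad_comma_monad[OF small])
  show "inj_on (cloven_to_psmor small B) (cells1 (ClCoFib small B))"
  proof (rule inj_onI)
    fix T S assume TS: "T \<in> cells1 (ClCoFib small B)" "S \<in> cells1 (ClCoFib small B)" "cloven_to_psmor small B T = cloven_to_psmor small B S"
    have "cloven_to_psalg small B (source T) = cloven_to_psalg small B (source S)"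
      "cloven_to_psalg small B (target T) = cloven_to_psalg small B (target S)" "slice_of_mor T = slice_of_mor S"
      using TS(3) by (metis cloven_to_psmor_sel(1-3))+
    then have "source T = source S" "target T = target S" "fun_over T = fun_over S"
      using inj_onD[OF bij_betw_imp_inj_on[OF b0]] ClCoFib_src_tgt[OF TS(1)] ClCoFib_src_tgt[OF TS(2)]
      by (blast, blast, metis slice_of_mor_sel(3))
    then show "T = S" by simp
  qed
  fix F
  show "F \<in> {F. pseudomorphism (CAT_over small B) comma_monad F}" if "F \<in> cloven_to_psmor small B ` cells1 (ClCoFib small B)"
    using that pseudomorphism_ClCoFib[OF small] by auto
  assume "F \<in> {F. pseudomorphism (CAT_over small B) comma_monad F}"
  then have F: "pseudomorphism (CAT_over small B) comma_monad F" by simp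
  obtain \<P> \<Q> where PQ: "\<P> \<in> cells0 (ClCoFib small B)" "source F = cloven_to_psalg small B \<P>"
    "\<Q> \<in> cells0 (ClCoFib small B)" "target F = cloven_to_psalg small B \<Q>"
    using b0 M.pseudomorphism_cells(1,2)[OF F] unfolding bij_betw_def by blast
  \<comment> \<open>The cloven ends come from surjectivity on objects; the functor is the one
    underlying the given pseudomorphism.\<close>
  define T where "T = \<lparr>source = \<P>, target = \<Q>, fun_over = over1 (mor F)\<rparr>"
  have PQ': "cloven_cofibration \<P>" "cloven_cofibration \<Q>" using PQ by (simp_all add: ClCoFib_cells)
  have m: "mor F = slice_of_mor T"
    using M.pseudomorphism_cells(4,5)[OF F] PQ by (intro slice_mor_eqI) (simp_all add: T_def)
  have T: "source F = cloven_to_psalg small B (source T)" "target F = cloven_to_psalg small B (target T)"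
    "cloven_cofibration (source T)" "cloven_cofibration (target T)" using PQ PQ' by (simp_all add: T_def)
  have "T \<in> cells1 (ClCoFib small B)"
    using cocartesian_functor_of_psmor[OF small F T m] M.pseudomorphism_cells(3)[OF F] m by (simp add: ClCoFib_cells)
  then show "F \<in> cloven_to_psmor small B ` cells1 (ClCoFib small B)"
    using cloven_to_psmor_eqI[OF small F T m] by (intro image_eqI[of _ _ T]) simp_all
qed

text \<open>By \<open>two_isomorphismI\<close> it remains to give the three bijections, closure of
  cloven cofibrations under the operations, and compatibility. The 2-category laws on the cloven
  side come out as a by-product.\<close>

lemma two_isomorphism_ClCoFib_to_PsAlg:
  assumes small: "smallness small"
  shows "two_isomorphism (ClCoFib small B) (PsAlg (CAT_over small B) comma_monad) (ClCoFib_to_PsAlg small B)"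
proof -
  interpret M: two_monad "CAT_over small B" comma_monad by (rule two_monad_comma_monad[OF small])
  let ?C = "ClCoFib small B" and ?K = "CAT_over small B"
  note b0 = bij_betw_cloven_to_psalg[OF small, of B] and b1 = bij_betw_cloven_to_psmor[OF small, of B]
  note inj1 = inj_onD[OF bij_betw_imp_inj_on[OF b1]]
  have b2: "bij_betw (map2 (ClCoFib_to_PsAlg small B)) (cells2 ?C) {\<tau>. algebra_transformation ?K comma_monad \<tau>}"
    unfolding bij_betw_def
  proof (intro conjI set_eqI iffI)
    show "inj_on (map2 (ClCoFib_to_PsAlg small B)) (cells2 ?C)"
    proof (rule inj_onI)
      fix \<alpha> \<beta> assume ab: "\<alpha> \<in> cells2 ?C" "\<beta> \<in> cells2 ?C" "map2 (ClCoFib_to_PsAlg small B) \<alpha> = map2 (ClCoFib_to_PsAlg small B) \<beta>"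
      have e: "cloven_to_psmor small B (source \<alpha>) = cloven_to_psmor small B (source \<beta>)"
        "cloven_to_psmor small B (target \<alpha>) = cloven_to_psmor small B (target \<beta>)" "slice_of_cell \<alpha> = slice_of_cell \<beta>"
        using ab(3) by (metis ClCoFib_to_PsAlg_sel(3-5))+
      have "source \<alpha> = source \<beta>" "target \<alpha> = target \<beta>"
        using inj1[OF e(1)] inj1[OF e(2)] ab(1,2) unfolding ClCoFib_cells(3) by blast+
      moreover have "trans_over \<alpha> = trans_over \<beta>" using e(3) by (metis slice_of_cell_sel(3))
      ultimately show "\<alpha> = \<beta>" by simp
    qed
    fix \<tau>
    show "\<tau> \<in> {\<tau>. algebra_transformation ?K comma_monad \<tau>}" if "\<tau> \<in> map2 (ClCoFib_to_PsAlg small B) ` cells2 ?C"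
      using that algebra_transformation_cloven[OF small] by auto
    assume "\<tau> \<in> {\<tau>. algebra_transformation ?K comma_monad \<tau>}"
    then have \<tau>: "algebra_transformation ?K comma_monad \<tau>" by simp
    obtain T S where TS: "T \<in> cells1 ?C" "source \<tau> = cloven_to_psmor small B T" "S \<in> cells1 ?C" "target \<tau> = cloven_to_psmor small B S"
      using b1 M.algebra_transformation_cells(1,2)[OF \<tau>] unfolding bij_betw_def by blast
    \<comment> \<open>An algebra transformation carries just a cell over the base, so its preimage
      keeps that cell and only replaces the two boundaries by their preimages.\<close>
    define \<alpha> where "\<alpha> = \<lparr>source = T, target = S, trans_over = over2 (trans \<tau>)\<rparr>"
    have s: "slice_of_cell \<alpha> = trans \<tau>"
      using M.algebra_transformation_cells(6,7)[OF \<tau>] TS by (intro slice_cell_eqI) (simp_all add: \<alpha>_def)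
    have "cloven_to_psalg small B (source T) = cloven_to_psalg small B (source S)"
      "cloven_to_psalg small B (target T) = cloven_to_psalg small B (target S)"
      using M.algebra_transformation_cells(3,4)[OF \<tau>] TS by simp_all
    then have "source T = source S" "target T = target S"
      using inj_onD[OF bij_betw_imp_inj_on[OF b0]] ClCoFib_src_tgt[OF TS(1)] ClCoFib_src_tgt[OF TS(3)] by blast+
    then have "\<alpha> \<in> cells2 ?C"
      unfolding ClCoFib_cells(3) s using TS M.algebra_transformation_cells(5)[OF \<tau>] by (simp add: \<alpha>_def)
    moreover have "\<tau> = map2 (ClCoFib_to_PsAlg small B) \<alpha>"
      using TS s by (intro algtrans_eqI) (simp_all add: \<alpha>_def)
    ultimately show "\<tau> \<in> map2 (ClCoFib_to_PsAlg small B) ` cells2 ?C" by blast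
  qed
  have hcompC: "\<beta> \<star>\<^bsub>?C\<^esub> \<alpha> \<in> cells2 ?C"
    if a: "\<alpha> \<in> cells2 ?C" and b: "\<beta> \<in> cells2 ?C" and ab: "target (source \<alpha>) = source (source \<beta>)" for \<alpha> \<beta>
  proof -
    note a' = a[unfolded ClCoFib_cells(3)] and b' = b[unfolded ClCoFib_cells(3)]
    have "source \<beta> \<cdot>\<^bsub>?C\<^esub> source \<alpha> \<in> cells1 ?C" "target \<beta> \<cdot>\<^bsub>?C\<^esub> target \<alpha> \<in> cells1 ?C"
      using a' b' ab by (metis ClCoFib_comp1)+
    moreover have "slice_of_cell (\<beta> \<star>\<^bsub>?C\<^esub> \<alpha>) \<in> cells2 ?K"
      unfolding slice_of_ClCoFib_ops using a' b' ab by (intro M.endo.dom.cells_of_hcomp(1)) simp_all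
    ultimately show ?thesis using a' b' ab by (simp add: ClCoFib_cells(3))
  qed
  show ?thesis
  proof (rule two_isomorphismI[OF M.two_category_PsAlg], goal_cases)
    case 1
    then show ?case using b0 by simp
  next
    case 2
    then show ?case using b1 by simp
  next
    case 3
    then show ?case using b2 by simp
  next
    case (4 f)
    show ?case using ClCoFib_src_tgt[OF 4] by simp
  next
    case (5 \<alpha>)
    then show ?case by (simp add: ClCoFib_cells(3))
  next
    case (6 X)
    show ?case using ClCoFib_id1[OF 6] by simp
  next
    case (7 f)
    then have "slice_of_cell (id2 ?C f) \<in> cells2 ?K"
      unfolding slice_of_ClCoFib_ops by (simp add: ClCoFib_cells)
    with 7 show ?case by (simp add: ClCoFib_cells(3))
  next
    case (8 f g)
    show ?case using ClCoFib_comp1[OF 8(1,2)] 8(3) by simp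
  next
    case (9 \<alpha> \<beta>)
    note a' = 9(1)[unfolded ClCoFib_cells(3)] and b' = 9(2)[unfolded ClCoFib_cells(3)]
    have "slice_of_cell (\<beta> \<bullet>\<^bsub>?C\<^esub> \<alpha>) \<in> cells2 ?K"
      unfolding slice_of_ClCoFib_ops using a' b' 9(3) by (intro M.endo.dom.cells_of_vcomp(1)) simp_all
    with a' b' 9(3) show ?case by (simp add: ClCoFib_cells(3))
  next
    case (10 \<alpha> \<beta>)
    show ?case using hcompC[OF 10(1,2)] 10(3) by simp
  next
    case (13 X)
    show ?case using cloven_to_psmor_id1[OF small 13] by simp
  next
    case (14 f)
    then show ?case using slice_of_ClCoFib_ops(3)[of small B f] by (intro algtrans_eqI) simp_all
  next
    case (15 f g)
    show ?case using cloven_to_psmor_comp1[OF small 15(1,2)] 15(3) by simp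
  next
    case (16 \<alpha> \<beta>)
    then show ?case using slice_of_ClCoFib_ops(4)[of small B \<beta> \<alpha>] by (intro algtrans_eqI) simp_all
  next
    case (17 \<alpha> \<beta>)
    note a' = 17(1)[unfolded ClCoFib_cells(3)] and b' = 17(2)[unfolded ClCoFib_cells(3)]
    have st: "target (target \<alpha>) = source (target \<beta>)" using a' b' 17(3) by simp
    have "cloven_to_psmor small B (source \<beta> \<cdot>\<^bsub>?C\<^esub> source \<alpha>)
        = cloven_to_psmor small B (source \<beta>) \<cdot>\<^bsub>PsAlg ?K comma_monad\<^esub> cloven_to_psmor small B (source \<alpha>)"
      using a' b' 17(3) by (intro cloven_to_psmor_comp1[OF small]) simp_all
    moreover have "cloven_to_psmor small B (target \<beta> \<cdot>\<^bsub>?C\<^esub> target \<alpha>)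
        = cloven_to_psmor small B (target \<beta>) \<cdot>\<^bsub>PsAlg ?K comma_monad\<^esub> cloven_to_psmor small B (target \<alpha>)"
      using a' b' st by (intro cloven_to_psmor_comp1[OF small]) simp_all
    ultimately show ?case using slice_of_ClCoFib_ops(5)[of small B \<beta> \<alpha>] by (intro algtrans_eqI) simp_all
  qed simp_all
qed

section \<open>The factorization selected by the cleavage\<close>

lemma Fact_ps_sel [simp]:
  "under (map0 (Fact_ps small B) \<P>) = source (proj \<P>)"
  "act (map0 (Fact_ps small B) \<P>) = comp_functor (cleavage_action \<P>) (kappa (proj \<P>))"
  "unitor (map0 (Fact_ps small B) \<P>) = over2 (unitor (cloven_to_psalg small B \<P>))"
  by (simp_all add: Fact_ps_def restrict_scalars_def Let_def)

lemma two_functor_Fact_ps: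
  assumes "smallness small"
  shows "two_functor (ClCoFib small B) (PsAlg (CAT small) square_monad) (Fact_ps small B)"
  unfolding Fact_ps_def
  using two_isomorphism.axioms(1)[OF two_isomorphism_ClCoFib_to_PsAlg[OF assms]]
    colax_monad_morphism.two_functor_restrict_scalars[OF colax_monad_morphism_kappa[OF assms]]
  by (rule two_functor_comp)

lemma iso_closed_CoCart:
  assumes P: "is_functor P"
  shows "iso_closed (source P) (CoCart P)"
  unfolding iso_closed_def CoCart_def
  using cocartesian_Cmp[OF P] cocartesian_iso[OF P] by auto

lemma iso_closed_inverse_image_Iso:
  assumes P: "is_functor P"
  shows "iso_closed (source P) (inverse_image_Iso P)"
  unfolding iso_closed_def
proof (intro ballI allI impI conjI)
  fix f i assume f: "f \<in> inverse_image_Iso P" and i: "iso (source P) i"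
  have f': "f \<in> Arr (source P)" "iso (target P) (amap P f)" using f by (simp_all add: inverse_image_Iso_def)
  have i': "i \<in> Arr (source P)" "iso (target P) (amap P i)" using i iso_amap[OF P] by (simp_all add: iso_def)
  show "Cmp (source P) i f \<in> inverse_image_Iso P" if "Dom (source P) i = Cod (source P) f"
    using that P f' i' iso_Cmp[of "target P" "amap P f" "amap P i"] by (simp add: inverse_image_Iso_def)
  show "Cmp (source P) f i \<in> inverse_image_Iso P" if "Cod (source P) i = Dom (source P) f"
    using that P f' i' iso_Cmp[of "target P" "amap P i" "amap P f"] by (simp add: inverse_image_Iso_def)
qed

text \<open>A diagonal \<open>d\<close> must lie over \<open>(P m)\<^sup>-\<^sup>1 (P h)\<close>, which determines it by cocartesianness of \<open>e\<close>.\<close>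

lemma cocartesian_diagonal:
  assumes P: "is_functor P" and e: "cocartesian P e" and m: "m \<in> Arr (source P)" "iso (target P) (amap P m)"
    and g: "g \<in> Arr (source P)" "Dom (source P) g = Dom (source P) e" "Cod (source P) g = Dom (source P) m"
    and h: "h \<in> Arr (source P)" "Dom (source P) h = Cod (source P) e" "Cod (source P) h = Cod (source P) m"
    and eq: "Cmp (source P) m g = Cmp (source P) h e"
  shows "\<exists>!d. d \<in> hom (source P) (Cod (source P) e) (Dom (source P) m) \<and> Cmp (source P) d e = g \<and> Cmp (source P) m d = h"
proof -
  let ?E = "source P" and ?B = "target P"
  note E = is_functor_category[OF P] cocartesian_Arr[OF e]
  note I = iso_inv_arr[OF E(2) m(2)]
  let ?v = "Cmp ?B (inv_arr ?B (amap P m)) (amap P h)"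
  have eqP: "Cmp ?B (amap P m) (amap P g) = Cmp ?B (amap P h) (amap P e)"
    using arg_cong[OF eq, of "amap P"] P E m g h by simp
  have v: "?v \<in> Arr ?B" "Dom ?B ?v = omap P (Cod ?E e)" "Cod ?B ?v = omap P (Dom ?E m)"
    using P E m h I(2-4) by simp_all
  have "Cmp ?B ?v (amap P e) = Cmp ?B (inv_arr ?B (amap P m)) (Cmp ?B (amap P m) (amap P g))"
    unfolding eqP using P E m h I(2-4) by simp
  also have "\<dots> = amap P g"
    using Cmp_reassoc[OF I(5) E(2), of "amap P g"] P m g I(2-4) by simp
  finally have ve: "amap P g = Cmp ?B ?v (amap P e)" by simp
  obtain d where d: "d \<in> Arr ?E" "Dom ?E d = Cod ?E e" "Cod ?E d = Cod ?E g" "Cmp ?E d e = g" "amap P d = ?v"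
    by (rule cocartesian_lift[OF e E(1,2) g(1,2), of ?v]) (use v ve g in simp_all)
  have Pmv: "Cmp ?B (amap P m) ?v = amap P h"
    using Cmp_reassoc[OF I(6) E(2), of "amap P h"] P m h I(2-4) by simp
  have md: "Cmp ?E m d = h"
    by (rule cocartesian_unique[OF e P]) (use E d m g h eq Pmv P in simp_all)
  show ?thesis
  proof (rule ex1I[of _ d])
    show "d \<in> hom ?E (Cod ?E e) (Dom ?E m) \<and> Cmp ?E d e = g \<and> Cmp ?E m d = h" using d md g by (simp add: hom_def)
    fix k assume "k \<in> hom ?E (Cod ?E e) (Dom ?E m) \<and> Cmp ?E k e = g \<and> Cmp ?E m k = h"
    then have k: "k \<in> Arr ?E" "Dom ?E k = Cod ?E e" "Cod ?E k = Dom ?E m" "Cmp ?E k e = g" "Cmp ?E m k = h" by (simp_all add: hom_def)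
    have "Cmp ?B (amap P m) (amap P k) = Cmp ?B (amap P m) (amap P d)"
      using is_functor_Cmp[OF P refl k(1) m(1)] is_functor_Cmp[OF P refl d(1) m(1)] k d md g by simp
    then have "amap P k = amap P d"
      by (rule iso_cancel[OF E(2) m(2), rotated -1]) (use P k d(1-4) g m in simp_all)
    then show "k = d"
      by (rule cocartesian_unique[OF e P, rotated -1]) (use k d g in simp_all)
  qed
qed

text \<open>Stated for a given h so that the right factor can be recognised as \<nu>_f from its
  verified properties, by cancelling the chosen lift.\<close>

lemma nu_eqI:
  assumes P: "cloven_cofibration \<P>" and f: "f \<in> Arr (source (proj \<P>))"
    and h: "h \<in> Arr (source (proj \<P>))" "Dom (source (proj \<P>)) h = push \<P> (Dom (source (proj \<P>)) f) (amap (proj \<P>) f)"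
    "Cod (source (proj \<P>)) h = Cod (source (proj \<P>)) f"
    "Cmp (source (proj \<P>)) h (clv \<P> (Dom (source (proj \<P>)) f) (amap (proj \<P>) f)) = f"
    "amap (proj \<P>) h = Ide (target (proj \<P>)) (omap (proj \<P>) (Cod (source (proj \<P>)) f))"
  shows "nu \<P> f = h"
  unfolding nu_def Let_def
proof (rule the_equality)
  fix k assume k: "k \<in> hom (source (proj \<P>)) (push \<P> (Dom (source (proj \<P>)) f) (amap (proj \<P>) f)) (Cod (source (proj \<P>)) f) \<and>
      Cmp (source (proj \<P>)) k (clv \<P> (Dom (source (proj \<P>)) f) (amap (proj \<P>) f)) = f \<and>
      amap (proj \<P>) k = Ide (target (proj \<P>)) (omap (proj \<P>) (Cod (source (proj \<P>)) f))"
  show "k = h"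
    by (rule clv_eqI[OF P, of "Dom (source (proj \<P>)) f" "amap (proj \<P>) f"]) (use P f h k in \<open>simp_all add: hom_def\<close>)
qed (use h in \<open>simp add: hom_def\<close>)

locale cloven_over =
  fixes small :: "'a elt set \<Rightarrow> bool" and B :: "'a elt cat" and \<P>
  assumes \<P>: "\<P> \<in> cells0 (ClCoFib small B)"
begin

abbreviation "P \<equiv> proj \<P>"
abbreviation "E \<equiv> source P"
abbreviation "\<delta> \<equiv> clv \<P>"
abbreviation "A \<equiv> map0 (Fact_ps small B) \<P>"
abbreviation "F \<equiv> act A"
abbreviation "j \<equiv> component (unitor A)"
abbreviation "e \<equiv> left_factor A"
abbreviation "m \<equiv> right_factor A"

lemma cloven: "cloven_cofibration \<P>" "is_functor P" "target P = B" "category E" "category B"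
proof -
  show "cloven_cofibration \<P>" "target P = B" using \<P> by (simp_all add: ClCoFib_cells CAT_over_cells)
  then show "is_functor P" "category E" "category B" using is_functor_category(2)[of P] by simp_all
qed

lemma omap_F: "f \<in> Arr E \<Longrightarrow> omap F f = push \<P> (Dom E f) (amap P f)"
  using cloven by simp

lemma amap_F: "commutative_square E f g r s \<Longrightarrow>
    amap F (tag f g (Pair r s)) = amap (cleavage_action \<P>) (tag (Pair (Dom E f) (amap P f)) (Pair (Dom E g) (amap P g)) (Pair r (amap P s)))"
  using cloven by simp

lemma omap_P: "x \<in> Obj E \<Longrightarrow> omap P x \<in> Obj B"
  using is_functor_omap[OF cloven(2), of B x] cloven(3) by simp

lemma j:
  assumes x: "x \<in> Obj E"
  shows "j x = \<delta> x (Ide B (omap P x))" "j x \<in> Arr E" "Dom E (j x) = x" "Cod E (j x) = omap F (Ide E x)" "iso E (j x)"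
    "amap P (j x) = Ide B (omap P x)"
proof -
  show j: "j x = \<delta> x (Ide B (omap P x))" using x by simp
  note c = omap_P[OF x] cloven
  show "j x \<in> Arr E" "Dom E (j x) = x" "amap P (j x) = Ide B (omap P x)" unfolding j using x c by simp_all
  show "Cod E (j x) = omap F (Ide E x)" unfolding j using x c omap_F[of "Ide E x"] by simp
  show "iso E (j x)" unfolding j using x c by (intro clv_iso) (simp_all add: iso_Ide)
qed

text \<open>The square (1_x, f) becomes the comma arrow (1_x, P f), and the unit is the chosen lift
  of an identity. The claim is then the defining equation of the action.\<close>

lemma e_eq:
  assumes f: "f \<in> Arr E"
  shows "e f = \<delta> (Dom E f) (amap P f)"
proof -
  let ?x = "Dom E f"
  have x: "?x \<in> Obj E" using f cloven by simp
  have sq: "comma_square P ?x (amap P (Ide E ?x)) ?x (amap P f) (Ide E ?x) (amap P f)"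
    using f cloven comma_square_kappa[OF cloven(2), of "Ide E ?x" f "Ide E ?x" f] by (simp add: commutative_square_def)
  have "e f = Cmp E (amap (cleavage_action \<P>) (tag (Pair ?x (amap P (Ide E ?x))) (Pair ?x (amap P f)) (Pair (Ide E ?x) (amap P f)))) (j ?x)"
    unfolding left_factor_def Let_def square_def using amap_F[of "Ide E ?x" f "Ide E ?x" f] f cloven by (simp add: commutative_square_def)
  \<comment> \<open>The base identity is written as P 1_x, the form in which \<kappa> delivers it,
    so that it matches the comma object at which the action is taken.\<close>
  also have "j ?x = \<delta> ?x (amap P (Ide E ?x))" using j(1)[OF x] x cloven by simp
  also have "Cmp E (amap (cleavage_action \<P>) (tag (Pair ?x (amap P (Ide E ?x))) (Pair ?x (amap P f)) (Pair (Ide E ?x) (amap P f)))) (\<delta> ?x (amap P (Ide E ?x)))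
      = Cmp E (\<delta> ?x (amap P f)) (Ide E ?x)"
    by (rule cleavage_action_arrow(5)[OF cloven(1) sq refl])
  also have "\<dots> = \<delta> ?x (amap P f)" using f x cloven by simp
  finally show ?thesis .
qed

text \<open>On \<delta>^x_{P f} the action at (f, 1) gives \<delta>^y_1 f, that is j_y f, and
  j_y^{-1} removes the first factor. Both factors of the right factor lie over an identity, so these
  properties single it out as \<nu>_f.\<close>

lemma m_props:
  assumes f: "f \<in> Arr E"
  shows "m f \<in> Arr E" "Dom E (m f) = omap F f" "Cod E (m f) = Cod E f" "Cmp E (m f) (\<delta> (Dom E f) (amap P f)) = f"
    "amap P (m f) = Ide B (omap P (Cod E f))"
proof -
  let ?x = "Dom E f" and ?y = "Cod E f"
  have y: "?y \<in> Obj E" and x: "?x \<in> Obj E" using f cloven by simp_all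
  have cs: "commutative_square E f (Ide E ?y) f (Ide E ?y)" using f cloven by (simp add: commutative_square_def)
  have sq: "comma_square P ?x (amap P f) ?y (amap P (Ide E ?y)) f (amap P (Ide E ?y))"
    using comma_square_kappa[OF cloven(2) cs] y cloven by simp
  let ?h = "amap (cleavage_action \<P>) (tag (Pair ?x (amap P f)) (Pair ?y (amap P (Ide E ?y))) (Pair f (amap P (Ide E ?y))))"
  note h = cleavage_action_arrow[OF cloven(1) sq refl]
  have jy: "\<delta> ?y (amap P (Ide E ?y)) = j ?y" using j(1)[OF y] y cloven by simp
  note i = iso_inv_arr[OF cloven(4) j(5)[OF y]]
  have m: "m f = Cmp E (inv_arr E (j ?y)) ?h"
    unfolding right_factor_def Let_def square_def using amap_F[OF cs] f y cloven by simp
  have d: "Cod E ?h = Cod E (j ?y)" using h(3) jy j(3,4)[OF y] omap_F[of "Ide E ?y"] y cloven by simp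
  have dl: "\<delta> ?x (amap P f) \<in> Arr E" "Cod E (\<delta> ?x (amap P f)) = push \<P> ?x (amap P f)" using f x cloven by simp_all
  show "m f \<in> Arr E" "Dom E (m f) = omap F f" "Cod E (m f) = ?y"
    unfolding m using cloven(4) h(1,2) d i(2-4) j(3)[OF y] omap_F[OF f] by simp_all
  have "Cmp E (m f) (\<delta> ?x (amap P f)) = Cmp E (inv_arr E (j ?y)) (Cmp E (j ?y) f)"
    unfolding m using h(1,2,5) d i(2-4) dl cloven(4) jy by simp
  also have "\<dots> = f" using Cmp_reassoc[OF i(5) cloven(4), of f] f i(2-4) j(2,3)[OF y] cloven(4) by simp
  finally show "Cmp E (m f) (\<delta> ?x (amap P f)) = f" .
  \<comment> \<open>The inverse of a vertical isomorphism is vertical: apply P to the equation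
    j_y^{-1} j_y = 1.\<close>
  have "amap P (inv_arr E (j ?y)) = Ide B (omap P ?y)"
  proof -
    have "amap P (Cmp E (inv_arr E (j ?y)) (j ?y)) = Ide B (omap P ?y)" unfolding i(5) using j(3)[OF y] y cloven by simp
    moreover have "amap P (Cmp E (inv_arr E (j ?y)) (j ?y)) = amap P (inv_arr E (j ?y))"
      using i(2-4) j(2,3,6)[OF y] is_functor_amap[OF cloven(2), of B "j ?y"] is_functor_amap[OF cloven(2), of B "inv_arr E (j ?y)"] cloven y by simp
    ultimately show ?thesis by simp
  qed
  moreover have "amap P ?h = Ide B (omap P ?y)" using h(4)[OF refl] y cloven by simp
  ultimately show "amap P (m f) = Ide B (omap P ?y)"
    unfolding m using is_functor_Cmp[OF cloven(2) refl h(1) i(2)] d i(3) cloven omap_P[OF y] by simp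
qed

text \<open>If m_f is invertible, f is a chosen lift followed by an isomorphism, hence cocartesian.
  If f is cocartesian, m_f compares two cocartesian arrows over an identity, hence is
  invertible.\<close>

lemma left_class_eq: "left_class A = CoCart P"
proof (rule set_eqI)
  fix f
  show "f \<in> left_class A \<longleftrightarrow> f \<in> CoCart P"
  proof (cases "f \<in> Arr E")
    case True
    let ?d = "\<delta> (Dom E f) (amap P f)"
    note m = m_props[OF True]
    have d: "cocartesian P ?d" "Cod E ?d = omap F f" using True cloven omap_F[OF True] by simp_all
    have "iso E (m f) \<longleftrightarrow> cocartesian P f"
    proof
      assume i: "iso E (m f)"
      have "cocartesian P (Cmp E (m f) ?d)"
        using d m(1,2) cloven(2) cocartesian_iso[OF cloven(2) i] by (intro cocartesian_Cmp) simp_all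
      then show "cocartesian P f" using m by simp
    next
      assume "cocartesian P f"
      then show "iso E (m f)"
        using d m cloven True omap_P[of "Cod E f"] by (intro iso_of_cocartesian_factor[OF cloven(2) d(1)]) (simp_all add: iso_Ide)
    qed
    then show ?thesis using True by (simp add: left_class_def CoCart_def)
  next
    case False
    then show ?thesis using cocartesian_Arr[of P f] by (auto simp: left_class_def CoCart_def)
  qed
qed

text \<open>The left factor lies over P f. In one direction P preserves isomorphisms; in the other,
  a chosen lift of an isomorphism is one.\<close>

lemma right_class_eq: "right_class A = inverse_image_Iso P"
proof -
  have "iso E (e f) \<longleftrightarrow> iso (target P) (amap P f)" if f: "f \<in> Arr E" for f
  proof
    assume "iso E (e f)"
    then have "iso (target P) (amap P (e f))" using cloven by (intro iso_amap)
    then show "iso (target P) (amap P f)" using f cloven by (simp add: e_eq)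
  next
    assume "iso (target P) (amap P f)"
    then show "iso E (e f)" unfolding e_eq[OF f] using f cloven by (intro clv_iso) simp_all
  qed
  then show ?thesis by (auto simp: right_class_def inverse_image_Iso_def)
qed

text \<open>The selected factors provide the factorizations: the chosen lift is cocartesian, and the
  right factor lies over an identity, in particular over an isomorphism.\<close>

lemma factorization_system: "orthogonal_factorization_system E (CoCart P) (inverse_image_Iso P)"
  unfolding orthogonal_factorization_system_def
proof (intro conjI ballI impI)
  show "iso_closed E (CoCart P)" "iso_closed E (inverse_image_Iso P)"
    using cloven iso_closed_CoCart iso_closed_inverse_image_Iso by blast+
  show "CoCart P \<subseteq> Arr E" "inverse_image_Iso P \<subseteq> Arr E"
    using cocartesian_Arr[of P] by (auto simp: CoCart_def inverse_image_Iso_def)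
next
  fix f assume f: "f \<in> Arr E"
  note m = m_props[OF f]
  have "\<delta> (Dom E f) (amap P f) \<in> CoCart P" using f cloven by (simp add: CoCart_def)
  moreover have "m f \<in> inverse_image_Iso P" using m f cloven omap_P[of "Cod E f"] by (simp add: inverse_image_Iso_def iso_Ide)
  moreover have "Cod E (\<delta> (Dom E f) (amap P f)) = Dom E (m f)" using f m omap_F[OF f] cloven by simp
  ultimately show "\<exists>e \<in> CoCart P. \<exists>m \<in> inverse_image_Iso P. Cod E e = Dom E m \<and> Cmp E m e = f"
    using m(4) by blast
next
  fix a b g h assume "a \<in> CoCart P" "b \<in> inverse_image_Iso P" "g \<in> hom E (Dom E a) (Dom E b)" "h \<in> hom E (Cod E a) (Cod E b)"
    "Cmp E b g = Cmp E h a"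
  then show "\<exists>!d. d \<in> hom E (Cod E a) (Dom E b) \<and> Cmp E d a = g \<and> Cmp E b d = h"
    using cloven(2) by (intro cocartesian_diagonal) (simp_all add: CoCart_def inverse_image_Iso_def hom_def)
qed

text \<open>For f = 1_x the left factor is j_x, so the right factor is a left inverse of the
  invertible arrow j_x.\<close>

lemma m_Ide:
  assumes x: "x \<in> Obj E"
  shows "m (Ide E x) = inv_arr E (j x)"
proof -
  note i = iso_inv_arr[OF cloven(4) j(5)[OF x]] and C = cloven(4)
  have I: "Ide E x \<in> Arr E" "Dom E (Ide E x) = x" "Cod E (Ide E x) = x" using x C by simp_all
  have mx: "m (Ide E x) \<in> Arr E" "Dom E (m (Ide E x)) = Cod E (j x)" "Cod E (m (Ide E x)) = x"
    using m_props[OF I(1)] j(4)[OF x] I by simp_all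
  have "Cmp E (m (Ide E x)) (j x) = Ide E x"
    using m_props(4)[OF I(1)] I(2) j(1)[OF x] is_functor_Ide[OF cloven(2) refl x] cloven(3) by simp
  then have "Cmp E (Cmp E (m (Ide E x)) (j x)) (inv_arr E (j x)) = Cmp E (Ide E x) (inv_arr E (j x))" by (rule arg_cong)
  then show ?thesis
    using mx i(1-4,6) C j(3)[OF x] by simp
qed

lemma e_Ide: "x \<in> Obj E \<Longrightarrow> e (Ide E x) = j x"
  using e_eq[of "Ide E x"] cloven by simp

text \<open>If j_x is an identity, so is its inverse. The two factors of 1_x are therefore both
  identities exactly when the chosen lift of the base identity is one.\<close>

lemma normal_iff: "(\<forall>x \<in> Obj E. e (Ide E x) = Ide E x \<and> m (Ide E x) = Ide E x) \<longleftrightarrow> normal_cleavage \<P>"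
  unfolding normal_cleavage_def Let_def
  using e_Ide m_Ide j(1) inv_arr_Ide[OF cloven(4)] cloven(3) by metis

end

theorem corollary6p8:
  fixes small :: "'a elt set \<Rightarrow> bool" and B :: "'a elt cat"
  assumes "smallness small" and "B \<in> cells0 (CAT small)"
  shows
    "colax_monad_morphism (CAT_over small B) comma_monad (CAT small) square_monad
       (Dom_fun (CAT small)) kappa
     \<and> two_isomorphism (ClCoFib small B) (PsAlg (CAT_over small B) comma_monad)
       (ClCoFib_to_PsAlg small B)
     \<and> two_functor (ClCoFib small B) (PsAlg (CAT small) square_monad) (Fact_ps small B)
     \<and> (\<forall>\<P> \<in> cells0 (ClCoFib small B).
         let P = proj \<P>; E = source P; \<delta> = clv \<P>;
             A = map0 (Fact_ps small B) \<P>; F = act A; j = component (unitor A);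
             e = left_factor A; m = right_factor A
         in F = comp_functor (cleavage_action \<P>) (kappa P)
          \<and> (\<forall>x \<in> Obj E. j x = \<delta> x (Ide B (omap P x))
                \<and> j x \<in> hom E x (omap F (Ide E x)) \<and> iso E (j x))
          \<and> (\<forall>x \<in> Obj E. \<forall>y \<in> Obj E. \<forall>f \<in> hom E x y.
                e f \<in> hom E x (omap F f) \<and> m f \<in> hom E (omap F f) y \<and> Cmp E (m f) (e f) = f
                \<and> e f = \<delta> x (amap P f) \<and> m f = nu \<P> f)
          \<and> left_class A = CoCart P
          \<and> right_class A = inverse_image_Iso P
          \<and> orthogonal_factorization_system E (CoCart P) (inverse_image_Iso P)
          \<and> (\<forall>x \<in> Obj E. e (Ide E x) = j x \<and> m (Ide E x) = inv_arr E (j x))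
          \<and> ((\<forall>x \<in> Obj E. e (Ide E x) = Ide E x \<and> m (Ide E x) = Ide E x)
               \<longleftrightarrow> normal_cleavage \<P>))"
proof (intro conjI ballI, goal_cases)
  case 1
  show ?case using assms(1) by (rule colax_monad_morphism_kappa)
next
  case 2
  show ?case using assms(1) by (rule two_isomorphism_ClCoFib_to_PsAlg)
next
  case 3
  show ?case using assms(1) by (rule two_functor_Fact_ps)
next
  case (4 \<P>)
  then interpret cloven_over small B \<P> by unfold_locales
  have factors: "e f \<in> hom E x (omap F f) \<and> m f \<in> hom E (omap F f) y \<and> Cmp E (m f) (e f) = f \<and> e f = \<delta> x (amap P f) \<and> m f = nu \<P> f"
    if f: "f \<in> hom E x y" for f x y
  proof -
    have f': "f \<in> Arr E" "Dom E f = x" "Cod E f = y" using f by (simp_all add: hom_def)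
    note m = m_props[OF f'(1)]
    \<comment> \<open>The properties collected in \<open>m_props\<close> are those that define
      \<nu>_f.\<close>
    have "nu \<P> f = m f" using m f' omap_F[OF f'(1)] cloven by (intro nu_eqI) simp_all
    moreover have "\<delta> x (amap P f) \<in> hom E x (omap F f)" using f' omap_F[OF f'(1)] cloven by (auto simp: hom_def)
    ultimately show ?thesis using m f' e_eq[OF f'(1)] by (simp add: hom_def)
  qed
  have units: "\<forall>x \<in> Obj E. j x = \<delta> x (Ide B (omap P x)) \<and> j x \<in> hom E x (omap F (Ide E x)) \<and> iso E (j x)"
    using j unfolding hom_def by blast
  have identities: "\<forall>x \<in> Obj E. e (Ide E x) = j x \<and> m (Ide E x) = inv_arr E (j x)"
    using e_Ide m_Ide by blast
  show ?case
    unfolding Let_def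
    by (intro conjI Fact_ps_sel(2) units ballI[OF ballI[OF ballI[OF factors]]] left_class_eq right_class_eq
        factorization_system identities normal_iff)
qed

end
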